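(* Let $\sigma_k=(\rho_k,\xi_k^1,\xi_k^2)$, $k\ge 1$, be i.i.d. $\mathbb N\times\mathbb Z^2$-valued random variables satisfying conditions (P1)-(P3) given in the context. For $v,x\in\mathbb Z$ let $\mathbb P_{v,x}$ be the law of the random walk $S_n=(T_n,V_n,X_n)=S_0+\sum_{k=1}^n\sigma_k$ with $S_0=(0,v,x)$, and let $\mathcal R_n^+=\{X_k>V_k \text{ for } k=1,\dots,n\}$. Then there exist a function $U:\mathbb N\to(0,\infty)$ of at most linear growth (i.e. $\sup_{z\in\mathbb N}U(z)/z<\infty$) and a constant $c>0$ such that for every $K>0$ $$\lim_{N\to\infty}\ \frac{N^2\ \mathbb P_{v,x}\Big(\bigcup_n\big(\{S_n=(N,u,y)\}\cap\mathcal R_n^+\big)\Big)}{U(x-v)\,U(y-u)}=c,$$ uniformly in integers $v<x$ and $u<y$ satisfying $|v|,|x|,|u|,|y|\le K\log N$.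
   Context: $\mathbb N=\{1,2,\dots\}$. Let $\sigma=(\rho,\xi^1,\xi^2)$ denote a generic step. The conditions are: (P1) There exists $0<\alpha<\infty$ such that the range (set of values taken with positive probability) of $\sigma$ is $\{(t,v,x)\in\mathbb N\times\mathbb Z^2:\ |v|,|x|<\alpha t\}$. (P2) There exist $\beta>0$ and $C<\infty$ such that $\mathbb P(\rho>t)\le C e^{-\beta t}$ for all $t$. (P3) For every $t\in\mathbb N$ the conditional distribution of $(\xi^1,\xi^2)$ given $\rho=t$ is symmetric with respect to the axes and the diagonal: for all $(v,x)\in\mathbb Z^2$, $\mathbb P(\xi^1=v,\xi^2=x\mid\rho=t)=\mathbb P(\xi^1=|v|,\xi^2=|x|\mid\rho=t)=\mathbb P(\xi^1=x,\xi^2=v\mid\rho=t)$. *)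

theory Defs
  imports "HOL-Probability.Probability"
begin

text \<open>
  A step is a triple \<open>(\<rho>, \<xi>\<^sup>1, \<xi>\<^sup>2)\<close>. The type \<open>nat\<close> contains 0, so positivity of \<open>\<rho>\<close> is
  always stated explicitly. Addition of triples is componentwise (\<open>HOL-Library.Product_Plus\<close>).
\<close>

type_synonym triple = "nat \<times> int \<times> int"

definition time_of :: "triple \<Rightarrow> nat" where
  "time_of s = fst s"

definition V_of :: "triple \<Rightarrow> int" where
  "V_of s = fst (snd s)"

definition X_of :: "triple \<Rightarrow> int" where
  "X_of s = snd (snd s)"

definition full_cone_range :: "'a measure \<Rightarrow> ('a \<Rightarrow> triple) \<Rightarrow> bool" where
  "full_cone_range M \<sigma> \<longleftrightarrow> (\<exists>\<alpha>::real. \<alpha> > 0 \<and>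
     {s. \<P>(\<omega> in M. \<sigma> \<omega> = s) > 0} =
     {(t, v, x). t \<ge> 1 \<and> \<bar>real_of_int v\<bar> < \<alpha> * real t \<and> \<bar>real_of_int x\<bar> < \<alpha> * real t})"

definition exponential_time_tail :: "'a measure \<Rightarrow> ('a \<Rightarrow> triple) \<Rightarrow> bool" where
  "exponential_time_tail M \<sigma> \<longleftrightarrow> (\<exists>(\<beta>::real) (C::real). \<beta> > 0 \<and>
     (\<forall>t::nat. \<P>(\<omega> in M. time_of (\<sigma> \<omega>) > t) \<le> C * exp (- \<beta> * real t)))"

text \<open>
  \<open>\<P>(\<omega> in M. P \<omega> \<bar> Q \<omega>)\<close> is 0 if the condition has probability 0; under
  \<^const>\<open>full_cone_range\<close> every \<open>t \<ge> 1\<close> is taken by the time component with positive probability.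
\<close>

definition conditionally_symmetric :: "'a measure \<Rightarrow> ('a \<Rightarrow> triple) \<Rightarrow> bool" where
  "conditionally_symmetric M \<sigma> \<longleftrightarrow> (\<forall>t\<ge>1. \<forall>v x.
     \<P>(\<omega> in M. V_of (\<sigma> \<omega>) = v \<and> X_of (\<sigma> \<omega>) = x \<bar> time_of (\<sigma> \<omega>) = t) =
     \<P>(\<omega> in M. V_of (\<sigma> \<omega>) = \<bar>v\<bar> \<and> X_of (\<sigma> \<omega>) = \<bar>x\<bar> \<bar> time_of (\<sigma> \<omega>) = t) \<and>
     \<P>(\<omega> in M. V_of (\<sigma> \<omega>) = v \<and> X_of (\<sigma> \<omega>) = x \<bar> time_of (\<sigma> \<omega>) = t) =
     \<P>(\<omega> in M. V_of (\<sigma> \<omega>) = x \<and> X_of (\<sigma> \<omega>) = v \<bar> time_of (\<sigma> \<omega>) = t))"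

text \<open>Only the values \<open>\<sigma> k\<close> with \<open>k \<ge> 1\<close> are used; \<open>\<sigma> 0\<close> is irrelevant.\<close>

definition iid_steps :: "'a measure \<Rightarrow> (nat \<Rightarrow> 'a \<Rightarrow> triple) \<Rightarrow> bool" where
  "iid_steps M \<sigma> \<longleftrightarrow>
     (\<forall>k\<ge>1. \<forall>\<omega>\<in>space M. time_of (\<sigma> k \<omega>) \<ge> 1) \<and>
     prob_space.indep_vars M (\<lambda>_. count_space UNIV) \<sigma> {1..} \<and>
     (\<forall>k\<ge>1. distr M (count_space UNIV) (\<sigma> k) = distr M (count_space UNIV) (\<sigma> 1))"

definition walk :: "(nat \<Rightarrow> 'a \<Rightarrow> triple) \<Rightarrow> int \<Rightarrow> int \<Rightarrow> nat \<Rightarrow> 'a \<Rightarrow> triple" where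
  "walk \<sigma> v x n \<omega> = (0, v, x) + (\<Sum>k=1..n. \<sigma> k \<omega>)"

definition ordered_event ::
  "'a measure \<Rightarrow> (nat \<Rightarrow> 'a \<Rightarrow> triple) \<Rightarrow> int \<Rightarrow> int \<Rightarrow> nat \<Rightarrow> 'a set" where
  "ordered_event M \<sigma> v x n =
     {\<omega> \<in> space M. \<forall>k\<in>{1..n}. X_of (walk \<sigma> v x k \<omega>) > V_of (walk \<sigma> v x k \<omega>)}"

definition ordered_hitting_prob ::
  "'a measure \<Rightarrow> (nat \<Rightarrow> 'a \<Rightarrow> triple) \<Rightarrow> int \<Rightarrow> int \<Rightarrow> triple \<Rightarrow> real" where
  "ordered_hitting_prob M \<sigma> v x s =
     measure M (\<Union>n. {\<omega> \<in> space M. walk \<sigma> v x n \<omega> = s} \<inter> ordered_event M \<sigma> v x n)"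

end

theory Submission
  imports Defs "HOL-Real_Asymp.Real_Asymp"
begin

text \<open>
  By the symmetry under exchanging the two space coordinates, the walk without killing at the
  diagonal cannot tell a point from its mirror image. Hence the killed kernel \<open>kill n\<close>
  differs from the reflected difference of free kernels \<open>p\<^sub>n(w - z) - p\<^sub>n(w - mirror z)\<close>
  only through the steps that jump over the diagonal. The overshoots have exponential tails, and a
  bounded superharmonic function makes their expected total size finite, which yields a harmonic
  function \<open>ren z\<close> (the limiting value of \<open>gap z\<close> plus the expected overshoot), comparable to
  \<open>gap z\<close>. Far from the diagonal the free difference is \<open>dker n\<close>, a difference quotient of
  \<open>p\<^sub>n\<close> in the direction \<open>(0, -1, 1)\<close>, so the killed kernel is asymptotically
  \<open>ren z * dker n w\<close>. All free estimates come from the characteristic function: \<open>k\<close>-th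
  differences of \<open>p\<^sub>n\<close> are of order \<open>n\<^bsup>-(3+k)/2\<^esup>\<close>.

  Cutting a path at half of its steps and reversing time in the second half gives
  \<open>ren z * ren z2\<close> times the half-space convolution of two such kernels, which by
  antisymmetry is a quarter of a second difference \<open>curv n N\<close> of \<open>p\<^sub>n\<close> at time \<open>N\<close>. Its
  sum over the number \<open>n\<close> of steps is a Riemann sum in the time variable; the time integral
  leaves a second difference of the planar walk \<open>(V\<^sub>n, X\<^sub>n)\<close>, of order \<open>n\<^bsup>-2\<^esup>\<close>
  by the planar local limit theorem.
\<close>

text \<open>Powers of \<open>N\<close> are scarce, logarithms are free. A killed kernel over a
  number of steps comparable to \<open>N\<close> is of order \<open>N^-2\<close>; the product of two
  of them, summed over about \<open>N^(3/2)\<close> points of a box of side \<open>sqrt N\<close>,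
  gives \<open>N^(-5/2)\<close>, and about \<open>sqrt N\<close> values of \<open>n\<close> matter,
  which gives \<open>N^-2\<close>. Gaps are at most of order \<open>ln N\<close>, so an error is
  harmless once it saves a fixed power of \<open>N\<close>. Hence deviation bounds that are only
  exponential in \<open>R / sqrt n\<close>, with boxes enlarged by \<open>(ln N)^2\<close>, suffice.
  Reflection alone cannot treat an end point near the diagonal: if the walk leaves the half-space
  shortly before the end, the remaining kernel is not smooth on the scale of the overshoot. The
  one-sided estimate therefore takes an end point at distance \<open>a\<close> from the diagonal,
  which a walk that has just left is unlikely to reach in time. Cutting at half of the steps
  replaces the true end point by an intermediate position, and only a thin strip of these is too
  close to the diagonal; there the crude order \<open>N^-2\<close> of each factor is enough.\<close>

type_synonym point = "int \<times> int \<times> int"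

section \<open>Gap, reflection and norm on the space-time lattice\<close>

definition gap :: "point \<Rightarrow> int" where "gap z = snd (snd z) - fst (snd z)"

definition mirror :: "point \<Rightarrow> point" where "mirror z = (fst z, snd (snd z), fst (snd z))"

definition nrm :: "point \<Rightarrow> real" where
  "nrm z = real_of_int (\<bar>fst z\<bar> + \<bar>fst (snd z)\<bar> + \<bar>snd (snd z)\<bar>)"

text \<open>The displacement across the diagonal that raises the gap by \<open>2 * k\<close>. Since
  \<open>mirror z\<close> is \<open>z - shear (gap z)\<close>, a reflected difference of kernels is
  a difference of shifted kernels, which Fourier analysis can estimate.\<close>

definition shear :: "int \<Rightarrow> point" where "shear k = (0, - k, k)"

lemma gap_add: "gap (x + y) = gap x + gap y"
  by (simp add: gap_def)

lemma gap_diff [simp]: "gap (x - y) = gap x - gap y"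
  by (simp add: gap_def)

lemma gap_zero [simp]: "gap 0 = 0"
  by (simp add: gap_def zero_prod_def)

lemma gap_mirror [simp]: "gap (mirror z) = - gap z"
  by (simp add: gap_def mirror_def)

lemma mirror_mirror [simp]: "mirror (mirror z) = z"
  by (simp add: mirror_def)

lemma mirror_add: "mirror (x + y) = mirror x + mirror y"
  by (simp add: mirror_def)

lemma mirror_diff: "mirror (x - y) = mirror x - mirror y"
  by (simp add: mirror_def)

lemma mirror_eq_shear: "mirror z = z - shear (gap z)"
  by (cases z) (simp add: mirror_def shear_def gap_def)

lemma abs_gap_le_nrm: "real_of_int \<bar>gap z\<bar> \<le> nrm z"
  unfolding gap_def nrm_def by linarith

lemma nrm_nonneg [simp]: "0 \<le> nrm z"
  by (simp add: nrm_def)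

lemma nrm_triangle: "nrm (x + y) \<le> nrm x + nrm y"
  unfolding nrm_def fst_add snd_add by linarith

lemma one_le_gap_real: "gap z > 0 \<Longrightarrow> 1 \<le> real_of_int (gap z)"
  by linarith

section \<open>Expectations of bounded functions under probability mass functions\<close>

lemma expectation_bind_pmf:
  fixes f :: "'b \<Rightarrow> real"
  assumes "\<And>x. \<bar>f x\<bar> \<le> B"
  shows "measure_pmf.expectation (bind_pmf q N) f
    = measure_pmf.expectation q (\<lambda>x. measure_pmf.expectation (N x) f)"
proof -
  note [measurable] = measurable_measure_pmf[of N]
  show ?thesis
    unfolding measure_pmf_bind
    by (rule integral_bind[where K="count_space UNIV" and B=B and B'=1])
      (use assms measurable_measure_pmf[of N] measure_pmf.emeasure_space_1 in
        \<open>auto simp: measure_pmf.finite_measure_axioms\<close>)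
qed

text \<open>Fubini for bounded functions: both sides are the expectation of
  \<open>case_prod f\<close> under one joint law, and \<open>bind_commute_pmf\<close> says that the
  order of sampling does not matter.\<close>

lemma expectation_commute_pmf:
  fixes f :: "'a \<Rightarrow> 'b \<Rightarrow> real"
  assumes B: "\<And>x y. \<bar>f x y\<bar> \<le> B"
  shows "measure_pmf.expectation q (\<lambda>x. measure_pmf.expectation r (f x))
    = measure_pmf.expectation r (\<lambda>y. measure_pmf.expectation q (\<lambda>x. f x y))"
proof -
  let ?l = "bind_pmf q (\<lambda>x. bind_pmf r (\<lambda>y. return_pmf (x, y)))"
  let ?r = "bind_pmf r (\<lambda>y. bind_pmf q (\<lambda>x. return_pmf (x, y)))"
  have B': "\<bar>case_prod f z\<bar> \<le> B" for z
    by (cases z) (simp add: B)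
  have "measure_pmf.expectation ?l (case_prod f) = measure_pmf.expectation ?r (case_prod f)"
    by (subst bind_commute_pmf) simp
  then show ?thesis
    by (simp add: expectation_bind_pmf[OF B'])
qed

lemma integrable_pmf_bounded:
  fixes f :: "'a \<Rightarrow> 'b::{banach, second_countable_topology}"
  assumes "\<And>x. norm (f x) \<le> B"
  shows "integrable (measure_pmf q) f"
  by (rule measure_pmf.integrable_const_bound[where B=B]) (auto simp: assms)

lemma expectation_abs_le:
  fixes f :: "'a \<Rightarrow> real"
  assumes "\<And>x. \<bar>f x\<bar> \<le> B"
  shows "\<bar>measure_pmf.expectation q f\<bar> \<le> B"
proof -
  have "\<bar>measure_pmf.expectation q f\<bar> \<le> measure_pmf.expectation q (\<lambda>x. \<bar>f x\<bar>)"
    by (rule integral_abs_bound)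
  also have "\<dots> \<le> measure_pmf.expectation q (\<lambda>_. B)"
    by (rule integral_mono') (use assms in \<open>auto intro: order_trans[OF abs_ge_zero]\<close>)
  finally show ?thesis by simp
qed

text \<open>Boundedness is asked only on the half-space where the killed walk lives. The function
  \<open>over\<close> needs this: it is bounded there but grows without bound deep on the other
  side.\<close>

definition bounded_pos :: "(point \<Rightarrow> real) \<Rightarrow> bool" where
  "bounded_pos f \<longleftrightarrow> (\<exists>B. \<forall>y. gap y > 0 \<longrightarrow> \<bar>f y\<bar> \<le> B)"

lemma bounded_posI: "(\<And>y. gap y > 0 \<Longrightarrow> \<bar>f y\<bar> \<le> B) \<Longrightarrow> bounded_pos f"
  unfolding bounded_pos_def by blast

lemma bounded_pos_const [simp]: "bounded_pos (\<lambda>_. c)"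
  unfolding bounded_pos_def by blast

lemma bounded_pos_indicator [simp]: "bounded_pos (indicat_real A)"
  by (rule bounded_posI[where B=1]) (simp add: indicator_def)

lemma bounded_pos_lin:
  assumes "bounded_pos f" "bounded_pos g"
  shows "bounded_pos (\<lambda>y. a * f y + b * g y)"
proof -
  obtain B C where B: "\<And>y. gap y > 0 \<Longrightarrow> \<bar>f y\<bar> \<le> B" and C: "\<And>y. gap y > 0 \<Longrightarrow> \<bar>g y\<bar> \<le> C"
    using assms unfolding bounded_pos_def by blast
  show ?thesis
  proof (rule bounded_posI)
    fix y assume y: "gap y > 0"
    have "\<bar>a * f y + b * g y\<bar> \<le> \<bar>a\<bar> * \<bar>f y\<bar> + \<bar>b\<bar> * \<bar>g y\<bar>"
      by (metis abs_mult abs_triangle_ineq)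
    also have "\<dots> \<le> \<bar>a\<bar> * B + \<bar>b\<bar> * C"
      by (intro add_mono mult_left_mono B C y) auto
    finally show "\<bar>a * f y + b * g y\<bar> \<le> \<bar>a\<bar> * B + \<bar>b\<bar> * C" .
  qed
qed

lemma bounded_pos_sum:
  assumes "\<And>i. i \<in> A \<Longrightarrow> bounded_pos (f i)"
  shows "bounded_pos (\<lambda>y. \<Sum>i\<in>A. f i y)"
  using assms
proof (induction A rule: infinite_finite_induct)
  case (insert x F)
  then show ?case
    using bounded_pos_lin[of "f x" "\<lambda>y. \<Sum>i\<in>F. f i y" 1 1] by simp
qed simp_all

subsection \<open>The killed and the free transition operators\<close>

text \<open>The semigroup of the walk killed on leaving the open half-space. Positivity of the gap
  is tested after steps 1 to \<open>n\<close> but not at the start, as in the event to be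
  estimated.\<close>

primrec kill :: "point pmf \<Rightarrow> nat \<Rightarrow> (point \<Rightarrow> real) \<Rightarrow> point \<Rightarrow> real" where
  "kill p 0 f z = f z"
| "kill p (Suc n) f z
    = measure_pmf.expectation p (\<lambda>s. if gap (z + s) > 0 then kill p n f (z + s) else 0)"

primrec steps :: "point pmf \<Rightarrow> nat \<Rightarrow> point pmf" where
  "steps p 0 = return_pmf 0"
| "steps p (Suc n) = bind_pmf p (\<lambda>s. map_pmf ((+) s) (steps p n))"

definition free :: "point pmf \<Rightarrow> nat \<Rightarrow> (point \<Rightarrow> real) \<Rightarrow> point \<Rightarrow> real" where
  "free p n f z = measure_pmf.expectation (steps p n) (\<lambda>s. f (z + s))"

lemma kill_cong:
  "(\<And>y. gap y > 0 \<Longrightarrow> f y = g y) \<Longrightarrow> gap z > 0 \<Longrightarrow> kill p n f z = kill p n g z"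
proof (induction n arbitrary: z)
  case (Suc n)
  then have "(if gap (z + s) > 0 then kill p n f (z + s) else 0)
      = (if gap (z + s) > 0 then kill p n g (z + s) else 0)" for s by auto
  then show ?case by (simp only: kill.simps)
qed simp

lemma kill_abs_le:
  "(\<And>y. gap y > 0 \<Longrightarrow> \<bar>f y\<bar> \<le> B) \<Longrightarrow> gap z > 0 \<Longrightarrow> \<bar>kill p n f z\<bar> \<le> B"
proof (induction n arbitrary: z)
  case (Suc n)
  have "0 \<le> B" using Suc.prems(1)[OF Suc.prems(2)] by linarith
  with Suc show ?case
    unfolding kill.simps by (intro expectation_abs_le) auto
qed simp

lemma bounded_pos_kill: "bounded_pos f \<Longrightarrow> bounded_pos (kill p n f)"
  unfolding bounded_pos_def using kill_abs_le by blast

lemma kill_integrable: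
  assumes "bounded_pos f"
  shows "integrable (measure_pmf p) (\<lambda>s. if gap (z + s) > 0 then kill q n f (z + s) else 0)"
proof -
  obtain B where B: "\<And>y. gap y > 0 \<Longrightarrow> \<bar>kill q n f y\<bar> \<le> B"
    using bounded_pos_kill[OF assms] unfolding bounded_pos_def by blast
  show ?thesis
    by (rule integrable_pmf_bounded[where B="\<bar>B\<bar>"]) (simp add: order_trans[OF B abs_ge_self])
qed

lemma kill_lin:
  assumes "bounded_pos f" "bounded_pos g"
  shows "kill p n (\<lambda>y. a * f y + b * g y) z = a * kill p n f z + b * kill p n g z"
proof (induction n arbitrary: z)
  case (Suc n)
  have "kill p (Suc n) (\<lambda>y. a * f y + b * g y) z = measure_pmf.expectation p
     (\<lambda>s. a * (if gap (z + s) > 0 then kill p n f (z + s) else 0)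
        + b * (if gap (z + s) > 0 then kill p n g (z + s) else 0))"
    unfolding kill.simps by (rule Bochner_Integration.integral_cong) (auto simp: Suc)
  also have "\<dots> = a * kill p (Suc n) f z + b * kill p (Suc n) g z"
    unfolding kill.simps
    by (subst Bochner_Integration.integral_add)
      (use kill_integrable[OF assms(1)] kill_integrable[OF assms(2)] in auto)
  finally show ?case .
qed simp

lemma kill_diff:
  "bounded_pos f \<Longrightarrow> bounded_pos g \<Longrightarrow> kill p n (\<lambda>y. f y - g y) z = kill p n f z - kill p n g z"
  using kill_lin[of f g p n 1 "-1" z] by simp

lemma kill_add:
  "bounded_pos f \<Longrightarrow> bounded_pos g \<Longrightarrow> kill p n (\<lambda>y. f y + g y) z = kill p n f z + kill p n g z"
  using kill_lin[of f g p n 1 1 z] by simp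

lemma kill_cmult:
  "bounded_pos f \<Longrightarrow> kill p n (\<lambda>y. c * f y) z = c * kill p n f z"
  using kill_lin[of f "\<lambda>_. 0" p n c 0 z] by simp

lemma kill_zero [simp]: "kill p n (\<lambda>_. 0) z = 0"
  using kill_cmult[of "\<lambda>_. 0" p n 0 z] by simp

lemma kill_sum:
  assumes "\<And>i. i \<in> A \<Longrightarrow> bounded_pos (f i)"
  shows "kill p n (\<lambda>y. \<Sum>i\<in>A. f i y) z = (\<Sum>i\<in>A. kill p n (f i) z)"
  using assms
proof (induction A rule: infinite_finite_induct)
  case (insert x F)
  then show ?case by (simp add: kill_add bounded_pos_sum)
qed simp_all

lemma kill_nonneg:
  "(\<And>y. gap y > 0 \<Longrightarrow> 0 \<le> f y) \<Longrightarrow> gap z > 0 \<Longrightarrow> 0 \<le> kill p n f z"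
proof (induction n arbitrary: z)
  case (Suc n)
  show ?case unfolding kill.simps
    by (rule integral_nonneg_AE) (use Suc in auto)
qed simp

lemma kill_mono:
  assumes "bounded_pos f" "bounded_pos g" "\<And>y. gap y > 0 \<Longrightarrow> f y \<le> g y" "gap z > 0"
  shows "kill p n f z \<le> kill p n g z"
  using kill_nonneg[of "\<lambda>y. g y - f y" z p n] assms by (simp add: kill_diff)

lemma kill_add_time: "kill p (m + n) f z = kill p m (kill p n f) z"
proof (induction m arbitrary: z)
  case (Suc m)
  show ?case by (simp add: Suc cong: if_cong)
qed simp

lemma kill_abs_mono:
  assumes "bounded_pos f" "bounded_pos g" "\<And>y. gap y > 0 \<Longrightarrow> \<bar>f y\<bar> \<le> g y" "gap z > 0"
  shows "\<bar>kill p n f z\<bar> \<le> kill p n g z"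
proof -
  have "kill p n f z \<le> kill p n g z"
    by (rule kill_mono) (use assms in \<open>auto intro: order_trans[OF abs_ge_self]\<close>)
  moreover have "kill p n (\<lambda>y. (-1) * f y) z \<le> kill p n g z"
    by (rule kill_mono) (use assms bounded_pos_lin[OF assms(1,1), of "-1" 0] in
      \<open>auto intro: order_trans[OF abs_ge_minus_self]\<close>)
  ultimately show ?thesis
    using kill_cmult[OF assms(1), of p n "-1" z] by simp
qed

text \<open>Maximum principle: along the killed walk \<open>w\<close> is a nonnegative
  supermartingale, so its expectation never exceeds the initial value.\<close>

lemma kill_le_superharmonic:
  assumes f: "\<And>y. gap y > 0 \<Longrightarrow> f y \<le> w y" and w0: "\<And>y. gap y > 0 \<Longrightarrow> 0 \<le> w y"
    and int: "\<And>y. gap y > 0 \<Longrightarrow> integrable (measure_pmf p) (\<lambda>s. if gap (y + s) > 0 then w (y + s) else 0)"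
    and super: "\<And>y. gap y > 0 \<Longrightarrow>
      measure_pmf.expectation p (\<lambda>s. if gap (y + s) > 0 then w (y + s) else 0) \<le> w y"
    and z: "gap z > 0"
  shows "kill p n f z \<le> w z"
  using z
proof (induction n arbitrary: z)
  case (Suc n)
  have "kill p (Suc n) f z
      \<le> measure_pmf.expectation p (\<lambda>s. if gap (z + s) > 0 then w (z + s) else 0)"
    unfolding kill.simps
    by (rule integral_mono'[OF int]) (use Suc w0 in auto)
  also have "\<dots> \<le> w z" by (rule super[OF Suc.prems])
  finally show ?case .
qed (simp add: f)

text \<open>Potential bound: each step lowers the expectation of \<open>w\<close> by at least the
  charge \<open>f\<close>, so the total charge collected along the walk is at most the initial
  \<open>w\<close>.\<close>

lemma sum_kill_le_superharmonic:
  assumes f: "bounded_pos f" and w0: "\<And>y. gap y > 0 \<Longrightarrow> 0 \<le> w y"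
    and int: "\<And>y. gap y > 0 \<Longrightarrow> integrable (measure_pmf p) (\<lambda>s. if gap (y + s) > 0 then w (y + s) else 0)"
    and super: "\<And>y. gap y > 0 \<Longrightarrow>
      f y + measure_pmf.expectation p (\<lambda>s. if gap (y + s) > 0 then w (y + s) else 0) \<le> w y"
    and z: "gap z > 0"
  shows "(\<Sum>k<n. kill p k f z) \<le> w z"
  using z
proof (induction n arbitrary: z)
  case 0
  then show ?case using w0 by simp
next
  case (Suc n)
  have "(\<Sum>k<Suc n. kill p k f z) = f z + (\<Sum>k<n. kill p (Suc k) f z)"
    by (simp add: sum.lessThan_Suc_shift del: sum.lessThan_Suc kill.simps(2))
  also have "(\<Sum>k<n. kill p (Suc k) f z)
    = measure_pmf.expectation p (\<lambda>s. \<Sum>k<n. if gap (z + s) > 0 then kill p k f (z + s) else 0)"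
    by (subst Bochner_Integration.integral_sum) (auto intro!: kill_integrable[OF f] simp: cong: if_cong)
  also have "\<dots> \<le> measure_pmf.expectation p (\<lambda>s. if gap (z + s) > 0 then w (z + s) else 0)"
    by (rule integral_mono'[OF int]) (use Suc w0 in auto)
  finally show ?case using super[OF Suc.prems] by linarith
qed

text \<open>Serves the error terms that grow linearly with the position: the expected norm increases
  by at most the mean norm of a step per step.\<close>

lemma kill_growth:
  assumes f: "\<And>y. gap y > 0 \<Longrightarrow> \<bar>f y\<bar> \<le> a * nrm y + b" and a: "0 \<le> a" and b: "0 \<le> b"
    and int: "integrable (measure_pmf p) nrm" and z: "gap z > 0"
  shows "\<bar>kill p n f z\<bar> \<le> a * (nrm z + real n * measure_pmf.expectation p nrm) + b"
  using z
proof (induction n arbitrary: z)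
  case 0
  then show ?case using f by simp
next
  case (Suc n)
  let ?m = "measure_pmf.expectation p nrm"
  have m0: "0 \<le> ?m" by (rule integral_nonneg_AE) simp
  have "\<bar>kill p (Suc n) f z\<bar>
      \<le> measure_pmf.expectation p (\<lambda>s. \<bar>if gap (z + s) > 0 then kill p n f (z + s) else 0\<bar>)"
    unfolding kill.simps by (rule integral_abs_bound)
  also have "\<dots> \<le> measure_pmf.expectation p (\<lambda>s. a * (nrm z + nrm s + real n * ?m) + b)"
  proof (rule integral_mono')
    show "integrable (measure_pmf p) (\<lambda>s. a * (nrm z + nrm s + real n * ?m) + b)"
      using int by (intro Bochner_Integration.integrable_add integrable_mult_right) auto
    fix s
    show "0 \<le> a * (nrm z + nrm s + real n * ?m) + b"
      using a b m0 by simp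
    then show "\<bar>if gap (z + s) > 0 then kill p n f (z + s) else 0\<bar>
        \<le> a * (nrm z + nrm s + real n * ?m) + b"
      using Suc.IH[of "z + s"] mult_left_mono[OF nrm_triangle[of z s] a]
      by (auto simp: algebra_simps)
  qed
  also have "\<dots> = a * (nrm z + ?m + real n * ?m) + b"
    using int by simp
  finally show ?case by (simp add: algebra_simps)
qed

lemma free_0 [simp]: "free p 0 f z = f z"
  by (simp add: free_def)

lemma free_Suc:
  assumes "\<And>y. \<bar>f y\<bar> \<le> B"
  shows "free p (Suc n) f z = measure_pmf.expectation p (\<lambda>s. free p n f (z + s))"
  unfolding free_def steps.simps
  by (subst expectation_bind_pmf[where B=B]) (auto simp: assms add.assoc)

lemma free_abs_le: "(\<And>y. \<bar>f y\<bar> \<le> B) \<Longrightarrow> \<bar>free p n f z\<bar> \<le> B"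
  unfolding free_def by (intro expectation_abs_le) auto

lemma kill_le_free:
  assumes f: "\<And>y. 0 \<le> f y" "\<And>y. f y \<le> B"
  shows "kill p n f z \<le> free p n f z"
proof (induction n arbitrary: z)
  case (Suc n)
  have B: "\<bar>f y\<bar> \<le> B" for y using f[of y] by simp
  have nn: "0 \<le> free p n f y" for y unfolding free_def by (rule integral_nonneg_AE) (simp add: f)
  show ?case
    unfolding kill.simps free_Suc[OF B]
    by (rule integral_mono') (use Suc nn in \<open>auto intro!: integrable_pmf_bounded[where B=B] free_abs_le B\<close>)
qed simp

lemma free_indicator: "free p n (indicator A) z = measure_pmf.prob (steps p n) {s. z + s \<in> A}"
proof -
  have "(\<lambda>s. indicat_real A (z + s)) = indicator {s. z + s \<in> A}"
    by (auto simp: indicator_def)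
  then show ?thesis by (simp add: free_def)
qed

lemma free_indicator_single: "free p n (indicator {y}) z = pmf (steps p n) (y - z)"
proof -
  have "{s. z + s \<in> {y}} = {y - z}" by (auto simp: algebra_simps)
  then show ?thesis by (simp add: free_indicator measure_pmf_single)
qed

section \<open>First-passage decomposition\<close>

definition exit_op :: "point pmf \<Rightarrow> (point \<Rightarrow> real) \<Rightarrow> point \<Rightarrow> real" where
  "exit_op p g y = measure_pmf.expectation p (\<lambda>s. if gap (y + s) > 0 then 0 else g (y + s))"

lemma exit_op_abs_le:
  assumes "\<And>y. \<bar>f y\<bar> \<le> B" shows "\<bar>exit_op p f y\<bar> \<le> B"
proof -
  have "0 \<le> B" using assms[of y] by linarith
  then show ?thesis unfolding exit_op_def by (intro expectation_abs_le) (auto simp: assms)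
qed

text \<open>The free walk is split at its first exit. The \<open>k\<close>-th summand collects the
  paths that survive \<open>k\<close> steps and leave at step \<open>k + 1\<close>; then
  \<open>n - 1 - k\<close> free steps remain.\<close>

lemma first_passage:
  assumes B: "\<And>y. \<bar>f y\<bar> \<le> B"
  shows "kill p n f z = free p n f z - (\<Sum>k<n. kill p k (exit_op p (free p (n - 1 - k) f)) z)"
proof (induction n arbitrary: z)
  case (Suc n)
  note FB = free_abs_le[OF B]
  have EB: "bounded_pos (exit_op p (free p m f))" for m
    by (rule bounded_posI, rule exit_op_abs_le, rule FB)
  have "free p (Suc n) f z = measure_pmf.expectation p (\<lambda>s. (if gap (z + s) > 0 then free p n f (z + s) else 0)
      + (if gap (z + s) > 0 then 0 else free p n f (z + s)))"
    unfolding free_Suc[OF B] by (rule Bochner_Integration.integral_cong) auto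
  also have "\<dots> = measure_pmf.expectation p (\<lambda>s. if gap (z + s) > 0 then free p n f (z + s) else 0)
      + exit_op p (free p n f) z"
    unfolding exit_op_def
    by (rule Bochner_Integration.integral_add)
      (rule integrable_pmf_bounded[where B=B], use FB in \<open>auto intro: order_trans[OF abs_ge_zero FB]\<close>)+
  also have "measure_pmf.expectation p (\<lambda>s. if gap (z + s) > 0 then free p n f (z + s) else 0)
     = measure_pmf.expectation p (\<lambda>s. (if gap (z + s) > 0 then kill p n f (z + s) else 0)
        + (\<Sum>k<n. if gap (z + s) > 0 then kill p k (exit_op p (free p (n - 1 - k) f)) (z + s) else 0))"
    by (rule Bochner_Integration.integral_cong) (auto simp: Suc)
  also have "\<dots> = kill p (Suc n) f z + (\<Sum>k<n. kill p (Suc k) (exit_op p (free p (n - 1 - k) f)) z)"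
  proof (subst Bochner_Integration.integral_add)
    show "integrable (measure_pmf p) (\<lambda>s. if gap (z + s) > 0 then kill p n f (z + s) else 0)"
      by (rule kill_integrable, rule bounded_posI[where B=B], rule B)
    show "integrable (measure_pmf p) (\<lambda>s. \<Sum>k<n. if gap (z + s) > 0
        then kill p k (exit_op p (free p (n - 1 - k) f)) (z + s) else 0)"
      by (intro Bochner_Integration.integrable_sum kill_integrable EB)
    show "measure_pmf.expectation p (\<lambda>s. if gap (z + s) > 0 then kill p n f (z + s) else 0)
      + measure_pmf.expectation p (\<lambda>s. \<Sum>k<n. if gap (z + s) > 0
        then kill p k (exit_op p (free p (n - 1 - k) f)) (z + s) else 0)
      = kill p (Suc n) f z + (\<Sum>k<n. kill p (Suc k) (exit_op p (free p (n - 1 - k) f)) z)"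
      by (subst Bochner_Integration.integral_sum) (simp_all add: kill_integrable EB cong: if_cong)
  qed
  finally have "free p (Suc n) f z = kill p (Suc n) f z
      + ((\<Sum>k<n. kill p (Suc k) (exit_op p (free p (n - 1 - k) f)) z) + exit_op p (free p n f) z)"
    by linarith
  moreover have "(\<Sum>k<Suc n. kill p k (exit_op p (free p (Suc n - 1 - k) f)) z)
    = (\<Sum>k<n. kill p (Suc k) (exit_op p (free p (n - 1 - k) f)) z) + exit_op p (free p n f) z"
    by (simp add: sum.lessThan_Suc_shift del: sum.lessThan_Suc kill.simps(2))
  ultimately show ?case by linarith
qed simp

lemma kill_finite_support:
  assumes "finite A" and "gap z > 0"
    and "\<And>y. gap y > 0 \<Longrightarrow> y \<notin> A \<Longrightarrow> f y = 0"
  shows "kill p n f z = (\<Sum>a\<in>A. f a * kill p n (indicator {a}) z)"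
proof -
  have "kill p n f z = kill p n (\<lambda>y. \<Sum>a\<in>A. f a * indicator {a} y) z"
  proof (rule kill_cong[OF _ assms(2)])
    fix y assume y: "gap y > 0"
    show "f y = (\<Sum>a\<in>A. f a * indicator {a} y)"
    proof (cases "y \<in> A")
      case True
      have "(\<Sum>a\<in>A - {y}. f a * indicator {a} y) = 0"
        by (intro sum.neutral ballI) (auto simp: indicator_def simp del: split_paired_All)
      then show ?thesis
        by (subst sum.remove[OF assms(1) True]) simp
    next
      case False
      then have "(\<Sum>a\<in>A. f a * indicator {a} y) = 0" by (intro sum.neutral ballI) (auto simp: indicator_def simp del: split_paired_All)
      then show ?thesis using assms(3)[OF y False] by simp
    qed
  qed
  also have "\<dots> = (\<Sum>a\<in>A. f a * kill p n (indicator {a}) z)"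
  proof (subst kill_sum)
    show "bounded_pos (\<lambda>y. f i * indicator {i} y)" for i
      using bounded_pos_lin[of "indicator {i}" "\<lambda>_. 0" "f i" 0] by simp
  qed (simp add: kill_cmult)
  finally show ?thesis .
qed

text \<open>What the proof extracts from the conditions on the step, with time as an integer.
  \<open>mirror_sym\<close> drives the reflection, \<open>neg_sym\<close> gives centring and time
  reversal. The atoms differ by the three unit vectors, which makes the walk aperiodic in every
  direction.\<close>

locale cone_walk =
  fixes p :: "point pmf"
  assumes mirror_sym: "map_pmf mirror p = p"
    and neg_sym: "map_pmf (\<lambda>z. (fst z, - fst (snd z), - snd (snd z))) p = p"
    and time_pos: "s \<in> set_pmf p \<Longrightarrow> 1 \<le> fst s"
    and exp_moment: "\<exists>\<gamma>>0. integrable (measure_pmf p) (\<lambda>s. exp (\<gamma> * nrm s))"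
    and atoms: "\<exists>t. 0 < pmf p (t, 0, 0) \<and> 0 < pmf p (t + 1, 0, 0)
      \<and> 0 < pmf p (t, 1, 0) \<and> 0 < pmf p (t, 0, 1)"
begin

definition rate :: real where
  "rate = (SOME \<gamma>. 0 < \<gamma> \<and> integrable (measure_pmf p) (\<lambda>s. exp (\<gamma> * nrm s)))"

lemma rate: "0 < rate" "integrable (measure_pmf p) (\<lambda>s. exp (rate * nrm s))"
  using someI_ex[OF exp_moment] by (auto simp: rate_def)

lemma integrable_by_exp:
  fixes f :: "point \<Rightarrow> real"
  assumes "\<And>s. \<bar>f s\<bar> \<le> C * exp (b * nrm s)" "b \<le> rate" "0 \<le> C"
  shows "integrable (measure_pmf p) f"
proof (rule Bochner_Integration.integrable_bound)
  show "integrable (measure_pmf p) (\<lambda>s. C * exp (rate * nrm s))"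
    by (intro integrable_mult_right rate)
  show "AE s in measure_pmf p. norm (f s) \<le> norm (C * exp (rate * nrm s))"
  proof (rule AE_I2)
    fix s
    have "exp (b * nrm s) \<le> exp (rate * nrm s)"
      using assms(2) by (simp add: mult_right_mono)
    then have "C * exp (b * nrm s) \<le> C * exp (rate * nrm s)"
      using assms(3) by (rule mult_left_mono)
    then show "norm (f s) \<le> norm (C * exp (rate * nrm s))"
      using assms(1)[of s] assms(3) by simp
  qed
qed simp

lemma integrable_nrm_sq: "integrable (measure_pmf p) (\<lambda>s. (nrm s)\<^sup>2)"
proof (rule integrable_by_exp[where b=rate and C="2 / rate\<^sup>2"])
  fix s
  have "(rate * nrm s)\<^sup>2 / 2 \<le> exp (rate * nrm s)"
  proof -
    have r: "0 \<le> rate * nrm s" using rate(1) by simp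
    show ?thesis using exp_lower_Taylor_quadratic[OF r] r by linarith
  qed
  then show "\<bar>(nrm s)\<^sup>2\<bar> \<le> 2 / rate\<^sup>2 * exp (rate * nrm s)"
    using rate(1) by (simp add: field_simps power_mult_distrib)
qed auto

lemma integrable_nrm: "integrable (measure_pmf p) nrm"
proof (rule Bochner_Integration.integrable_bound)
  show "integrable (measure_pmf p) (\<lambda>s. 1 + (nrm s)\<^sup>2)"
    using integrable_nrm_sq by auto
  show "AE s in measure_pmf p. norm (nrm s) \<le> norm (1 + (nrm s)\<^sup>2)"
  proof (rule AE_I2)
    fix s
    have "0 \<le> (nrm s - 1)\<^sup>2" by simp
    then have "2 * nrm s \<le> 1 + (nrm s)\<^sup>2" by (simp add: power2_eq_square algebra_simps)
    then have "nrm s \<le> 1 + (nrm s)\<^sup>2" using nrm_nonneg[of s] by linarith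
    then show "norm (nrm s) \<le> norm (1 + (nrm s)\<^sup>2)" using nrm_nonneg[of s] by simp
  qed
qed simp

lemma integrable_le_nrm:
  fixes f :: "point \<Rightarrow> real"
  assumes "\<And>s. \<bar>f s\<bar> \<le> C * nrm s + B"
  shows "integrable (measure_pmf p) f"
proof (rule Bochner_Integration.integrable_bound)
  show "integrable (measure_pmf p) (\<lambda>s. C * nrm s + B)"
    using integrable_nrm by auto
  show "AE s in measure_pmf p. norm (f s) \<le> norm (C * nrm s + B)"
    by (rule AE_I2) (use assms in \<open>auto intro: order_trans[OF _ abs_ge_self]\<close>)
qed simp

lemma integrable_gap: "integrable (measure_pmf p) (\<lambda>s. real_of_int (gap s))"
  by (rule integrable_le_nrm[where C=1 and B=0]) (use abs_gap_le_nrm in auto)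

lemma expectation_gap [simp]: "measure_pmf.expectation p (\<lambda>s. real_of_int (gap s)) = 0"
proof -
  have "measure_pmf.expectation p (\<lambda>s. real_of_int (gap s))
      = measure_pmf.expectation (map_pmf mirror p) (\<lambda>s. real_of_int (gap s))"
    by (simp only: mirror_sym)
  also have "\<dots> = - measure_pmf.expectation p (\<lambda>s. real_of_int (gap s))" by simp
  finally show ?thesis by simp
qed

subsection \<open>Overshoot and the harmonic function\<close>

text \<open>As the gap has centred increments, this is also the amount by which the expected
  positive part of the gap after one step exceeds \<open>gap y\<close>. It measures how far the gap
  is from being harmonic for the killed walk.\<close>

definition over :: "point \<Rightarrow> real" where
  "over y = exit_op p (\<lambda>z. - real_of_int (gap z)) y"

lemma over_nonneg: "0 \<le> over y"
  unfolding over_def exit_op_def by (rule integral_nonneg_AE) auto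

lemma over_integrand_integrable:
  "integrable (measure_pmf p) (\<lambda>s. if gap (y + s) > 0 then 0 else - real_of_int (gap (y + s)))"
proof (rule integrable_le_nrm[where C=1 and B="nrm y"])
  fix s
  show "\<bar>if gap (y + s) > 0 then 0 else - real_of_int (gap (y + s))\<bar> \<le> 1 * nrm s + nrm y"
    using abs_gap_le_nrm[of "y + s"] nrm_triangle[of y s] nrm_nonneg[of y] nrm_nonneg[of s] by auto
qed

text \<open>The exit position is controlled by the bounded superharmonic function
  \<open>B (A - exp (- \<gamma> gap))\<close>: exponential moments make the correction at the
  boundary quadratic in \<open>exp (- \<gamma> gap)\<close>, hence negligible for large \<open>A\<close>.\<close>

lemma superharmonic_majorant:
  obtains w :: "point \<Rightarrow> real" and Q :: real where "0 \<le> Q"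
    "\<And>y. gap y > 0 \<Longrightarrow> 0 \<le> w y" "\<And>y. gap y > 0 \<Longrightarrow> w y \<le> Q"
    "\<And>y. gap y > 0 \<Longrightarrow> over y \<le> Q"
    "\<And>y. gap y > 0 \<Longrightarrow>
      over y + measure_pmf.expectation p (\<lambda>s. if gap (y + s) > 0 then w (y + s) else 0) \<le> w y"
proof -
  \<comment> \<open>Half the rate, so that the square of \<open>e \<gamma>\<close> still has a
    finite expectation.\<close>
  define \<gamma> where "\<gamma> = rate / 2"
  have \<gamma>: "0 < \<gamma>" "2 * \<gamma> \<le> rate" using rate by (auto simp: \<gamma>_def)
  define e where "e b s = exp (- b * real_of_int (gap s))" for b s
  have e_int: "integrable (measure_pmf p) (e b)" if "0 \<le> b" "b \<le> rate" for b
  proof (rule integrable_by_exp[where b=b and C=1])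
    fix s
    have "- real_of_int (gap s) \<le> nrm s" using abs_gap_le_nrm[of s] by linarith
    then show "\<bar>e b s\<bar> \<le> 1 * exp (b * nrm s)"
      using that mult_left_mono[of "- real_of_int (gap s)" "nrm s" b] by (simp add: e_def)
  qed (use that in auto)
  have e_add: "e b (y + s) = e b y * e b s" for b y s
    by (simp add: e_def gap_add exp_add[symmetric] algebra_simps)
  have e_pos: "0 < e b s" for b s by (simp add: e_def)
  have e_le1: "e b y \<le> 1" if "gap y > 0" "0 \<le> b" for b y using that by (simp add: e_def)
  have e2: "e (2 * \<gamma>) y = (e \<gamma> y)\<^sup>2" for y
    by (simp add: e_def power2_eq_square exp_add[symmetric])
  define M1 where "M1 = measure_pmf.expectation p (e \<gamma>)"
  define M2 where "M2 = measure_pmf.expectation p (e (2 * \<gamma>))"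
  have i1: "integrable (measure_pmf p) (e \<gamma>)" and i2: "integrable (measure_pmf p) (e (2*\<gamma>))"
    using e_int \<gamma> by auto
  have M2: "0 \<le> M2" unfolding M2_def by (rule integral_nonneg_AE) (simp add: e_def)
  \<comment> \<open>Strict form of Jensen's inequality: the gap has mean zero and is not almost
    surely zero, as the atom with gap 1 shows. The function \<open>h\<close> is the nonnegative
    defect.\<close>
  have M1: "1 < M1"
  proof -
    obtain t where t: "0 < pmf p (t, 0, 1)" using atoms by blast
    define h where "h s = e \<gamma> s - 1 + \<gamma> * real_of_int (gap s)" for s
    have h0: "0 \<le> h s" for s
      using exp_ge_add_one_self[of "- \<gamma> * real_of_int (gap s)"] by (simp add: h_def e_def)
    have ih: "integrable (measure_pmf p) h"
      unfolding h_def using i1 integrable_gap by auto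
    have "1 - \<gamma> < exp (- \<gamma>)"
    proof (cases "\<gamma> < 2")
      case True
      have "1 - \<gamma> < (1 - \<gamma> / 2)\<^sup>2"
        using \<gamma>(1) by (simp add: power2_eq_square algebra_simps)
      also have "\<dots> \<le> (exp (- \<gamma> / 2))\<^sup>2"
        using True exp_ge_add_one_self[of "- \<gamma> / 2"] by (intro power_mono) auto
      also have "\<dots> = exp (- \<gamma>)"
        by (simp add: power2_eq_square exp_add[symmetric])
      finally show ?thesis .
    next
      case False
      then show ?thesis using exp_gt_zero[of "- \<gamma>"] by linarith
    qed
    then have hp: "0 < h (t, 0, 1)" by (simp add: h_def e_def gap_def)
    have "0 < pmf p (t, 0, 1) * h (t, 0, 1)" using t hp by simp
    also have "\<dots> = measure_pmf.expectation p (\<lambda>s. h s * indicator {(t,0,1)} s)"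
      by (subst integral_measure_pmf_real[where A="{(t,0,1)}"]) (auto simp: indicator_def)
    also have "\<dots> \<le> measure_pmf.expectation p h"
      by (rule integral_mono'[OF ih]) (simp_all add: h0 indicator_def)
    also have "\<dots> = M1 - 1"
      unfolding h_def M1_def using i1 integrable_gap by simp
    finally show ?thesis by simp
  qed
  \<comment> \<open>\<open>A\<close> keeps the quadratic boundary correction below half of the gain
    \<open>M1 - 1\<close>; \<open>B\<close> scales the remaining half to
    \<open>M1 / \<gamma>\<close>, the constant in the bound on \<open>over\<close>.\<close>
  define A where "A = 1 + 2 * M2 / (M1 - 1)"
  define B where "B = 2 * M1 / (\<gamma> * (M1 - 1))"
  have A: "1 \<le> A" using M1 M2 by (simp add: A_def)
  have B: "0 < B" using M1 \<gamma> by (simp add: B_def)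
  define w where "w y = B * (A - e \<gamma> y)" for y
  have over: "over y \<le> M1 / \<gamma> * e \<gamma> y" for y
  proof -
    have "over y \<le> measure_pmf.expectation p (\<lambda>s. e \<gamma> y / \<gamma> * e \<gamma> s)"
      unfolding over_def exit_op_def
    proof (rule integral_mono')
      show "integrable (measure_pmf p) (\<lambda>s. e \<gamma> y / \<gamma> * e \<gamma> s)" using i1 by simp
      fix s
      have "- \<gamma> * real_of_int (gap (y + s)) \<le> e \<gamma> (y + s)"
        unfolding e_def using exp_ge_add_one_self[of "- \<gamma> * real_of_int (gap (y + s))"] by linarith
      then have "- real_of_int (gap (y + s)) \<le> e \<gamma> y / \<gamma> * e \<gamma> s"
        using \<gamma>(1) by (simp add: e_add field_simps)
      then show "(if gap (y + s) > 0 then 0 else - real_of_int (gap (y + s))) \<le> e \<gamma> y / \<gamma> * e \<gamma> s"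
        using e_pos[of \<gamma> y] e_pos[of \<gamma> s] \<gamma>(1) by simp
      show "0 \<le> e \<gamma> y / \<gamma> * e \<gamma> s"
        using e_pos[of \<gamma> y] e_pos[of \<gamma> s] \<gamma>(1) by simp
    qed
    then show ?thesis by (simp add: M1_def mult.commute)
  qed
  show thesis
  proof (rule that[of "B * A + M1 / \<gamma>" w])
    show "0 \<le> B * A + M1 / \<gamma>" using A B M1 \<gamma> by simp
    fix y assume y: "gap y > 0"
    note ey = e_pos[of \<gamma> y] e_le1[OF y less_imp_le[OF \<gamma>(1)]]
    show "0 \<le> w y" unfolding w_def using A B ey by simp
    have "w y \<le> B * A" unfolding w_def using ey B by (intro mult_left_mono) auto
    moreover have Mg: "0 \<le> M1 / \<gamma>" "0 \<le> B * A" using M1 \<gamma> A B by auto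
    ultimately show "w y \<le> B * A + M1 / \<gamma>" by linarith
    have "M1 / \<gamma> * e \<gamma> y \<le> M1 / \<gamma>" using ey M1 \<gamma> by (intro mult_left_le) auto
    then show "over y \<le> B * A + M1 / \<gamma>" using over[of y] Mg by linarith
    \<comment> \<open>Beyond the diagonal \<open>w\<close> can be negative, so it does not dominate
      its own truncation to the half-space. Adding the square of \<open>e \<gamma>\<close> over
      \<open>A\<close> gives a majorant that is nonnegative on the whole lattice, since its
      discriminant as a quadratic is negative.\<close>
    define X where "X s = B * (A - e \<gamma> y * e \<gamma> s + (e \<gamma> y)\<^sup>2 / A * e (2*\<gamma>) s)" for s
    have X: "X s = B * (A - e \<gamma> (y+s) + (e \<gamma> (y+s))\<^sup>2 / A)" for s
      by (simp add: X_def e_add e2 power_mult_distrib)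
    have X0: "0 \<le> X s" for s
    proof -
      have "0 \<le> (A - e \<gamma> (y+s) / 2)\<^sup>2 + 3/4 * (e \<gamma> (y+s))\<^sup>2" by simp
      also have "\<dots> = A * (A - e \<gamma> (y+s) + (e \<gamma> (y+s))\<^sup>2 / A)"
        using A by (simp add: power2_eq_square field_simps)
      finally show ?thesis unfolding X using A B by (simp add: zero_le_mult_iff)
    qed
    have Xint: "integrable (measure_pmf p) X"
      unfolding X_def using i1 i2 by auto
    have "measure_pmf.expectation p (\<lambda>s. if gap (y + s) > 0 then w (y + s) else 0)
        \<le> measure_pmf.expectation p X"
    proof (rule integral_mono'[OF Xint _ X0])
      fix s
      have "w (y + s) \<le> X s" unfolding w_def X using A B by (intro mult_left_mono) auto
      then show "(if gap (y + s) > 0 then w (y + s) else 0) \<le> X s" using X0 by simp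
    qed
    also have "\<dots> = B * (A - e \<gamma> y * M1 + (e \<gamma> y)\<^sup>2 / A * M2)"
      unfolding X_def M1_def M2_def using i1 i2 by simp
    also have "\<dots> \<le> w y - M1 / \<gamma> * e \<gamma> y"
    proof -
      have "M2 / A \<le> (M1 - 1) / 2"
      proof -
        have "2 * M2 \<le> A * (M1 - 1)" using M1 by (simp add: A_def distrib_right)
        then show ?thesis using A by (simp add: field_simps)
      qed
      then have "(e \<gamma> y)\<^sup>2 * (M2 / A) \<le> e \<gamma> y * ((M1 - 1) / 2)"
        using ey M2 A by (intro mult_mono) (auto simp: power2_eq_square mult_left_le)
      then have "B * (A - e \<gamma> y * M1 + (e \<gamma> y)\<^sup>2 / A * M2)
          \<le> B * (A - e \<gamma> y * M1 + e \<gamma> y * ((M1 - 1) / 2))"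
        using B by (intro mult_left_mono) auto
      also have "\<dots> = w y - B * (M1 - 1) / 2 * e \<gamma> y"
        unfolding w_def by (simp add: field_simps)
      also have "B * (M1 - 1) / 2 = M1 / \<gamma>" using M1 \<gamma> by (simp add: B_def field_simps)
      finally show ?thesis .
    qed
    finally show "over y + measure_pmf.expectation p (\<lambda>s. if gap (y + s) > 0 then w (y + s) else 0) \<le> w y"
      using over[of y] by linarith
  qed
qed

lemma bounded_pos_over [simp]: "bounded_pos over"
proof -
  obtain w Q where w: "0 \<le> Q" "\<And>y. gap y > 0 \<Longrightarrow> 0 \<le> w y" "\<And>y. gap y > 0 \<Longrightarrow> w y \<le> Q"
    "\<And>y. gap y > 0 \<Longrightarrow> over y \<le> Q"
    "\<And>y. gap y > 0 \<Longrightarrow>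
      over y + measure_pmf.expectation p (\<lambda>s. if gap (y + s) > 0 then w (y + s) else 0) \<le> w y"
    by (rule superharmonic_majorant, rule that)
  then show ?thesis by (intro bounded_posI[where B=Q]) (use over_nonneg w(4) in \<open>simp add: abs_of_nonneg\<close>)
qed

text \<open>The sum is the expected overshoot on the event that the walk leaves within
  \<open>n\<close> steps; the bounded majorant controls it uniformly in the start.\<close>

lemma sum_kill_over_bounded:
  obtains Q where "0 \<le> Q" "\<And>n z. gap z > 0 \<Longrightarrow> (\<Sum>k<n. kill p k over z) \<le> Q"
proof -
  obtain w Q where w: "0 \<le> Q" "\<And>y. gap y > 0 \<Longrightarrow> 0 \<le> w y" "\<And>y. gap y > 0 \<Longrightarrow> w y \<le> Q"
    "\<And>y. gap y > 0 \<Longrightarrow> over y \<le> Q"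
    "\<And>y. gap y > 0 \<Longrightarrow>
      over y + measure_pmf.expectation p (\<lambda>s. if gap (y + s) > 0 then w (y + s) else 0) \<le> w y"
    by (rule superharmonic_majorant, rule that)
  have int: "integrable (measure_pmf p) (\<lambda>s. if gap (y + s) > 0 then w (y + s) else 0)" for y
    by (rule integrable_pmf_bounded[where B=Q]) (simp add: w)
  have "(\<Sum>k<n. kill p k over z) \<le> Q" if "gap z > 0" for n z
    using sum_kill_le_superharmonic[OF bounded_pos_over w(2) int w(5) that, of n] w(3)[OF that] by simp
  with w(1) that show thesis by blast
qed

text \<open>Markov's inequality for the gap plus the majorant \<open>w\<close>. This sum is
  superharmonic for the killed walk, because \<open>w\<close> absorbs the defect \<open>over\<close>
  of the gap.\<close>

lemma kill_gap_ge:
  obtains Q where "0 \<le> Q"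
    "\<And>n z L. gap z > 0 \<Longrightarrow> 0 < L \<Longrightarrow>
      kill p n (indicator {y. L \<le> real_of_int (gap y)}) z \<le> (real_of_int (gap z) + Q) / L"
proof -
  obtain w Q where w: "0 \<le> Q" "\<And>y. gap y > 0 \<Longrightarrow> 0 \<le> w y" "\<And>y. gap y > 0 \<Longrightarrow> w y \<le> Q"
    "\<And>y. gap y > 0 \<Longrightarrow> over y \<le> Q"
    "\<And>y. gap y > 0 \<Longrightarrow>
      over y + measure_pmf.expectation p (\<lambda>s. if gap (y + s) > 0 then w (y + s) else 0) \<le> w y"
    by (rule superharmonic_majorant, rule that)
  have iw: "integrable (measure_pmf p) (\<lambda>s. if gap (y + s) > 0 then w (y + s) else 0)" for y
    by (rule integrable_pmf_bounded[where B=Q]) (simp add: w)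
  have ig: "integrable (measure_pmf p) (\<lambda>s. real_of_int (gap (y + s)))" for y
    unfolding gap_add of_int_add using integrable_gap by simp
  have gp: "(\<lambda>s. if gap (y + s) > 0 then real_of_int (gap (y + s)) else 0)
      = (\<lambda>s. real_of_int (gap (y + s)) + (if gap (y + s) > 0 then 0 else - real_of_int (gap (y + s))))" for y
    by auto
  have igp: "integrable (measure_pmf p) (\<lambda>s. if gap (y + s) > 0 then real_of_int (gap (y + s)) else 0)" for y
    unfolding gp using ig over_integrand_integrable by simp
  have egp: "measure_pmf.expectation p (\<lambda>s. if gap (y + s) > 0 then real_of_int (gap (y + s)) else 0)
      = real_of_int (gap y) + over y" for y
    unfolding gp over_def exit_op_def
    using ig[of y] over_integrand_integrable[of y] integrable_gap
    by (simp add: gap_add)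
  define \<Psi> where "\<Psi> y = real_of_int (gap y) + w y" for y
  have \<Psi>_if: "(\<lambda>s. if gap (y + s) > 0 then \<Psi> (y + s) / L else 0)
      = (\<lambda>s. ((if gap (y + s) > 0 then real_of_int (gap (y + s)) else 0)
        + (if gap (y + s) > 0 then w (y + s) else 0)) / L)" for y L
    by (auto simp: \<Psi>_def)
  have "kill p n (indicator {y. L \<le> real_of_int (gap y)}) z \<le> (real_of_int (gap z) + Q) / L"
    if z: "gap z > 0" and L: "0 < L" for n z L
  proof -
    have "kill p n (indicator {y. L \<le> real_of_int (gap y)}) z \<le> \<Psi> z / L"
    proof (rule kill_le_superharmonic[OF _ _ _ _ z])
      fix y assume y: "gap y > 0"
      show nn: "0 \<le> \<Psi> y / L" using w(2)[OF y] y L by (simp add: \<Psi>_def)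
      show "indicator {y. L \<le> real_of_int (gap y)} y \<le> \<Psi> y / L"
        using w(2)[OF y] nn L by (auto simp: indicator_def \<Psi>_def field_simps)
      show "integrable (measure_pmf p) (\<lambda>s. if gap (y + s) > 0 then \<Psi> (y + s) / L else 0)"
        unfolding \<Psi>_if using igp iw by simp
      show "measure_pmf.expectation p (\<lambda>s. if gap (y + s) > 0 then \<Psi> (y + s) / L else 0) \<le> \<Psi> y / L"
        unfolding \<Psi>_if using w(5)[OF y] L igp[of y] iw[of y] egp[of y]
        by (simp add: \<Psi>_def divide_right_mono)
    qed
    also have "\<dots> \<le> (real_of_int (gap z) + Q) / L"
      using w(3)[OF z] L by (simp add: \<Psi>_def divide_right_mono)
    finally show ?thesis .
  qed
  with w(1) that show thesis by blast
qed

end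

subsection \<open>Fourier analysis on the torus\<close>

lemma integral_pair_times:
  fixes f :: "'a \<Rightarrow> 'c::{real_normed_field, banach, second_countable_topology}"
  assumes "prob_space M" "prob_space N"
    and [measurable]: "f \<in> borel_measurable M" "g \<in> borel_measurable N"
    and f: "\<And>x. norm (f x) \<le> A" and g: "\<And>x. norm (g x) \<le> B"
  shows "(\<integral>x. f (fst x) * g (snd x) \<partial>(M \<Otimes>\<^sub>M N)) = (\<integral>x. f x \<partial>M) * (\<integral>x. g x \<partial>N)"
proof -
  interpret M: prob_space M by fact
  interpret N: prob_space N by fact
  interpret pair_prob_space M N ..
  have A: "0 \<le> A" using order_trans[OF norm_ge_zero f] .
  have int: "integrable (M \<Otimes>\<^sub>M N) (\<lambda>x. f (fst x) * g (snd x))"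
    by (rule integrable_const_bound[where B="A * B"])
      (auto simp: norm_mult intro!: mult_mono f g A)
  have "(\<integral>x. f (fst x) * g (snd x) \<partial>(M \<Otimes>\<^sub>M N)) = (\<integral>x. (\<integral>y. f x * g y \<partial>N) \<partial>M)"
    using integral_fst'[OF int] by simp
  also have "\<dots> = (\<integral>x. f x * (\<integral>y. g y \<partial>N) \<partial>M)"
  proof (rule Bochner_Integration.integral_cong[OF refl])
    have "integrable N g"
      by (rule N.integrable_const_bound[where B=B]) (auto intro: g)
    then show "(\<integral>y. f x * g y \<partial>N) = f x * (\<integral>y. g y \<partial>N)" for x by simp
  qed
  also have "\<dots> = (\<integral>x. f x \<partial>M) * (\<integral>x. g x \<partial>N)"
  proof -
    have "integrable M f"
      by (rule M.integrable_const_bound[where B=A]) (auto intro: f)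
    then show ?thesis by simp
  qed
  finally show ?thesis .
qed

text \<open>Normalised Haar measure of the circle, realised on the real line so that angles are
  plain reals. Their range is therefore available only almost everywhere, through
  \<open>AE_circ\<close>.\<close>

definition circ :: "real measure" where "circ = uniform_measure lborel {- pi..pi}"

lemma sets_circ [simp, measurable_cong]: "sets circ = sets borel"
  by (simp add: circ_def)

lemma space_circ [simp]: "space circ = UNIV"
  by (simp add: circ_def)

interpretation circ: prob_space circ
  unfolding circ_def by (rule prob_space_uniform_measure) auto

lemma integral_circ:
  fixes f :: "real \<Rightarrow> 'b::{banach, second_countable_topology}"
  assumes [measurable]: "f \<in> borel_measurable borel"
  shows "(\<integral>x. f x \<partial>circ) = (\<integral>x. (indicator {- pi..pi} x / (2 * pi)) *\<^sub>R f x \<partial>lborel)"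
proof -
  have eq: "circ = density lborel (\<lambda>x. ennreal (indicator {- pi..pi} x / (2 * pi)))"
    unfolding circ_def uniform_measure_def
    by (intro density_cong) (auto simp: indicator_def divide_ennreal[symmetric] ennreal_1[symmetric] simp del: ennreal_1)
  show ?thesis unfolding eq by (rule integral_density) auto
qed

lemma AE_circ: "AE x in circ. \<bar>x\<bar> \<le> pi"
  unfolding circ_def by (rule AE_uniform_measureI) auto

lemma measurable_cis [measurable]: "cis \<in> borel_measurable borel"
  by (rule borel_measurable_continuous_onI) (rule continuous_on_cis, rule continuous_on_id)

lemma integral_circ_cis: "(\<integral>x. cis (x * real_of_int k) \<partial>circ) = of_bool (k = 0)"
proof (cases "k = 0")
  case True
  then show ?thesis using circ.prob_space by simp
next
  case False
  define F where "F x = cis (x * real_of_int k) / (\<i> * of_int k)" for x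
  have "(\<integral>x. indicator {- pi..pi} x *\<^sub>R cis (x * real_of_int k) \<partial>lborel) = F pi - F (- pi)"
  proof (rule integral_FTC_atLeastAtMost)
    fix x
    show "(F has_vector_derivative cis (x * real_of_int k)) (at x within {- pi..pi})"
      unfolding F_def has_vector_derivative_def using False
      by (auto intro!: derivative_eq_intros ext simp: field_simps scaleR_conv_of_real)
  qed (auto intro!: continuous_intros)
  also have "\<dots> = (cis (pi * real_of_int k) - cis (- pi * real_of_int k)) / (\<i> * of_int k)"
    by (simp add: F_def diff_divide_distrib)
  also have "cis (pi * real_of_int k) - cis (- pi * real_of_int k) = 0"
    by (simp add: complex_eq_iff)
  finally show ?thesis using False
    by (subst integral_circ) (auto simp: scaleR_conv_of_real)
qed

definition torus2 :: "(real \<times> real) measure" where "torus2 = circ \<Otimes>\<^sub>M circ"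

definition torus :: "(real \<times> real \<times> real) measure" where "torus = circ \<Otimes>\<^sub>M torus2"

lemma sets_torus2 [simp, measurable_cong]: "sets torus2 = sets (borel \<Otimes>\<^sub>M borel)"
  unfolding torus2_def by (rule sets_pair_measure_cong) simp_all

lemma sets_torus [simp, measurable_cong]: "sets torus = sets (borel \<Otimes>\<^sub>M (borel \<Otimes>\<^sub>M borel))"
  unfolding torus_def by (rule sets_pair_measure_cong) simp_all

lemma space_torus [simp]: "space torus = UNIV" "space torus2 = UNIV"
  by (simp_all add: torus_def torus2_def space_pair_measure)

interpretation torus2: prob_space torus2
proof -
  interpret pair_prob_space circ circ ..
  show "prob_space torus2" unfolding torus2_def by (rule prob_space_axioms)
qed

interpretation torus: prob_space torus
proof -
  interpret pair_prob_space circ torus2 ..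
  show "prob_space torus" unfolding torus_def by (rule prob_space_axioms)
qed

lemma AE_torus2: "AE \<theta> in torus2. \<bar>fst \<theta>\<bar> \<le> pi \<and> \<bar>snd \<theta>\<bar> \<le> pi"
proof -
  interpret pair_prob_space circ circ ..
  show ?thesis
    unfolding torus2_def
    by (rule AE_pair_measure) (measurable, use AE_circ in auto)
qed

lemma AE_torus: "AE \<theta> in torus. \<bar>fst \<theta>\<bar> \<le> pi \<and> \<bar>fst (snd \<theta>)\<bar> \<le> pi \<and> \<bar>snd (snd \<theta>)\<bar> \<le> pi"
proof -
  interpret pair_prob_space circ torus2 ..
  have "AE x in circ. AE y in torus2. \<bar>x\<bar> \<le> pi \<and> \<bar>fst y\<bar> \<le> pi \<and> \<bar>snd y\<bar> \<le> pi"
    using AE_circ AE_torus2 by auto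
  note ae = this
  show ?thesis
    unfolding torus_def by (rule AE_pair_measure) (measurable, use ae in simp)
qed

definition ang :: "real \<times> real \<times> real \<Rightarrow> point \<Rightarrow> real" where
  "ang \<theta> s = fst \<theta> * of_int (fst s) + fst (snd \<theta>) * of_int (fst (snd s))
    + snd (snd \<theta>) * of_int (snd (snd s))"

definition mag :: "real \<times> real \<times> real \<Rightarrow> real" where
  "mag \<theta> = \<bar>fst \<theta>\<bar> + \<bar>fst (snd \<theta>)\<bar> + \<bar>snd (snd \<theta>)\<bar>"

lemma ang_add: "ang \<theta> (x + y) = ang \<theta> x + ang \<theta> y"
  by (simp add: ang_def algebra_simps)

lemma ang_diff: "ang \<theta> (x - y) = ang \<theta> x - ang \<theta> y"
  by (simp add: ang_def algebra_simps)

lemma ang_zero [simp]: "ang \<theta> 0 = 0"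
  by (simp add: ang_def zero_prod_def)

lemma mag_nonneg [simp]: "0 \<le> mag \<theta>"
  by (simp add: mag_def)

lemma abs_ang_le: "\<bar>ang \<theta> s\<bar> \<le> mag \<theta> * nrm s"
proof -
  obtain t v x where s: "s = (t, v, x)" by (cases s)
  obtain a b c where \<theta>: "\<theta> = (a, b, c)" by (cases \<theta>)
  let ?t = "\<bar>real_of_int t\<bar>" and ?v = "\<bar>real_of_int v\<bar>" and ?x = "\<bar>real_of_int x\<bar>"
  have "\<bar>ang \<theta> s\<bar> \<le> \<bar>a\<bar> * ?t + \<bar>b\<bar> * ?v + \<bar>c\<bar> * ?x"
    unfolding ang_def s \<theta> fst_conv snd_conv abs_mult[symmetric] by linarith
  also have "\<dots> \<le> (\<bar>a\<bar> + \<bar>b\<bar> + \<bar>c\<bar>) * (?t + ?v + ?x)"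
    by (simp add: algebra_simps)
  finally show ?thesis by (simp add: mag_def nrm_def s \<theta>)
qed

lemma measurable_ang [measurable]: "(\<lambda>\<theta>. ang \<theta> s) \<in> borel_measurable (borel \<Otimes>\<^sub>M (borel \<Otimes>\<^sub>M borel))"
  unfolding ang_def by measurable

lemma integral_torus2_cis:
  "(\<integral>\<theta>. cis (fst \<theta> * of_int v + snd \<theta> * of_int x) \<partial>torus2) = of_bool (v = 0 \<and> x = 0)"
  using integral_pair_times[of circ circ "\<lambda>a. cis (a * of_int v)" "\<lambda>a. cis (a * of_int x)" 1 1]
  by (simp add: circ.prob_space_axioms torus2_def cis_mult integral_circ_cis)

lemma integral_torus_cis: "(\<integral>\<theta>. cis (ang \<theta> s) \<partial>torus) = of_bool (s = 0)"
proof -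
  obtain t v x where s: "s = (t, v, x)" by (cases s)
  have "(\<integral>\<theta>. cis (fst \<theta> * of_int t) * cis (fst (snd \<theta>) * of_int v + snd (snd \<theta>) * of_int x) \<partial>torus)
      = (\<integral>a. cis (a * of_int t) \<partial>circ) * (\<integral>b. cis (fst b * of_int v + snd b * of_int x) \<partial>torus2)"
    unfolding torus_def
    by (rule integral_pair_times[of circ torus2 "\<lambda>a. cis (a * of_int t)"
        "\<lambda>b. cis (fst b * of_int v + snd b * of_int x)" 1 1])
      (simp_all add: circ.prob_space_axioms torus2.prob_space_axioms)
  also have "\<dots> = of_bool (s = 0)"
    unfolding integral_circ_cis integral_torus2_cis by (simp add: s zero_prod_def)
  finally show ?thesis
    by (simp only: cis_mult ang_def s fst_conv snd_conv add.assoc)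
qed

lemma norm_cis_minus_one_le: "norm (cis x - 1) \<le> \<bar>x\<bar>"
  using iexp_approx1[of x 0] by (simp add: cis_conv_exp)

lemma norm_cis_minus_linear_le: "norm (cis x - 1 - \<i> * x) \<le> x\<^sup>2 / 2"
proof -
  have "(\<Sum>k\<le>1. (\<i> * complex_of_real x) ^ k / fact k) = 1 + \<i> * x"
    by simp
  then show ?thesis
    using iexp_approx1[of x 1] by (simp add: cis_conv_exp diff_diff_eq numeral_2_eq_2)
qed

lemma expectation_bind_pmf_complex:
  fixes f :: "'b \<Rightarrow> complex"
  assumes f: "\<And>x. norm (f x) \<le> B"
  shows "measure_pmf.expectation (bind_pmf q N) f
    = measure_pmf.expectation q (\<lambda>x. measure_pmf.expectation (N x) f)"
proof -
  have B: "0 \<le> B" using order_trans[OF norm_ge_zero f] .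
  have int: "integrable (measure_pmf r) f" for r by (rule integrable_pmf_bounded[OF f])
  have int2: "integrable (measure_pmf q) (\<lambda>x. measure_pmf.expectation (N x) f)"
  proof (rule integrable_pmf_bounded[where B=B])
    fix x
    have "norm (measure_pmf.expectation (N x) f) \<le> measure_pmf.expectation (N x) (\<lambda>y. norm (f y))"
      by (rule integral_norm_bound)
    also have "\<dots> \<le> B" using expectation_abs_le[of "\<lambda>y. norm (f y)" B] f by fastforce
    finally show "norm (measure_pmf.expectation (N x) f) \<le> B" .
  qed
  have r: "\<bar>Re (f x)\<bar> \<le> B" "\<bar>Im (f x)\<bar> \<le> B" for x
    using abs_Re_le_cmod[of "f x"] abs_Im_le_cmod[of "f x"] f[of x] by linarith+
  show ?thesis
    by (rule complex_eqI)
      (simp_all add: integral_Re[OF int, symmetric] integral_Im[OF int, symmetric]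
        integral_Re[OF int2, symmetric] integral_Im[OF int2, symmetric]
        expectation_bind_pmf[of "\<lambda>x. Re (f x)", OF r(1)] expectation_bind_pmf[of "\<lambda>x. Im (f x)", OF r(2)])
qed

context cone_walk
begin

definition phi :: "real \<times> real \<times> real \<Rightarrow> complex" where
  "phi \<theta> = measure_pmf.expectation p (\<lambda>s. cis (ang \<theta> s))"

lemma integrable_cis [simp]: "integrable (measure_pmf q) (\<lambda>s. cis (g s))"
  by (rule integrable_pmf_bounded[where B=1]) simp

lemma norm_phi_le_1: "norm (phi \<theta>) \<le> 1"
proof -
  have "norm (phi \<theta>) \<le> measure_pmf.expectation p (\<lambda>s. norm (cis (ang \<theta> s)))"
    unfolding phi_def by (rule integral_norm_bound)
  then show ?thesis by simp
qed

lemma measurable_ang_pair: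
  "(\<lambda>x. ang (snd x) (fst x)) \<in> borel_measurable (measure_pmf q \<Otimes>\<^sub>M (borel \<Otimes>\<^sub>M (borel \<Otimes>\<^sub>M borel)))"
proof -
  have [measurable]: "g \<in> borel_measurable (measure_pmf q)" for g :: "point \<Rightarrow> real" by simp
  have [measurable]: "(\<lambda>x. g (fst x)) \<in> borel_measurable (measure_pmf q \<Otimes>\<^sub>M N)" for g :: "point \<Rightarrow> real" and N :: "'z measure"
    by measurable
  show ?thesis
    unfolding ang_def
    by (intro borel_measurable_add borel_measurable_times) measurable
qed

lemma measurable_phi [measurable]: "phi \<in> borel_measurable (borel \<Otimes>\<^sub>M (borel \<Otimes>\<^sub>M borel))"
proof -
  have "(\<lambda>x. ang (fst x) (snd x)) \<in> borel_measurable ((borel \<Otimes>\<^sub>M (borel \<Otimes>\<^sub>M borel)) \<Otimes>\<^sub>M measure_pmf p)"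
    using measurable_compose[OF measurable_pair_swap' measurable_ang_pair[of p]] by (simp add: case_prod_beta)
  then have "(\<lambda>(\<theta>, s). cis (ang \<theta> s)) \<in> borel_measurable ((borel \<Otimes>\<^sub>M (borel \<Otimes>\<^sub>M borel)) \<Otimes>\<^sub>M measure_pmf p)"
    by (simp add: case_prod_beta measurable_compose[OF _ measurable_cis])
  then show ?thesis
    unfolding phi_def[abs_def] by (rule measure_pmf.borel_measurable_lebesgue_integral)
qed

lemma expectation_steps_cis:
  "measure_pmf.expectation (steps p n) (\<lambda>s. cis (ang \<theta> s)) = phi \<theta> ^ n"
proof (induction n)
  case (Suc n)
  show ?case
    by (simp add: expectation_bind_pmf_complex[where B=1] ang_add cis_mult[symmetric] Suc
        flip: phi_def)
qed simp

text \<open>Fubini for an arbitrary family of angles \<open>\<Theta>\<close>, so that inversion for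
  the full law, for the law of the gap and for the spatial marginal are three instances.\<close>

lemma fourier_steps:
  assumes "prob_space N" and \<Theta> [measurable]: "\<Theta> \<in> measurable N (borel \<Otimes>\<^sub>M (borel \<Otimes>\<^sub>M borel))"
    and a [measurable]: "a \<in> borel_measurable N" and A: "\<And>\<omega>. norm (a \<omega>) \<le> A"
  shows "measure_pmf.expectation (steps p n) (\<lambda>s. \<integral>\<omega>. a \<omega> * cis (ang (\<Theta> \<omega>) s) \<partial>N)
    = (\<integral>\<omega>. a \<omega> * phi (\<Theta> \<omega>) ^ n \<partial>N)"
proof -
  interpret N: prob_space N by fact
  interpret pair_prob_space "measure_pmf (steps p n)" N ..
  have m: "(\<lambda>x. ang (\<Theta> (snd x)) (fst x)) \<in> borel_measurable (measure_pmf (steps p n) \<Otimes>\<^sub>M N)"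
    using measurable_compose[of "\<lambda>x. (fst x, \<Theta> (snd x))" "measure_pmf (steps p n) \<Otimes>\<^sub>M N"
        "measure_pmf (steps p n) \<Otimes>\<^sub>M (borel \<Otimes>\<^sub>M (borel \<Otimes>\<^sub>M borel))", OF _ measurable_ang_pair] by simp
  have m': "(\<lambda>x. a (snd x) * cis (ang (\<Theta> (snd x)) (fst x)))
      \<in> borel_measurable (measure_pmf (steps p n) \<Otimes>\<^sub>M N)"
    using measurable_compose[OF m measurable_cis] by measurable
  have "integrable (measure_pmf (steps p n) \<Otimes>\<^sub>M N) (\<lambda>x. a (snd x) * cis (ang (\<Theta> (snd x)) (fst x)))"
    by (rule integrable_const_bound[where B=A, OF _ m']) (auto simp: norm_mult A)
  then have "(\<integral>\<omega>. (\<integral>s. a \<omega> * cis (ang (\<Theta> \<omega>) s) \<partial>measure_pmf (steps p n)) \<partial>N)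
     = measure_pmf.expectation (steps p n) (\<lambda>s. \<integral>\<omega>. a \<omega> * cis (ang (\<Theta> \<omega>) s) \<partial>N)"
    by (intro Fubini_integral) (simp only: case_prod_unfold)
  then show ?thesis by (simp add: expectation_steps_cis)
qed

lemma pmf_steps_fourier:
  "complex_of_real (pmf (steps p n) z) = (\<integral>\<theta>. phi \<theta> ^ n * cis (- ang \<theta> z) \<partial>torus)"
proof -
  have "complex_of_real (pmf (steps p n) z)
      = measure_pmf.expectation (steps p n) (\<lambda>s. complex_of_real (indicator {z} s))"
    by (simp add: measure_pmf_single)
  also have "(\<lambda>s. complex_of_real (indicator {z} s)) = (\<lambda>s. \<integral>\<theta>. cis (- ang \<theta> z) * cis (ang \<theta> s) \<partial>torus)"
    using integral_torus_cis[of "s - z" for s]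
    by (auto simp: cis_mult ang_diff indicator_def algebra_simps fun_eq_iff simp del: split_paired_All)
  also have "measure_pmf.expectation (steps p n) (\<lambda>s. \<integral>\<theta>. cis (- ang \<theta> z) * cis (ang \<theta> s) \<partial>torus)
     = (\<integral>\<theta>. cis (- ang \<theta> z) * phi \<theta> ^ n \<partial>torus)"
    by (rule fourier_steps[where A=1]) (auto simp: torus.prob_space_axioms)
  finally show ?thesis by (simp add: mult.commute)
qed

text \<open>The angle \<open>(0, - \<theta>, \<theta>)\<close> pairs with a point to
  \<open>\<theta>\<close> times its gap, so the one-dimensional law of the gap is inverted on a
  single circle.\<close>

lemma prob_gap_fourier:
  "complex_of_real (measure_pmf.prob (steps p n) {s. gap s = j})
    = (\<integral>\<theta>. phi (0, - \<theta>, \<theta>) ^ n * cis (- \<theta> * of_int j) \<partial>circ)"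
proof -
  have "complex_of_real (measure_pmf.prob (steps p n) {s. gap s = j})
      = measure_pmf.expectation (steps p n) (\<lambda>s. complex_of_real (indicator {s. gap s = j} s))"
    by simp
  also have "(\<lambda>s. complex_of_real (indicator {s. gap s = j} s))
      = (\<lambda>s. \<integral>\<theta>. cis (- \<theta> * of_int j) * cis (ang (0, - \<theta>, \<theta>) s) \<partial>circ)"
    using integral_circ_cis[of "gap s - j" for s]
    by (auto simp: cis_mult ang_def gap_def indicator_def algebra_simps fun_eq_iff simp del: split_paired_All)
  also have "measure_pmf.expectation (steps p n) (\<lambda>s. \<integral>\<theta>. cis (- \<theta> * of_int j) * cis (ang (0, - \<theta>, \<theta>) s) \<partial>circ)
     = (\<integral>\<theta>. cis (- \<theta> * of_int j) * phi (0, - \<theta>, \<theta>) ^ n \<partial>circ)"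
    by (rule fourier_steps[where A=1]) (auto simp: circ.prob_space_axioms)
  finally show ?thesis by (simp add: mult.commute)
qed

lemma prob_space_fourier:
  "complex_of_real (measure_pmf.prob (steps p n) {s. snd s = (v, x)})
    = (\<integral>\<theta>. phi (0, \<theta>) ^ n * cis (- (fst \<theta> * of_int v + snd \<theta> * of_int x)) \<partial>torus2)"
proof -
  have "complex_of_real (measure_pmf.prob (steps p n) {s. snd s = (v, x)})
      = measure_pmf.expectation (steps p n) (\<lambda>s. complex_of_real (indicator {s. snd s = (v, x)} s))"
    by simp
  also have "(\<lambda>s. complex_of_real (indicator {s. snd s = (v, x)} s))
      = (\<lambda>s. \<integral>\<theta>. cis (- (fst \<theta> * of_int v + snd \<theta> * of_int x)) * cis (ang (0, \<theta>) s) \<partial>torus2)"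
    using integral_torus2_cis[of "fst (snd s) - v" "snd (snd s) - x" for s] torus2.prob_space
    by (auto simp: cis_mult ang_def indicator_def algebra_simps fun_eq_iff prod_eq_iff simp del: split_paired_All)
  also have "measure_pmf.expectation (steps p n)
      (\<lambda>s. \<integral>\<theta>. cis (- (fst \<theta> * of_int v + snd \<theta> * of_int x)) * cis (ang (0, \<theta>) s) \<partial>torus2)
     = (\<integral>\<theta>. cis (- (fst \<theta> * of_int v + snd \<theta> * of_int x)) * phi (0, \<theta>) ^ n \<partial>torus2)"
    by (rule fourier_steps[where A=1]) (auto simp: torus2.prob_space_axioms)
  finally show ?thesis by (simp add: mult.commute)
qed

end

section \<open>Gaussian decay of the characteristic function\<close>

lemma one_minus_cos_ge:
  assumes "\<bar>u\<bar> \<le> (2::real)"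
  shows "u\<^sup>2 / 3 \<le> 1 - cos u"
proof -
  obtain t where "cos u = (\<Sum>m<4. cos_coeff m * u ^ m) + (cos (t + 1/2 * real 4 * pi) / fact 4) * u ^ 4"
    using Maclaurin_cos_expansion[of u 4] by blast
  moreover have "(\<Sum>m<4. cos_coeff m * u ^ m) = 1 - u\<^sup>2 / 2"
    by (simp add: cos_coeff_def lessThan_nat_numeral lessThan_Suc fact_numeral)
  moreover have "(cos (t + 1/2 * real 4 * pi) / fact 4) * u ^ 4 \<le> 1 / 24 * u ^ 4"
    by (intro mult_right_mono) (simp_all add: fact_numeral)
  \<comment> \<open>On this range the fourth-order term is at most \<open>u^2 / 6\<close>, and
    \<open>1/2 - 1/6\<close> is the constant claimed.\<close>
  moreover have "u ^ 4 \<le> 4 * u\<^sup>2"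
  proof -
    have "u\<^sup>2 \<le> 2\<^sup>2" using assms by (subst abs_le_square_iff[symmetric]) simp
    then have "u\<^sup>2 * u\<^sup>2 \<le> 4 * u\<^sup>2" by (intro mult_right_mono) auto
    then show ?thesis by (simp add: power4_eq_xxxx power2_eq_square)
  qed
  ultimately show ?thesis by simp
qed

lemma power_le_fact_exp: "0 \<le> x \<Longrightarrow> x ^ k \<le> fact k * exp (x::real)"
proof -
  assume x: "0 \<le> x"
  have "(\<Sum>n\<in>{k}. x ^ n /\<^sub>R fact n) \<le> (\<Sum>n. x ^ n /\<^sub>R fact n)"
    by (rule sum_le_suminf[OF summable_exp_generic]) (use x in auto)
  then show ?thesis by (simp add: exp_def field_simps)
qed

text \<open>Completing the square bounds \<open>x\<close> by \<open>b * x^2 + 1 / (4 * b)\<close> in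
  the exponent. This lets a small part of a Gaussian absorb polynomial factors.\<close>

lemma power_le_gauss:
  assumes "0 \<le> x" "0 < (b::real)"
  shows "x ^ k \<le> fact k * (exp (1 / (4 * b)) * exp (b * x\<^sup>2))"
proof -
  have "0 \<le> (2 * b * x - 1)\<^sup>2 / (4 * b)" using assms by simp
  also have "\<dots> = b * x\<^sup>2 - x + 1 / (4 * b)"
    using assms by (simp add: power2_eq_square field_simps)
  finally have "exp x \<le> exp (1 / (4 * b) + b * x\<^sup>2)" by simp
  then have "fact k * exp x \<le> fact k * (exp (1 / (4 * b)) * exp (b * x\<^sup>2))"
    by (intro mult_left_mono) (auto simp: exp_add)
  with power_le_fact_exp[OF assms(1), of k] show ?thesis by linarith
qed

lemma integral_circ_gauss_le:
  assumes b: "0 < b"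
  shows "(\<integral>x. exp (- (b * x\<^sup>2)) \<partial>circ) \<le> 1 / sqrt b"
proof -
  define \<sigma> where "\<sigma> = 1 / sqrt (2 * b)"
  have \<sigma>: "0 < \<sigma>" using b by (simp add: \<sigma>_def)
  have \<sigma>2: "2 * \<sigma>\<^sup>2 = 1 / b" using b by (simp add: \<sigma>_def power_divide)
  have eq: "exp (- (b * x\<^sup>2)) = sqrt (pi / b) * normal_density 0 \<sigma> x" for x
  proof -
    have "2 * pi * \<sigma>\<^sup>2 = pi / b" using \<sigma>2 by (simp add: field_simps)
    moreover have "x\<^sup>2 / (2 * \<sigma>\<^sup>2) = b * x\<^sup>2" unfolding \<sigma>2 using b by simp
    ultimately show ?thesis using b unfolding normal_density_def by (simp add: real_sqrt_divide)
  qed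
  have int: "integrable lborel (\<lambda>x. exp (- (b * x\<^sup>2)))"
    unfolding eq using integrable_normal_density[OF \<sigma>] by simp
  have val: "(\<integral>x. exp (- (b * x\<^sup>2)) \<partial>lborel) = sqrt (pi / b)"
    unfolding eq using integral_normal_density[OF \<sigma>] by simp
  have "(\<integral>x. exp (- (b * x\<^sup>2)) \<partial>circ)
      = (\<integral>x. (indicator {- pi..pi} x / (2 * pi)) *\<^sub>R exp (- (b * x\<^sup>2)) \<partial>lborel)"
    by (rule integral_circ) simp
  also have "\<dots> \<le> (\<integral>x. 1 / (2 * pi) * exp (- (b * x\<^sup>2)) \<partial>lborel)"
    by (rule integral_mono') (use int in \<open>auto simp: indicator_def\<close>)
  also have "\<dots> = sqrt pi / (2 * pi) / sqrt b"
    using val by (simp add: real_sqrt_divide)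
  also have "\<dots> \<le> 1 / sqrt b"
  proof -
    have "sqrt pi \<le> sqrt (pi\<^sup>2)"
      using pi_ge_two by (intro real_sqrt_le_mono) (simp add: power2_eq_square)
    then have "sqrt pi \<le> 2 * pi" using pi_gt_zero by (smt (verit) real_sqrt_abs)
    then have "sqrt pi / (2 * pi) \<le> 1" using pi_gt_zero by (simp add: field_simps)
    then show ?thesis using b by (intro divide_right_mono) auto
  qed
  finally show ?thesis .
qed

definition sqm :: "real \<times> real \<times> real \<Rightarrow> real" where
  "sqm \<theta> = (fst \<theta>)\<^sup>2 + (fst (snd \<theta>))\<^sup>2 + (snd (snd \<theta>))\<^sup>2"

lemma sqm_nonneg [simp]: "0 \<le> sqm \<theta>"
  by (simp add: sqm_def)

lemma measurable_sqm [measurable]: "sqm \<in> borel_measurable (borel \<Otimes>\<^sub>M (borel \<Otimes>\<^sub>M borel))"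
  unfolding sqm_def[abs_def] by measurable

lemma mag_sq_le: "(mag \<theta>)\<^sup>2 \<le> 3 * sqm \<theta>"
proof -
  let ?a = "\<bar>fst \<theta>\<bar>" and ?b = "\<bar>fst (snd \<theta>)\<bar>" and ?c = "\<bar>snd (snd \<theta>)\<bar>"
  have "0 \<le> (?a - ?b)\<^sup>2 + (?b - ?c)\<^sup>2 + (?a - ?c)\<^sup>2" by simp
  then have "(?a + ?b + ?c)\<^sup>2 \<le> 3 * (?a\<^sup>2 + ?b\<^sup>2 + ?c\<^sup>2)"
    by (simp add: power2_eq_square algebra_simps)
  then show ?thesis by (simp add: mag_def sqm_def)
qed

lemma integral_torus_gauss_le:
  assumes b: "0 < b"
  shows "(\<integral>\<theta>. exp (- (b * sqm \<theta>)) \<partial>torus) \<le> 1 / sqrt b ^ 3"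
proof -
  let ?g = "\<lambda>x. exp (- (b * x\<^sup>2))"
  have [simp]: "exp (- (b * x\<^sup>2)) \<le> 1" for x using b by simp
  have "(\<integral>\<theta>. exp (- (b * sqm \<theta>)) \<partial>torus)
      = (\<integral>\<theta>. ?g (fst \<theta>) * (?g (fst (snd \<theta>)) * ?g (snd (snd \<theta>))) \<partial>torus)"
    by (simp add: sqm_def exp_add[symmetric] algebra_simps)
  also have "\<dots> = (\<integral>x. ?g x \<partial>circ) * (\<integral>\<theta>. ?g (fst \<theta>) * ?g (snd \<theta>) \<partial>torus2)"
    unfolding torus_def
    by (rule integral_pair_times[where A=1 and B=1])
      (use b in \<open>auto simp: circ.prob_space_axioms torus2.prob_space_axioms norm_mult intro!: mult_le_one\<close>)
  also have "(\<integral>\<theta>. ?g (fst \<theta>) * ?g (snd \<theta>) \<partial>torus2) = (\<integral>x. ?g x \<partial>circ) * (\<integral>x. ?g x \<partial>circ)"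
    unfolding torus2_def
    by (rule integral_pair_times[where A=1 and B=1]) (use b in \<open>auto simp: circ.prob_space_axioms\<close>)
  finally have "(\<integral>\<theta>. exp (- (b * sqm \<theta>)) \<partial>torus) = (\<integral>x. ?g x \<partial>circ) ^ 3"
    by (simp add: power3_eq_cube)
  also have "\<dots> \<le> (1 / sqrt b) ^ 3"
    by (intro power_mono integral_circ_gauss_le b integral_nonneg_AE) simp
  finally show ?thesis by (simp add: power_divide)
qed

context cone_walk
begin

lemma expectation_ge_pmf:
  fixes f :: "point \<Rightarrow> real"
  assumes "integrable (measure_pmf p) f" "\<And>s. 0 \<le> f s" "finite A"
  shows "(\<Sum>a\<in>A. f a * pmf p a) \<le> measure_pmf.expectation p f"
proof -
  have "(\<Sum>a\<in>A. f a * pmf p a) = measure_pmf.expectation p (\<lambda>s. f s * indicator A s)"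
    by (subst integral_measure_pmf_real[OF assms(3)])
      (auto simp: indicator_def intro!: sum.cong)
  also have "\<dots> \<le> measure_pmf.expectation p f"
    by (rule integral_mono'[OF assms(1)]) (simp_all add: assms(2) indicator_def)
  finally show ?thesis .
qed

text \<open>Rotating by the argument of \<open>phi \<theta>\<close> writes
  \<open>1 - norm (phi \<theta>)\<close> as the expectation of the nonnegative function
  \<open>f\<close>. Two atoms that differ by a unit vector cannot both have an angle close to that
  argument unless the corresponding component of \<open>\<theta>\<close> is small.\<close>

lemma norm_phi_le_exp:
  obtains c where "0 < c" "\<And>\<theta>. \<bar>fst \<theta>\<bar> \<le> pi \<Longrightarrow> \<bar>fst (snd \<theta>)\<bar> \<le> pi \<Longrightarrow> \<bar>snd (snd \<theta>)\<bar> \<le> pi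
    \<Longrightarrow> norm (phi \<theta>) \<le> exp (- (c * sqm \<theta>))"
proof -
  obtain t where t: "0 < pmf p (t, 0, 0)" "0 < pmf p (t + 1, 0, 0)" "0 < pmf p (t, 1, 0)"
    "0 < pmf p (t, 0, 1)" using atoms by blast
  let ?a = "(t, 0, 0) :: point" and ?b = "(t + 1, 0, 0) :: point"
    and ?c = "(t, 1, 0) :: point" and ?d = "(t, 0, 1) :: point"
  \<comment> \<open>The atom \<open>?a\<close> is paired with each of the other three, so only a
    third of its mass is available to each pair.\<close>
  define \<epsilon> where "\<epsilon> = Min {pmf p ?a / 3, pmf p ?b, pmf p ?c, pmf p ?d}"
  have \<epsilon>: "0 < \<epsilon>" "\<epsilon> \<le> pmf p ?a / 3" "\<epsilon> \<le> pmf p ?b" "\<epsilon> \<le> pmf p ?c" "\<epsilon> \<le> pmf p ?d"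
    using t by (auto simp: \<epsilon>_def)
  have "norm (phi \<theta>) \<le> exp (- (\<epsilon> / 6 * sqm \<theta>))"
    if \<theta>: "\<bar>fst \<theta>\<bar> \<le> pi" "\<bar>fst (snd \<theta>)\<bar> \<le> pi" "\<bar>snd (snd \<theta>)\<bar> \<le> pi" for \<theta>
  proof -
    define r where "r = cis (- Arg (phi \<theta>)) * phi \<theta>"
    define f where "f s = 1 - cos (ang \<theta> s - Arg (phi \<theta>))" for s
    have f0: "0 \<le> f s" for s by (simp add: f_def)
    have "norm (phi \<theta>) = Re r"
    proof -
      have "r = complex_of_real (norm (phi \<theta>))"
        using rcis_cmod_Arg[of "phi \<theta>"] unfolding r_def rcis_def
        by (metis cis_mult cis_zero add.left_inverse mult.left_commute mult.right_neutral)
      then show ?thesis by simp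
    qed
    also have "r = measure_pmf.expectation p (\<lambda>s. cis (ang \<theta> s - Arg (phi \<theta>)))"
      unfolding r_def phi_def[of \<theta>] by (simp add: cis_mult flip: integral_mult_right_zero)
    also have "Re \<dots> = measure_pmf.expectation p (\<lambda>s. Re (cis (ang \<theta> s - Arg (phi \<theta>))))"
      by (rule integral_Re[symmetric]) simp
    also have "\<dots> = 1 - measure_pmf.expectation p f"
    proof -
      have "integrable (measure_pmf p) (\<lambda>s. cos (ang \<theta> s - Arg (phi \<theta>)))"
        by (rule integrable_pmf_bounded[where B=1]) simp
      then show ?thesis by (simp add: f_def[abs_def])
    qed
    finally have 1: "norm (phi \<theta>) = 1 - measure_pmf.expectation p f" .
    have "integrable (measure_pmf p) f"
      by (rule integrable_pmf_bounded[where B=2])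
        (use f0 cos_ge_minus_one in \<open>simp add: f_def; smt (verit)\<close>)
    then have "(\<Sum>a\<in>{?a, ?b, ?c, ?d}. f a * pmf p a) \<le> measure_pmf.expectation p f"
      using f0 by (intro expectation_ge_pmf) auto
    then have 2: "f ?a * pmf p ?a + f ?b * pmf p ?b + f ?c * pmf p ?c + f ?d * pmf p ?d
        \<le> measure_pmf.expectation p f"
      by simp
    have "f ?a * (3 * \<epsilon>) \<le> f ?a * pmf p ?a" "f ?b * \<epsilon> \<le> f ?b * pmf p ?b"
      "f ?c * \<epsilon> \<le> f ?c * pmf p ?c" "f ?d * \<epsilon> \<le> f ?d * pmf p ?d"
      using \<epsilon> f0 by (auto intro!: mult_left_mono)
    with 2 have 3: "((f ?a + f ?b) + (f ?a + f ?c) + (f ?a + f ?d)) * \<epsilon> \<le> measure_pmf.expectation p f"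
      by (simp add: algebra_simps)
    \<comment> \<open>Sum-to-product: two cosines whose angles differ by \<open>u\<close> have sum
      at most \<open>2 * cos (u / 2)\<close>, whatever the common rotation is.\<close>
    have pair: "u\<^sup>2 / 6 \<le> f ?a + (1 - cos (ang \<theta> ?a - Arg (phi \<theta>) + u))" if u: "\<bar>u\<bar> \<le> pi" for u
    proof -
      let ?x = "ang \<theta> ?a - Arg (phi \<theta>)"
      have "cos ?x + cos (?x + u) = 2 * (cos (?x + u / 2) * cos (u / 2))"
      proof -
        define y where "y = ?x + u / 2"
        have "?x = y - u / 2" "?x + u = y + u / 2" by (simp_all add: y_def)
        then show ?thesis
          unfolding y_def[symmetric] by (simp only: cos_add cos_diff)
      qed
      also have "\<dots> \<le> 2 * cos (u / 2)"
      proof -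
        have "0 \<le> cos (u / 2)" using u by (intro cos_ge_zero) auto
        then have "cos (?x + u / 2) * cos (u / 2) \<le> 1 * cos (u / 2)"
          by (intro mult_right_mono) auto
        then show ?thesis by simp
      qed
      finally have "2 * (1 - cos (u / 2)) \<le> f ?a + (1 - cos (?x + u))" by (simp add: f_def)
      moreover have "(u / 2)\<^sup>2 / 3 \<le> 1 - cos (u / 2)"
        using u pi_less_4 by (intro one_minus_cos_ge) auto
      ultimately show ?thesis by (simp add: power_divide)
    qed
    have "(fst \<theta>)\<^sup>2 / 6 \<le> f ?a + f ?b" "(fst (snd \<theta>))\<^sup>2 / 6 \<le> f ?a + f ?c"
      "(snd (snd \<theta>))\<^sup>2 / 6 \<le> f ?a + f ?d"
      using pair[OF \<theta>(1)] pair[OF \<theta>(2)] pair[OF \<theta>(3)] by (simp_all add: f_def ang_def algebra_simps)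
    then have "sqm \<theta> / 6 * \<epsilon> \<le> ((f ?a + f ?b) + (f ?a + f ?c) + (f ?a + f ?d)) * \<epsilon>"
      using \<epsilon>(1) by (intro mult_right_mono) (auto simp: sqm_def)
    with 1 3 have "norm (phi \<theta>) \<le> 1 + (- (\<epsilon> / 6 * sqm \<theta>))" by (simp add: algebra_simps)
    also have "\<dots> \<le> exp (- (\<epsilon> / 6 * sqm \<theta>))" by (rule exp_ge_add_one_self)
    finally show ?thesis .
  qed
  then show thesis using \<epsilon>(1) by (intro that[of "\<epsilon> / 6"]) auto
qed

text \<open>The scale of the integral is \<open>mag\<close> of order \<open>1 / sqrt n\<close>, so
  every factor \<open>mag\<close> gains one such power. Half of the Gaussian decay is spent on
  \<open>mag ^ k\<close>, the other half is integrated over the torus.\<close>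

lemma integral_mag_phi_le:
  obtains C where "0 \<le> C"
    "\<And>n F A. 1 \<le> n \<Longrightarrow> 0 \<le> A \<Longrightarrow> (\<And>\<theta>. norm (F \<theta>) \<le> A * mag \<theta> ^ k)
      \<Longrightarrow> norm (\<integral>\<theta>. phi \<theta> ^ n * F \<theta> \<partial>torus) \<le> A * C / sqrt (real n) ^ (3 + k)"
proof -
  obtain c where c: "0 < c" and phi: "\<And>\<theta>. \<bar>fst \<theta>\<bar> \<le> pi \<Longrightarrow> \<bar>fst (snd \<theta>)\<bar> \<le> pi \<Longrightarrow> \<bar>snd (snd \<theta>)\<bar> \<le> pi
    \<Longrightarrow> norm (phi \<theta>) \<le> exp (- (c * sqm \<theta>))"
    by (rule norm_phi_le_exp, rule that)
  \<comment> \<open>The rate \<open>c / 6\<close> becomes \<open>c / 2\<close> after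
    \<open>mag_sq_le\<close>, which costs a factor 3.\<close>
  define G where "G = fact k * exp (1 / (4 * (c / 6)))"
  define C where "C = G / sqrt (c / 2) ^ 3"
  have G: "0 \<le> G" by (simp add: G_def)
  have "norm (\<integral>\<theta>. phi \<theta> ^ n * F \<theta> \<partial>torus) \<le> A * C / sqrt (real n) ^ (3 + k)"
    if n: "1 \<le> n" and A: "0 \<le> A" and F: "\<And>\<theta>. norm (F \<theta>) \<le> A * mag \<theta> ^ k" for n F A
  proof -
    define b where "b = c / 2 * real n"
    have b: "0 < b" using c n by (simp add: b_def)
    let ?maj = "\<lambda>\<theta>. A * G / sqrt (real n) ^ k * exp (- (b * sqm \<theta>))"
    have "norm (\<integral>\<theta>. phi \<theta> ^ n * F \<theta> \<partial>torus) \<le> (\<integral>\<theta>. norm (phi \<theta> ^ n * F \<theta>) \<partial>torus)"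
      by (rule integral_norm_bound)
    also have "\<dots> \<le> (\<integral>\<theta>. ?maj \<theta> \<partial>torus)"
    proof (rule integral_mono_AE')
      show "integrable torus ?maj"
        by (rule torus.integrable_const_bound[where B="A * G / sqrt (real n) ^ k"])
          (use A G b in \<open>auto intro!: AE_I2 divide_right_mono mult_left_le\<close>)
      show "AE \<theta> in torus. 0 \<le> ?maj \<theta>" using A G by auto
      show "AE \<theta> in torus. norm (phi \<theta> ^ n * F \<theta>) \<le> ?maj \<theta>"
        using AE_torus
      proof eventually_elim
        fix \<theta> :: "real \<times> real \<times> real" assume \<theta>: "\<bar>fst \<theta>\<bar> \<le> pi \<and> \<bar>fst (snd \<theta>)\<bar> \<le> pi \<and> \<bar>snd (snd \<theta>)\<bar> \<le> pi"
        have "norm (phi \<theta>) ^ n \<le> exp (- (c * sqm \<theta>)) ^ n"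
          using phi \<theta> by (intro power_mono) auto
        also have "\<dots> = exp (- (2 * (b * sqm \<theta>)))"
          by (simp add: exp_of_nat_mult[symmetric] b_def algebra_simps)
        finally have 1: "norm (phi \<theta>) ^ n \<le> exp (- (2 * (b * sqm \<theta>)))" .
        have "(sqrt (real n) * mag \<theta>) ^ k \<le> G * exp (c / 6 * (sqrt (real n) * mag \<theta>)\<^sup>2)"
          unfolding G_def mult.assoc using c by (intro power_le_gauss) auto
        also have "c / 6 * (sqrt (real n) * mag \<theta>)\<^sup>2 = c / 6 * real n * (mag \<theta>)\<^sup>2"
          by (simp add: power_mult_distrib)
        also have "G * exp (c / 6 * real n * (mag \<theta>)\<^sup>2) \<le> G * exp (b * sqm \<theta>)"
        proof -
          have "c / 6 * real n * (mag \<theta>)\<^sup>2 \<le> c / 6 * real n * (3 * sqm \<theta>)"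
            using c by (intro mult_left_mono mag_sq_le) auto
          then show ?thesis using G by (intro mult_left_mono) (auto simp: b_def)
        qed
        finally have 2: "mag \<theta> ^ k \<le> G * exp (b * sqm \<theta>) / sqrt (real n) ^ k"
          using n by (simp add: power_mult_distrib field_simps)
        have "norm (phi \<theta> ^ n * F \<theta>) \<le> exp (- (2 * (b * sqm \<theta>))) * (A * (G * exp (b * sqm \<theta>) / sqrt (real n) ^ k))"
          unfolding norm_mult norm_power
          by (intro mult_mono 1 order_trans[OF F] mult_left_mono 2 A) auto
        also have "\<dots> = A * G / sqrt (real n) ^ k * (exp (- (2 * (b * sqm \<theta>))) * exp (b * sqm \<theta>))"
          by simp
        also have "exp (- (2 * (b * sqm \<theta>))) * exp (b * sqm \<theta>) = exp (- (b * sqm \<theta>))"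
          by (simp add: exp_add[symmetric])
        finally show "norm (phi \<theta> ^ n * F \<theta>) \<le> ?maj \<theta>" .
      qed
    qed
    also have "\<dots> = A * G / sqrt (real n) ^ k * (\<integral>\<theta>. exp (- (b * sqm \<theta>)) \<partial>torus)"
      by simp
    also have "\<dots> \<le> A * G / sqrt (real n) ^ k * (1 / sqrt b ^ 3)"
      using A G by (intro mult_left_mono integral_torus_gauss_le b) auto
    also have "sqrt b ^ 3 = sqrt (c / 2) ^ 3 * sqrt (real n) ^ 3"
      by (simp only: b_def real_sqrt_mult power_mult_distrib)
    also have "A * G / sqrt (real n) ^ k * (1 / (sqrt (c / 2) ^ 3 * sqrt (real n) ^ 3)) = A * C / sqrt (real n) ^ (3 + k)"
      by (simp add: C_def power_add mult_ac)
    finally show ?thesis .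
  qed
  moreover have "0 \<le> C" using G c by (simp add: C_def)
  ultimately show thesis using that by blast
qed

lemma prob_gap_le:
  obtains C where "0 \<le> C"
    "\<And>n j. 1 \<le> n \<Longrightarrow> measure_pmf.prob (steps p n) {s. gap s = j} \<le> C / sqrt (real n)"
proof -
  obtain c where c: "0 < c" and phi: "\<And>\<theta>. \<bar>fst \<theta>\<bar> \<le> pi \<Longrightarrow> \<bar>fst (snd \<theta>)\<bar> \<le> pi \<Longrightarrow> \<bar>snd (snd \<theta>)\<bar> \<le> pi
    \<Longrightarrow> norm (phi \<theta>) \<le> exp (- (c * sqm \<theta>))"
    by (rule norm_phi_le_exp, rule that)
  have "measure_pmf.prob (steps p n) {s. gap s = j} \<le> (1 / sqrt (2 * c)) / sqrt (real n)"
    if n: "1 \<le> n" for n j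
  proof -
    define b where "b = 2 * c * real n"
    have b: "0 < b" using c n by (simp add: b_def)
    have "measure_pmf.prob (steps p n) {s. gap s = j}
        = norm (complex_of_real (measure_pmf.prob (steps p n) {s. gap s = j}))" by simp
    also have "\<dots> \<le> (\<integral>\<theta>. norm (phi (0, - \<theta>, \<theta>) ^ n * cis (- \<theta> * of_int j)) \<partial>circ)"
      unfolding prob_gap_fourier by (rule integral_norm_bound)
    also have "\<dots> \<le> (\<integral>\<theta>. exp (- (b * \<theta>\<^sup>2)) \<partial>circ)"
    proof (rule integral_mono_AE')
      show "integrable circ (\<lambda>\<theta>. exp (- (b * \<theta>\<^sup>2)))"
        by (rule circ.integrable_const_bound[where B=1]) (use b in auto)
      show "AE \<theta> in circ. norm (phi (0, - \<theta>, \<theta>) ^ n * cis (- \<theta> * of_int j)) \<le> exp (- (b * \<theta>\<^sup>2))"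
        using AE_circ
      proof eventually_elim
        fix \<theta> :: real assume \<theta>: "\<bar>\<theta>\<bar> \<le> pi"
        have "norm (phi (0, - \<theta>, \<theta>)) ^ n \<le> exp (- (c * sqm (0, - \<theta>, \<theta>))) ^ n"
          using phi[of "(0, - \<theta>, \<theta>)"] \<theta> by (intro power_mono) auto
        also have "\<dots> = exp (- (b * \<theta>\<^sup>2))"
          by (simp add: exp_of_nat_mult[symmetric] b_def sqm_def algebra_simps)
        finally show "norm (phi (0, - \<theta>, \<theta>) ^ n * cis (- \<theta> * of_int j)) \<le> exp (- (b * \<theta>\<^sup>2))"
          by (simp add: norm_mult norm_power)
      qed
    qed auto
    also have "\<dots> \<le> 1 / sqrt b" by (rule integral_circ_gauss_le[OF b])
    also have "\<dots> = (1 / sqrt (2 * c)) / sqrt (real n)" by (simp add: b_def real_sqrt_mult)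
    finally show ?thesis .
  qed
  moreover have "0 \<le> 1 / sqrt (2 * c)" using c by simp
  ultimately show thesis using that by blast
qed

end

lemma sqrt_half_le:
  assumes "1 \<le> n" "real n \<le> 4 * real m"
  shows "sqrt (real n) \<le> 2 * sqrt (real m)"
proof -
  have "sqrt (real n) \<le> sqrt (4 * real m)" using assms by simp
  then show ?thesis by (simp add: real_sqrt_mult)
qed

lemma div_sqrt_half_le:
  assumes "1 \<le> m" "1 \<le> n" "real n \<le> 4 * real m" "0 \<le> C"
  shows "C / sqrt (real m) ^ k \<le> 2 ^ k * C / sqrt (real n) ^ k"
proof -
  have "sqrt (real n) ^ k \<le> (2 * sqrt (real m)) ^ k"
    using assms by (intro power_mono sqrt_half_le) auto
  then have "C * sqrt (real n) ^ k \<le> C * (2 ^ k * sqrt (real m) ^ k)"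
    using assms(4) by (intro mult_left_mono) (simp_all add: power_mult_distrib)
  then show ?thesis using assms by (simp add: field_simps)
qed

lemma div2_bounds:
  assumes "2 \<le> (n::nat)"
  shows "1 \<le> n div 2" "1 \<le> n - n div 2" "real n \<le> 4 * real (n div 2)" "real n \<le> 4 * real (n - n div 2)"
  using assms by linarith+

context cone_walk
begin

subsection \<open>Survival estimates\<close>

lemma free_strip_le:
  obtains C where "0 \<le> C"
    "\<And>n z L. 1 \<le> n \<Longrightarrow> 0 \<le> L \<Longrightarrow>
      free p n (indicator {y. 0 < gap y \<and> real_of_int (gap y) < L}) z \<le> C * (L + 1) / sqrt (real n)"
proof -
  obtain C where C: "0 \<le> C"
    "\<And>n j. 1 \<le> n \<Longrightarrow> measure_pmf.prob (steps p n) {s. gap s = j} \<le> C / sqrt (real n)"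
    by (rule prob_gap_le, rule that)
  have "free p n (indicator {y. 0 < gap y \<and> real_of_int (gap y) < L}) z \<le> C * (L + 1) / sqrt (real n)"
    if n: "1 \<le> n" and L: "0 \<le> L" for n z L
  proof -
    define J where "J = {1 - gap z..\<lceil>L\<rceil> - gap z}"
    have "free p n (indicator {y. 0 < gap y \<and> real_of_int (gap y) < L}) z
        = measure_pmf.prob (steps p n) {s. z + s \<in> {y. 0 < gap y \<and> real_of_int (gap y) < L}}"
      by (rule free_indicator)
    also have "\<dots> \<le> measure_pmf.prob (steps p n) (\<Union>j\<in>J. {s. gap s = j})"
    proof (rule measure_pmf.finite_measure_mono)
      show "{s. z + s \<in> {y. 0 < gap y \<and> real_of_int (gap y) < L}} \<subseteq> (\<Union>j\<in>J. {s. gap s = j})"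
      proof
        fix s assume "s \<in> {s. z + s \<in> {y. 0 < gap y \<and> real_of_int (gap y) < L}}"
        then have "0 < gap z + gap s" "real_of_int (gap z + gap s) < L" by (auto simp: gap_add)
        then have "gap s \<in> J" unfolding J_def by (simp; linarith)
        then show "s \<in> (\<Union>j\<in>J. {s. gap s = j})" by blast
      qed
    qed simp
    also have "\<dots> \<le> (\<Sum>j\<in>J. measure_pmf.prob (steps p n) {s. gap s = j})"
      by (rule measure_pmf.finite_measure_subadditive_finite) (auto simp: J_def)
    also have "\<dots> \<le> (\<Sum>j\<in>J. C / sqrt (real n))" by (intro sum_mono C n)
    also have "\<dots> = of_int \<lceil>L\<rceil> * (C / sqrt (real n))"
      using L by (simp add: J_def)
    also have "\<dots> \<le> (L + 1) * (C / sqrt (real n))"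
      using C(1) by (intro mult_right_mono) (auto intro: less_imp_le ceiling_correct[THEN conjunct1, THEN less_imp_le] simp: of_int_ceiling_le_add_one)
    finally show ?thesis by (simp add: mult.commute)
  qed
  with C(1) that show thesis by blast
qed

text \<open>Strong induction by halving time. A survivor either has gap at least \<open>L\<close>,
  which Markov's inequality bounds by the initial gap over \<open>L\<close>, or lies in the strip
  below \<open>L\<close>. The second case costs survival of the first half, known by induction,
  times the small probability that the second half ends in a strip. For small
  \<open>\<epsilon>\<close> the product reproduces the constant \<open>C\<close> with a factor below
  one half.\<close>

lemma survival_le:
  obtains C where "0 \<le> C"
    "\<And>n z. 1 \<le> n \<Longrightarrow> gap z > 0 \<Longrightarrow> kill p n (\<lambda>_. 1) z \<le> C * real_of_int (gap z) / sqrt (real n)"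
proof -
  obtain C2 where C2: "0 \<le> C2" "\<And>n z L. 1 \<le> n \<Longrightarrow> 0 \<le> L \<Longrightarrow>
      free p n (indicator {y. 0 < gap y \<and> real_of_int (gap y) < L}) z \<le> C2 * (L + 1) / sqrt (real n)"
    by (rule free_strip_le, rule that)
  obtain Q where Q: "0 \<le> Q" "\<And>n z L. gap z > 0 \<Longrightarrow> 0 < L \<Longrightarrow>
      kill p n (indicator {y. L \<le> real_of_int (gap y)}) z \<le> (real_of_int (gap z) + Q) / L"
    by (rule kill_gap_ge, rule that)
  \<comment> \<open>Chosen so that the strip probability over the second half is at most 1/8: one
    factor 2 comes from \<open>L + 1 \<le> 2 * L\<close>, one from halving the time, and 4 times
    \<open>C2 * \<epsilon>\<close> is at most 1/8.\<close>
  define \<epsilon> where "\<epsilon> = 1 / (32 * (C2 + 1))"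
  define C where "C = 2 * (1 + Q) / \<epsilon> + 1 / \<epsilon>"
  have \<epsilon>: "0 < \<epsilon>" "C2 * \<epsilon> \<le> 1 / 32" using C2(1) by (auto simp: \<epsilon>_def field_simps)
  have C: "0 \<le> C" "1 / \<epsilon> \<le> C" "2 * (1 + Q) / \<epsilon> \<le> C" using \<epsilon> Q(1) by (auto simp: C_def)
  have "kill p n (\<lambda>_. 1) z \<le> C * real_of_int (gap z) / sqrt (real n)" if "1 \<le> n" "gap z > 0" for n z
    using that
  proof (induction n arbitrary: z rule: less_induct)
    case (less n)
    let ?g = "real_of_int (gap z)"
    have g: "1 \<le> ?g" using less.prems by linarith
    have sn: "0 < sqrt (real n)" using less.prems by simp
    define L where "L = \<epsilon> * sqrt (real n)"
    have L: "0 < L" using \<epsilon> sn by (simp add: L_def)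
    show ?case
    \<comment> \<open>If \<open>L < 1\<close>, the claimed bound exceeds 1 and is trivial. Otherwise
      \<open>L\<close> dominates the rounding \<open>L + 1\<close>, and \<open>n\<close> is at least
      2, so it can be halved.\<close>
    proof (cases "L < 1")
      case True
      have "kill p n (\<lambda>_. 1) z \<le> 1"
        using kill_abs_le[of "\<lambda>_. 1" 1 z p n] less.prems by auto
      also have "\<dots> \<le> (1 / \<epsilon>) / sqrt (real n)"
        using True \<epsilon> sn by (simp add: L_def field_simps)
      also have "\<dots> \<le> C * ?g / sqrt (real n)"
        using C g sn by (intro divide_right_mono order_trans[OF C(2)]) (auto simp: mult_le_cancel_left1)
      finally show ?thesis .
    next
      case False
      have n2: "2 \<le> n"
      proof (rule ccontr)
        assume "\<not> 2 \<le> n"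
        then have "n = 1" using less.prems by simp
        then have "L \<le> 1 / 32" using C2(1) by (simp add: L_def \<epsilon>_def field_simps)
        with False show False by simp
      qed
      define n1 where "n1 = n div 2"
      define m where "m = n - n div 2"
      have nm: "n = n1 + m" by (simp add: n1_def m_def)
      note d = div2_bounds[OF n2, folded n1_def m_def]
      let ?I1 = "indicat_real {y. L \<le> real_of_int (gap y)}"
      let ?I2 = "indicat_real {y. 0 < gap y \<and> real_of_int (gap y) < L}"
      have "kill p n (\<lambda>_. 1) z = kill p n (\<lambda>y. ?I1 y + ?I2 y) z"
        by (rule kill_cong[OF _ less.prems(2)]) (auto simp: indicator_def)
      also have "\<dots> = kill p n ?I1 z + kill p n ?I2 z" by (rule kill_add) simp_all
      also have "kill p n ?I1 z \<le> (?g + Q) / L" by (rule Q(2)[OF less.prems(2) L])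
      also have "(?g + Q) / L \<le> C / 2 * ?g / sqrt (real n)"
      proof -
        have "?g + Q \<le> (1 + Q) * ?g" using g Q(1) by (simp add: algebra_simps mult_le_cancel_left1)
        then have "(?g + Q) / L \<le> (1 + Q) * ?g / L" using L by (simp add: divide_right_mono)
        also have "\<dots> = ((1 + Q) / \<epsilon>) * ?g / sqrt (real n)" by (simp add: L_def)
        also have "\<dots> \<le> C / 2 * ?g / sqrt (real n)"
        proof -
          have "2 * ((1 + Q) / \<epsilon>) \<le> C" using C(3) by (simp only: times_divide_eq_right)
          then have "(1 + Q) / \<epsilon> \<le> C / 2" by linarith
          then have "(1 + Q) / \<epsilon> * ?g \<le> C / 2 * ?g" by (rule mult_right_mono) (use g in simp)
          then show ?thesis by (rule divide_right_mono) (use sn in simp)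
        qed
        finally show ?thesis .
      qed
      also have "kill p n ?I2 z \<le> C / 2 * ?g / sqrt (real n)"
      proof -
        let ?c = "C2 * (L + 1) / sqrt (real m)"
        have "kill p n ?I2 z = kill p n1 (kill p m ?I2) z" unfolding nm by (rule kill_add_time)
        also have "\<dots> \<le> kill p n1 (\<lambda>_. ?c * 1) z"
        proof (rule kill_mono[OF _ _ _ less.prems(2)])
          fix y
          have "kill p m ?I2 y \<le> free p m ?I2 y"
            by (rule kill_le_free[where B=1]) (simp_all add: indicator_def)
          also have "\<dots> \<le> ?c" using L d by (intro C2(2)) auto
          finally show "kill p m ?I2 y \<le> ?c * 1" by simp
        qed (simp_all add: bounded_pos_kill)
        also have "\<dots> = ?c * kill p n1 (\<lambda>_. 1) z" by (rule kill_cmult) simp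
        also have "\<dots> \<le> 1 / 8 * (C * ?g / sqrt (real n1))"
        proof (rule mult_mono)
          show "kill p n1 (\<lambda>_. 1) z \<le> C * ?g / sqrt (real n1)"
            using d n2 less.prems by (intro less.IH) (auto simp: n1_def)
          have "?c \<le> 2 * (C2 * (L + 1)) / sqrt (real n)"
            using div_sqrt_half_le[of m n "C2 * (L + 1)" 1] d n2 C2(1) L by simp
          also have "\<dots> \<le> 2 * (C2 * (2 * L)) / sqrt (real n)"
            using mult_left_mono[of "L + 1" "2 * L" C2] False C2(1) sn
            by (intro divide_right_mono) (linarith, simp)
          also have "\<dots> = 4 * (C2 * \<epsilon>)" using sn by (simp add: L_def)
          also have "\<dots> \<le> 1 / 8" using \<epsilon>(2) by simp
          finally show "?c \<le> 1 / 8" .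
          show "0 \<le> kill p n1 (\<lambda>_. 1) z" by (rule kill_nonneg) (use less.prems in auto)
        qed simp
        also have "\<dots> \<le> 1 / 8 * (2 ^ 1 * (C * ?g) / sqrt (real n))"
          using div_sqrt_half_le[of n1 n "C * ?g" 1] d n2 C(1) g by simp
        also have "\<dots> \<le> C / 2 * ?g / sqrt (real n)"
        proof -
          have "0 \<le> C * ?g / sqrt (real n)" using C(1) g sn by simp
          moreover have "1 / 8 * (2 ^ 1 * (C * ?g) / sqrt (real n)) = 1 / 4 * (C * ?g / sqrt (real n))"
            "C / 2 * ?g / sqrt (real n) = 1 / 2 * (C * ?g / sqrt (real n))" by simp_all
          ultimately show ?thesis by linarith
        qed
        finally show ?thesis .
      qed
      finally show ?thesis by simp
    qed
  qed
  with C(1) that show thesis by blast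
qed

text \<open>The series is the expected overshoot at the exit from the half-space. By reflection the
  gap is the weight of the start as seen from far away, and the overshoot restores what the jumps
  across the diagonal take from it.\<close>

definition ren :: "point \<Rightarrow> real" where
  "ren z = real_of_int (gap z) + (\<Sum>k. kill p k over z)"

lemma kill_over_nonneg: "gap z > 0 \<Longrightarrow> 0 \<le> kill p k over z"
  by (rule kill_nonneg) (use over_nonneg in auto)

lemma summable_kill_over: "gap z > 0 \<Longrightarrow> summable (\<lambda>k. kill p k over z)"
proof -
  assume z: "gap z > 0"
  obtain Q where Q: "0 \<le> Q" "\<And>n z. gap z > 0 \<Longrightarrow> (\<Sum>k<n. kill p k over z) \<le> Q"
    by (rule sum_kill_over_bounded, rule that)
  show ?thesis
    by (rule bounded_imp_summable[where B=Q])
      (use kill_over_nonneg[OF z] Q(2)[OF z, of "Suc n" for n] in \<open>simp_all only: lessThan_Suc_atMost\<close>)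
qed

text \<open>The last two bounds are the Markov property at time \<open>m\<close>: overshoot that
  occurs later costs at most a constant times the probability of surviving \<open>m\<close> steps.
  So the partial sums approach \<open>ren\<close> at the rate of the survival probability.\<close>

lemma ren_bounds:
  obtains Q where "0 \<le> Q" "\<And>z. gap z > 0 \<Longrightarrow> real_of_int (gap z) \<le> ren z"
    "\<And>z. gap z > 0 \<Longrightarrow> ren z \<le> Q * real_of_int (gap z)"
    "\<And>z m l. gap z > 0 \<Longrightarrow> (\<Sum>k=m..<m+l. kill p k over z) \<le> Q * kill p m (\<lambda>_. 1) z"
    "\<And>z m. gap z > 0 \<Longrightarrow>
      \<bar>ren z - real_of_int (gap z) - (\<Sum>k<m. kill p k over z)\<bar> \<le> Q * kill p m (\<lambda>_. 1) z"
proof -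
  obtain Q where Q: "0 \<le> Q" "\<And>n z. gap z > 0 \<Longrightarrow> (\<Sum>k<n. kill p k over z) \<le> Q"
    by (rule sum_kill_over_bounded, rule that)
  have tail: "(\<Sum>k=m..<m+l. kill p k over z) \<le> Q * kill p m (\<lambda>_. 1) z" if z: "gap z > 0" for z m l
  proof -
    have "(\<Sum>k=m..<m+l. kill p k over z) = (\<Sum>k<l. kill p (m + k) over z)"
      using sum.shift_bounds_nat_ivl[of "\<lambda>k. kill p k over z" 0 m l]
      by (simp add: add.commute lessThan_atLeast0)
    also have "\<dots> = (\<Sum>k<l. kill p m (kill p k over) z)"
      by (simp add: kill_add_time)
    also have "\<dots> = kill p m (\<lambda>y. \<Sum>k<l. kill p k over y) z"
      by (rule kill_sum[symmetric]) (simp add: bounded_pos_kill)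
    also have "\<dots> \<le> kill p m (\<lambda>y. Q * 1) z"
      by (rule kill_mono[OF _ _ _ z]) (use Q(2) in \<open>simp_all add: bounded_pos_sum bounded_pos_kill\<close>)
    also have "\<dots> = Q * kill p m (\<lambda>_. 1) z" by (rule kill_cmult) simp
    finally show ?thesis .
  qed
  have sum_le: "(\<Sum>k. kill p k over z) \<le> Q" if z: "gap z > 0" for z
    by (rule suminf_le_const[OF summable_kill_over[OF z]]) (rule Q(2)[OF z])
  have sum_ge: "0 \<le> (\<Sum>k. kill p k over z)" if z: "gap z > 0" for z
    by (rule suminf_nonneg[OF summable_kill_over[OF z]]) (rule kill_over_nonneg[OF z])
  have 4: "\<bar>ren z - real_of_int (gap z) - (\<Sum>k<m. kill p k over z)\<bar> \<le> (Q + 1) * kill p m (\<lambda>_. 1) z"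
    if z: "gap z > 0" for z m
  proof -
    have k1: "0 \<le> kill p m (\<lambda>_. 1) z" by (rule kill_nonneg) (use z in auto)
    have s: "summable (\<lambda>k. kill p (k + m) over z)"
      by (rule summable_iff_shift[THEN iffD2]) (rule summable_kill_over[OF z])
    have "(\<Sum>k<l. kill p (k + m) over z) \<le> Q * kill p m (\<lambda>_. 1) z" for l
      using tail[OF z, of m l] sum.shift_bounds_nat_ivl[of "\<lambda>k. kill p k over z" 0 m l]
      by (simp add: add.commute lessThan_atLeast0)
    then have "(\<Sum>k. kill p (k + m) over z) \<le> Q * kill p m (\<lambda>_. 1) z"
      by (rule suminf_le_const[OF s])
    moreover have "0 \<le> (\<Sum>k. kill p (k + m) over z)"
      by (rule suminf_nonneg[OF s]) (rule kill_over_nonneg[OF z])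
    moreover have "ren z - real_of_int (gap z) - (\<Sum>k<m. kill p k over z) = (\<Sum>k. kill p (k + m) over z)"
      unfolding ren_def using suminf_split_initial_segment[OF summable_kill_over[OF z], of m] by simp
    ultimately show ?thesis using k1 by (simp add: algebra_simps)
  qed
  show thesis
  \<comment> \<open>As the gap is at least 1, the additive constant \<open>Q\<close> can be absorbed
    into a multiple of the gap.\<close>
  proof (rule that[of "Q + 1"])
    show "real_of_int (gap z) \<le> ren z" if "gap z > 0" for z
      using sum_ge[OF that] by (simp add: ren_def)
    show "ren z \<le> (Q + 1) * real_of_int (gap z)" if "gap z > 0" for z
    proof -
      have "Q * 1 \<le> Q * real_of_int (gap z)" using that Q(1) by (intro mult_left_mono) linarith+
      then show ?thesis using sum_le[OF that] by (simp add: ren_def algebra_simps)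
    qed
    show "(\<Sum>k=m..<m+l. kill p k over z) \<le> (Q + 1) * kill p m (\<lambda>_. 1) z" if "gap z > 0" for z m l
      using tail[OF that, of m l] kill_nonneg[of "\<lambda>_. 1" z p m] that by (simp add: algebra_simps)
  qed (use Q(1) 4 in auto)
qed

lemma kill_gap_only:
  assumes "\<And>y y'. gap y = gap y' \<Longrightarrow> f y = f y'" "gap z = gap z'"
  shows "kill q n f z = kill q n f z'"
  using assms(2)
proof (induction n arbitrary: z z')
  case (Suc n)
  have "(if gap (z + s) > 0 then kill q n f (z + s) else 0)
      = (if gap (z' + s) > 0 then kill q n f (z' + s) else 0)" for s
    using Suc.IH[of "z + s" "z' + s"] Suc.prems by (simp add: gap_add)
  then show ?case by (simp only: kill.simps)
next
  case 0
  show ?case unfolding kill.simps by (rule assms(1)[OF 0])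
qed

lemma over_gap_only: "gap y = gap y' \<Longrightarrow> over y = over y'"
proof -
  assume "gap y = gap y'"
  then have "gap (y + s) = gap (y' + s)" for s by (simp add: gap_add)
  then show ?thesis by (simp only: over_def exit_op_def)
qed

text \<open>Lets \<open>ren\<close> be read as a function of one integer, the form in which the
  theorem asks for \<open>U\<close>.\<close>

lemma ren_gap_only: "gap z = gap z' \<Longrightarrow> ren z = ren z'"
  unfolding ren_def using kill_gap_only[of over z z' p, OF over_gap_only] by simp

subsection \<open>Local estimates for the free walk\<close>

text \<open>A predicate for the conclusion of \<open>integral_mag_phi_le\<close>, so that constants
  for several orders \<open>k\<close> can be picked side by side as witnesses.\<close>

definition osc_bound :: "nat \<Rightarrow> real \<Rightarrow> bool" where
  "osc_bound k C \<longleftrightarrow> 0 \<le> C \<and> (\<forall>n F A. 1 \<le> n \<longrightarrow> 0 \<le> A \<longrightarrow> (\<forall>\<theta>. norm (F \<theta>) \<le> A * mag \<theta> ^ k)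
    \<longrightarrow> norm (\<integral>\<theta>. phi \<theta> ^ n * F \<theta> \<partial>torus) \<le> A * C / sqrt (real n) ^ (3 + k))"

lemma osc_bound_ex: "\<exists>C. osc_bound k C"
  unfolding osc_bound_def by (rule integral_mag_phi_le[of k]) blast

lemma osc_boundD:
  assumes "osc_bound k C"
  shows "0 \<le> C"
    "\<And>n F A. 1 \<le> n \<Longrightarrow> 0 \<le> A \<Longrightarrow> (\<And>\<theta>. norm (F \<theta>) \<le> A * mag \<theta> ^ k)
      \<Longrightarrow> norm (\<integral>\<theta>. phi \<theta> ^ n * F \<theta> \<partial>torus) \<le> A * C / sqrt (real n) ^ (3 + k)"
  using assms unfolding osc_bound_def by blast+

lemma torus_integrable:
  assumes [measurable]: "F \<in> borel_measurable torus" and F: "\<And>\<theta>. norm (F \<theta>) \<le> B"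
  shows "integrable torus (\<lambda>\<theta>. phi \<theta> ^ n * F \<theta>)"
proof (rule torus.integrable_const_bound[where B=B])
  show "AE \<theta> in torus. norm (phi \<theta> ^ n * F \<theta>) \<le> B"
  proof (rule AE_I2)
    fix \<theta>
    have "norm (phi \<theta>) ^ n \<le> 1" by (rule power_le_one) (simp_all add: norm_phi_le_1)
    then have "norm (phi \<theta>) ^ n * norm (F \<theta>) \<le> 1 * B" by (intro mult_mono F) auto
    then show "norm (phi \<theta> ^ n * F \<theta>) \<le> B" by (simp add: norm_mult norm_power)
  qed
qed measurable

lemma pmf_steps_le:
  obtains C where "0 \<le> C" "\<And>n w. 1 \<le> n \<Longrightarrow> pmf (steps p n) w \<le> C / sqrt (real n) ^ 3"
proof -
  obtain C where "osc_bound 0 C" using osc_bound_ex by blast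
  note C = osc_boundD[OF this]
  have "pmf (steps p n) w \<le> C / sqrt (real n) ^ 3" if "1 \<le> n" for n w
    using C(2)[OF that, of 1 "\<lambda>\<theta>. cis (- ang \<theta> w)"] pmf_steps_fourier[of n w, symmetric] by simp
  with C(1) that show thesis by blast
qed

text \<open>Survive the first half, then hit \<open>w\<close> freely in the second:
  \<open>n^(-1/2)\<close> times \<open>n^(-3/2)\<close>. Rounding the halves costs 2 to the fourth
  power, and the added 1 in the constant covers \<open>n = 1\<close>.\<close>

lemma kill_point_le:
  obtains C where "0 \<le> C" "\<And>n z w. 1 \<le> n \<Longrightarrow> gap z > 0 \<Longrightarrow>
    kill p n (indicator {w}) z \<le> C * real_of_int (gap z) / sqrt (real n) ^ 4"
proof -
  obtain C3 where C3: "0 \<le> C3" "\<And>n w. 1 \<le> n \<Longrightarrow> pmf (steps p n) w \<le> C3 / sqrt (real n) ^ 3"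
    by (rule pmf_steps_le, rule that)
  obtain C1 where C1: "0 \<le> C1" "\<And>n z. 1 \<le> n \<Longrightarrow> gap z > 0 \<Longrightarrow>
      kill p n (\<lambda>_. 1) z \<le> C1 * real_of_int (gap z) / sqrt (real n)"
    by (rule survival_le, rule that)
  have "kill p n (indicator {w}) z \<le> (16 * C3 * C1 + 1) * real_of_int (gap z) / sqrt (real n) ^ 4"
    if n: "1 \<le> n" and z: "gap z > 0" for n z w
  proof (cases "n = 1")
    case True
    have "\<bar>kill p n (indicator {w}) z\<bar> \<le> 1"
      by (rule kill_abs_le[OF _ z]) (simp add: indicator_def)
    moreover have "1 * 1 \<le> (16 * C3 * C1 + 1) * real_of_int (gap z)"
      using C3(1) C1(1) z by (intro mult_mono) auto
    ultimately show ?thesis using True by simp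
  next
    case False
    with n have n2: "2 \<le> n" by simp
    define n1 where "n1 = n div 2"
    define m where "m = n - n div 2"
    have nm: "n = n1 + m" by (simp add: n1_def m_def)
    note d = div2_bounds[OF n2, folded n1_def m_def]
    let ?g = "real_of_int (gap z)"
    have g: "0 \<le> ?g" using z by simp
    have "kill p n (indicator {w}) z = kill p n1 (kill p m (indicator {w})) z"
      unfolding nm by (rule kill_add_time)
    also have "\<dots> \<le> kill p n1 (\<lambda>_. C3 / sqrt (real m) ^ 3 * 1) z"
    proof (rule kill_mono[OF _ _ _ z])
      fix y
      have "kill p m (indicator {w}) y \<le> free p m (indicator {w}) y"
        by (rule kill_le_free[where B=1]) (simp_all add: indicator_def)
      also have "\<dots> \<le> C3 / sqrt (real m) ^ 3"
        unfolding free_indicator_single using d by (intro C3) auto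
      finally show "kill p m (indicator {w}) y \<le> C3 / sqrt (real m) ^ 3 * 1" by simp
    qed (simp_all add: bounded_pos_kill)
    also have "\<dots> = C3 / sqrt (real m) ^ 3 * kill p n1 (\<lambda>_. 1) z" by (rule kill_cmult) simp
    also have "\<dots> \<le> (2 ^ 3 * C3 / sqrt (real n) ^ 3) * (2 ^ 1 * (C1 * ?g) / sqrt (real n) ^ 1)"
    proof (rule mult_mono)
      show "C3 / sqrt (real m) ^ 3 \<le> 2 ^ 3 * C3 / sqrt (real n) ^ 3"
        using d n C3(1) by (intro div_sqrt_half_le) auto
      have "kill p n1 (\<lambda>_. 1) z \<le> (C1 * ?g) / sqrt (real n1) ^ 1"
        using C1(2)[OF _ z, of n1] d by simp
      also have "\<dots> \<le> 2 ^ 1 * (C1 * ?g) / sqrt (real n) ^ 1"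
        using d n C1(1) g by (intro div_sqrt_half_le) auto
      finally show "kill p n1 (\<lambda>_. 1) z \<le> 2 ^ 1 * (C1 * ?g) / sqrt (real n) ^ 1" .
      show "0 \<le> kill p n1 (\<lambda>_. 1) z" by (rule kill_nonneg) (use z in auto)
    qed (use C3(1) in simp)
    also have "\<dots> = (16 * C3 * C1) * ?g / sqrt (real n) ^ 4" by (simp add: eval_nat_numeral mult_ac)
    also have "\<dots> \<le> (16 * C3 * C1 + 1) * ?g / sqrt (real n) ^ 4"
      using g by (intro divide_right_mono mult_right_mono) auto
    finally show ?thesis .
  qed
  moreover have "0 \<le> 16 * C3 * C1 + 1" using C3(1) C1(1) by simp
  ultimately show thesis using that by blast
qed

text \<open>One unit of \<open>g\<close> in the difference between the kernel at a point and at its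
  shift by \<open>shear g\<close>. The centred difference is chosen because it is odd under
  \<open>mirror\<close> and becomes multiplication by \<open>\<i> * sin\<close> on the Fourier
  side.\<close>

definition dker :: "nat \<Rightarrow> point \<Rightarrow> real" where
  "dker n w = (pmf (steps p n) (w - shear 1) - pmf (steps p n) (w + shear 1)) / 2"

lemma ang_shear: "ang \<theta> (shear k) = of_int k * ang \<theta> (shear 1)"
  by (simp add: ang_def shear_def algebra_simps)

lemma abs_ang_shear_le: "\<bar>ang \<theta> (shear 1)\<bar> \<le> 2 * mag \<theta>"
  using abs_ang_le[of \<theta> "shear 1"] by (simp add: nrm_def shear_def)

lemma cis_diff_half: "(cis x - cis (- x)) / 2 = \<i> * sin x"
  by (simp add: complex_eq_iff)

lemma dker_fourier:
  "complex_of_real (dker n w)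
    = (\<integral>\<theta>. phi \<theta> ^ n * (cis (- ang \<theta> w) * (\<i> * sin (ang \<theta> (shear 1)))) \<partial>torus)"
proof -
  have i: "integrable torus (\<lambda>\<theta>. phi \<theta> ^ n * cis (- ang \<theta> y))" for y
    by (rule torus_integrable[where B=1]) auto
  have "complex_of_real (dker n w) = ((\<integral>\<theta>. phi \<theta> ^ n * cis (- ang \<theta> (w - shear 1)) \<partial>torus)
      - (\<integral>\<theta>. phi \<theta> ^ n * cis (- ang \<theta> (w + shear 1)) \<partial>torus)) / 2"
    by (simp add: dker_def pmf_steps_fourier)
  also have "\<dots> = (\<integral>\<theta>. (phi \<theta> ^ n * cis (- ang \<theta> (w - shear 1)) - phi \<theta> ^ n * cis (- ang \<theta> (w + shear 1))) / 2 \<partial>torus)"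
    by (subst integral_divide_zero, subst Bochner_Integration.integral_diff[OF i i]) simp
  also have "\<dots> = (\<integral>\<theta>. phi \<theta> ^ n * (cis (- ang \<theta> w) * (\<i> * sin (ang \<theta> (shear 1)))) \<partial>torus)"
  proof (rule Bochner_Integration.integral_cong[OF refl])
    fix \<theta>
    have "cis (- ang \<theta> (w - shear 1)) = cis (- ang \<theta> w) * cis (ang \<theta> (shear 1))"
      "cis (- ang \<theta> (w + shear 1)) = cis (- ang \<theta> w) * cis (- ang \<theta> (shear 1))"
      by (simp_all add: ang_add ang_diff cis_mult)
    then show "(phi \<theta> ^ n * cis (- ang \<theta> (w - shear 1)) - phi \<theta> ^ n * cis (- ang \<theta> (w + shear 1))) / 2
        = phi \<theta> ^ n * (cis (- ang \<theta> w) * (\<i> * sin (ang \<theta> (shear 1))))"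
      by (simp add: cis_diff_half[symmetric] algebra_simps diff_divide_distrib)
  qed
  finally show ?thesis .
qed

lemma abs_sin_le_abs: "\<bar>sin x\<bar> \<le> \<bar>x::real\<bar>"
  using abs_sin_x_le_abs_x by blast

lemma dker_le:
  obtains C where "0 \<le> C" "\<And>n w. 1 \<le> n \<Longrightarrow> \<bar>dker n w\<bar> \<le> C / sqrt (real n) ^ 4"
proof -
  obtain C where "osc_bound 1 C" using osc_bound_ex by blast
  note C = osc_boundD[OF this]
  have "\<bar>dker n w\<bar> \<le> 2 * C / sqrt (real n) ^ 4" if n: "1 \<le> n" for n w
  proof -
    have "\<bar>dker n w\<bar> = norm (complex_of_real (dker n w))" by simp
    also have "\<dots> \<le> 2 * C / sqrt (real n) ^ (3 + 1)"
      unfolding dker_fourier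
    proof (rule C(2)[OF n])
      fix \<theta>
      have "\<bar>sin (ang \<theta> (shear 1))\<bar> \<le> 2 * mag \<theta>"
        by (rule order_trans[OF abs_sin_le_abs abs_ang_shear_le])
      then show "norm (cis (- ang \<theta> w) * (\<i> * sin (ang \<theta> (shear 1)))) \<le> 2 * mag \<theta> ^ 1"
        by (simp add: norm_mult)
    qed simp
    finally show ?thesis by simp
  qed
  with C(1) that[of "2 * C"] show thesis by simp
qed

lemma norm_phi_minus_one_le:
  obtains C where "0 \<le> C" "\<And>\<theta>. norm (phi \<theta> - 1) \<le> C * mag \<theta>"
proof
  show "0 \<le> measure_pmf.expectation p nrm" by (rule integral_nonneg_AE) simp
  fix \<theta>
  have "norm (phi \<theta> - 1) = norm (measure_pmf.expectation p (\<lambda>s. cis (ang \<theta> s) - 1))"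
    by (simp add: phi_def)
  also have "\<dots> \<le> measure_pmf.expectation p (\<lambda>s. norm (cis (ang \<theta> s) - 1))"
    by (rule integral_norm_bound)
  also have "\<dots> \<le> measure_pmf.expectation p (\<lambda>s. mag \<theta> * nrm s)"
    by (rule integral_mono')
      (use integrable_nrm order_trans[OF norm_cis_minus_one_le abs_ang_le] in auto)
  also have "\<dots> = measure_pmf.expectation p nrm * mag \<theta>" by simp
  finally show "norm (phi \<theta> - 1) \<le> measure_pmf.expectation p nrm * mag \<theta>" .
qed

lemma norm_one_minus_power_le:
  fixes z :: complex
  assumes "norm z \<le> 1"
  shows "norm (1 - z ^ k) \<le> real k * norm (z - 1)"
  using norm_power_diff[of z 1 k] assms by (simp add: norm_minus_commute)

text \<open>The first bound spends one factor \<open>mag\<close>. In the second, subtracting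
  \<open>g * dker n w\<close> cancels everything linear in the angle, even after a bounded change of
  position and of the number of steps; the remainder is quadratic in \<open>mag\<close> and gains
  another \<open>n^(-1/2)\<close>.\<close>

lemma reflected_difference_le:
  obtains C where "0 \<le> C"
    "\<And>m w g. 1 \<le> m \<Longrightarrow>
      \<bar>pmf (steps p m) w - pmf (steps p m) (w + shear g)\<bar> \<le> C * real_of_int \<bar>g\<bar> / sqrt (real m) ^ 4"
    "\<And>m n w y g. 1 \<le> m \<Longrightarrow> m \<le> n \<Longrightarrow>
      \<bar>pmf (steps p m) (w - y) - pmf (steps p m) (w - y + shear g) - real_of_int g * dker n w\<bar>
        \<le> C * real_of_int \<bar>g\<bar> * (nrm y + real_of_int \<bar>g\<bar> + real (n - m) + 1) / sqrt (real m) ^ 5"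
proof -
  obtain C where "osc_bound 1 C" using osc_bound_ex by blast
  note C = osc_boundD[OF this]
  obtain C' where "osc_bound 2 C'" using osc_bound_ex by blast
  note C' = osc_boundD[OF this]
  obtain D where D: "0 \<le> D" "\<And>\<theta>. norm (phi \<theta> - 1) \<le> D * mag \<theta>"
    by (rule norm_phi_minus_one_le, rule that)
  have i: "integrable torus (\<lambda>\<theta>. phi \<theta> ^ n * cis (- ang \<theta> y))" for y n
    by (rule torus_integrable[where B=1]) auto
  have diff: "complex_of_real (pmf (steps p m) w - pmf (steps p m) (w + shear g))
      = (\<integral>\<theta>. phi \<theta> ^ m * (cis (- ang \<theta> w) * (1 - cis (- (of_int g * ang \<theta> (shear 1))))) \<partial>torus)" for m w g
  proof -
    have "cis (- ang \<theta> (w + shear g)) = cis (- ang \<theta> w) * cis (- (of_int g * ang \<theta> (shear 1)))" for \<theta>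
      by (simp add: ang_add ang_shear[of \<theta> g] cis_mult)
    then show ?thesis
      unfolding of_real_diff pmf_steps_fourier
      by (subst Bochner_Integration.integral_diff[OF i i, symmetric])
        (simp add: right_diff_distrib)
  qed
  have lin: "norm (1 - cis (- (of_int g * ang \<theta> (shear 1)))) \<le> real_of_int \<bar>g\<bar> * (2 * mag \<theta>)" for g \<theta>
  proof -
    have "norm (1 - cis (- (of_int g * ang \<theta> (shear 1)))) \<le> real_of_int \<bar>g\<bar> * \<bar>ang \<theta> (shear 1)\<bar>"
      using norm_cis_minus_one_le[of "- (of_int g * ang \<theta> (shear 1))"]
      by (simp add: norm_minus_commute abs_mult)
    also have "\<dots> \<le> real_of_int \<bar>g\<bar> * (2 * mag \<theta>)"
      by (intro mult_left_mono abs_ang_shear_le) simp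
    finally show ?thesis .
  qed
  have 1: "\<bar>pmf (steps p m) w - pmf (steps p m) (w + shear g)\<bar>
      \<le> (2 * real_of_int \<bar>g\<bar>) * C / sqrt (real m) ^ (3 + 1)" if m: "1 \<le> m" for m w g
  proof -
    have "\<bar>pmf (steps p m) w - pmf (steps p m) (w + shear g)\<bar>
        = norm (complex_of_real (pmf (steps p m) w - pmf (steps p m) (w + shear g)))"
      by (simp only: norm_of_real)
    also have "\<dots> \<le> (2 * real_of_int \<bar>g\<bar>) * C / sqrt (real m) ^ (3 + 1)"
      unfolding diff by (rule C(2)[OF m]) (use lin in \<open>simp_all add: norm_mult mult_ac\<close>)
    finally show ?thesis .
  qed
  define E where "E = 6 + 2 * D"
  have 2: "\<bar>pmf (steps p m) (w - y) - pmf (steps p m) (w - y + shear g) - real_of_int g * dker n w\<bar>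
        \<le> (E * real_of_int \<bar>g\<bar> * (nrm y + real_of_int \<bar>g\<bar> + real (n - m) + 1)) * C' / sqrt (real m) ^ (3 + 2)"
    if m: "1 \<le> m" and mn: "m \<le> n" for m n w y g
  proof -
    let ?g = "real_of_int \<bar>g\<bar>"
    define x where "x \<theta> = ang \<theta> (shear 1)" for \<theta>
    have [measurable]: "x \<in> borel_measurable (borel \<Otimes>\<^sub>M (borel \<Otimes>\<^sub>M borel))"
      unfolding x_def[abs_def] by measurable
    have x: "\<bar>x \<theta>\<bar> \<le> 2 * mag \<theta>" for \<theta> unfolding x_def by (rule abs_ang_shear_le)
    have x2: "(x \<theta>)\<^sup>2 \<le> (2 * mag \<theta>)\<^sup>2" for \<theta>
      using power_mono[OF x[of \<theta>], of 2] by simp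
    define F where "F \<theta> = cis (- ang \<theta> w) * (cis (ang \<theta> y) * (1 - cis (- (of_int g * x \<theta>)))
        - of_int g * (phi \<theta> ^ (n - m) * (\<i> * sin (x \<theta>))))" for \<theta>
    have i1: "integrable torus (\<lambda>\<theta>. phi \<theta> ^ m * (cis (- ang \<theta> (w - y)) * (1 - cis (- (of_int g * x \<theta>)))))"
    proof (rule torus_integrable[where B=2])
      show "norm (cis (- ang \<theta> (w - y)) * (1 - cis (- (of_int g * x \<theta>)))) \<le> 2" for \<theta>
        using norm_triangle_ineq4[of 1 "cis (- (of_int g * x \<theta>))"] by (simp add: norm_mult)
    qed measurable
    have i2: "integrable torus (\<lambda>\<theta>. phi \<theta> ^ n * (cis (- ang \<theta> w) * (\<i> * sin (x \<theta>))))"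
      by (rule torus_integrable[where B=1]) (auto simp: norm_mult)
    have "complex_of_real (pmf (steps p m) (w - y) - pmf (steps p m) (w - y + shear g) - real_of_int g * dker n w)
      = (\<integral>\<theta>. phi \<theta> ^ m * (cis (- ang \<theta> (w - y)) * (1 - cis (- (of_int g * x \<theta>)))) \<partial>torus)
        - of_int g * (\<integral>\<theta>. phi \<theta> ^ n * (cis (- ang \<theta> w) * (\<i> * sin (x \<theta>))) \<partial>torus)"
      unfolding of_real_diff[of _ "real_of_int g * dker n w"] diff of_real_mult dker_fourier x_def by simp
    also have "\<dots> = (\<integral>\<theta>. phi \<theta> ^ m * (cis (- ang \<theta> (w - y)) * (1 - cis (- (of_int g * x \<theta>))))
        - of_int g * (phi \<theta> ^ n * (cis (- ang \<theta> w) * (\<i> * sin (x \<theta>)))) \<partial>torus)"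
      by (subst Bochner_Integration.integral_diff[OF i1]) (use i2 in simp_all)
    also have "\<dots> = (\<integral>\<theta>. phi \<theta> ^ m * F \<theta> \<partial>torus)"
    proof (rule Bochner_Integration.integral_cong[OF refl])
      fix \<theta>
      have "phi \<theta> ^ n = phi \<theta> ^ m * phi \<theta> ^ (n - m)" using mn by (simp flip: power_add)
      moreover have "cis (- ang \<theta> (w - y)) = cis (- ang \<theta> w) * cis (ang \<theta> y)"
        by (simp add: ang_diff cis_mult)
      ultimately show "phi \<theta> ^ m * (cis (- ang \<theta> (w - y)) * (1 - cis (- (of_int g * x \<theta>))))
        - of_int g * (phi \<theta> ^ n * (cis (- ang \<theta> w) * (\<i> * sin (x \<theta>)))) = phi \<theta> ^ m * F \<theta>"
        unfolding F_def by (simp add: algebra_simps)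
    qed
    finally have "\<bar>pmf (steps p m) (w - y) - pmf (steps p m) (w - y + shear g) - real_of_int g * dker n w\<bar>
        = norm (\<integral>\<theta>. phi \<theta> ^ m * F \<theta> \<partial>torus)"
      by (metis norm_of_real)
    also have "\<dots> \<le> (E * ?g * (nrm y + ?g + real (n - m) + 1)) * C' / sqrt (real m) ^ (3 + 2)"
    proof (rule C'(2)[OF m])
      show "0 \<le> E * ?g * (nrm y + ?g + real (n - m) + 1)" using D(1) by (simp add: E_def)
      fix \<theta>
      let ?m = "mag \<theta>" and ?x = "x \<theta>"
      \<comment> \<open>Four sources of error, each quadratic in \<open>mag \<theta>\<close>: the
        shift by \<open>y\<close>, the linearisation of \<open>cis\<close>, the angle replaced by
        its sine, and the \<open>n - m\<close> missing steps.\<close>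
      let ?a = "(cis (ang \<theta> y) - 1) * (1 - cis (- (of_int g * ?x)))"
      let ?b = "1 - cis (- (of_int g * ?x)) - \<i> * of_real (of_int g * ?x)"
      let ?c = "of_int g * (\<i> * (of_real ?x - of_real (sin ?x)))"
      let ?d = "of_int g * ((1 - phi \<theta> ^ (n - m)) * (\<i> * of_real (sin ?x)))"
      have "F \<theta> = cis (- ang \<theta> w) * (?a + ?b + ?c + ?d)"
        unfolding F_def by (simp add: algebra_simps)
      then have "norm (F \<theta>) = norm (?a + ?b + ?c + ?d)" by (simp add: norm_mult)
      also have "\<dots> \<le> norm ?a + norm ?b + norm ?c + norm ?d"
        by (intro order_trans[OF norm_triangle_ineq] add_mono order_refl)
      also have "norm ?a \<le> (?m * nrm y) * (?g * (2 * ?m))"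
        unfolding norm_mult
        by (intro mult_mono order_trans[OF norm_cis_minus_one_le abs_ang_le] lin[folded x_def]) auto
      also have "norm ?b \<le> ?g\<^sup>2 * (2 * ?m\<^sup>2)"
      proof -
        have "norm ?b = norm (cis (- (of_int g * ?x)) - 1 - \<i> * complex_of_real (- (of_int g * ?x)))"
          by (subst norm_minus_cancel[symmetric]) (simp add: algebra_simps)
        also have "\<dots> \<le> (- (of_int g * ?x))\<^sup>2 / 2" by (rule norm_cis_minus_linear_le)
        also have "\<dots> = ?g\<^sup>2 * (?x\<^sup>2 / 2)" by (simp add: power_mult_distrib)
        also have "\<dots> \<le> ?g\<^sup>2 * ((2 * ?m)\<^sup>2 / 2)"
          by (intro mult_left_mono divide_right_mono x2) auto
        finally show ?thesis by (simp add: power_mult_distrib)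
      qed
      also have "norm ?c \<le> ?g * (2 * ?m\<^sup>2)"
      proof -
        have "\<bar>?x - sin ?x\<bar> \<le> norm (cis ?x - 1 - \<i> * ?x)"
          using abs_Im_le_cmod[of "cis ?x - 1 - \<i> * ?x"] by (simp add: abs_minus_commute)
        also have "\<dots> \<le> ?x\<^sup>2 / 2" by (rule norm_cis_minus_linear_le)
        also have "\<dots> \<le> (2 * ?m)\<^sup>2 / 2"
          by (intro divide_right_mono x2) auto
        finally have "\<bar>?x - sin ?x\<bar> \<le> 2 * ?m\<^sup>2" by (simp add: power_mult_distrib)
        moreover have "norm ?c = ?g * \<bar>?x - sin ?x\<bar>"
          by (simp add: norm_mult flip: of_real_diff)
        ultimately show ?thesis by (simp add: mult_left_mono)
      qed
      also have "norm ?d \<le> ?g * ((real (n - m) * (D * ?m)) * (2 * ?m))"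
      proof -
        have "norm (1 - phi \<theta> ^ (n - m)) \<le> real (n - m) * norm (phi \<theta> - 1)"
          by (rule norm_one_minus_power_le[OF norm_phi_le_1])
        also have "\<dots> \<le> real (n - m) * (D * ?m)" by (intro mult_left_mono D) simp
        finally have 1: "norm (1 - phi \<theta> ^ (n - m)) \<le> real (n - m) * (D * ?m)" .
        have "norm ?d = ?g * (norm (1 - phi \<theta> ^ (n - m)) * \<bar>sin ?x\<bar>)" by (simp add: norm_mult)
        also have "\<dots> \<le> ?g * ((real (n - m) * (D * ?m)) * (2 * ?m))"
          by (intro mult_left_mono mult_mono 1 order_trans[OF abs_sin_le_abs x]) (use D(1) in auto)
        finally show ?thesis .
      qed
      also have "(?m * nrm y) * (?g * (2 * ?m)) + ?g\<^sup>2 * (2 * ?m\<^sup>2) + ?g * (2 * ?m\<^sup>2)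
          + ?g * ((real (n - m) * (D * ?m)) * (2 * ?m))
          = ?g * (2 * nrm y + 2 * ?g + 2 + 2 * D * real (n - m)) * ?m\<^sup>2"
        by (simp add: power2_eq_square algebra_simps)
      also have "\<dots> \<le> ?g * (E * (nrm y + ?g + real (n - m) + 1)) * ?m\<^sup>2"
      proof (intro mult_right_mono mult_left_mono)
        have "0 \<le> D * nrm y" "0 \<le> D * ?g" using D(1) by simp_all
        moreover have "0 \<le> nrm y" "0 \<le> ?g" "0 \<le> real (n - m)" by simp_all
        ultimately show "2 * nrm y + 2 * ?g + 2 + 2 * D * real (n - m) \<le> E * (nrm y + ?g + real (n - m) + 1)"
          using D(1) unfolding E_def distrib_left distrib_right by linarith
      qed simp_all
      finally show "norm (F \<theta>) \<le> E * ?g * (nrm y + ?g + real (n - m) + 1) * mag \<theta> ^ 2"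
        by (simp add: mult_ac)
    qed
    finally show ?thesis .
  qed
  show thesis
  proof (rule that[of "2 * C + E * C'"])
    have E: "0 \<le> E" using D(1) by (simp add: E_def)
    show "0 \<le> 2 * C + E * C'" using C(1) C'(1) E by simp
    show "\<bar>pmf (steps p m) w - pmf (steps p m) (w + shear g)\<bar>
        \<le> (2 * C + E * C') * real_of_int \<bar>g\<bar> / sqrt (real m) ^ 4" if "1 \<le> m" for m w g
    proof -
      have "(2 * real_of_int \<bar>g\<bar>) * C / sqrt (real m) ^ 4 \<le> (2 * C + E * C') * real_of_int \<bar>g\<bar> / sqrt (real m) ^ 4"
        using E C'(1) by (intro divide_right_mono) (simp_all add: distrib_right)
      with 1[OF that, of w g] show ?thesis by simp
    qed
    show "\<bar>pmf (steps p m) (w - y) - pmf (steps p m) (w - y + shear g) - real_of_int g * dker n w\<bar>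
        \<le> (2 * C + E * C') * real_of_int \<bar>g\<bar> * (nrm y + real_of_int \<bar>g\<bar> + real (n - m) + 1) / sqrt (real m) ^ 5"
      if "1 \<le> m" "m \<le> n" for m n w y g
    proof -
      let ?r = "real_of_int \<bar>g\<bar> * (nrm y + real_of_int \<bar>g\<bar> + real (n - m) + 1)"
      have "(E * C') * ?r / sqrt (real m) ^ 5 \<le> (2 * C + E * C') * ?r / sqrt (real m) ^ 5"
        using C(1) by (intro divide_right_mono mult_right_mono) simp_all
      with 2[OF that, of w y g] show ?thesis by (simp add: mult_ac)
    qed
  qed
qed

end

text \<open>Applied to a centred increment, the linear term integrates to zero and the moment
  generating function is at most 1 plus a quadratic term.\<close>

lemma exp_le_quadratic: "exp x \<le> 1 + x + x\<^sup>2 * exp \<bar>x::real\<bar>"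
proof -
  have a: "exp y - 1 \<le> y * exp y" for y :: real
  proof -
    have "(1 - y) * exp y \<le> exp (- y) * exp y"
      using exp_ge_add_one_self[of "- y"] by (intro mult_right_mono) auto
    then show ?thesis by (simp add: exp_add[symmetric] algebra_simps)
  qed
  have "\<bar>exp x - 1\<bar> \<le> \<bar>x\<bar> * exp \<bar>x\<bar>"
  proof (cases "0 \<le> x")
    case True
    then show ?thesis using a[of x] by simp
  next
    case False
    have "\<bar>x\<bar> * 1 \<le> \<bar>x\<bar> * exp \<bar>x\<bar>" by (intro mult_left_mono) auto
    moreover have "\<bar>exp x - 1\<bar> \<le> \<bar>x\<bar>" using False exp_ge_add_one_self[of x] exp_le_one_iff[of x] by linarith
    ultimately show ?thesis by linarith
  qed
  then have "\<bar>x\<bar> * \<bar>exp x - 1\<bar> \<le> \<bar>x\<bar> * (\<bar>x\<bar> * exp \<bar>x\<bar>)" by (intro mult_left_mono) auto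
  moreover have "x * (exp x - 1) \<le> \<bar>x\<bar> * \<bar>exp x - 1\<bar>" by (metis abs_ge_self abs_mult)
  moreover have "\<bar>x\<bar> * (\<bar>x\<bar> * exp \<bar>x\<bar>) = x\<^sup>2 * exp \<bar>x\<bar>"
    by (simp add: power2_eq_square mult.assoc[symmetric])
  moreover have "exp x - 1 - x \<le> x * (exp x - 1)" using a[of x] by (simp add: algebra_simps)
  ultimately show ?thesis by linarith
qed

context cone_walk
begin

subsection \<open>Deviation bounds\<close>

text \<open>Chernoff bound with the single parameter \<open>\<delta> / sqrt n\<close>: for it the
  \<open>n\<close>-th power of the moment generating function stays bounded. The decay is
  exponential in \<open>R / sqrt n\<close>, enough for the radii used later, which exceed
  \<open>sqrt n\<close> by squared logarithms.\<close>

lemma deviation_one_sided: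
  assumes add: "\<And>x y. l (x + y) = l x + l y" and l: "\<And>s. \<bar>l s\<bar> \<le> nrm s"
  obtains c C where "0 < c" "0 \<le> C"
    "\<And>n R. 1 \<le> n \<Longrightarrow> measure_pmf.prob (steps p n) {s. R \<le> l s - real n * measure_pmf.expectation p l}
      \<le> C * exp (- c * (R / sqrt (real n)))"
proof -
  define m where "m = measure_pmf.expectation p l"
  define Y where "Y s = l s - m" for s
  \<comment> \<open>Half the rate; the other half of the exponential moment pays for the square of
    \<open>Y s\<close>.\<close>
  define \<delta> where "\<delta> = rate / 2"
  have \<delta>: "0 < \<delta>" "2 * \<delta> = rate" using rate(1) by (auto simp: \<delta>_def)
  have l0: "l 0 = 0" using add[of 0 0] by simp
  have il: "integrable (measure_pmf p) l"
    by (rule integrable_le_nrm[where C=1 and B=0]) (use l in auto)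
  have absY: "\<bar>Y s\<bar> \<le> nrm s + \<bar>m\<bar>" for s
    using l[of s] by (simp add: Y_def)
  have exp2: "exp (2 * \<delta> * \<bar>Y s\<bar>) \<le> exp (rate * \<bar>m\<bar>) * exp (rate * nrm s)" for s
    using mult_left_mono[OF absY[of s], of rate] rate(1)
    unfolding \<delta>(2) exp_add[symmetric] by (simp add: algebra_simps)
  have iD: "integrable (measure_pmf p) (\<lambda>s. (Y s)\<^sup>2 * exp (\<delta> * \<bar>Y s\<bar>))"
  proof (rule integrable_by_exp[where b=rate and C="2 / \<delta>\<^sup>2 * exp (rate * \<bar>m\<bar>)"])
    fix s
    have "(\<delta> * \<bar>Y s\<bar>) ^ 2 \<le> fact 2 * exp (\<delta> * \<bar>Y s\<bar>)"
      using \<delta>(1) by (intro power_le_fact_exp) simp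
    then have "(Y s)\<^sup>2 \<le> 2 / \<delta>\<^sup>2 * exp (\<delta> * \<bar>Y s\<bar>)"
      using \<delta>(1) by (simp add: power_mult_distrib fact_numeral field_simps)
    then have "(Y s)\<^sup>2 * exp (\<delta> * \<bar>Y s\<bar>) \<le> 2 / \<delta>\<^sup>2 * exp (\<delta> * \<bar>Y s\<bar>) * exp (\<delta> * \<bar>Y s\<bar>)"
      by (rule mult_right_mono) simp
    also have "\<dots> = 2 / \<delta>\<^sup>2 * exp (2 * \<delta> * \<bar>Y s\<bar>)"
      by (simp add: exp_add[symmetric])
    also have "\<dots> \<le> 2 / \<delta>\<^sup>2 * (exp (rate * \<bar>m\<bar>) * exp (rate * nrm s))"
      using exp2 by (intro mult_left_mono) auto
    finally show "\<bar>(Y s)\<^sup>2 * exp (\<delta> * \<bar>Y s\<bar>)\<bar> \<le> 2 / \<delta>\<^sup>2 * exp (rate * \<bar>m\<bar>) * exp (rate * nrm s)"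
      by simp
  qed auto
  define D where "D = measure_pmf.expectation p (\<lambda>s. (Y s)\<^sup>2 * exp (\<delta> * \<bar>Y s\<bar>))"
  have step: "(\<integral>\<^sup>+s. ennreal (exp (t * Y s)) \<partial>measure_pmf p) \<le> ennreal (exp (D * t\<^sup>2))"
    if t: "0 \<le> t" "t \<le> \<delta>" for t
  proof -
    have "(\<integral>\<^sup>+s. ennreal (exp (t * Y s)) \<partial>measure_pmf p)
        \<le> (\<integral>\<^sup>+s. ennreal (1 + t * Y s + t\<^sup>2 * ((Y s)\<^sup>2 * exp (\<delta> * \<bar>Y s\<bar>))) \<partial>measure_pmf p)"
    proof (rule nn_integral_mono, rule ennreal_leI)
      fix s
      have "exp \<bar>t * Y s\<bar> \<le> exp (\<delta> * \<bar>Y s\<bar>)" using t by (simp add: abs_mult mult_right_mono)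
      then have "(t * Y s)\<^sup>2 * exp \<bar>t * Y s\<bar> \<le> (t * Y s)\<^sup>2 * exp (\<delta> * \<bar>Y s\<bar>)"
        by (rule mult_left_mono) simp
      then show "exp (t * Y s) \<le> 1 + t * Y s + t\<^sup>2 * ((Y s)\<^sup>2 * exp (\<delta> * \<bar>Y s\<bar>))"
        using exp_le_quadratic[of "t * Y s"] by (simp add: power_mult_distrib mult.assoc)
    qed
    also have "\<dots> = ennreal (measure_pmf.expectation p (\<lambda>s. 1 + t * Y s + t\<^sup>2 * ((Y s)\<^sup>2 * exp (\<delta> * \<bar>Y s\<bar>))))"
    proof (rule nn_integral_eq_integral)
      show "integrable (measure_pmf p) (\<lambda>s. 1 + t * Y s + t\<^sup>2 * ((Y s)\<^sup>2 * exp (\<delta> * \<bar>Y s\<bar>)))"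
        using iD il by (simp add: Y_def)
      show "AE s in measure_pmf p. 0 \<le> 1 + t * Y s + t\<^sup>2 * ((Y s)\<^sup>2 * exp (\<delta> * \<bar>Y s\<bar>))"
      proof (rule AE_I2)
        fix s
        have "exp \<bar>t * Y s\<bar> \<le> exp (\<delta> * \<bar>Y s\<bar>)" using t by (simp add: abs_mult mult_right_mono)
        then have "(t * Y s)\<^sup>2 * exp \<bar>t * Y s\<bar> \<le> (t * Y s)\<^sup>2 * exp (\<delta> * \<bar>Y s\<bar>)"
          by (rule mult_left_mono) simp
        then show "0 \<le> 1 + t * Y s + t\<^sup>2 * ((Y s)\<^sup>2 * exp (\<delta> * \<bar>Y s\<bar>))"
          using order_trans[OF less_imp_le[OF exp_gt_zero] exp_le_quadratic[of "t * Y s"]]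
          by (simp add: power_mult_distrib mult.assoc)
      qed
    qed
    also have "measure_pmf.expectation p (\<lambda>s. 1 + t * Y s + t\<^sup>2 * ((Y s)\<^sup>2 * exp (\<delta> * \<bar>Y s\<bar>)))
        = 1 + t * measure_pmf.expectation p Y + t\<^sup>2 * D"
    proof -
      have "integrable (measure_pmf p) Y" unfolding Y_def[abs_def] using il by simp
      then show ?thesis unfolding D_def using iD by simp
    qed
    also have "measure_pmf.expectation p Y = 0"
      unfolding Y_def[abs_def] using il by (simp add: m_def)
    also have "ennreal (1 + t * 0 + t\<^sup>2 * D) \<le> ennreal (exp (D * t\<^sup>2))"
      using exp_ge_add_one_self[of "D * t\<^sup>2"] by (intro ennreal_leI) (simp add: mult.commute)
    finally show ?thesis .
  qed
  \<comment> \<open>Nonnegative integrals carry the induction without a separate proof of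
    integrability for each number of steps.\<close>
  have pow: "(\<integral>\<^sup>+s. ennreal (exp (t * (l s - real n * m))) \<partial>measure_pmf (steps p n))
      \<le> ennreal (exp (D * t\<^sup>2)) ^ n" if t: "0 \<le> t" "t \<le> \<delta>" for t n
  proof (induction n)
    case 0
    then show ?case by (simp add: l0)
  next
    case (Suc n)
    have eq: "ennreal (exp (t * (l (s + x) - real (Suc n) * m)))
        = ennreal (exp (t * Y s)) * ennreal (exp (t * (l x - real n * m)))" for s x
      by (simp add: ennreal_mult'[symmetric] exp_add[symmetric] add Y_def algebra_simps)
    have "(\<integral>\<^sup>+s. ennreal (exp (t * (l s - real (Suc n) * m))) \<partial>measure_pmf (steps p (Suc n)))
      = (\<integral>\<^sup>+s. \<integral>\<^sup>+x. ennreal (exp (t * (l (s + x) - real (Suc n) * m))) \<partial>measure_pmf (steps p n) \<partial>measure_pmf p)"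
      unfolding steps.simps by simp
    also have "\<dots> = (\<integral>\<^sup>+s. ennreal (exp (t * Y s)) \<partial>measure_pmf p)
        * (\<integral>\<^sup>+x. ennreal (exp (t * (l x - real n * m))) \<partial>measure_pmf (steps p n))"
      unfolding eq by (simp add: nn_integral_cmult nn_integral_multc)
    also have "\<dots> \<le> ennreal (exp (D * t\<^sup>2)) * ennreal (exp (D * t\<^sup>2)) ^ n"
      by (intro mult_mono step[OF t] Suc) auto
    finally show ?case by simp
  qed
  have "measure_pmf.prob (steps p n) {s. R \<le> l s - real n * m} \<le> exp (D * \<delta>\<^sup>2) * exp (- \<delta> * (R / sqrt (real n)))"
    if n: "1 \<le> n" for n R
  proof -
    define t where "t = \<delta> / sqrt (real n)"
    have sn: "1 \<le> sqrt (real n)" using n by simp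
    have t: "0 \<le> t" "t \<le> \<delta>" using \<delta>(1) sn by (auto simp: t_def field_simps)
    have "emeasure (measure_pmf (steps p n)) {s. R \<le> l s - real n * m}
        = (\<integral>\<^sup>+s. indicator {s. R \<le> l s - real n * m} s \<partial>measure_pmf (steps p n))" by simp
    also have "\<dots> \<le> (\<integral>\<^sup>+s. ennreal (exp (t * (l s - real n * m))) * ennreal (exp (- t * R)) \<partial>measure_pmf (steps p n))"
    proof (rule nn_integral_mono)
      fix s
      have "1 \<le> exp (t * (l s - real n * m)) * exp (- t * R)" if "R \<le> l s - real n * m"
        using mult_left_mono[OF that t(1)] by (simp add: exp_add[symmetric])
      then show "indicator {s. R \<le> l s - real n * m} s
          \<le> ennreal (exp (t * (l s - real n * m))) * ennreal (exp (- t * R))"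
        by (auto simp: indicator_def ennreal_mult'[symmetric] simp flip: ennreal_1)
    qed
    also have "\<dots> = (\<integral>\<^sup>+s. ennreal (exp (t * (l s - real n * m))) \<partial>measure_pmf (steps p n)) * ennreal (exp (- t * R))"
      by (simp add: nn_integral_multc)
    also have "\<dots> \<le> ennreal (exp (D * t\<^sup>2)) ^ n * ennreal (exp (- t * R))"
      by (intro mult_right_mono pow t) auto
    also have "\<dots> = ennreal (exp (D * t\<^sup>2) ^ n * exp (- t * R))"
      by (simp add: ennreal_power ennreal_mult')
    finally have "measure_pmf.prob (steps p n) {s. R \<le> l s - real n * m} \<le> exp (D * t\<^sup>2) ^ n * exp (- t * R)"
      by (simp add: measure_pmf.emeasure_eq_measure)
    also have "exp (D * t\<^sup>2) ^ n = exp (D * \<delta>\<^sup>2)"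
      using n by (simp add: exp_of_nat_mult[symmetric] t_def power_divide)
    also have "- t * R = - \<delta> * (R / sqrt (real n))" by (simp add: t_def)
    finally show ?thesis .
  qed
  then show thesis using \<delta>(1) unfolding m_def by (intro that[of \<delta> "exp (D * \<delta>\<^sup>2)"]) auto
qed

lemma deviation:
  assumes add: "\<And>x y. l (x + y) = l x + l y" and l: "\<And>s. \<bar>l s\<bar> \<le> nrm s"
  obtains c C where "0 < c" "0 \<le> C"
    "\<And>n R. 1 \<le> n \<Longrightarrow> measure_pmf.prob (steps p n) {s. R \<le> \<bar>l s - real n * measure_pmf.expectation p l\<bar>}
      \<le> C * exp (- c * (R / sqrt (real n)))"
proof -
  let ?P = "\<lambda>n A. measure_pmf.prob (steps p n) A"
  obtain c1 C1 where 1: "0 < c1" "0 \<le> C1"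
    "\<And>n R. 1 \<le> n \<Longrightarrow> ?P n {s. R \<le> l s - real n * measure_pmf.expectation p l}
      \<le> C1 * exp (- c1 * (R / sqrt (real n)))"
    by (rule deviation_one_sided[of l, OF add l], rule that)
  obtain c2 C2 where 2: "0 < c2" "0 \<le> C2"
    "\<And>n R. 1 \<le> n \<Longrightarrow> ?P n {s. R \<le> - l s - real n * measure_pmf.expectation p (\<lambda>s. - l s)}
      \<le> C2 * exp (- c2 * (R / sqrt (real n)))"
    by (rule deviation_one_sided[of "\<lambda>s. - l s"], simp add: add, simp add: l, rule that)
  have "?P n {s. R \<le> \<bar>l s - real n * measure_pmf.expectation p l\<bar>}
      \<le> (C1 + C2 + 1) * exp (- (min c1 c2) * (R / sqrt (real n)))" if n: "1 \<le> n" for n R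
  proof (cases "0 \<le> R")
    case True
    let ?r = "R / sqrt (real n)"
    let ?A = "{s. R \<le> l s - real n * measure_pmf.expectation p l}"
    let ?B = "{s. R \<le> - l s - real n * measure_pmf.expectation p (\<lambda>s. - l s)}"
    have "?P n {s. R \<le> \<bar>l s - real n * measure_pmf.expectation p l\<bar>} \<le> ?P n (?A \<union> ?B)"
      by (rule measure_pmf.finite_measure_mono) auto
    also have "\<dots> \<le> ?P n ?A + ?P n ?B" by (rule measure_subadditive) auto
    also have "\<dots> \<le> C1 * exp (- c1 * ?r) + C2 * exp (- c2 * ?r)" by (intro add_mono 1 2 n)
    also have "\<dots> \<le> C1 * exp (- (min c1 c2) * ?r) + C2 * exp (- (min c1 c2) * ?r)"
    proof -
      have "0 \<le> ?r" using True by simp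
      then have "min c1 c2 * ?r \<le> c1 * ?r" "min c1 c2 * ?r \<le> c2 * ?r"
        by (rule mult_right_mono[OF min.cobounded1], rule mult_right_mono[OF min.cobounded2])
      then show ?thesis using 1(2) 2(2) by (intro add_mono mult_left_mono) simp_all
    qed
    also have "\<dots> \<le> (C1 + C2 + 1) * exp (- (min c1 c2) * ?r)" by (simp add: algebra_simps)
    finally show ?thesis .
  next
    \<comment> \<open>For negative \<open>R\<close> the exponential is at least 1, and the 1 added
      to the constant makes the bound trivial.\<close>
    case False
    have "0 \<le> - (min c1 c2) * (R / sqrt (real n))"
      using False 1 2 by (intro mult_nonpos_nonpos) (auto simp: divide_nonpos_nonneg)
    then have "1 * 1 \<le> (C1 + C2 + 1) * exp (- (min c1 c2) * (R / sqrt (real n)))"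
      using 1 2 by (intro mult_mono) auto
    then show ?thesis using measure_pmf.prob_le_1[of "steps p n"] by (smt (verit) mult_1)
  qed
  then show thesis using 1 2 by (intro that[of "min c1 c2" "C1 + C2 + 1"]) auto
qed

definition drift :: real where
  "drift = measure_pmf.expectation p (\<lambda>s. real_of_int (fst s))"

lemma abs_coord_le_nrm:
  "\<bar>real_of_int (fst s)\<bar> \<le> nrm s" "\<bar>real_of_int (fst (snd s))\<bar> \<le> nrm s" "\<bar>real_of_int (snd (snd s))\<bar> \<le> nrm s"
  unfolding nrm_def by linarith+

lemma expectation_coords:
  "measure_pmf.expectation p (\<lambda>s. real_of_int (fst (snd s))) = 0"
  "measure_pmf.expectation p (\<lambda>s. real_of_int (snd (snd s))) = 0"
proof -
  let ?r = "\<lambda>z::point. (fst z, - fst (snd z), - snd (snd z))"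
  have "measure_pmf.expectation p f = measure_pmf.expectation p (\<lambda>s. f (?r s))" for f :: "point \<Rightarrow> real"
    using integral_map_pmf[of ?r p f] neg_sym by simp
  from this[of "\<lambda>s. real_of_int (fst (snd s))"] this[of "\<lambda>s. real_of_int (snd (snd s))"]
  show "measure_pmf.expectation p (\<lambda>s. real_of_int (fst (snd s))) = 0"
    "measure_pmf.expectation p (\<lambda>s. real_of_int (snd (snd s))) = 0" by simp_all
qed

lemma one_le_drift: "1 \<le> drift"
proof -
  have "measure_pmf.expectation p (\<lambda>s. 1) \<le> drift"
    unfolding drift_def
  proof (rule integral_mono_AE)
    show "integrable (measure_pmf p) (\<lambda>s. real_of_int (fst s))"
      by (rule integrable_le_nrm[where C=1 and B=0]) (use abs_coord_le_nrm in auto)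
    show "AE s in measure_pmf p. 1 \<le> real_of_int (fst s)"
      using time_pos by (auto simp: AE_measure_pmf_iff)
  qed simp
  then show ?thesis by simp
qed

lemma gap_deviation:
  obtains c C where "0 < c" "0 \<le> C"
    "\<And>n R. 1 \<le> n \<Longrightarrow> measure_pmf.prob (steps p n) {s. R \<le> \<bar>real_of_int (gap s)\<bar>}
      \<le> C * exp (- c * (R / sqrt (real n)))"
proof -
  have a: "real_of_int (gap (x + y)) = real_of_int (gap x) + real_of_int (gap y)" for x y
    by (simp add: gap_add)
  have b: "\<bar>real_of_int (gap s)\<bar> \<le> nrm s" for s using abs_gap_le_nrm[of s] by simp
  show thesis
    by (rule deviation[of "\<lambda>s. real_of_int (gap s)", OF a b], rule that) simp_all
qed

definition centred_box :: "nat \<Rightarrow> real \<Rightarrow> point set" where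
  "centred_box n R = {s. \<bar>real_of_int (fst s) - real n * drift\<bar> < R
    \<and> \<bar>real_of_int (fst (snd s))\<bar> < R \<and> \<bar>real_of_int (snd (snd s))\<bar> < R}"

lemma box_deviation:
  obtains c C where "0 < c" "0 \<le> C"
    "\<And>n R. 1 \<le> n \<Longrightarrow> 0 \<le> R \<Longrightarrow>
      measure_pmf.prob (steps p n) (- centred_box n R) \<le> C * exp (- c * (R / sqrt (real n)))"
proof -
  let ?P = "\<lambda>n A. measure_pmf.prob (steps p n) A"
  obtain c1 C1 where 1: "0 < c1" "0 \<le> C1"
    "\<And>n R. 1 \<le> n \<Longrightarrow> ?P n {s. R \<le> \<bar>real_of_int (fst s) - real n * drift\<bar>}
      \<le> C1 * exp (- c1 * (R / sqrt (real n)))"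
    by (rule deviation[of "\<lambda>s. real_of_int (fst s)", folded drift_def], simp, rule abs_coord_le_nrm, rule that)
  obtain c2 C2 where 2: "0 < c2" "0 \<le> C2"
    "\<And>n R. 1 \<le> n \<Longrightarrow> ?P n {s. R \<le> \<bar>real_of_int (fst (snd s)) - real n * measure_pmf.expectation p (\<lambda>s. real_of_int (fst (snd s)))\<bar>}
      \<le> C2 * exp (- c2 * (R / sqrt (real n)))"
    by (rule deviation[of "\<lambda>s. real_of_int (fst (snd s))"], simp, rule abs_coord_le_nrm, rule that)
  obtain c3 C3 where 3: "0 < c3" "0 \<le> C3"
    "\<And>n R. 1 \<le> n \<Longrightarrow> ?P n {s. R \<le> \<bar>real_of_int (snd (snd s)) - real n * measure_pmf.expectation p (\<lambda>s. real_of_int (snd (snd s)))\<bar>}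
      \<le> C3 * exp (- c3 * (R / sqrt (real n)))"
    by (rule deviation[of "\<lambda>s. real_of_int (snd (snd s))"], simp, rule abs_coord_le_nrm, rule that)
  define c where "c = min c1 (min c2 c3)"
  have c: "0 < c" "c \<le> c1" "c \<le> c2" "c \<le> c3" using 1 2 3 by (auto simp: c_def)
  have "?P n (- centred_box n R) \<le> (C1 + C2 + C3) * exp (- c * (R / sqrt (real n)))"
    if n: "1 \<le> n" and R: "0 \<le> R" for n R
  proof -
    let ?r = "R / sqrt (real n)"
    let ?A = "{s::point. R \<le> \<bar>real_of_int (fst s) - real n * drift\<bar>}"
    let ?B = "{s::point. R \<le> \<bar>real_of_int (fst (snd s))\<bar>}"
    let ?D = "{s::point. R \<le> \<bar>real_of_int (snd (snd s))\<bar>}"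
    have r: "0 \<le> ?r" using R by simp
    have "?P n (- centred_box n R) \<le> ?P n (?A \<union> (?B \<union> ?D))"
      by (rule measure_pmf.finite_measure_mono) (auto simp: centred_box_def)
    also have "\<dots> \<le> ?P n ?A + ?P n (?B \<union> ?D)" by (rule measure_subadditive) auto
    also have "?P n (?B \<union> ?D) \<le> ?P n ?B + ?P n ?D" by (rule measure_subadditive) auto
    also have "?P n ?A \<le> C1 * exp (- c1 * ?r)" by (rule 1(3)[OF n])
    also have "?P n ?B \<le> C2 * exp (- c2 * ?r)" using 2(3)[OF n, of R] by (simp add: expectation_coords)
    also have "?P n ?D \<le> C3 * exp (- c3 * ?r)" using 3(3)[OF n, of R] by (simp add: expectation_coords)
    also have "C1 * exp (- c1 * ?r) + (C2 * exp (- c2 * ?r) + C3 * exp (- c3 * ?r))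
        \<le> C1 * exp (- c * ?r) + (C2 * exp (- c * ?r) + C3 * exp (- c * ?r))"
      using c 1 2 3 mult_right_mono[OF c(2) r] mult_right_mono[OF c(3) r] mult_right_mono[OF c(4) r]
      by (intro add_mono mult_left_mono) auto
    also have "\<dots> = (C1 + C2 + C3) * exp (- c * ?r)" by (simp add: algebra_simps)
    finally show ?thesis by simp
  qed
  then show thesis using c 1 2 3 by (intro that[of c "C1 + C2 + C3"]) auto
qed

end

section \<open>Symmetries of the law of \<open>n\<close> steps\<close>

lemma map_steps_additive:
  assumes add: "\<And>x y. f (x + y) = f x + f y" and q: "map_pmf f q = q"
  shows "map_pmf f (steps q n) = steps q n"
proof (induction n)
  case 0
  have "f 0 = 0" using add[of 0 0] by simp
  then show ?case by simp
next
  case (Suc n)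
  have "map_pmf f (steps q (Suc n)) = bind_pmf q (\<lambda>s. map_pmf (\<lambda>x. f s + f x) (steps q n))"
    by (simp add: map_bind_pmf map_pmf_comp add)
  also have "\<dots> = bind_pmf q (\<lambda>s. map_pmf ((+) (f s)) (map_pmf f (steps q n)))"
    by (simp add: map_pmf_comp)
  also have "\<dots> = bind_pmf (map_pmf f q) (\<lambda>s. map_pmf ((+) s) (steps q n))"
    unfolding Suc.IH by (simp add: bind_map_pmf)
  finally show ?case by (simp add: q)
qed

lemma steps_1: "steps q 1 = q"
  by (simp add: map_pmf_def[symmetric] bind_return_pmf')

context cone_walk
begin

lemma pmf_steps_mirror: "pmf (steps p n) (mirror w) = pmf (steps p n) w"
proof -
  have "inj mirror" by (metis injI mirror_mirror)
  then have "pmf (map_pmf mirror (steps p n)) (mirror w) = pmf (steps p n) w"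
    by (rule pmf_map_inj')
  then show ?thesis using map_steps_additive[of mirror p n, OF mirror_add mirror_sym] by simp
qed

lemma pmf_steps_neg: "pmf (steps p n) (t, - v, - x) = pmf (steps p n) (t, v, x)"
proof -
  let ?r = "\<lambda>z::point. (fst z, - fst (snd z), - snd (snd z))"
  have "inj ?r" by (auto intro!: injI simp: prod_eq_iff)
  then have "pmf (map_pmf ?r (steps p n)) (?r (t, v, x)) = pmf (steps p n) (t, v, x)"
    by (rule pmf_map_inj')
  moreover have "map_pmf ?r (steps p n) = steps p n"
    by (rule map_steps_additive) (simp_all add: neg_sym)
  ultimately show ?thesis by simp
qed

subsection \<open>One-sided asymptotics by reflection\<close>

text \<open>Symmetry of the step law under \<open>mirror\<close> turns the target
  \<open>mirror w\<close> into the target \<open>w\<close> shifted by \<open>shear (gap y)\<close>.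
  In particular the function vanishes on the diagonal.\<close>

lemma reflected_free:
  "free p m (\<lambda>y. indicator {w} y - indicator {mirror w} y) y
    = pmf (steps p m) (w - y) - pmf (steps p m) (w - y + shear (gap y))"
proof -
  have int: "integrable (measure_pmf (steps p m)) (\<lambda>s. indicat_real {u} (y + s))" for u
    by (rule integrable_pmf_bounded[where B=1]) (simp add: indicator_def)
  have "free p m (\<lambda>y. indicator {w} y - indicator {mirror w} y) y
      = free p m (indicator {w}) y - free p m (indicator {mirror w}) y"
    unfolding free_def by (rule Bochner_Integration.integral_diff[OF int int])
  moreover have "mirror w - y = mirror (w - y + shear (gap y))"
    by (cases w, cases y) (simp add: mirror_def shear_def gap_def)
  ultimately show ?thesis
    by (simp add: free_indicator_single pmf_steps_mirror)
qed

lemma exit_op_abs_mono: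
  assumes "integrable (measure_pmf p) F" "\<And>s. gap (y + s) \<le> 0 \<Longrightarrow> \<bar>g (y + s)\<bar> \<le> F s" "\<And>s. 0 \<le> F s"
  shows "\<bar>exit_op p g y\<bar> \<le> measure_pmf.expectation p F"
proof -
  have "\<bar>exit_op p g y\<bar> \<le> measure_pmf.expectation p (\<lambda>s. \<bar>if gap (y + s) > 0 then 0 else g (y + s)\<bar>)"
    unfolding exit_op_def by (rule integral_abs_bound)
  also have "\<dots> \<le> measure_pmf.expectation p F"
    by (rule integral_mono'[OF assms(1)]) (use assms(2,3) in auto)
  finally show ?thesis .
qed

lemma exit_gap_le:
  assumes "gap y > 0" "gap (y + s) \<le> 0"
  shows "real_of_int \<bar>gap (y + s)\<bar> \<le> nrm s"
proof -
  have "\<bar>gap (y + s)\<bar> \<le> \<bar>gap s\<bar>" using assms by (simp add: gap_add)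
  then show ?thesis using abs_gap_le_nrm[of s] by linarith
qed

text \<open>\<open>first_passage\<close> is applied to the difference of the indicators of
  \<open>w\<close> and \<open>mirror w\<close>. The term without exit contributes
  \<open>gap z * dker n w\<close>; exits during the first \<open>\<kappa>\<close> steps contribute
  the overshoot times \<open>dker n w\<close>, and together these make up
  \<open>ren z * dker n w\<close>. Later exits are rare because the walk must first survive. Among
  them, exits with fewer than \<open>m0\<close> steps left are too late for reaching gap
  \<open>a\<close>. The error terms belong, in order, to the term without exit, the early exits, the
  exits up to half of the steps together with the tail of \<open>ren\<close>, the exits after that,
  and the last \<open>m0\<close> steps.\<close>

lemma one_sided:
  obtains C c where "0 \<le> C" "0 < c"
    "\<And>n \<kappa> m0 a z w. 2 \<le> n \<Longrightarrow> 1 \<le> \<kappa> \<Longrightarrow> 2 * \<kappa> \<le> n \<Longrightarrow> 1 \<le> m0 \<Longrightarrow> 2 * m0 \<le> n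
      \<Longrightarrow> gap z > 0 \<Longrightarrow> 0 < a \<Longrightarrow> a \<le> real_of_int (gap w)
      \<Longrightarrow> \<bar>kill p n (indicator {w}) z - ren z * dker n w\<bar>
        \<le> C * (real_of_int (gap z) * (nrm z + 1) / sqrt (real n) ^ 5
          + real \<kappa> * (nrm z + real \<kappa>) / sqrt (real n) ^ 5
          + real_of_int (gap z) / (sqrt (real \<kappa>) * sqrt (real n) ^ 4)
          + real_of_int (gap z) / (sqrt (real n) * sqrt (real m0) ^ 4)
          + real n * exp (- c * (a / sqrt (real m0))))"
proof -
  obtain C1 where C1: "0 \<le> C1" "\<And>n z. 1 \<le> n \<Longrightarrow> gap z > 0 \<Longrightarrow>
      kill p n (\<lambda>_. 1) z \<le> C1 * real_of_int (gap z) / sqrt (real n)"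
    by (rule survival_le, rule that)
  obtain Q where Q: "0 \<le> Q" "\<And>z. gap z > 0 \<Longrightarrow> real_of_int (gap z) \<le> ren z"
    "\<And>z. gap z > 0 \<Longrightarrow> ren z \<le> Q * real_of_int (gap z)"
    "\<And>z m l. gap z > 0 \<Longrightarrow> (\<Sum>k=m..<m+l. kill p k over z) \<le> Q * kill p m (\<lambda>_. 1) z"
    "\<And>z m. gap z > 0 \<Longrightarrow>
      \<bar>ren z - real_of_int (gap z) - (\<Sum>k<m. kill p k over z)\<bar> \<le> Q * kill p m (\<lambda>_. 1) z"
    by (rule ren_bounds, rule that)
  obtain C2 where C2: "0 \<le> C2" "\<And>n w. 1 \<le> n \<Longrightarrow> \<bar>dker n w\<bar> \<le> C2 / sqrt (real n) ^ 4"
    by (rule dker_le, rule that)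
  obtain C3 where C3: "0 \<le> C3"
    "\<And>m w g. 1 \<le> m \<Longrightarrow>
      \<bar>pmf (steps p m) w - pmf (steps p m) (w + shear g)\<bar> \<le> C3 * real_of_int \<bar>g\<bar> / sqrt (real m) ^ 4"
    "\<And>m n w y g. 1 \<le> m \<Longrightarrow> m \<le> n \<Longrightarrow>
      \<bar>pmf (steps p m) (w - y) - pmf (steps p m) (w - y + shear g) - real_of_int g * dker n w\<bar>
        \<le> C3 * real_of_int \<bar>g\<bar> * (nrm y + real_of_int \<bar>g\<bar> + real (n - m) + 1) / sqrt (real m) ^ 5"
    by (rule reflected_difference_le, rule that)
  obtain c4 C4 where C4: "0 < c4" "0 \<le> C4"
    "\<And>n R. 1 \<le> n \<Longrightarrow> measure_pmf.prob (steps p n) {s. R \<le> \<bar>real_of_int (gap s)\<bar>}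
      \<le> C4 * exp (- c4 * (R / sqrt (real n)))"
    by (rule gap_deviation, rule that)
  define M where "M = measure_pmf.expectation p nrm"
  define M2 where "M2 = measure_pmf.expectation p (\<lambda>s. nrm s * (nrm s + 1))"
  have iM2: "integrable (measure_pmf p) (\<lambda>s. nrm s * (nrm s + 1))"
    using integrable_nrm_sq integrable_nrm by (simp add: power2_eq_square algebra_simps)
  have M: "0 \<le> M" "M \<le> M2"
  proof -
    show "0 \<le> M" unfolding M_def by (rule integral_nonneg_AE) simp
    show "M \<le> M2" unfolding M_def M2_def
      by (rule integral_mono'[OF iM2]) (simp_all add: algebra_simps)
  qed
  define c where "c = c4 / 2"
  define KA where "KA = 32 * C3 * (4 * M2) * (M + 1)"
  define KB where "KB = C3 * 16 * (Q * C1)"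
  define KC where "KC = C3 * (Q * (2 * C1))"
  define KD where "KD = 4 * C4"
  define KT where "KT = C2 * (Q * C1)"
  define C where "C = 2 * C3 + KA + (KB + KT) + KC + KD"
  have nn: "0 \<le> KA" "0 \<le> KB" "0 \<le> KC" "0 \<le> KD" "0 \<le> KT" "0 < c"
    using C1(1) Q(1) C2(1) C3(1) C4(1,2) M by (auto simp: KA_def KB_def KC_def KD_def KT_def c_def)
  have main: "\<bar>kill p n (indicator {w}) z - ren z * dker n w\<bar>
        \<le> 2 * C3 * (real_of_int (gap z) * (nrm z + 1) / sqrt (real n) ^ 5)
          + KA * (real \<kappa> * (nrm z + real \<kappa>) / sqrt (real n) ^ 5)
          + (KB + KT) * (real_of_int (gap z) / (sqrt (real \<kappa>) * sqrt (real n) ^ 4))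
          + KC * (real_of_int (gap z) / (sqrt (real n) * sqrt (real m0) ^ 4))
          + KD * (real n * exp (- c * (a / sqrt (real m0))))"
    if n: "2 \<le> n" and \<kappa>: "1 \<le> \<kappa>" "2 * \<kappa> \<le> n" and m0: "1 \<le> m0" "2 * m0 \<le> n"
      and z: "gap z > 0" and a: "0 < a" "a \<le> real_of_int (gap w)" for n \<kappa> m0 a z w
  proof -
    let ?g = "real_of_int (gap z)"
    let ?sn = "sqrt (real n)"
    have g: "1 \<le> ?g" using z by linarith
    have sn: "0 < ?sn" using n by simp
    \<comment> \<open>On the half-space \<open>f\<close> is the indicator of \<open>w\<close>, so
      killing does not see the mirror image; its free evolution is odd under reflection.\<close>
    define f where "f y = indicat_real {w} y - indicator {mirror w} y" for y
    define dk where "dk = dker n w"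
    define h where "h m y = free p m f y" for m y
    define J where "J m = exit_op p (h m)" for m
    have h: "h m y = pmf (steps p m) (w - y) - pmf (steps p m) (w - y + shear (gap y))" for m y
      unfolding h_def f_def[abs_def] by (rule reflected_free)
    have h1: "\<bar>h m y\<bar> \<le> 1" for m y
      unfolding h using pmf_le_1[of "steps p m"] pmf_nonneg[of "steps p m"] by (smt (verit))
    have J1: "\<bar>J m y\<bar> \<le> 1" for m y
      unfolding J_def by (rule exit_op_abs_le) (rule h1)
    have JB [simp]: "bounded_pos (J m)" for m
      by (rule bounded_posI[where B=1]) (rule J1)
    have f1: "\<bar>f y\<bar> \<le> 1" for y by (simp add: f_def indicator_def)
    have expand: "kill p n (indicator {w}) z = h n z - (\<Sum>k<n. kill p k (J (n - 1 - k)) z)"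
    proof -
      have "kill p n (indicator {w}) z = kill p n f z"
      proof (rule kill_cong[OF _ z])
        fix y assume y: "gap y > 0"
        have "y \<noteq> mirror w" using y a by auto
        then show "indicator {w} y = f y" by (simp add: f_def)
      qed
      also have "\<dots> = free p n f z - (\<Sum>k<n. kill p k (exit_op p (free p (n - 1 - k) f)) z)"
        by (rule first_passage[OF f1])
      finally show ?thesis by (simp add: h_def[abs_def] J_def)
    qed
    have k1: "0 \<le> kill p m (\<lambda>_. 1) z" "kill p m (\<lambda>_. 1) z \<le> 1" for m
      using kill_nonneg[of "\<lambda>_. 1" z p m] kill_abs_le[of "\<lambda>_. 1" 1 z p m] z by auto

    have T0: "\<bar>h n z - ?g * dk\<bar> \<le> 2 * C3 * (?g * (nrm z + 1) / ?sn ^ 5)"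
    proof -
      have "\<bar>h n z - ?g * dk\<bar> \<le> C3 * real_of_int \<bar>gap z\<bar> * (nrm z + real_of_int \<bar>gap z\<bar> + real (n - n) + 1) / ?sn ^ 5"
        unfolding h dk_def using n by (intro C3(3)) auto
      also have "\<dots> \<le> (C3 * ?g * (2 * (nrm z + 1))) / ?sn ^ 5"
      proof (rule divide_right_mono, rule mult_mono)
        show "nrm z + real_of_int \<bar>gap z\<bar> + real (n - n) + 1 \<le> 2 * (nrm z + 1)"
          using abs_gap_le_nrm[of z] by simp
      qed (use z C3(1) in auto)
      finally show ?thesis by (simp add: mult_ac)
    qed

    \<comment> \<open>Early exits: almost all steps remain, so the reflected difference after the
      exit is linear in the overshoot with slope \<open>dk\<close>. The sign is that of a negative
      gap, whence the sum.\<close>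
    have TA: "\<bar>\<Sum>k<\<kappa>. kill p k (J (n - 1 - k)) z + dk * kill p k over z\<bar>
        \<le> KA * (real \<kappa> * (nrm z + real \<kappa>) / ?sn ^ 5)"
    proof -
      let ?A = "32 * C3 * (4 * M2) / ?sn ^ 5"
      have A0: "0 \<le> ?A" using C3(1) M by simp
      have each: "\<bar>kill p k (J (n - 1 - k)) z + dk * kill p k over z\<bar> \<le> ?A * (M + 1) * (nrm z + real \<kappa>)"
        if k: "k < \<kappa>" for k
      proof -
        define m where "m = n - 1 - k"
        have m: "1 \<le> m" "m \<le> n" "real n \<le> 4 * real m" "n - m = k + 1" using k \<kappa> n unfolding m_def by linarith+
        have Jo: "\<bar>J m y + dk * over y\<bar> \<le> ?A * nrm y + ?A * (real k + 1)" if y: "gap y > 0" for y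
        proof -
          let ?F = "\<lambda>s. C3 * nrm s * (2 * (nrm y + nrm s) + real k + 2) / sqrt (real m) ^ 5"
          have iF: "integrable (measure_pmf p) ?F"
          proof -
            have "?F = (\<lambda>s. C3 / sqrt (real m) ^ 5 * (2 * (nrm s * (nrm s + 1)) + (2 * nrm y + real k) * nrm s))"
              by (simp add: fun_eq_iff algebra_simps add_divide_distrib del: split_paired_All)
            then show ?thesis using iM2 integrable_nrm by simp
          qed
          \<comment> \<open>Outside the half-space \<open>over\<close> integrates minus the gap, so
            subtracting \<open>gap * dk\<close> under \<open>exit_op\<close> adds
            \<open>dk * over\<close>.\<close>
          have "J m y + dk * over y = exit_op p (\<lambda>u. h m u - real_of_int (gap u) * dk) y"
          proof -
            have i1: "integrable (measure_pmf p) (\<lambda>s. if gap (y + s) > 0 then 0 else h m (y + s))"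
              by (rule integrable_pmf_bounded[where B=1]) (use h1 in auto)
            have "exit_op p (\<lambda>u. h m u - real_of_int (gap u) * dk) y
              = measure_pmf.expectation p (\<lambda>s. (if gap (y + s) > 0 then 0 else h m (y + s))
                + dk * (if gap (y + s) > 0 then 0 else - real_of_int (gap (y + s))))"
              unfolding exit_op_def by (rule Bochner_Integration.integral_cong) auto
            also have "\<dots> = J m y + dk * over y"
              unfolding J_def over_def exit_op_def
              by (subst Bochner_Integration.integral_add[OF i1])
                (use over_integrand_integrable[of y] in simp_all)
            finally show ?thesis by simp
          qed
          also have "\<bar>\<dots>\<bar> \<le> measure_pmf.expectation p ?F"
          proof (rule exit_op_abs_mono[OF iF])
            fix s
            show "0 \<le> ?F s" using C3(1) by simp
            assume ex: "gap (y + s) \<le> 0"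
            have e: "real_of_int \<bar>gap (y + s)\<bar> \<le> nrm s" by (rule exit_gap_le[OF y ex])
            have "\<bar>h m (y + s) - real_of_int (gap (y + s)) * dk\<bar>
              \<le> C3 * real_of_int \<bar>gap (y + s)\<bar> * (nrm (y + s) + real_of_int \<bar>gap (y + s)\<bar> + real (n - m) + 1) / sqrt (real m) ^ 5"
              unfolding h dk_def using m by (intro C3(3)) auto
            also have "\<dots> \<le> ?F s"
            proof (rule divide_right_mono, rule mult_mono)
              show "C3 * real_of_int \<bar>gap (y + s)\<bar> \<le> C3 * nrm s" using e C3(1) by (rule mult_left_mono)
              show "nrm (y + s) + real_of_int \<bar>gap (y + s)\<bar> + real (n - m) + 1 \<le> 2 * (nrm y + nrm s) + real k + 2"
                using nrm_triangle[of y s] abs_gap_le_nrm[of "y + s"] m(4) by simp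
            qed (use C3(1) in auto)
            finally show "\<bar>h m (y + s) - real_of_int (gap (y + s)) * dk\<bar> \<le> ?F s" .
          qed
          also have "measure_pmf.expectation p ?F \<le> measure_pmf.expectation p
              (\<lambda>s. (nrm s * (nrm s + 1)) * (C3 * (4 * (nrm y + (real k + 1))) / sqrt (real m) ^ 5))"
          proof (rule integral_mono')
            fix s
            have "nrm s * (2 * (nrm y + nrm s) + real k + 2) \<le> nrm s * ((nrm s + 1) * (4 * (nrm y + (real k + 1))))"
            proof (rule mult_left_mono)
              have "0 \<le> nrm s * nrm y" "0 \<le> nrm s * real k" by simp_all
              then show "2 * (nrm y + nrm s) + real k + 2 \<le> (nrm s + 1) * (4 * (nrm y + (real k + 1)))"
                using nrm_nonneg[of s] nrm_nonneg[of y] unfolding distrib_left distrib_right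
                by (simp add: mult.assoc mult.left_commute[of "nrm s" 4])
            qed simp
            note le = this
            have "C3 * (nrm s * (2 * (nrm y + nrm s) + real k + 2)) / sqrt (real m) ^ 5
                \<le> C3 * (nrm s * ((nrm s + 1) * (4 * (nrm y + (real k + 1))))) / sqrt (real m) ^ 5"
              by (rule divide_right_mono[OF mult_left_mono[OF le C3(1)]]) simp
            then show "?F s \<le> (nrm s * (nrm s + 1)) * (C3 * (4 * (nrm y + (real k + 1))) / sqrt (real m) ^ 5)"
              by (simp add: mult_ac)
          qed (use iM2 C3(1) in auto)
          also have "\<dots> = M2 * (C3 * (4 * (nrm y + (real k + 1))) / sqrt (real m) ^ 5)"
            unfolding M2_def by (rule integral_mult_left_zero)
          also have "\<dots> = (C3 * (4 * M2) * (nrm y + (real k + 1))) / sqrt (real m) ^ 5"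
            by (simp add: mult_ac)
          also have "\<dots> \<le> 2 ^ 5 * (C3 * (4 * M2) * (nrm y + (real k + 1))) / ?sn ^ 5"
            using m n C3(1) M by (intro div_sqrt_half_le) auto
          also have "\<dots> = ?A * nrm y + ?A * (real k + 1)" by (simp add: algebra_simps add_divide_distrib)
          finally show ?thesis .
        qed
        have "kill p k (J m) z + dk * kill p k over z = kill p k (\<lambda>y. J m y + dk * over y) z"
          using kill_lin[of "J m" over p k 1 dk z] by simp
        also have "\<bar>\<dots>\<bar> \<le> ?A * (nrm z + real k * measure_pmf.expectation p nrm) + ?A * (real k + 1)"
          by (rule kill_growth[OF Jo A0 _ integrable_nrm z]) (simp, rule mult_nonneg_nonneg[OF A0], simp)
        also have "\<dots> = ?A * (nrm z + real k * M + (real k + 1))" by (simp only: M_def distrib_left)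
        also have "\<dots> \<le> ?A * ((M + 1) * (nrm z + real \<kappa>))"
        proof (rule mult_left_mono[OF _ A0])
          have "real k * M \<le> real \<kappa> * M" using k M by (intro mult_right_mono) auto
          moreover have "0 \<le> nrm z * M" using M by simp
          moreover have "real k + 1 \<le> real \<kappa>" using k by linarith
          ultimately show "nrm z + real k * M + (real k + 1) \<le> (M + 1) * (nrm z + real \<kappa>)"
            by (simp add: algebra_simps)
        qed
        finally show ?thesis by (simp add: m_def mult.assoc)
      qed
      have "\<bar>\<Sum>k<\<kappa>. kill p k (J (n - 1 - k)) z + dk * kill p k over z\<bar>
          \<le> (\<Sum>k<\<kappa>. \<bar>kill p k (J (n - 1 - k)) z + dk * kill p k over z\<bar>)"
        by (rule sum_abs)
      also have "\<dots> \<le> (\<Sum>k<\<kappa>. ?A * (M + 1) * (nrm z + real \<kappa>))"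
        by (rule sum_mono, rule each) (simp only: lessThan_iff)
      also have "\<dots> = KA * (real \<kappa> * (nrm z + real \<kappa>) / ?sn ^ 5)"
        by (simp add: KA_def mult_ac)
      finally show ?thesis .
    qed

    \<comment> \<open>Without the linear approximation the reflected difference is still
      proportional to the overshoot, so sums over \<open>k\<close> are controlled by sums of
      \<open>kill p k over z\<close>.\<close>
    have J_over: "\<bar>J m y\<bar> \<le> C3 / sqrt (real m) ^ 4 * over y" if "1 \<le> m" for m y
    proof -
      let ?c = "C3 / sqrt (real m) ^ 4"
      have "\<bar>J m y\<bar> \<le> measure_pmf.expectation p
          (\<lambda>s. ?c * (if gap (y + s) > 0 then 0 else - real_of_int (gap (y + s))))"
        unfolding J_def
      proof (rule exit_op_abs_mono)
        show "integrable (measure_pmf p) (\<lambda>s. ?c * (if gap (y + s) > 0 then 0 else - real_of_int (gap (y + s))))"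
          using over_integrand_integrable[of y] by simp
        fix s
        show "0 \<le> ?c * (if gap (y + s) > 0 then 0 else - real_of_int (gap (y + s)))"
          using C3(1) by simp
        assume "gap (y + s) \<le> 0"
        then show "\<bar>h m (y + s)\<bar> \<le> ?c * (if gap (y + s) > 0 then 0 else - real_of_int (gap (y + s)))"
          using C3(2)[OF that, of "w - (y + s)" "gap (y + s)"] unfolding h by simp
      qed
      also have "\<dots> = ?c * over y" unfolding over_def exit_op_def by (rule integral_mult_right_zero)
      finally show ?thesis .
    qed
    have block: "\<bar>\<Sum>k=i..<i+l. kill p k (J (n - 1 - k)) z\<bar> \<le> C3 / sqrt (real q) ^ 4 * (Q * kill p i (\<lambda>_. 1) z)"
      if q: "1 \<le> q" and kq: "\<And>k. i \<le> k \<Longrightarrow> k < i + l \<Longrightarrow> q \<le> n - 1 - k" for i l q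
    proof -
      let ?c = "C3 / sqrt (real q) ^ 4"
      have c0: "0 \<le> ?c" using C3(1) by simp
      have "\<bar>\<Sum>k=i..<i+l. kill p k (J (n - 1 - k)) z\<bar> \<le> (\<Sum>k=i..<i+l. \<bar>kill p k (J (n - 1 - k)) z\<bar>)"
        by (rule sum_abs)
      also have "\<dots> \<le> (\<Sum>k=i..<i+l. ?c * kill p k over z)"
      proof (rule sum_mono)
        fix k assume k: "k \<in> {i..<i+l}"
        let ?m = "n - 1 - k"
        have qm: "q \<le> ?m" using kq k by simp
        have "\<bar>J ?m y\<bar> \<le> ?c * over y" for y
        proof -
          have "\<bar>J ?m y\<bar> \<le> C3 / sqrt (real ?m) ^ 4 * over y" using qm q by (intro J_over) simp
          also have "\<dots> \<le> ?c * over y"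
            using qm q C3(1) over_nonneg
            by (intro mult_right_mono divide_left_mono power_mono mult_pos_pos) auto
          finally show ?thesis .
        qed
        then have "\<bar>kill p k (J ?m) z\<bar> \<le> kill p k (\<lambda>y. ?c * over y) z"
          using bounded_pos_lin[OF bounded_pos_over bounded_pos_over, of ?c 0]
          by (intro kill_abs_mono z) auto
        then show "\<bar>kill p k (J ?m) z\<bar> \<le> ?c * kill p k over z" by (simp only: kill_cmult[OF bounded_pos_over])
      qed
      also have "\<dots> = ?c * (\<Sum>k=i..<i+l. kill p k over z)" by (rule sum_distrib_left[symmetric])
      also have "\<dots> \<le> ?c * (Q * kill p i (\<lambda>_. 1) z)" by (rule mult_left_mono[OF Q(4)[OF z] c0])
      finally show ?thesis .
    qed
    define q where "q = n div 2"
    have q: "1 \<le> q" "real n \<le> 4 * real q" "\<kappa> \<le> n - q" "m0 \<le> q" "real n \<le> 4 * real (n - q)" "1 \<le> n - q" "q \<le> n"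
      using n \<kappa> m0 unfolding q_def by linarith+

    \<comment> \<open>Exits after step \<open>\<kappa>\<close> with at least \<open>q\<close> steps
      left: surviving \<open>\<kappa>\<close> steps yields the factor
      \<open>1 / sqrt \<kappa>\<close>, while the remaining kernel keeps the full order in
      \<open>n\<close>.\<close>
    have TB: "\<bar>\<Sum>k=\<kappa>..<n-q. kill p k (J (n - 1 - k)) z\<bar> \<le> KB * (?g / (sqrt (real \<kappa>) * ?sn ^ 4))"
    proof -
      have "\<bar>\<Sum>k=\<kappa>..<\<kappa> + (n - q - \<kappa>). kill p k (J (n - 1 - k)) z\<bar> \<le> C3 / sqrt (real q) ^ 4 * (Q * kill p \<kappa> (\<lambda>_. 1) z)"
        by (rule block) (use q in linarith)+
      also have "\<dots> \<le> (2 ^ 4 * C3 / ?sn ^ 4) * (Q * (C1 * ?g / sqrt (real \<kappa>)))"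
        using q n C3(1) Q(1) C1(2)[OF \<kappa>(1) z] k1(1)
        by (intro mult_mono div_sqrt_half_le mult_left_mono) auto
      finally have "\<bar>\<Sum>k=\<kappa>..<\<kappa> + (n - q - \<kappa>). kill p k (J (n - 1 - k)) z\<bar>
          \<le> KB * (?g / (sqrt (real \<kappa>) * ?sn ^ 4))" by (simp add: KB_def mult_ac)
      moreover have "\<kappa> + (n - q - \<kappa>) = n - q" using q(3) by linarith
      ultimately show ?thesis by metis
    qed

    \<comment> \<open>Exits in the second half with at least \<open>m0\<close> steps left: the full
      survival factor is available, but the kernel is only as small as \<open>m0\<close> steps make
      it.\<close>
    have TC: "\<bar>\<Sum>k=n-q..<n-m0. kill p k (J (n - 1 - k)) z\<bar> \<le> KC * (?g / (?sn * sqrt (real m0) ^ 4))"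
    proof -
      have "\<bar>\<Sum>k=n-q..<(n-q) + (q-m0). kill p k (J (n - 1 - k)) z\<bar> \<le> C3 / sqrt (real m0) ^ 4 * (Q * kill p (n-q) (\<lambda>_. 1) z)"
        by (rule block) (use q m0 in linarith)+
      also have "\<dots> \<le> C3 / sqrt (real m0) ^ 4 * (Q * (2 ^ 1 * (C1 * ?g) / ?sn ^ 1))"
      proof (intro mult_left_mono)
        have "kill p (n-q) (\<lambda>_. 1) z \<le> C1 * ?g / sqrt (real (n - q)) ^ 1"
          using C1(2)[OF q(6) z] by simp
        also have "\<dots> \<le> 2 ^ 1 * (C1 * ?g) / ?sn ^ 1"
          using q n C1(1) g by (intro div_sqrt_half_le) auto
        finally show "kill p (n-q) (\<lambda>_. 1) z \<le> 2 ^ 1 * (C1 * ?g) / ?sn ^ 1" .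
      qed (use Q(1) C3(1) in auto)
      finally have "\<bar>\<Sum>k=n-q..<(n-q) + (q-m0). kill p k (J (n - 1 - k)) z\<bar>
          \<le> KC * (?g / (?sn * sqrt (real m0) ^ 4))" by (simp add: KC_def mult_ac)
      moreover have "(n-q) + (q-m0) = n - m0" using q by linarith
      ultimately show ?thesis by metis
    qed

    have TD: "\<bar>\<Sum>k=n-m0..<n. kill p k (J (n - 1 - k)) z\<bar> \<le> KD * (real n * exp (- c * (a / sqrt (real m0))))"
    proof -
      let ?e = "exp (- c * (a / sqrt (real m0)))"
      have dev: "measure_pmf.prob (steps p m) {s. a / 2 \<le> \<bar>real_of_int (gap s)\<bar>} \<le> C4 * ?e"
        if m: "1 \<le> m" "m \<le> m0" for m
      proof -
        have "measure_pmf.prob (steps p m) {s. a / 2 \<le> \<bar>real_of_int (gap s)\<bar>} \<le> C4 * exp (- c4 * (a / 2 / sqrt (real m)))"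
          by (rule C4(3)[OF m(1)])
        also have "\<dots> \<le> C4 * ?e"
        proof -
          have "a / sqrt (real m0) \<le> a / sqrt (real m)"
            using m a by (intro divide_left_mono) auto
          then have "c * (a / sqrt (real m0)) \<le> c * (a / sqrt (real m))"
            by (rule mult_left_mono) (use nn(6) in simp)
          also have "\<dots> = c4 * (a / 2 / sqrt (real m))" by (simp add: c_def)
          finally show ?thesis using C4(2) by (intro mult_left_mono) auto
        qed
        finally show ?thesis .
      qed
      \<comment> \<open>From beyond the diagonal to \<open>w\<close> the gap must change by at least
        \<open>a\<close>. Either the exit jump itself changes it by \<open>a / 2\<close>, or the
        remaining fewer than \<open>m0\<close> steps do, both for \<open>w\<close> and for its
        mirror image. This explains \<open>c = c4 / 2\<close>.\<close>
      have Jsmall: "\<bar>J m y\<bar> \<le> KD * ?e" if m: "m < m0" and y: "gap y > 0" for m y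
      proof -
        define A where "A = {s. a / 2 \<le> \<bar>real_of_int (gap s)\<bar>}"
        have iA: "integrable (measure_pmf p) (indicat_real A)"
          by (rule integrable_pmf_bounded[where B=1]) (simp add: indicator_def)
        let ?F = "\<lambda>s. 2 * C4 * ?e + indicat_real A s"
        have "\<bar>J m y\<bar> \<le> measure_pmf.expectation p ?F"
          unfolding J_def
        proof (rule exit_op_abs_mono)
          show "integrable (measure_pmf p) ?F"
            by (rule Bochner_Integration.integrable_add[OF _ iA]) simp
          fix s
          show "0 \<le> ?F s" using C4(2) by simp
          assume ex: "gap (y + s) \<le> 0"
          show "\<bar>h m (y + s)\<bar> \<le> ?F s"
          proof (cases "real_of_int (gap (y + s)) \<le> - (a / 2)")
            case True
            have "gap s \<le> gap (y + s)" using y by (simp add: gap_add)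
            then have "real_of_int (gap s) \<le> - (a / 2)" using True by linarith
            then have "a / 2 \<le> \<bar>real_of_int (gap s)\<bar>" by linarith
            then have "indicat_real A s = 1" by (simp add: A_def)
            moreover have "0 \<le> 2 * C4 * ?e" using C4(2) by simp
            ultimately show ?thesis using h1[of m "y + s"] by linarith
          next
            case False
            let ?u = "w - (y + s)" and ?u' = "w - (y + s) + shear (gap (y + s))"
            have gu: "a / 2 \<le> \<bar>real_of_int (gap ?u)\<bar>"
              using ex a by simp
            have "gap (shear k) = 2 * k" for k by (simp add: gap_def shear_def)
            then have gu': "a / 2 \<le> \<bar>real_of_int (gap ?u')\<bar>"
              using False a ex by (simp add: gap_add[of "w - (y + s)"])
            have pz: "pmf (steps p m) u \<le> C4 * ?e" if u: "a / 2 \<le> \<bar>real_of_int (gap u)\<bar>" for u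
            proof (cases "m = 0")
              case True
              have "u \<noteq> 0" using u a by auto
              then show ?thesis using True C4(2) by simp
            next
              case False
              have "pmf (steps p m) u = measure_pmf.prob (steps p m) {u}" by (simp add: measure_pmf_single)
              also have "\<dots> \<le> measure_pmf.prob (steps p m) {s. a / 2 \<le> \<bar>real_of_int (gap s)\<bar>}"
                by (rule measure_pmf.finite_measure_mono) (use u in auto)
              also have "\<dots> \<le> C4 * ?e" using False m by (intro dev) auto
              finally show ?thesis .
            qed
            have "\<bar>h m (y + s)\<bar> \<le> pmf (steps p m) ?u + pmf (steps p m) ?u'"
              unfolding h using pmf_nonneg[of "steps p m" ?u] pmf_nonneg[of "steps p m" ?u'] by linarith
            also have "\<dots> \<le> C4 * ?e + C4 * ?e" by (intro add_mono pz gu gu')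
            finally have "\<bar>h m (y + s)\<bar> \<le> 2 * C4 * ?e" by simp
            moreover have "0 \<le> indicat_real A s" by simp
            ultimately show ?thesis by linarith
          qed
        qed
        \<comment> \<open>A single step has the law \<open>steps p 1\<close>, so the deviation bound
          also covers a long exit jump.\<close>
        also have "\<dots> = 2 * C4 * ?e + measure_pmf.prob (steps p 1) A"
          by (subst Bochner_Integration.integral_add[OF _ iA])
            (simp_all add: steps_1 del: steps.simps One_nat_def)
        also have "\<dots> \<le> 2 * C4 * ?e + C4 * ?e"
          unfolding A_def by (intro add_left_mono dev) (use m0 in auto)
        also have "\<dots> \<le> KD * ?e" using C4(2) by (simp add: KD_def)
        finally show ?thesis .
      qed
      have "\<bar>\<Sum>k=n-m0..<n. kill p k (J (n - 1 - k)) z\<bar> \<le> (\<Sum>k=n-m0..<n. \<bar>kill p k (J (n - 1 - k)) z\<bar>)"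
        by (rule sum_abs)
      also have "\<dots> \<le> (\<Sum>k=n-m0..<n. KD * ?e)"
      proof (rule sum_mono)
        fix k assume k: "k \<in> {n-m0..<n}"
        have "n - 1 - k < m0" using k m0 by auto
        then show "\<bar>kill p k (J (n - 1 - k)) z\<bar> \<le> KD * ?e"
          by (intro kill_abs_le z Jsmall)
      qed
      also have "\<dots> = real m0 * (KD * ?e)" using m0 by simp
      also have "\<dots> \<le> real n * (KD * ?e)" using m0 nn(4) by (intro mult_right_mono) auto
      finally show ?thesis by (simp add: mult_ac)
    qed

    \<comment> \<open>Completing the truncated overshoot sum to \<open>ren z\<close> costs survival
      of \<open>\<kappa>\<close> steps times the size of \<open>dk\<close>.\<close>
    have TT: "\<bar>dk * (ren z - ?g - (\<Sum>k<\<kappa>. kill p k over z))\<bar> \<le> KT * (?g / (sqrt (real \<kappa>) * ?sn ^ 4))"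
    proof -
      have "\<bar>dk * (ren z - ?g - (\<Sum>k<\<kappa>. kill p k over z))\<bar> = \<bar>dk\<bar> * \<bar>ren z - ?g - (\<Sum>k<\<kappa>. kill p k over z)\<bar>"
        by (rule abs_mult)
      also have "\<dots> \<le> (C2 / ?sn ^ 4) * (Q * kill p \<kappa> (\<lambda>_. 1) z)"
        using n C2(1) unfolding dk_def by (intro mult_mono C2(2) Q(5) z) auto
      also have "\<dots> \<le> (C2 / ?sn ^ 4) * (Q * (C1 * ?g / sqrt (real \<kappa>)))"
        using C1(2)[OF \<kappa>(1) z] Q(1) C2(1) by (intro mult_left_mono) auto
      finally show ?thesis by (simp add: KT_def mult_ac)
    qed

    have split: "(\<Sum>k<n. kill p k (J (n - 1 - k)) z) = (\<Sum>k<\<kappa>. kill p k (J (n - 1 - k)) z)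
        + (\<Sum>k=\<kappa>..<n-q. kill p k (J (n - 1 - k)) z) + (\<Sum>k=n-q..<n-m0. kill p k (J (n - 1 - k)) z)
        + (\<Sum>k=n-m0..<n. kill p k (J (n - 1 - k)) z)"
      using q m0 \<kappa> unfolding lessThan_atLeast0 by (simp add: sum.atLeastLessThan_concat)
    have "kill p n (indicator {w}) z - ren z * dk = (h n z - ?g * dk)
        - (\<Sum>k<\<kappa>. kill p k (J (n - 1 - k)) z + dk * kill p k over z)
        - (\<Sum>k=\<kappa>..<n-q. kill p k (J (n - 1 - k)) z) - (\<Sum>k=n-q..<n-m0. kill p k (J (n - 1 - k)) z)
        - (\<Sum>k=n-m0..<n. kill p k (J (n - 1 - k)) z)
        - dk * (ren z - ?g - (\<Sum>k<\<kappa>. kill p k over z))"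
      unfolding expand split by (simp add: sum.distrib sum_distrib_left algebra_simps)
    moreover have tri: "\<bar>x0 - x1 - x2 - x3 - x4 - x5\<bar> \<le> \<bar>x0\<bar> + \<bar>x1\<bar> + \<bar>x2\<bar> + \<bar>x3\<bar> + \<bar>x4\<bar> + \<bar>x5\<bar>"
      for x0 x1 x2 x3 x4 x5 :: real by linarith
    ultimately have "\<bar>kill p n (indicator {w}) z - ren z * dk\<bar> \<le> 2 * C3 * (?g * (nrm z + 1) / ?sn ^ 5)
        + KA * (real \<kappa> * (nrm z + real \<kappa>) / ?sn ^ 5)
        + KB * (?g / (sqrt (real \<kappa>) * ?sn ^ 4))
        + KC * (?g / (?sn * sqrt (real m0) ^ 4))
        + KD * (real n * exp (- c * (a / sqrt (real m0))))
        + KT * (?g / (sqrt (real \<kappa>) * ?sn ^ 4))"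
      using order_trans[OF tri add_mono[OF add_mono[OF add_mono[OF add_mono[OF add_mono[OF T0 TA] TB] TC] TD] TT]]
      by simp
    then show ?thesis unfolding dk_def[symmetric] distrib_right[of KB KT] by linarith
  qed
  show thesis
  proof (rule that[of C c])
    show "0 \<le> C" using nn C3(1) by (simp add: C_def)
    show "0 < c" by (rule nn)
    fix n \<kappa> m0 :: nat and a :: real and z w :: point
    assume *: "2 \<le> n" "1 \<le> \<kappa>" "2 * \<kappa> \<le> n" "1 \<le> m0" "2 * m0 \<le> n" "gap z > 0" "0 < a" "a \<le> real_of_int (gap w)"
    let ?g = "real_of_int (gap z)"
    define x1 where "x1 = ?g * (nrm z + 1) / sqrt (real n) ^ 5"
    define x2 where "x2 = real \<kappa> * (nrm z + real \<kappa>) / sqrt (real n) ^ 5"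
    define x3 where "x3 = ?g / (sqrt (real \<kappa>) * sqrt (real n) ^ 4)"
    define x4 where "x4 = ?g / (sqrt (real n) * sqrt (real m0) ^ 4)"
    define x5 where "x5 = real n * exp (- c * (a / sqrt (real m0)))"
    have x: "0 \<le> x1" "0 \<le> x2" "0 \<le> x3" "0 \<le> x4" "0 \<le> x5"
      using * by (auto simp: x1_def x2_def x3_def x4_def x5_def)
    have le: "2 * C3 \<le> C" "KA \<le> C" "KB + KT \<le> C" "KC \<le> C" "KD \<le> C" using nn C3(1) by (auto simp: C_def)
    have "\<bar>kill p n (indicator {w}) z - ren z * dker n w\<bar>
        \<le> 2 * C3 * x1 + KA * x2 + (KB + KT) * x3 + KC * x4 + KD * x5"
      unfolding x1_def x2_def x3_def x4_def x5_def using * by (intro main) auto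
    also have "\<dots> \<le> C * x1 + C * x2 + C * x3 + C * x4 + C * x5"
      by (intro add_mono mult_right_mono le x)
    also have "\<dots> = C * (x1 + x2 + x3 + x4 + x5)" by (simp add: algebra_simps)
    finally show "\<bar>kill p n (indicator {w}) z - ren z * dker n w\<bar>
        \<le> C * (?g * (nrm z + 1) / sqrt (real n) ^ 5
          + real \<kappa> * (nrm z + real \<kappa>) / sqrt (real n) ^ 5
          + ?g / (sqrt (real \<kappa>) * sqrt (real n) ^ 4)
          + ?g / (sqrt (real n) * sqrt (real m0) ^ 4)
          + real n * exp (- c * (a / sqrt (real m0))))"
      unfolding x1_def x2_def x3_def x4_def x5_def .
  qed
qed

end

lemma kill_expectation:
  fixes G :: "'a \<Rightarrow> point \<Rightarrow> real"
  assumes B: "\<And>s u. \<bar>G s u\<bar> \<le> B" and z: "gap z > 0"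
  shows "kill p n (\<lambda>u. measure_pmf.expectation q (\<lambda>s. G s u)) z = measure_pmf.expectation q (\<lambda>s. kill p n (G s) z)"
  using z
proof (induction n arbitrary: z)
  case (Suc n)
  have B0: "0 \<le> B" using B order_trans[OF abs_ge_zero] by blast
  have "kill p (Suc n) (\<lambda>u. measure_pmf.expectation q (\<lambda>s. G s u)) z
    = measure_pmf.expectation p (\<lambda>t. measure_pmf.expectation q
        (\<lambda>s. if gap (z + t) > 0 then kill p n (G s) (z + t) else 0))"
    unfolding kill.simps by (rule Bochner_Integration.integral_cong) (auto simp: Suc.IH)
  also have "\<dots> = measure_pmf.expectation q (\<lambda>s. measure_pmf.expectation p
        (\<lambda>t. if gap (z + t) > 0 then kill p n (G s) (z + t) else 0))"
  proof (rule expectation_commute_pmf)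
    fix t s
    show "\<bar>if gap (z + t) > 0 then kill p n (G s) (z + t) else 0\<bar> \<le> B"
      using kill_abs_le[of "G s" B "z + t" p n] B B0 by simp
  qed
  finally show ?case by simp
qed simp

lemma kill_translate:
  assumes "gap c = 0"
  shows "kill p n (indicator {w + c}) (z + c) = kill p n (indicator {w}) z"
proof (induction n arbitrary: z)
  case (Suc n)
  have "(if gap (z + c + s) > 0 then kill p n (indicator {w + c}) (z + c + s) else 0)
      = (if gap (z + s) > 0 then kill p n (indicator {w}) (z + s) else 0)" for s
  proof -
    have "z + c + s = (z + s) + c" by (simp add: ac_simps)
    moreover have "gap ((z + s) + c) = gap (z + s)" using assms gap_add[of "z + s" c] by simp
    ultimately show ?thesis using Suc[of "z + s"] by (simp only:)
  qed
  then show ?case by (simp only: kill.simps)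
qed (simp add: indicator_def)

definition time_flip :: "int \<Rightarrow> point \<Rightarrow> point" where
  "time_flip N z = (N - fst z, snd z)"

lemma gap_time_flip [simp]: "gap (time_flip N z) = gap z"
  by (simp add: time_flip_def gap_def)

lemma mirror_time_flip: "mirror (time_flip N z) = time_flip N (mirror z)"
  by (simp add: time_flip_def mirror_def)

context cone_walk
begin

subsection \<open>Reversal and convolution\<close>

text \<open>A reversed path has steps \<open>- s\<close>; flipping the sign of time turns them into
  steps with only the space part negated, which \<open>neg_sym\<close> identifies in law with
  \<open>s\<close>. The induction peels the last step on the left and the first on the right. Both
  ends must have positive gap, because \<open>kill\<close> tests the end but not the start.\<close>

lemma kill_time_flip_0:
  assumes y: "gap y > 0" and w: "gap w > 0"
  shows "kill p n (indicator {w}) y = kill p n (indicator {time_flip 0 y}) (time_flip 0 w)"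
  using w
proof (induction n arbitrary: w)
  case 0
  have "y = w \<longleftrightarrow> time_flip 0 w = time_flip 0 y" by (auto simp: time_flip_def prod_eq_iff)
  then show ?case by (simp add: indicator_def)
next
  case (Suc n)
  \<comment> \<open>\<open>w - s\<close> is the position before the last step \<open>s\<close>,
    which must itself have survived.\<close>
  define G where "G s = (\<lambda>u. if gap (w - s) > 0 then indicat_real {w - s} u else 0)" for s
  have "kill p (Suc n) (indicator {w}) y = kill p n (kill p 1 (indicator {w})) y"
    using kill_add_time[of p n 1] by simp
  also have "\<dots> = kill p n (\<lambda>u. measure_pmf.expectation p (\<lambda>s. G s u)) y"
  proof (rule kill_cong[OF _ y])
    fix u assume u: "gap u > 0"
    have "(if gap (u + s) > 0 then indicat_real {w} (u + s) else 0) = G s u" for s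
    proof (cases "u = w - s")
      case True
      then show ?thesis using Suc.prems u by (simp add: G_def)
    next
      case False
      then have "u + s \<noteq> w" by auto
      then show ?thesis using False by (simp add: G_def)
    qed
    then show "kill p 1 (indicator {w}) u = measure_pmf.expectation p (\<lambda>s. G s u)"
      by (simp only: One_nat_def kill.simps)
  qed
  also have "\<dots> = measure_pmf.expectation p (\<lambda>s. kill p n (G s) y)"
    by (rule kill_expectation[where B=1, OF _ y]) (simp add: G_def indicator_def)
  also have "\<dots> = measure_pmf.expectation p
      (\<lambda>s. if gap (w - s) > 0 then kill p n (indicator {time_flip 0 y}) (time_flip 0 (w - s)) else 0)"
    by (rule Bochner_Integration.integral_cong) (auto simp: G_def Suc.IH simp del: gap_diff split_paired_All)
  also have "\<dots> = measure_pmf.expectation (map_pmf (\<lambda>z. (fst z, - fst (snd z), - snd (snd z))) p)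
      (\<lambda>s. if gap (time_flip 0 w + s) > 0 then kill p n (indicator {time_flip 0 y}) (time_flip 0 w + s) else 0)"
  proof -
    have tf: "time_flip 0 (w - s) = time_flip 0 w + (fst s, - fst (snd s), - snd (snd s))" for s
      by (simp add: time_flip_def prod_eq_iff)
    have gp: "gap (w - s) = gap (time_flip 0 w + (fst s, - fst (snd s), - snd (snd s)))" for s
      using gap_time_flip[of 0 "w - s"] unfolding tf by simp
    show ?thesis unfolding integral_map_pmf gp tf ..
  qed
  also have "\<dots> = kill p (Suc n) (indicator {time_flip 0 y}) (time_flip 0 w)"
    unfolding neg_sym by simp
  finally show ?case .
qed

lemma kill_reverse:
  assumes "gap y > 0" "gap w > 0"
  shows "kill p n (indicator {w}) y = kill p n (indicator {time_flip N y}) (time_flip N w)"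
proof -
  have "time_flip N z = time_flip 0 z + (N, 0, 0)" for z by (simp add: time_flip_def prod_eq_iff)
  moreover have "gap (N, 0, 0) = 0" by (simp add: gap_def)
  ultimately show ?thesis
    using kill_time_flip_0[OF assms, of n] kill_translate[of "(N, 0, 0)" p n] by simp
qed

lemma steps_add: "steps p (m + n) = bind_pmf (steps p m) (\<lambda>s. map_pmf ((+) s) (steps p n))"
proof (induction m)
  case 0
  have "(+) (0::point) = id" by (rule ext) simp
  then show ?case by (simp add: bind_return_pmf pmf.map_id0)
next
  case (Suc m)
  have "(+) (a + b) = (\<lambda>x. a + (b + x))" for a b :: point
    by (rule ext) (simp add: add.assoc)
  then show ?case
    by (simp add: Suc bind_assoc_pmf map_bind_pmf bind_map_pmf map_pmf_comp)
qed

lemma convolution_le: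
  assumes A: "finite A"
  shows "\<bar>pmf (steps p (m + n)) x - (\<Sum>u\<in>A. pmf (steps p m) u * pmf (steps p n) (x - u))\<bar>
    \<le> measure_pmf.prob (steps p m) (- A)"
proof -
  let ?f = "\<lambda>u. pmf (steps p n) (x - u)"
  have shift: "pmf (map_pmf ((+) u) (steps p n)) x = ?f u" for u
  proof -
    have "inj ((+) u)" by (simp add: inj_def)
    from pmf_map_inj'[OF this, of "steps p n" "x - u"] show ?thesis by simp
  qed
  have "pmf (steps p (m + n)) x = measure_pmf.expectation (steps p m) ?f"
    unfolding steps_add pmf_bind shift ..
  also have "\<dots> = measure_pmf.expectation (steps p m) (\<lambda>u. ?f u * indicator A u + ?f u * indicator (- A) u)"
    by (rule Bochner_Integration.integral_cong) (auto simp: indicator_def)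
  also have "\<dots> = measure_pmf.expectation (steps p m) (\<lambda>u. ?f u * indicator A u)
      + measure_pmf.expectation (steps p m) (\<lambda>u. ?f u * indicator (- A) u)"
    by (rule Bochner_Integration.integral_add; rule integrable_pmf_bounded[where B=1])
      (simp_all add: indicator_def pmf_le_1)
  also have "measure_pmf.expectation (steps p m) (\<lambda>u. ?f u * indicator A u) = (\<Sum>u\<in>A. ?f u * indicator A u * pmf (steps p m) u)"
    by (rule integral_measure_pmf_real[OF A]) (auto simp: indicator_def split: if_splits)
  also have "\<dots> = (\<Sum>u\<in>A. pmf (steps p m) u * pmf (steps p n) (x - u))"
    by (rule sum.cong) (auto simp: indicator_def)
  finally have "pmf (steps p (m + n)) x - (\<Sum>u\<in>A. pmf (steps p m) u * pmf (steps p n) (x - u))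
      = measure_pmf.expectation (steps p m) (\<lambda>u. ?f u * indicator (- A) u)" by simp
  moreover have "0 \<le> measure_pmf.expectation (steps p m) (\<lambda>u. ?f u * indicator (- A) u)"
    by (rule integral_nonneg_AE) simp
  moreover have "measure_pmf.expectation (steps p m) (\<lambda>u. ?f u * indicator (- A) u)
      \<le> measure_pmf.expectation (steps p m) (\<lambda>u. indicator (- A) u)"
  proof (rule integral_mono')
    show "integrable (measure_pmf (steps p m)) (indicat_real (- A))"
      by (rule integrable_pmf_bounded[where B=1]) (simp add: indicator_def)
  qed (simp_all add: indicator_def pmf_le_1)
  ultimately show ?thesis by simp
qed

text \<open>Up to a factor, the convolution of two kernels \<open>dker\<close> at total time \<open>N\<close>.\<close>

definition curv :: "nat \<Rightarrow> int \<Rightarrow> real" where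
  "curv n N = pmf (steps p n) (N, 0, 0)
    - (pmf (steps p n) (N, 2, - 2) + pmf (steps p n) (N, - 2, 2)) / 2"

lemma finite_centred_box [simp]: "finite (centred_box n R)"
proof -
  let ?a = "\<lfloor>real n * drift - R\<rfloor>" and ?b = "\<lceil>real n * drift + R\<rceil>" and ?r = "\<lceil>R\<rceil>"
  have "centred_box n R \<subseteq> {?a..?b} \<times> {-?r..?r} \<times> {-?r..?r}"
  proof
    fix s assume "s \<in> centred_box n R"
    then show "s \<in> {?a..?b} \<times> {-?r..?r} \<times> {-?r..?r}"
      unfolding centred_box_def mem_Collect_eq mem_Times_iff atLeastAtMost_iff by linarith
  qed
  then show ?thesis by (rule finite_subset) simp
qed

lemma card_int_interval_le:
  assumes "A \<subseteq> {i::int. a < real_of_int i \<and> real_of_int i < b}" "a \<le> b"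
  shows "real (card A) \<le> b - a + 1"
proof -
  have sub: "A \<subseteq> {\<lfloor>a\<rfloor> + 1..\<lceil>b\<rceil> - 1}"
  proof
    fix i assume "i \<in> A"
    with assms(1) have "a < real_of_int i" "real_of_int i < b" by auto
    then show "i \<in> {\<lfloor>a\<rfloor> + 1..\<lceil>b\<rceil> - 1}" by (simp; linarith)
  qed
  have "real (card A) \<le> real (card {\<lfloor>a\<rfloor> + 1..\<lceil>b\<rceil> - 1})"
    using card_mono[OF _ sub] by simp
  also have "\<dots> = real (nat (\<lceil>b\<rceil> - 1 - \<lfloor>a\<rfloor>))" by simp
  also have "\<dots> \<le> b - a + 1" using assms(2) by linarith
  finally show ?thesis .
qed

text \<open>In the coordinates time, first space coordinate and gap, the strip is contained in a box
  with one short side.\<close>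

lemma card_strip_le:
  assumes R: "0 \<le> R" and a: "0 \<le> a"
  shows "real (card {s \<in> centred_box n R. 0 < gap s \<and> real_of_int (gap s) < a}) \<le> (2 * R + 1)\<^sup>2 * (a + 1)"
proof -
  let ?S = "{s \<in> centred_box n R. 0 < gap s \<and> real_of_int (gap s) < a}"
  let ?f = "\<lambda>s::point. (fst s, fst (snd s), gap s)"
  let ?A = "{i. real n * drift - R < real_of_int i \<and> real_of_int i < real n * drift + R}"
  let ?B = "{i. - R < real_of_int i \<and> real_of_int i < R}"
  let ?C = "{i. 0 < real_of_int i \<and> real_of_int i < a}"
  have fin: "finite {i::int. c < real_of_int i \<and> real_of_int i < d}" for c d
  proof -
    have "{i::int. c < real_of_int i \<and> real_of_int i < d} \<subseteq> {\<lfloor>c\<rfloor>..\<lceil>d\<rceil>}" by (auto; linarith)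
    then show ?thesis by (rule finite_subset) simp
  qed
  have "inj_on ?f ?S" by (rule inj_onI) (auto simp: gap_def)
  then have "card ?S = card (?f ` ?S)" by (rule card_image[symmetric])
  also have "\<dots> \<le> card (?A \<times> ?B \<times> ?C)"
  proof (rule card_mono)
    show "finite (?A \<times> ?B \<times> ?C)" by (intro finite_cartesian_product fin)
    show "?f ` ?S \<subseteq> ?A \<times> ?B \<times> ?C"
      by (auto simp: centred_box_def abs_less_iff)
  qed
  also have "\<dots> = card ?A * (card ?B * card ?C)" by (simp add: card_cartesian_product)
  finally have "card ?S \<le> card ?A * (card ?B * card ?C)" .
  then have "real (card ?S) \<le> real (card ?A * (card ?B * card ?C))" by (rule of_nat_mono)
  also have "\<dots> = real (card ?A) * (real (card ?B) * real (card ?C))" by (simp only: of_nat_mult)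
  also have "\<dots> \<le> (2 * R + 1) * ((2 * R + 1) * (a + 1))"
  proof -
    have A: "real (card ?A) \<le> 2 * R + 1"
      using card_int_interval_le[of ?A "real n * drift - R" "real n * drift + R"] R by simp
    have B: "real (card ?B) \<le> 2 * R + 1" using card_int_interval_le[of ?B "- R" R] R by simp
    have C: "real (card ?C) \<le> a + 1" using card_int_interval_le[of ?C 0 a] a by simp
    show ?thesis using R a by (intro mult_mono A B C) auto
  qed
  finally show ?thesis by (simp add: power2_eq_square mult.assoc)
qed

lemma card_centred_box_le:
  assumes R: "0 \<le> R"
  shows "real (card (centred_box n R)) \<le> (2 * R + 1) ^ 3"
proof -
  let ?A = "{i. real n * drift - R < real_of_int i \<and> real_of_int i < real n * drift + R}"
  let ?B = "{i. - R < real_of_int i \<and> real_of_int i < R}"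
  have fin: "finite {i::int. c < real_of_int i \<and> real_of_int i < d}" for c d
  proof -
    have "{i::int. c < real_of_int i \<and> real_of_int i < d} \<subseteq> {\<lfloor>c\<rfloor>..\<lceil>d\<rceil>}" by (auto; linarith)
    then show ?thesis by (rule finite_subset) simp
  qed
  have "card (centred_box n R) \<le> card (?A \<times> ?B \<times> ?B)"
  proof (rule card_mono)
    show "finite (?A \<times> ?B \<times> ?B)" by (intro finite_cartesian_product fin)
    show "centred_box n R \<subseteq> ?A \<times> ?B \<times> ?B" by (auto simp: centred_box_def abs_less_iff)
  qed
  also have "\<dots> = card ?A * (card ?B * card ?B)" by (simp add: card_cartesian_product)
  finally have "card (centred_box n R) \<le> card ?A * (card ?B * card ?B)" .
  then have "real (card (centred_box n R)) \<le> real (card ?A * (card ?B * card ?B))" by (rule of_nat_mono)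
  also have "\<dots> = real (card ?A) * (real (card ?B) * real (card ?B))" by (simp only: of_nat_mult)
  also have "\<dots> \<le> (2 * R + 1) * ((2 * R + 1) * (2 * R + 1))"
  proof -
    have A: "real (card ?A) \<le> 2 * R + 1"
      using card_int_interval_le[of ?A "real n * drift - R" "real n * drift + R"] R by simp
    have B: "real (card ?B) \<le> 2 * R + 1" using card_int_interval_le[of ?B "- R" R] R by simp
    show ?thesis using R by (intro mult_mono A B) auto
  qed
  finally show ?thesis by (simp add: power3_eq_cube mult.assoc)
qed

lemma mirror_centred_box: "mirror w \<in> centred_box n R \<longleftrightarrow> w \<in> centred_box n R"
  by (auto simp: centred_box_def mirror_def)

lemma mirror_shear: "mirror (shear k) = - shear k"
  by (simp add: mirror_def shear_def)

lemma dker_mirror: "dker n (mirror w) = - dker n w"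
proof -
  have "mirror w - shear 1 = mirror (w + shear 1)" "mirror w + shear 1 = mirror (w - shear 1)"
    by (simp_all add: mirror_add mirror_diff mirror_shear)
  then have eq: "dker n (mirror w) = (pmf (steps p n) (w + shear 1) - pmf (steps p n) (w - shear 1)) / 2"
    by (simp only: dker_def pmf_steps_mirror)
  show ?thesis unfolding eq dker_def[of n w] by (simp add: diff_divide_distrib)
qed

text \<open>Negating space turns the flipped argument into \<open>(N, 0, 0) - w\<close>, the form
  needed for a convolution; the two shifts exchange their roles.\<close>

lemma dker_time_flip:
  "dker n (time_flip N w) = (pmf (steps p n) ((N, 0, 0) - w + shear 1) - pmf (steps p n) ((N, 0, 0) - w - shear 1)) / 2"
proof -
  obtain t v x where w: "w = (t, v, x)" by (cases w)
  have "(N, 0, 0) - w + shear 1 = (N - t, - v - 1, 1 - x)" "(N, 0, 0) - w - shear 1 = (N - t, 1 - v, - x - 1)"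
    "time_flip N w - shear 1 = (N - t, - (- v - 1), - (1 - x))" "time_flip N w + shear 1 = (N - t, - (1 - v), - (- x - 1))"
    by (simp_all add: shear_def time_flip_def w)
  then show ?thesis by (simp only: dker_def pmf_steps_neg)
qed

text \<open>The product of the two kernels is symmetric under \<open>mirror\<close> and vanishes on the diagonal, so
  the half-space sum is half of a sum over the whole lattice, which is a convolution.\<close>

lemma half_space_sum:
  assumes R: "1 \<le> R"
  shows "\<bar>(\<Sum>w\<in>{w \<in> centred_box m R. gap w > 0}. dker m w * dker n (time_flip N w)) - curv (m + n) N / 4\<bar>
    \<le> measure_pmf.prob (steps p m) (- centred_box m (R - 1))"
proof -
  let ?B = "centred_box m R" and ?e = "(N, 0, 0) :: point"
  let ?F = "\<lambda>w. dker m w * dker n (time_flip N w)"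
  let ?T = "measure_pmf.prob (steps p m) (- centred_box m (R - 1))"
  let ?p = "pmf (steps p m)" and ?q = "pmf (steps p n)" and ?r = "pmf (steps p (m + n))"
  let ?P = "{w \<in> ?B. gap w > 0}" and ?M = "{w \<in> ?B. gap w < 0}" and ?Z = "{w \<in> ?B. gap w = 0}"
  have Z: "sum ?F ?Z = 0"
  proof (intro sum.neutral ballI)
    fix w assume "w \<in> ?Z"
    then have "mirror w = w" by (simp add: mirror_eq_shear shear_def zero_prod_def[symmetric])
    then show "?F w = 0" using dker_mirror[of m w] by simp
  qed
  have M: "sum ?F ?M = sum ?F ?P"
  proof (rule sum.reindex_bij_witness[of _ mirror mirror])
    fix w
    show "mirror (mirror w) = w" "mirror (mirror w) = w" by simp_all
    show "w \<in> ?M \<Longrightarrow> mirror w \<in> ?P" "w \<in> ?P \<Longrightarrow> mirror w \<in> ?M" by (simp_all add: mirror_centred_box)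
    show "?F (mirror w) = ?F w" by (simp add: dker_mirror flip: mirror_time_flip)
  qed
  have "?B = ?P \<union> (?M \<union> ?Z)" by (auto simp del: split_paired_All)
  then have "sum ?F ?B = sum ?F (?P \<union> (?M \<union> ?Z))" by simp
  also have "\<dots> = sum ?F ?P + (sum ?F ?M + sum ?F ?Z)"
    by (subst sum.union_disjoint; (subst sum.union_disjoint)?) (auto simp del: split_paired_All)
  finally have half: "sum ?F ?P = sum ?F ?B / 2" unfolding Z M by simp
  \<comment> \<open>Shifting by \<open>shear 1\<close> moves each space coordinate by one unit,
    hence the tail outside the box of radius \<open>R - 1\<close>.\<close>
  have conv: "\<bar>?r (?e + b - a) - (\<Sum>w\<in>?B. ?p (w - a) * ?q (?e - w + b))\<bar> \<le> ?T"
    if a: "a = shear 1 \<or> a = - shear 1" for a b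
  proof -
    let ?A = "(\<lambda>w. w - a) ` ?B"
    have "\<bar>?r (?e + b - a) - (\<Sum>u\<in>?A. ?p u * ?q (?e + b - a - u))\<bar> \<le> measure_pmf.prob (steps p m) (- ?A)"
      by (rule convolution_le) simp
    also have "(\<Sum>u\<in>?A. ?p u * ?q (?e + b - a - u)) = (\<Sum>w\<in>?B. ?p (w - a) * ?q (?e - w + b))"
      by (subst sum.reindex) (auto simp: inj_on_def algebra_simps)
    also have "measure_pmf.prob (steps p m) (- ?A) \<le> ?T"
    proof (rule measure_pmf.finite_measure_mono)
      have "u \<in> ?A" if "u \<in> centred_box m (R - 1)" for u
      proof -
        have "u + a \<in> ?B" using that a by (auto simp: centred_box_def shear_def)
        then show ?thesis by (metis add_diff_cancel_right' imageI)
      qed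
      then show "- ?A \<subseteq> - centred_box m (R - 1)" by blast
    qed simp
    finally show ?thesis .
  qed
  define s where "s = shear 1"
  let ?s1 = "\<Sum>w\<in>?B. ?p (w - s) * ?q (?e - w + s)" and ?s2 = "\<Sum>w\<in>?B. ?p (w - s) * ?q (?e - w - s)"
  let ?s3 = "\<Sum>w\<in>?B. ?p (w + s) * ?q (?e - w + s)" and ?s4 = "\<Sum>w\<in>?B. ?p (w + s) * ?q (?e - w - s)"
  \<comment> \<open>The product of two centred differences gives four convolutions. Two end at
    \<open>(N, 0, 0)\<close>, the others at the two points displaced by 2 across the diagonal. Two
    factors 1/2 from \<open>dker\<close> and one from the half-space make 1/8, and
    \<open>curv\<close> over 4 is the same combination.\<close>
  have "sum ?F ?B = (\<Sum>w\<in>?B. (?p (w - s) * ?q (?e - w + s) - ?p (w - s) * ?q (?e - w - s)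
      - ?p (w + s) * ?q (?e - w + s) + ?p (w + s) * ?q (?e - w - s)) / 4)"
    by (rule sum.cong) (simp_all add: dker_def[of m] dker_time_flip s_def field_simps)
  also have "\<dots> = (?s1 - ?s2 - ?s3 + ?s4) / 4"
    by (simp add: sum_divide_distrib[symmetric] sum.distrib sum_subtractf)
  finally have F: "sum ?F ?B = (?s1 - ?s2 - ?s3 + ?s4) / 4" .
  have e: "?e + s - s = ?e" "?e + (- s) - (- s) = ?e" "?e + (- s) - s = (N, 2, - 2)" "?e + s - (- s) = (N, - 2, 2)"
    by (simp_all add: s_def shear_def zero_prod_def)
  have "\<bar>?r ?e - ?s1\<bar> \<le> ?T" "\<bar>?r (N, 2, - 2) - ?s2\<bar> \<le> ?T" "\<bar>?r (N, - 2, 2) - ?s3\<bar> \<le> ?T" "\<bar>?r ?e - ?s4\<bar> \<le> ?T"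
    using conv[of s s] conv[of s "- s"] conv[of "- s" s] conv[of "- s" "- s"] unfolding e by (simp_all add: s_def)
  moreover have lin: "\<bar>(x1 - x2 - x3 + x4) / 8 - (y1 + y1 - y2 - y3) / 8\<bar> \<le> t"
    if "\<bar>y1 - x1\<bar> \<le> t" "\<bar>y2 - x2\<bar> \<le> t" "\<bar>y3 - x3\<bar> \<le> t" "\<bar>y1 - x4\<bar> \<le> t"
    for x1 x2 x3 x4 y1 y2 y3 t :: real
    using that unfolding add_divide_distrib diff_divide_distrib by linarith
  ultimately have "\<bar>(?s1 - ?s2 - ?s3 + ?s4) / 8 - (?r ?e + ?r ?e - ?r (N, 2, - 2) - ?r (N, - 2, 2)) / 8\<bar> \<le> ?T"
    by (intro lin)
  moreover have "x / 4 / 2 - (y1 - (y2 + y3) / 2) / 4 = x / 8 - (y1 + y1 - y2 - y3) / 8" for x y1 y2 y3 :: real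
    by (simp add: add_divide_distrib diff_divide_distrib)
  ultimately have *: "\<bar>(?s1 - ?s2 - ?s3 + ?s4) / 4 / 2 - (?r ?e - (?r (N, 2, - 2) + ?r (N, - 2, 2)) / 2) / 4\<bar> \<le> ?T"
    by metis
  show ?thesis unfolding half F curv_def by (rule *)
qed

text \<open>The path is cut after \<open>m1\<close> steps and its second part reversed. The three
  errors come from intermediate points away from the diagonal, where both factors are approximated;
  from the strip, where exact and approximate products are bounded separately by \<open>M\<close>
  squared; and from leaving the box, both for the walk and for the convolution.\<close>

lemma two_sided:
  fixes z z2 :: point and N :: int
  assumes n: "n = m1 + m2" and z: "gap z > 0" and z2: "gap z2 > 0" and z20: "fst z2 = 0"
    and R: "2 \<le> R" "nrm z \<le> R / 2" and a: "0 \<le> a"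
    and M: "\<And>w. gap w > 0 \<Longrightarrow> kill p m1 (indicator {w}) z \<le> M" "\<And>w. \<bar>ren z * dker m1 w\<bar> \<le> M"
    and M2: "\<And>w. gap w > 0 \<Longrightarrow> kill p m2 (indicator {w}) z2 \<le> M" "\<And>w. \<bar>ren z2 * dker m2 w\<bar> \<le> M"
    and \<epsilon>: "\<And>w. a \<le> real_of_int (gap w) \<Longrightarrow> gap w > 0 \<Longrightarrow> \<bar>kill p m1 (indicator {w}) z - ren z * dker m1 w\<bar> \<le> \<epsilon>"
    and \<epsilon>2: "\<And>w. a \<le> real_of_int (gap w) \<Longrightarrow> gap w > 0 \<Longrightarrow> \<bar>kill p m2 (indicator {w}) z2 - ren z2 * dker m2 w\<bar> \<le> \<epsilon>"
  shows "\<bar>kill p n (indicator {time_flip N z2}) z - ren z * ren z2 * (curv n N / 4)\<bar>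
    \<le> (2 * R + 1) ^ 3 * (2 * M * \<epsilon>) + (2 * R + 1)\<^sup>2 * (a + 1) * (2 * M\<^sup>2)
      + (1 + \<bar>ren z * ren z2\<bar>) * measure_pmf.prob (steps p m1) (- centred_box m1 (R / 2))"
proof -
  let ?B = "centred_box m1 R" and ?z' = "time_flip N z2"
  let ?T = "measure_pmf.prob (steps p m1) (- centred_box m1 (R / 2))"
  let ?P = "{w \<in> ?B. gap w > 0}"
  define G where "G = {w \<in> ?B. gap w > 0 \<and> a \<le> real_of_int (gap w)}"
  define S where "S = {w \<in> ?B. 0 < gap w \<and> real_of_int (gap w) < a}"
  define X where "X w = kill p m1 (indicator {w}) z" for w
  define Y where "Y w = kill p m2 (indicator {?z'}) w" for w
  define A where "A w = ren z * dker m1 w" for w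
  define A2 where "A2 w = ren z2 * dker m2 (time_flip N w)" for w
  have M0: "0 \<le> M" using M(2)[of 0] by (rule order_trans[OF abs_ge_zero])
  have gz': "gap ?z' > 0" using z2 by simp
  have Yr: "Y w = kill p m2 (indicator {time_flip N w}) z2" if "gap w > 0" for w
  proof -
    have "time_flip N ?z' = z2" by (simp add: time_flip_def)
    then show ?thesis unfolding Y_def using kill_reverse[OF that gz', of m2 N] by simp
  qed
  have X: "0 \<le> X w" "X w \<le> M" "\<bar>A w\<bar> \<le> M" "0 \<le> Y w" "Y w \<le> M" "\<bar>A2 w\<bar> \<le> M" "Y w \<le> 1" if w: "gap w > 0" for w
  proof -
    show "0 \<le> X w" unfolding X_def by (rule kill_nonneg) (use z in auto)
    show "0 \<le> Y w" unfolding Y_def by (rule kill_nonneg) (use w in auto)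
    show "X w \<le> M" unfolding X_def by (rule M(1)[OF w])
    show "Y w \<le> M" unfolding Yr[OF w] by (rule M2(1)) (use w in simp)
    show "\<bar>A w\<bar> \<le> M" unfolding A_def by (rule M(2))
    show "\<bar>A2 w\<bar> \<le> M" unfolding A2_def by (rule M2(2))
    have "\<bar>Y w\<bar> \<le> 1" unfolding Y_def by (rule kill_abs_le[OF _ w]) (simp add: indicator_def)
    then show "Y w \<le> 1" by simp
  qed
  have e: "\<bar>X w - A w\<bar> \<le> \<epsilon>" "\<bar>Y w - A2 w\<bar> \<le> \<epsilon>" if w: "gap w > 0" "a \<le> real_of_int (gap w)" for w
    unfolding X_def A_def A2_def Yr[OF w(1)] using w by (auto intro: \<epsilon> \<epsilon>2)
  have BY: "bounded_pos (\<lambda>w. Y w * indicator D w)" for D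
    by (rule bounded_posI[where B=1]) (use X(4,7) in \<open>simp add: indicator_def\<close>)
  have "kill p n (indicator {?z'}) z = kill p m1 Y z"
    unfolding n kill_add_time Y_def[abs_def] ..
  also have "\<dots> = kill p m1 (\<lambda>w. Y w * indicator ?P w + Y w * indicator (- ?B) w) z"
    by (rule kill_cong[OF _ z]) (simp add: indicator_def)
  also have "\<dots> = kill p m1 (\<lambda>w. Y w * indicator ?P w) z + kill p m1 (\<lambda>w. Y w * indicator (- ?B) w) z"
    by (rule kill_add[OF BY BY])
  also have "kill p m1 (\<lambda>w. Y w * indicator ?P w) z = (\<Sum>w\<in>?P. Y w * indicator ?P w * kill p m1 (indicator {w}) z)"
    by (rule kill_finite_support[OF _ z]) (simp_all add: indicator_def)
  also have "\<dots> = (\<Sum>w\<in>?P. X w * Y w)"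
    by (rule sum.cong) (simp_all add: X_def indicator_def)
  finally have main: "kill p n (indicator {?z'}) z = (\<Sum>w\<in>?P. X w * Y w) + kill p m1 (\<lambda>w. Y w * indicator (- ?B) w) z" .
  have out: "\<bar>kill p m1 (\<lambda>w. Y w * indicator (- ?B) w) z\<bar> \<le> ?T"
  proof -
    have "\<bar>kill p m1 (\<lambda>w. Y w * indicator (- ?B) w) z\<bar> \<le> kill p m1 (indicator (- ?B)) z"
      by (rule kill_abs_mono[OF BY _ _ z]) (use X(4,7) in \<open>simp_all add: indicator_def\<close>)
    also have "\<dots> \<le> free p m1 (indicator (- ?B)) z"
      by (rule kill_le_free[where B=1]) (simp_all add: indicator_def)
    also have "\<dots> = measure_pmf.prob (steps p m1) {s. z + s \<in> - ?B}" by (rule free_indicator)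
    also have "\<dots> \<le> ?T"
    proof (rule measure_pmf.finite_measure_mono)
      have "z + s \<in> ?B" if "s \<in> centred_box m1 (R / 2)" for s
        using that R(2) abs_coord_le_nrm[of z] unfolding centred_box_def mem_Collect_eq fst_add snd_add of_int_add
        by linarith
      then show "{s. z + s \<in> - ?B} \<subseteq> - centred_box m1 (R / 2)" by blast
    qed simp
    finally show ?thesis .
  qed
  have good: "\<bar>X w * Y w - A w * A2 w\<bar> \<le> 2 * M * \<epsilon>" if w: "gap w > 0" "a \<le> real_of_int (gap w)" for w
  proof -
    have "X w * Y w - A w * A2 w = (X w - A w) * Y w + A w * (Y w - A2 w)" by (simp add: algebra_simps)
    then have "\<bar>X w * Y w - A w * A2 w\<bar> \<le> \<bar>X w - A w\<bar> * \<bar>Y w\<bar> + \<bar>A w\<bar> * \<bar>Y w - A2 w\<bar>"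
      by (metis abs_triangle_ineq abs_mult)
    also have "\<dots> \<le> \<epsilon> * M + M * \<epsilon>"
      using X[OF w(1)] e[OF w] M0 by (intro add_mono mult_mono) auto
    finally show ?thesis by simp
  qed
  have bad: "\<bar>X w * Y w - A w * A2 w\<bar> \<le> 2 * M\<^sup>2" if w: "gap w > 0" for w
  proof -
    have "\<bar>X w * Y w - A w * A2 w\<bar> \<le> \<bar>X w\<bar> * \<bar>Y w\<bar> + \<bar>A w\<bar> * \<bar>A2 w\<bar>"
      by (metis abs_triangle_ineq4 abs_mult)
    also have "\<dots> \<le> M * M + M * M"
      using X[OF w] M0 by (intro add_mono mult_mono) auto
    finally show ?thesis by (simp add: power2_eq_square)
  qed
  \<comment> \<open>Evaluating the approximation hypothesis at any point with large enough gap shows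
    that the error bound is nonnegative.\<close>
  have \<epsilon>0: "0 \<le> \<epsilon>"
  proof -
    obtain k :: int where k: "1 \<le> k" "a \<le> real_of_int k"
      using that[of "max 1 \<lceil>a\<rceil>"] by (simp; linarith)
    have "gap (0, 0, k) = k" by (simp add: gap_def)
    then show ?thesis using \<epsilon>[of "(0,0,k)"] k by linarith
  qed
  have PGS: "?P = G \<union> S" by (auto simp: G_def S_def simp del: split_paired_All)
  have "\<bar>(\<Sum>w\<in>?P. X w * Y w) - (\<Sum>w\<in>?P. A w * A2 w)\<bar> = \<bar>\<Sum>w\<in>?P. X w * Y w - A w * A2 w\<bar>"
    by (simp add: sum_subtractf)
  also have "\<dots> \<le> (\<Sum>w\<in>?P. \<bar>X w * Y w - A w * A2 w\<bar>)" by (rule sum_abs)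
  also have "(\<Sum>w\<in>?P. \<bar>X w * Y w - A w * A2 w\<bar>)
      = (\<Sum>w\<in>G. \<bar>X w * Y w - A w * A2 w\<bar>) + (\<Sum>w\<in>S. \<bar>X w * Y w - A w * A2 w\<bar>)"
    unfolding PGS by (rule sum.union_disjoint) (auto simp: G_def S_def simp del: split_paired_All)
  also have "(\<Sum>w\<in>G. \<bar>X w * Y w - A w * A2 w\<bar>) \<le> real (card G) * (2 * M * \<epsilon>)"
    by (rule sum_bounded_above) (use good in \<open>simp add: G_def\<close>)
  also have "real (card G) * (2 * M * \<epsilon>) \<le> (2 * R + 1) ^ 3 * (2 * M * \<epsilon>)"
  proof (rule mult_right_mono)
    have "card G \<le> card ?B" by (rule card_mono) (auto simp: G_def)
    then show "real (card G) \<le> (2 * R + 1) ^ 3" using card_centred_box_le[of R m1] R by linarith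
  qed (use M0 \<epsilon>0 in simp)
  also have "(\<Sum>w\<in>S. \<bar>X w * Y w - A w * A2 w\<bar>) \<le> real (card S) * (2 * M\<^sup>2)"
    by (rule sum_bounded_above) (use bad in \<open>simp add: S_def\<close>)
  also have "real (card S) * (2 * M\<^sup>2) \<le> (2 * R + 1)\<^sup>2 * (a + 1) * (2 * M\<^sup>2)"
    unfolding S_def using card_strip_le[of R a m1] R a by (intro mult_right_mono) auto
  finally have sums: "\<bar>(\<Sum>w\<in>?P. X w * Y w) - (\<Sum>w\<in>?P. A w * A2 w)\<bar>
      \<le> (2 * R + 1) ^ 3 * (2 * M * \<epsilon>) + (2 * R + 1)\<^sup>2 * (a + 1) * (2 * M\<^sup>2)" by simp
  let ?U = "ren z * ren z2"
  have AA: "(\<Sum>w\<in>?P. A w * A2 w) = ?U * (\<Sum>w\<in>?P. dker m1 w * dker m2 (time_flip N w))"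
    by (simp add: A_def A2_def sum_distrib_left mult_ac)
  have "\<bar>(\<Sum>w\<in>?P. A w * A2 w) - ?U * (curv n N / 4)\<bar>
      = \<bar>?U\<bar> * \<bar>(\<Sum>w\<in>?P. dker m1 w * dker m2 (time_flip N w)) - curv n N / 4\<bar>"
    unfolding AA abs_mult[symmetric] right_diff_distrib ..
  also have "\<dots> \<le> \<bar>?U\<bar> * ?T"
  proof (rule mult_left_mono)
    have "\<bar>(\<Sum>w\<in>?P. dker m1 w * dker m2 (time_flip N w)) - curv n N / 4\<bar>
        \<le> measure_pmf.prob (steps p m1) (- centred_box m1 (R - 1))"
      unfolding n by (rule half_space_sum) (use R in simp)
    also have "\<dots> \<le> ?T"
      by (rule measure_pmf.finite_measure_mono) (use R(1) in \<open>auto simp: centred_box_def\<close>)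
    finally show "\<bar>(\<Sum>w\<in>?P. dker m1 w * dker m2 (time_flip N w)) - curv n N / 4\<bar> \<le> ?T" .
  qed simp
  finally have "\<bar>(\<Sum>w\<in>?P. A w * A2 w) - ?U * (curv n N / 4)\<bar> \<le> \<bar>?U\<bar> * ?T" .
  with sums out main show ?thesis by (simp add: distrib_right)
qed

subsection \<open>The planar local limit\<close>

text \<open>What remains of \<open>curv\<close> after summation over all integer times: the same
  second difference, taken for the law of the space coordinates alone.\<close>

definition planar :: "nat \<Rightarrow> real" where
  "planar m = measure_pmf.prob (steps p m) {s. snd s = (0, 0)}
    - (measure_pmf.prob (steps p m) {s. snd s = (2, - 2)} + measure_pmf.prob (steps p m) {s. snd s = (- 2, 2)}) / 2"

lemma planar_fourier:
  "complex_of_real (planar m)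
    = (\<integral>\<theta>. phi (0, \<theta>) ^ m * complex_of_real (2 * (sin (snd \<theta> - fst \<theta>))\<^sup>2) \<partial>torus2)"
proof -
  have i: "integrable torus2 (\<lambda>\<theta>. phi (0, \<theta>) ^ m * cis (g \<theta>))"
    if [measurable]: "g \<in> borel_measurable (borel \<Otimes>\<^sub>M borel)" for g
  proof (rule torus2.integrable_const_bound[where B=1])
    show "AE \<theta> in torus2. norm (phi (0, \<theta>) ^ m * cis (g \<theta>)) \<le> 1"
      by (rule AE_I2) (simp add: norm_mult norm_power power_le_one norm_phi_le_1)
  qed measurable
  let ?f = "\<lambda>v x. \<lambda>\<theta>. phi (0, \<theta>) ^ m * cis (- (fst \<theta> * of_int v + snd \<theta> * of_int x))"
  have if': "integrable torus2 (?f v x)" for v x by (rule i) measurable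
  have "complex_of_real (planar m) = (\<integral>\<theta>. ?f 0 0 \<theta> \<partial>torus2) - ((\<integral>\<theta>. ?f 2 (-2) \<theta> \<partial>torus2) + (\<integral>\<theta>. ?f (-2) 2 \<theta> \<partial>torus2)) / 2"
    unfolding planar_def of_real_diff of_real_divide of_real_add prob_space_fourier by simp
  also have "\<dots> = (\<integral>\<theta>. ?f 0 0 \<theta> - (?f 2 (-2) \<theta> + ?f (-2) 2 \<theta>) / 2 \<partial>torus2)"
    using if'[of 0 0] if'[of 2 "-2"] if'[of "-2" 2]
    by (subst Bochner_Integration.integral_diff) (simp_all only: Bochner_Integration.integral_add
      integral_divide_zero Bochner_Integration.integrable_add integrable_divide_zero)
  also have "\<dots> = (\<integral>\<theta>. phi (0, \<theta>) ^ m * complex_of_real (2 * (sin (snd \<theta> - fst \<theta>))\<^sup>2) \<partial>torus2)"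
  proof (rule Bochner_Integration.integral_cong[OF refl])
    fix \<theta> :: "real \<times> real"
    define y where "y = snd \<theta> - fst \<theta>"
    have e: "- (fst \<theta> * of_int 2 + snd \<theta> * of_int (-2)) = 2 * y" "- (fst \<theta> * of_int (-2) + snd \<theta> * of_int 2) = - (2 * y)"
      by (simp_all add: y_def)
    have "(cis (2 * y) + cis (- (2 * y))) / 2 = complex_of_real (cos (2 * y))"
      by (simp add: complex_eq_iff)
    also have "cos (2 * y) = 1 - 2 * (sin y)\<^sup>2" by (rule cos_double_sin)
    finally have "(cis (2 * y) + cis (- (2 * y))) / 2 = 1 - complex_of_real (2 * (sin y)\<^sup>2)" by simp
    moreover have "?f 0 0 \<theta> - (?f 2 (-2) \<theta> + ?f (-2) 2 \<theta>) / 2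
        = phi (0, \<theta>) ^ m * (1 - (cis (2 * y) + cis (- (2 * y))) / 2)"
      unfolding e by (simp add: algebra_simps add_divide_distrib)
    ultimately have "?f 0 0 \<theta> - (?f 2 (-2) \<theta> + ?f (-2) 2 \<theta>) / 2
        = phi (0, \<theta>) ^ m * (1 - (1 - complex_of_real (2 * (sin y)\<^sup>2)))"
      by (simp only:)
    also have "1 - (1 - complex_of_real (2 * (sin y)\<^sup>2)) = complex_of_real (2 * (sin y)\<^sup>2)"
      by (rule diff_diff_eq2[THEN trans]) simp
    finally show "?f 0 0 \<theta> - (?f 2 (-2) \<theta> + ?f (-2) 2 \<theta>) / 2
        = phi (0, \<theta>) ^ m * complex_of_real (2 * (sin (snd \<theta> - fst \<theta>))\<^sup>2)"
      unfolding y_def .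
  qed
  finally show ?thesis .
qed

lemma integrable_nrm_cube: "integrable (measure_pmf p) (\<lambda>s. nrm s ^ 3)"
proof (rule integrable_by_exp[where b=rate and C="6 / rate ^ 3"])
  fix s
  have "(rate * nrm s) ^ 3 \<le> fact 3 * exp (rate * nrm s)"
    using rate(1) by (intro power_le_fact_exp) simp
  then show "\<bar>nrm s ^ 3\<bar> \<le> 6 / rate ^ 3 * exp (rate * nrm s)"
    using rate(1) by (simp add: power_mult_distrib fact_numeral field_simps)
qed (use rate(1) in auto)

text \<open>The covariance form of the space part of a step, since the space coordinates have mean
  zero.\<close>

definition quad :: "real \<times> real \<Rightarrow> real" where
  "quad \<theta> = measure_pmf.expectation p (\<lambda>s. (ang (0, \<theta>) s)\<^sup>2)"

lemma ang_scale: "ang (0, a / r, b / r) s = ang (0, a, b) s / r"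
  by (simp add: ang_def add_divide_distrib)

lemma expectation_ang_planar: "measure_pmf.expectation p (\<lambda>s. ang (0, \<theta>) s) = 0"
proof -
  have "integrable (measure_pmf p) (\<lambda>s. real_of_int (fst (snd s)))" "integrable (measure_pmf p) (\<lambda>s. real_of_int (snd (snd s)))"
    by (rule integrable_le_nrm[where C=1 and B=0]; use abs_coord_le_nrm in simp)+
  then show ?thesis by (simp add: ang_def expectation_coords)
qed

lemma integrable_ang: "integrable (measure_pmf p) (ang \<theta>)"
  by (rule integrable_le_nrm[where C="mag \<theta>" and B=0]) (use abs_ang_le in simp)

lemma integrable_ang_sq: "integrable (measure_pmf p) (\<lambda>s. (ang \<theta> s)\<^sup>2)"
proof (rule Bochner_Integration.integrable_bound)
  show "integrable (measure_pmf p) (\<lambda>s. (mag \<theta>)\<^sup>2 * (nrm s)\<^sup>2)" using integrable_nrm_sq by simp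
  show "AE s in measure_pmf p. norm ((ang \<theta> s)\<^sup>2) \<le> norm ((mag \<theta>)\<^sup>2 * (nrm s)\<^sup>2)"
    by (rule AE_I2) (use power_mono[OF abs_ang_le, where n=2] in \<open>simp add: power_mult_distrib\<close>)
qed simp

text \<open>Taylor expansion with cubic remainder at time angle zero; the linear term disappears
  because the space coordinates are centred.\<close>

lemma phi_expansion_le:
  obtains D where "0 \<le> D" "\<And>\<theta>. norm (phi (0, \<theta>) - (1 - complex_of_real (quad \<theta> / 2))) \<le> D * mag (0, \<theta>) ^ 3"
proof
  let ?D = "measure_pmf.expectation p (\<lambda>s. nrm s ^ 3)"
  show "0 \<le> ?D" by (rule integral_nonneg_AE) simp
  fix \<theta>
  let ?a = "ang (0, \<theta>)"
  have i1: "integrable (measure_pmf p) (\<lambda>s. complex_of_real (?a s))" using integrable_ang[of "(0, \<theta>)"] by simp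
  have i2: "integrable (measure_pmf p) (\<lambda>s. complex_of_real ((?a s)\<^sup>2))"
    unfolding complex_of_real_integrable_eq by (rule integrable_ang_sq)
  have "phi (0, \<theta>) - (1 - complex_of_real (quad \<theta> / 2))
      = measure_pmf.expectation p (\<lambda>s. cis (?a s) - 1 - \<i> * complex_of_real (?a s) + complex_of_real ((?a s)\<^sup>2) / 2)"
  proof -
    have "measure_pmf.expectation p (\<lambda>s. \<i> * complex_of_real (?a s)) = 0"
      by (simp add: expectation_ang_planar)
    moreover have "measure_pmf.expectation p (\<lambda>s. complex_of_real ((?a s)\<^sup>2)) = complex_of_real (quad \<theta>)"
      unfolding quad_def by (rule integral_complex_of_real)
    moreover have "integrable (measure_pmf p) (\<lambda>s. \<i> * complex_of_real (?a s))"
      using i1 by (rule integrable_mult_right)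
    moreover have "integrable (measure_pmf p) (\<lambda>s. complex_of_real ((?a s)\<^sup>2) / 2)"
      using i2 by (rule integrable_divide)
    ultimately show ?thesis
      by (simp only: phi_def[of "(0, \<theta>)"] Bochner_Integration.integral_add Bochner_Integration.integral_diff
        Bochner_Integration.integrable_diff integrable_cis measure_pmf.integrable_const integral_divide_zero)
        simp
  qed
  also have "norm \<dots> \<le> measure_pmf.expectation p
      (\<lambda>s. norm (cis (?a s) - 1 - \<i> * complex_of_real (?a s) + complex_of_real ((?a s)\<^sup>2) / 2))"
    by (rule integral_norm_bound)
  also have "\<dots> \<le> measure_pmf.expectation p (\<lambda>s. mag (0, \<theta>) ^ 3 * nrm s ^ 3)"
  proof (rule integral_mono')
    show "integrable (measure_pmf p) (\<lambda>s. mag (0, \<theta>) ^ 3 * nrm s ^ 3)" using integrable_nrm_cube by simp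
    fix s
    have "(\<Sum>k\<le>2. (\<i> * complex_of_real (?a s)) ^ k / fact k) = 1 + \<i> * ?a s - (complex_of_real (?a s))\<^sup>2 / 2"
    proof -
      have "(\<Sum>k\<le>2. f k) = f 0 + f 1 + f 2" for f :: "nat \<Rightarrow> complex" by (simp add: numeral_2_eq_2)
      then show ?thesis by (simp only:) (simp add: power_mult_distrib)
    qed
    then have "norm (cis (?a s) - (1 + \<i> * ?a s - (complex_of_real (?a s))\<^sup>2 / 2)) \<le> \<bar>?a s\<bar> ^ 3 / fact 3"
      using iexp_approx1[of "?a s" 2] by (simp add: cis_conv_exp numeral_3_eq_3)
    also have "\<dots> \<le> \<bar>?a s\<bar> ^ 3" by (simp add: fact_numeral)
    also have "\<dots> \<le> (mag (0, \<theta>) * nrm s) ^ 3" by (intro power_mono abs_ang_le) simp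
    finally show "norm (cis (?a s) - 1 - \<i> * complex_of_real (?a s) + complex_of_real ((?a s)\<^sup>2) / 2)
        \<le> mag (0, \<theta>) ^ 3 * nrm s ^ 3"
      by (simp add: power_mult_distrib algebra_simps)
  qed simp
  also have "\<dots> = ?D * mag (0, \<theta>) ^ 3" by simp
  finally show "norm (phi (0, \<theta>) - (1 - complex_of_real (quad \<theta> / 2))) \<le> ?D * mag (0, \<theta>) ^ 3" .
qed

lemma quad_nonneg: "0 \<le> quad \<theta>"
  unfolding quad_def by (rule integral_nonneg_AE) simp

text \<open>Central limit theorem on the Fourier side. Replacing each of the \<open>m\<close>
  factors by \<open>1 - quad / (2 * m)\<close> costs \<open>m^(-3/2)\<close> apiece, so
  \<open>m^(-1/2)\<close> in total.\<close>

lemma phi_power_limit: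
  "(\<lambda>m. phi (0, a / sqrt (real m), b / sqrt (real m)) ^ m) \<longlonglongrightarrow> complex_of_real (exp (- quad (a, b) / 2))"
proof -
  obtain D where D: "0 \<le> D" "\<And>\<theta>. norm (phi (0, \<theta>) - (1 - complex_of_real (quad \<theta> / 2))) \<le> D * mag (0, \<theta>) ^ 3"
    by (rule phi_expansion_le, rule that)
  let ?V = "quad (a, b)" and ?\<theta> = "\<lambda>m. (a / sqrt (real m), b / sqrt (real m))"
  let ?e = "\<lambda>m. D * mag (0, a, b) ^ 3 * (1 / sqrt (real m))"
  have quad: "quad (?\<theta> m) = ?V / real m" for m
    unfolding quad_def ang_scale by (simp add: power_divide)
  have close: "\<forall>\<^sub>F m in sequentially. norm (phi (0, ?\<theta> m) ^ m - (1 + complex_of_real (- ?V / 2) / of_nat m) ^ m) \<le> ?e m"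
    using eventually_ge_at_top[of "nat \<lceil>?V\<rceil> + 1"]
  proof eventually_elim
    case (elim m)
    then have m: "1 \<le> m" "?V \<le> real m" by linarith+
    have eq: "1 + complex_of_real (- ?V / 2) / of_nat m = 1 - complex_of_real (quad (?\<theta> m) / 2)"
      unfolding quad by simp
    have "norm (1 - complex_of_real (quad (?\<theta> m) / 2)) \<le> 1"
    proof -
      have "1 - complex_of_real (quad (?\<theta> m) / 2) = complex_of_real (1 - quad (?\<theta> m) / 2)" by simp
      moreover have "\<bar>1 - quad (?\<theta> m) / 2\<bar> \<le> 1"
      proof -
        have "quad (?\<theta> m) \<le> 1" unfolding quad using m by simp
        then show ?thesis using quad_nonneg[of "?\<theta> m"] by linarith
      qed
      ultimately show ?thesis by (simp only: norm_of_real)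
    qed
    then have "norm (phi (0, ?\<theta> m) ^ m - (1 - complex_of_real (quad (?\<theta> m) / 2)) ^ m)
        \<le> real m * norm (phi (0, ?\<theta> m) - (1 - complex_of_real (quad (?\<theta> m) / 2)))"
      by (intro norm_power_diff norm_phi_le_1)
    also have "\<dots> \<le> real m * (D * mag (0, ?\<theta> m) ^ 3)" by (intro mult_left_mono D) simp
    also have "mag (0, ?\<theta> m) = mag (0, a, b) / sqrt (real m)" using m by (simp add: mag_def add_divide_distrib)
    also have "real m * (D * (mag (0, a, b) / sqrt (real m)) ^ 3) = ?e m"
    proof -
      have "real m * (1 / sqrt (real m)) ^ 3 = 1 / sqrt (real m)"
        using m by (simp add: power_divide power3_eq_cube field_simps)
      moreover have "real m * (D * (mag (0, a, b) / sqrt (real m)) ^ 3)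
          = D * mag (0, a, b) ^ 3 * (real m * (1 / sqrt (real m)) ^ 3)"
        by (simp add: power_divide)
      ultimately show ?thesis by (simp only:)
    qed
    finally show ?case unfolding eq .
  qed
  have "?e \<longlonglongrightarrow> 0"
    by (rule tendsto_mult_right_zero) real_asymp
  from Lim_null_comparison[OF close this]
  have 1: "(\<lambda>m. phi (0, ?\<theta> m) ^ m - (1 + complex_of_real (- ?V / 2) / of_nat m) ^ m) \<longlonglongrightarrow> 0" .
  have "(\<lambda>m. complex_of_real ((1 + (- ?V / 2) / real m) ^ m)) \<longlonglongrightarrow> complex_of_real (exp (- ?V / 2))"
    by (intro tendsto_of_real tendsto_exp_limit_sequentially)
  then have 2: "(\<lambda>m. (1 + complex_of_real (- ?V / 2) / of_nat m) ^ m) \<longlonglongrightarrow> complex_of_real (exp (- ?V / 2))"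
    by simp
  show ?thesis using tendsto_add[OF 1 2] by simp
qed

lemma integral_circ_scaled:
  fixes f :: "real \<Rightarrow> complex"
  assumes [measurable]: "f \<in> borel_measurable borel" and r: "0 < r"
  shows "(\<integral>x. f x \<partial>circ) = (\<integral>x. (indicator {- pi..pi} (x / r) / (2 * pi * r)) *\<^sub>R f (x / r) \<partial>lborel)"
proof -
  have "(\<integral>x. f x \<partial>circ) = (\<integral>x. (indicator {- pi..pi} x / (2 * pi)) *\<^sub>R f x \<partial>lborel)"
    by (rule integral_circ) measurable
  also have "\<dots> = \<bar>1 / r\<bar> *\<^sub>R (\<integral>x. (indicator {- pi..pi} (0 + 1 / r * x) / (2 * pi)) *\<^sub>R f (0 + 1 / r * x) \<partial>lborel)"
    by (rule lborel_integral_real_affine) (use r in simp)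
  also have "\<dots> = (\<integral>x. \<bar>1 / r\<bar> *\<^sub>R ((indicator {- pi..pi} (0 + 1 / r * x) / (2 * pi)) *\<^sub>R f (0 + 1 / r * x)) \<partial>lborel)"
    by (rule integral_scaleR_right[symmetric])
  also have "\<dots> = (\<integral>x. (indicator {- pi..pi} (x / r) / (2 * pi * r)) *\<^sub>R f (x / r) \<partial>lborel)"
    using r by (intro Bochner_Integration.integral_cong) (auto simp: field_simps)
  finally show ?thesis .
qed

text \<open>Integrable majorant of all rescaled integrands. Half of the decay rate \<open>c\<close>
  has been spent on the quadratic factor, which leaves \<open>8 / c\<close> in front.\<close>

definition gauss2 :: "real \<Rightarrow> real \<times> real \<Rightarrow> real" where
  "gauss2 c \<theta> = 8 / c * (exp (- (c / 2 * (fst \<theta>)\<^sup>2)) * exp (- (c / 2 * (snd \<theta>)\<^sup>2)))"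

lemma integrable_gauss1:
  assumes "0 < (b::real)" shows "integrable lborel (\<lambda>x. exp (- (b * x\<^sup>2)))"
proof -
  define \<sigma> where "\<sigma> = 1 / sqrt (2 * b)"
  have \<sigma>: "0 < \<sigma>" using assms by (simp add: \<sigma>_def)
  have \<sigma>2: "2 * \<sigma>\<^sup>2 = 1 / b" using assms by (simp add: \<sigma>_def power_divide)
  have eq: "exp (- (b * x\<^sup>2)) = sqrt (2 * pi * \<sigma>\<^sup>2) * normal_density 0 \<sigma> x" for x
  proof -
    have "x\<^sup>2 / (2 * \<sigma>\<^sup>2) = b * x\<^sup>2" unfolding \<sigma>2 using assms by simp
    then show ?thesis using \<sigma> unfolding normal_density_def by simp
  qed
  show ?thesis unfolding eq using integrable_normal_density[OF \<sigma>] by simp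
qed

lemma integrable_gauss2:
  assumes c: "0 < c" shows "integrable (lborel \<Otimes>\<^sub>M lborel) (gauss2 c)"
proof (rule lborel_pair.Fubini_integrable)
  show "gauss2 c \<in> borel_measurable (lborel \<Otimes>\<^sub>M lborel)" unfolding gauss2_def[abs_def] by measurable
  have i: "integrable lborel (\<lambda>x. exp (- (c / 2 * x\<^sup>2)))" by (rule integrable_gauss1) (use c in simp)
  show "AE x in lborel. integrable lborel (\<lambda>y. gauss2 c (x, y))"
    unfolding gauss2_def using i by simp
  have "(\<integral>y. norm (gauss2 c (x, y)) \<partial>lborel)
      = 8 / c * (exp (- (c / 2 * x\<^sup>2)) * (\<integral>y. exp (- (c / 2 * y\<^sup>2)) \<partial>lborel))" for x
    unfolding gauss2_def using c i by (simp add: abs_mult)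
  then show "integrable lborel (\<lambda>x. \<integral>y. norm (gauss2 c (x, y)) \<partial>lborel)"
    using i by simp
qed

text \<open>The integrand of \<open>planar_fourier\<close> after dividing the angles by
  \<open>sqrt m\<close>, with the square of integration written as indicators. Of the factor
  \<open>m^2\<close> in the limit, one \<open>m\<close> cancels the Jacobian and the other stays
  with the squared sine.\<close>

definition planar_integrand :: "nat \<Rightarrow> real \<times> real \<Rightarrow> complex" where
  "planar_integrand m \<theta> = (indicator {- pi..pi} (fst \<theta> / sqrt (real m)) * indicator {- pi..pi} (snd \<theta> / sqrt (real m))) *\<^sub>R
    (phi (0, fst \<theta> / sqrt (real m), snd \<theta> / sqrt (real m)) ^ m
      * complex_of_real (real m * (2 * (sin ((snd \<theta> - fst \<theta>) / sqrt (real m)))\<^sup>2)))"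

lemma measurable_planar_integrand [measurable]: "planar_integrand m \<in> borel_measurable (borel \<Otimes>\<^sub>M borel)"
  unfolding planar_integrand_def[abs_def] by measurable

lemma planar_integrand_le:
  obtains c where "0 < c" "\<And>m \<theta>. 1 \<le> m \<Longrightarrow> norm (planar_integrand m \<theta>) \<le> gauss2 c \<theta>"
proof -
  obtain c where c: "0 < c" and phi: "\<And>\<theta>. \<bar>fst \<theta>\<bar> \<le> pi \<Longrightarrow> \<bar>fst (snd \<theta>)\<bar> \<le> pi \<Longrightarrow> \<bar>snd (snd \<theta>)\<bar> \<le> pi
    \<Longrightarrow> norm (phi \<theta>) \<le> exp (- (c * sqm \<theta>))"
    by (rule norm_phi_le_exp, rule that)
  have "norm (planar_integrand m \<theta>) \<le> gauss2 c \<theta>" if m: "1 \<le> m" for m \<theta>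
  proof -
    obtain a b where \<theta>: "\<theta> = (a, b)" by (cases \<theta>)
    let ?r = "sqrt (real m)"
    have r: "0 < ?r" using m by simp
    have g0: "0 \<le> gauss2 c \<theta>" using c by (simp add: gauss2_def)
    show ?thesis
    proof (cases "\<bar>a / ?r\<bar> \<le> pi \<and> \<bar>b / ?r\<bar> \<le> pi")
      case True
      have "norm (phi (0, a / ?r, b / ?r)) ^ m \<le> exp (- (c * sqm (0, a / ?r, b / ?r))) ^ m"
        using True by (intro power_mono phi) auto
      also have "\<dots> = exp (- (c * (a\<^sup>2 + b\<^sup>2)))"
        using m by (simp add: exp_of_nat_mult[symmetric] sqm_def power_divide field_simps)
      finally have 1: "norm (phi (0, a / ?r, b / ?r)) ^ m \<le> exp (- (c * (a\<^sup>2 + b\<^sup>2)))" .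
      have "(sin ((b - a) / ?r))\<^sup>2 \<le> ((b - a) / ?r)\<^sup>2"
        by (rule abs_le_square_iff[THEN iffD1, OF abs_sin_le_abs])
      then have "real m * (2 * (sin ((b - a) / ?r))\<^sup>2) \<le> real m * (2 * ((b - a) / ?r)\<^sup>2)"
        by (intro mult_left_mono) auto
      also have "\<dots> = 2 * (b - a)\<^sup>2" using m by (simp add: power_divide)
      also have "\<dots> \<le> 4 * (a\<^sup>2 + b\<^sup>2)"
      proof -
        have "0 \<le> (a + b)\<^sup>2" by simp
        then show ?thesis by (simp add: power2_eq_square algebra_simps)
      qed
      also have "\<dots> \<le> 8 / c * exp (c / 2 * (a\<^sup>2 + b\<^sup>2))"
        using exp_ge_add_one_self[of "c / 2 * (a\<^sup>2 + b\<^sup>2)"] c by (simp add: field_simps)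
      finally have 2: "real m * (2 * (sin ((b - a) / ?r))\<^sup>2) \<le> 8 / c * exp (c / 2 * (a\<^sup>2 + b\<^sup>2))" .
      have "- pi \<le> a / ?r" "a / ?r \<le> pi" "- pi \<le> b / ?r" "b / ?r \<le> pi" using True by linarith+
      then have "indicat_real {- pi..pi} (a / ?r) = 1" "indicat_real {- pi..pi} (b / ?r) = 1"
        by (simp_all only: indicator_def atLeastAtMost_iff simp_thms if_True of_bool_def)
      then have "norm (planar_integrand m \<theta>)
          = norm (phi (0, a / ?r, b / ?r)) ^ m * (real m * (2 * (sin ((b - a) / ?r))\<^sup>2))"
        by (simp add: planar_integrand_def \<theta> norm_mult norm_power)
      also have "\<dots> \<le> exp (- (c * (a\<^sup>2 + b\<^sup>2))) * (8 / c * exp (c / 2 * (a\<^sup>2 + b\<^sup>2)))"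
        by (intro mult_mono 1 2) auto
      also have "\<dots> = gauss2 c \<theta>"
        by (simp add: gauss2_def \<theta> exp_add[symmetric] algebra_simps)
      finally show ?thesis .
    next
      case False
      then have "planar_integrand m \<theta> = 0" by (auto simp: planar_integrand_def \<theta> indicator_def abs_le_iff)
      then show ?thesis using g0 by simp
    qed
  qed
  with c that show thesis by blast
qed

lemma planar_scaled:
  assumes m: "1 \<le> m"
  shows "complex_of_real ((real m)\<^sup>2 * planar m)
    = (\<integral>\<theta>. planar_integrand m \<theta> \<partial>(lborel \<Otimes>\<^sub>M lborel)) / complex_of_real (4 * pi\<^sup>2)"
proof -
  let ?r = "sqrt (real m)"
  have r: "0 < ?r" using m by simp
  obtain c where c: "0 < c" "\<And>m \<theta>. 1 \<le> m \<Longrightarrow> norm (planar_integrand m \<theta>) \<le> gauss2 c \<theta>"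
    by (rule planar_integrand_le, rule that)
  have int: "integrable (lborel \<Otimes>\<^sub>M lborel) (planar_integrand m)"
  proof (rule Bochner_Integration.integrable_bound[OF integrable_gauss2[OF c(1)]])
    show "AE \<theta> in lborel \<Otimes>\<^sub>M lborel. norm (planar_integrand m \<theta>) \<le> norm (gauss2 c \<theta>)"
      by (rule AE_I2) (use c(2)[OF m] in \<open>auto intro: order_trans[OF _ abs_ge_self]\<close>)
  qed measurable
  define f where "f \<theta> = phi (0, \<theta>) ^ m * complex_of_real (2 * (sin (snd \<theta> - fst \<theta>))\<^sup>2)" for \<theta>
  have [measurable]: "f \<in> borel_measurable (borel \<Otimes>\<^sub>M borel)" unfolding f_def[abs_def] by measurable
  interpret P: pair_prob_space circ circ ..
  have fint: "integrable (circ \<Otimes>\<^sub>M circ) f"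
  proof (rule P.integrable_const_bound[where B=2])
    have "norm (f \<theta>) \<le> 2" for \<theta>
    proof -
      have "norm (phi (0, \<theta>)) ^ m \<le> 1" by (rule power_le_one) (simp_all add: norm_phi_le_1)
      moreover have "(sin (snd \<theta> - fst \<theta>))\<^sup>2 \<le> 1" by (simp add: abs_square_le_1)
      ultimately have "norm (phi (0, \<theta>)) ^ m * (2 * (sin (snd \<theta> - fst \<theta>))\<^sup>2) \<le> 1 * (2 * 1)"
        by (intro mult_mono) auto
      then show ?thesis by (simp add: f_def norm_mult norm_power)
    qed
    then show "AE \<theta> in circ \<Otimes>\<^sub>M circ. norm (f \<theta>) \<le> 2" by simp
  qed measurable
  have "complex_of_real (planar m) = (\<integral>\<theta>. f \<theta> \<partial>(circ \<Otimes>\<^sub>M circ))"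
    unfolding planar_fourier torus2_def f_def ..
  also have "\<dots> = (\<integral>a. (\<integral>b. f (a, b) \<partial>circ) \<partial>circ)"
    using P.integral_fst'[OF fint] by simp
  also have "\<dots> = (\<integral>a. (indicator {- pi..pi} (a / ?r) / (2 * pi * ?r)) *\<^sub>R (\<integral>b. f (a / ?r, b) \<partial>circ) \<partial>lborel)"
    by (rule integral_circ_scaled[OF _ r]) measurable
  also have "\<dots> = (\<integral>a. (\<integral>b. planar_integrand m (a, b) / complex_of_real (4 * pi\<^sup>2 * (real m)\<^sup>2) \<partial>lborel) \<partial>lborel)"
  proof (rule Bochner_Integration.integral_cong[OF refl])
    fix a
    have "(\<integral>b. f (a / ?r, b) \<partial>circ) = (\<integral>b. (indicator {- pi..pi} (b / ?r) / (2 * pi * ?r)) *\<^sub>R f (a / ?r, b / ?r) \<partial>lborel)"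
      by (rule integral_circ_scaled[OF _ r]) measurable
    then have "(indicator {- pi..pi} (a / ?r) / (2 * pi * ?r)) *\<^sub>R (\<integral>b. f (a / ?r, b) \<partial>circ)
      = (\<integral>b. (indicator {- pi..pi} (a / ?r) / (2 * pi * ?r)) *\<^sub>R ((indicator {- pi..pi} (b / ?r) / (2 * pi * ?r)) *\<^sub>R f (a / ?r, b / ?r)) \<partial>lborel)"
      by (simp only: integral_scaleR_right)
    also have "\<dots> = (\<integral>b. planar_integrand m (a, b) / complex_of_real (4 * pi\<^sup>2 * (real m)\<^sup>2) \<partial>lborel)"
    proof (rule Bochner_Integration.integral_cong[OF refl])
      fix b
      have "?r * ?r = real m" by simp
      then have k: "1 / (2 * pi * ?r) * (1 / (2 * pi * ?r)) = real m / (4 * pi\<^sup>2 * (real m)\<^sup>2)"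
        using m by (simp add: power2_eq_square field_simps)
      have l: "(i1 / k) *\<^sub>R ((i2 / k) *\<^sub>R (w * complex_of_real s)) = complex_of_real (i1 * i2 * (1 / k * (1 / k)) * s) * w"
        for i1 i2 k s w by (simp add: scaleR_conv_of_real mult_ac)
      have r: "((i1 * i2) *\<^sub>R (w * complex_of_real (M * s))) / complex_of_real D = complex_of_real (i1 * i2 * (M / D) * s) * w"
        for i1 i2 w s M D by (simp add: scaleR_conv_of_real mult_ac)
      show "(indicator {- pi..pi} (a / ?r) / (2 * pi * ?r)) *\<^sub>R ((indicator {- pi..pi} (b / ?r) / (2 * pi * ?r)) *\<^sub>R f (a / ?r, b / ?r))
          = planar_integrand m (a, b) / complex_of_real (4 * pi\<^sup>2 * (real m)\<^sup>2)"
        unfolding planar_integrand_def f_def fst_conv snd_conv diff_divide_distrib l r k ..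
    qed
    finally show "(indicator {- pi..pi} (a / ?r) / (2 * pi * ?r)) *\<^sub>R (\<integral>b. f (a / ?r, b) \<partial>circ)
      = (\<integral>b. planar_integrand m (a, b) / complex_of_real (4 * pi\<^sup>2 * (real m)\<^sup>2) \<partial>lborel)" .
  qed
  also have "\<dots> = (\<integral>a. (\<integral>b. planar_integrand m (a, b) \<partial>lborel) \<partial>lborel) / complex_of_real (4 * pi\<^sup>2 * (real m)\<^sup>2)"
    by simp
  also have "(\<integral>a. (\<integral>b. planar_integrand m (a, b) \<partial>lborel) \<partial>lborel) = (\<integral>\<theta>. planar_integrand m \<theta> \<partial>(lborel \<Otimes>\<^sub>M lborel))"
    using lborel_pair.integral_fst'[OF int] by simp
  finally show ?thesis using m by (simp add: field_simps)
qed

text \<open>Dominated convergence to a Gaussian integral of \<open>2 * (b - a)^2\<close>. The limit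
  is positive because that integrand vanishes only on the diagonal of the plane.\<close>

lemma planar_limit:
  obtains \<beta> where "0 < \<beta>" "(\<lambda>m. (real m)\<^sup>2 * planar m) \<longlonglongrightarrow> \<beta>"
proof -
  obtain c where c: "0 < c" "\<And>m \<theta>. 1 \<le> m \<Longrightarrow> norm (planar_integrand m \<theta>) \<le> gauss2 c \<theta>"
    by (rule planar_integrand_le, rule that)
  define g where "g \<theta> = exp (- quad \<theta> / 2) * (2 * (snd \<theta> - fst \<theta>)\<^sup>2)" for \<theta>
  let ?L = "lborel \<Otimes>\<^sub>M lborel :: (real \<times> real) measure"
  have lim: "(\<lambda>m. planar_integrand m \<theta>) \<longlonglongrightarrow> complex_of_real (g \<theta>)" for \<theta>
  proof -
    obtain a b where \<theta>: "\<theta> = (a, b)" by (cases \<theta>)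
    have ind: "(\<lambda>m. indicat_real {- pi..pi} (u / sqrt (real m))) \<longlonglongrightarrow> 1" for u
    proof -
      have "(\<lambda>m. u * (1 / sqrt (real m))) \<longlonglongrightarrow> 0" by (rule tendsto_mult_right_zero) real_asymp
      then have "(\<lambda>m. u / sqrt (real m)) \<longlonglongrightarrow> 0" by simp
      then have "\<forall>\<^sub>F m in sequentially. u / sqrt (real m) \<in> {- pi<..<pi}"
        by (rule topological_tendstoD) auto
      then have "\<forall>\<^sub>F m in sequentially. indicat_real {- pi..pi} (u / sqrt (real m)) = 1"
        by eventually_elim (auto simp: indicator_def)
      then show ?thesis by (rule tendsto_eventually)
    qed
    have sin: "(\<lambda>m. real m * (2 * (sin (y / sqrt (real m)))\<^sup>2)) \<longlonglongrightarrow> 2 * y\<^sup>2" for y :: real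
    proof (cases "y = 0")
      case False
      have "(\<lambda>m. y / sqrt (real m)) \<longlonglongrightarrow> 0"
        using tendsto_mult_right_zero[of "\<lambda>m. 1 / sqrt (real m)" sequentially y] by (simp; real_asymp)
      moreover have "\<forall>\<^sub>F m in sequentially. y / sqrt (real m) \<noteq> 0"
        using eventually_gt_at_top[of 0] by eventually_elim (use False in auto)
      ultimately have "filterlim (\<lambda>m. y / sqrt (real m)) (at 0) sequentially"
        by (simp add: filterlim_at)
      then have "(\<lambda>m. sin (y / sqrt (real m)) / (y / sqrt (real m))) \<longlonglongrightarrow> 1"
        by (rule filterlim_compose[where g="\<lambda>x. sin x / x", rotated])
          (use DERIV_D[OF DERIV_sin[of "0::real"]] in simp)
      then have "(\<lambda>m. 2 * y\<^sup>2 * (sin (y / sqrt (real m)) / (y / sqrt (real m)))\<^sup>2) \<longlonglongrightarrow> 2 * y\<^sup>2 * 1\<^sup>2"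
        by (intro tendsto_intros)
      moreover have "\<forall>\<^sub>F m in sequentially. 2 * y\<^sup>2 * (sin (y / sqrt (real m)) / (y / sqrt (real m)))\<^sup>2
          = real m * (2 * (sin (y / sqrt (real m)))\<^sup>2)"
        using eventually_gt_at_top[of 0]
        by eventually_elim (use False in \<open>simp add: power_divide field_simps\<close>)
      ultimately have "(\<lambda>m. real m * (2 * (sin (y / sqrt (real m)))\<^sup>2)) \<longlonglongrightarrow> 2 * y\<^sup>2 * 1\<^sup>2"
        by (rule Lim_transform_eventually)
      then show ?thesis by simp
    qed simp
    have "(\<lambda>m. planar_integrand m \<theta>) \<longlonglongrightarrow> (1 * 1) *\<^sub>R (complex_of_real (exp (- quad (a, b) / 2)) * complex_of_real (2 * (b - a)\<^sup>2))"
      unfolding planar_integrand_def \<theta> fst_conv snd_conv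
      by (intro tendsto_scaleR tendsto_mult ind tendsto_of_real sin phi_power_limit)
    then show ?thesis by (simp add: g_def \<theta>)
  qed
  have [measurable]: "(\<lambda>\<theta>. complex_of_real (g \<theta>)) \<in> borel_measurable ?L"
    by (rule borel_measurable_LIMSEQ_metric[where f="planar_integrand", OF _ lim]) measurable
  \<comment> \<open>The index is shifted by one because the majorant is valid only from
    \<open>m = 1\<close> on.\<close>
  let ?s = "\<lambda>m. planar_integrand (m + 1)"
  have lim': "AE \<theta> in ?L. (\<lambda>m. ?s m \<theta>) \<longlonglongrightarrow> complex_of_real (g \<theta>)"
    by (rule AE_I2) (rule LIMSEQ_ignore_initial_segment[OF lim])
  have bnd: "AE \<theta> in ?L. norm (?s m \<theta>) \<le> gauss2 c \<theta>" for m
    by (rule AE_I2) (rule c(2), simp)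
  have igc: "integrable ?L (\<lambda>\<theta>. complex_of_real (g \<theta>))"
    by (rule integrable_dominated_convergence[OF _ _ integrable_gauss2[OF c(1)] lim' bnd]) measurable
  have conv: "(\<lambda>m. \<integral>\<theta>. ?s m \<theta> \<partial>?L) \<longlonglongrightarrow> (\<integral>\<theta>. complex_of_real (g \<theta>) \<partial>?L)"
    by (rule integral_dominated_convergence[OF _ _ integrable_gauss2[OF c(1)] lim' bnd]) measurable
  have ig: "integrable ?L g" using igc unfolding complex_of_real_integrable_eq .
  define \<beta> where "\<beta> = (\<integral>\<theta>. g \<theta> \<partial>?L) / (4 * pi\<^sup>2)"
  have g0: "0 \<le> g \<theta>" for \<theta> by (simp add: g_def)
  have "(\<integral>\<theta>. g \<theta> \<partial>?L) \<noteq> 0"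
  proof
    assume "(\<integral>\<theta>. g \<theta> \<partial>?L) = 0"
    then have "AE \<theta> in ?L. g \<theta> = 0"
      using integral_nonneg_eq_0_iff_AE[OF ig] g0 by simp
    \<comment> \<open>This rectangle has area 1 and misses the diagonal, the zero set of
      \<open>g\<close>.\<close>
    then have "AE \<theta> in ?L. \<theta> \<notin> {0..1} \<times> {2..3::real}"
      by eventually_elim (auto simp: g_def)
    then have "emeasure ?L ({0..1} \<times> {2..3::real}) = 0"
      by (subst (asm) AE_iff_measurable[OF _ refl]) (auto simp: space_pair_measure)
    then show False by (simp add: lborel.emeasure_pair_measure_Times)
  qed
  moreover have "0 \<le> (\<integral>\<theta>. g \<theta> \<partial>?L)" by (rule integral_nonneg_AE) (simp add: g0)
  ultimately have \<beta>: "0 < \<beta>" by (simp add: \<beta>_def)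
  have "(\<lambda>m. complex_of_real ((real (m + 1))\<^sup>2 * planar (m + 1))) \<longlonglongrightarrow> complex_of_real \<beta>"
  proof -
    have "(\<lambda>m. (\<integral>\<theta>. ?s m \<theta> \<partial>?L) / complex_of_real (4 * pi\<^sup>2)) \<longlonglongrightarrow> (\<integral>\<theta>. complex_of_real (g \<theta>) \<partial>?L) / complex_of_real (4 * pi\<^sup>2)"
      using conv by (intro tendsto_divide tendsto_const) auto
    moreover have "(\<integral>\<theta>. complex_of_real (g \<theta>) \<partial>?L) / complex_of_real (4 * pi\<^sup>2) = complex_of_real \<beta>"
      unfolding \<beta>_def of_real_divide integral_complex_of_real ..
    ultimately show ?thesis by (simp only: planar_scaled[OF le_add2])
  qed
  then have "(\<lambda>m. Re (complex_of_real ((real (m + 1))\<^sup>2 * planar (m + 1)))) \<longlonglongrightarrow> Re (complex_of_real \<beta>)"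
    by (rule tendsto_Re)
  then have "(\<lambda>m. (real (m + 1))\<^sup>2 * planar (m + 1)) \<longlonglongrightarrow> \<beta>"
    by (simp only: Re_complex_of_real)
  then have "(\<lambda>m. (real m)\<^sup>2 * planar m) \<longlonglongrightarrow> \<beta>" by (rule LIMSEQ_offset)
  with \<beta> that show thesis by blast
qed

end

text \<open>Left-endpoint rule, one cell at a time. It will be used for the same function with mesh
  \<open>drift\<close> and with mesh 1.\<close>

lemma riemann_sum_lipschitz:
  fixes g :: "real \<Rightarrow> real"
  assumes L: "\<And>x y. \<bar>g x - g y\<bar> \<le> L * \<bar>x - y\<bar>" and h: "0 \<le> h"
  shows "\<bar>integral {a..a + real k * h} g - h * (\<Sum>i<k. g (a + real i * h))\<bar> \<le> real k * h\<^sup>2 * L"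
proof -
  have L0: "0 \<le> L" using L[of 0 1] by simp
  have cont: "continuous_on S g" for S
  proof (rule continuous_on_subset[OF lipschitz_on_continuous_on])
    show "L-lipschitz_on UNIV g" using L L0 by (intro lipschitz_onI) (auto simp: dist_real_def)
  qed simp
  have one: "\<bar>integral {u..u + h} g - h * g u\<bar> \<le> h\<^sup>2 * L" for u
  proof -
    have "integral {u..u + h} (\<lambda>x. g x - g u) = integral {u..u + h} g - integral {u..u + h} (\<lambda>x. g u)"
      by (rule Henstock_Kurzweil_Integration.integral_diff) (auto intro: integrable_continuous_real cont)
    also have "integral {u..u + h} (\<lambda>x. g u) = h * g u" using h by simp
    finally have "\<bar>integral {u..u + h} g - h * g u\<bar> = norm (integral {u..u + h} (\<lambda>x. g x - g u))" by simp
    also have "\<dots> \<le> (L * h) * (u + h - u)"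
    proof (rule integral_bound)
      show "continuous_on {u..u + h} (\<lambda>x. g x - g u)" by (intro continuous_intros cont)
      fix x assume "x \<in> {u..u + h}"
      then have "L * \<bar>x - u\<bar> \<le> L * h" using L0 by (intro mult_left_mono) auto
      then show "norm (g x - g u) \<le> L * h" using L[of x u] by simp
    qed (use h in simp)
    finally show ?thesis by (simp add: power2_eq_square mult_ac)
  qed
  show ?thesis
  proof (induction k)
    case (Suc k)
    let ?u = "a + real k * h"
    have "integral {a..?u} g + integral {?u..?u + h} g = integral {a..?u + h} g"
      by (rule Henstock_Kurzweil_Integration.integral_combine) (use h in \<open>auto intro: integrable_continuous_real cont\<close>)
    moreover have "a + real (Suc k) * h = ?u + h" by (simp add: algebra_simps)
    ultimately have "integral {a..a + real (Suc k) * h} g - h * (\<Sum>i<Suc k. g (a + real i * h))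
        = (integral {a..?u} g - h * (\<Sum>i<k. g (a + real i * h))) + (integral {?u..?u + h} g - h * g ?u)"
      by (simp add: algebra_simps)
    then have "\<bar>integral {a..a + real (Suc k) * h} g - h * (\<Sum>i<Suc k. g (a + real i * h))\<bar>
        \<le> real k * h\<^sup>2 * L + h\<^sup>2 * L"
      using Suc.IH one[of ?u] by linarith
    then show ?case by (simp add: algebra_simps)
  qed simp
qed

context cone_walk
begin

subsection \<open>Summation over the number of steps\<close>

text \<open>The Fourier integral extends \<open>curv\<close> to real times; then it can be compared at shifted
  times \<open>t + j * drift\<close> without rounding.\<close>

definition curvc :: "nat \<Rightarrow> real \<Rightarrow> real" where
  "curvc m t = Re (\<integral>\<theta>. phi \<theta> ^ m * (cis (- (fst \<theta> * t)) * complex_of_real (2 * (sin (ang \<theta> (shear 1)))\<^sup>2)) \<partial>torus)"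

lemma curvc_int: "curvc m (real_of_int N) = curv m N"
proof -
  let ?f = "\<lambda>w \<theta>. phi \<theta> ^ m * cis (- ang \<theta> w)"
  have i: "integrable torus (?f w)" for w
    by (rule torus_integrable[where B=1]) auto
  have "complex_of_real (curv m N) = (\<integral>\<theta>. ?f (N,0,0) \<theta> \<partial>torus) - ((\<integral>\<theta>. ?f (N,2,-2) \<theta> \<partial>torus) + (\<integral>\<theta>. ?f (N,-2,2) \<theta> \<partial>torus)) / 2"
    unfolding curv_def of_real_diff of_real_divide of_real_add pmf_steps_fourier by simp
  also have "\<dots> = (\<integral>\<theta>. ?f (N,0,0) \<theta> - (?f (N,2,-2) \<theta> + ?f (N,-2,2) \<theta>) / 2 \<partial>torus)"
    using i[of "(N,0,0)"] i[of "(N,2,-2)"] i[of "(N,-2,2)"]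
    by (subst Bochner_Integration.integral_diff) (simp_all only: Bochner_Integration.integral_add
      integral_divide_zero Bochner_Integration.integrable_add integrable_divide_zero)
  also have "\<dots> = (\<integral>\<theta>. phi \<theta> ^ m * (cis (- (fst \<theta> * real_of_int N)) * complex_of_real (2 * (sin (ang \<theta> (shear 1)))\<^sup>2)) \<partial>torus)"
  proof (rule Bochner_Integration.integral_cong[OF refl])
    fix \<theta> :: "real \<times> real \<times> real"
    define y where "y = ang \<theta> (shear 1)"
    define t where "t = fst \<theta> * real_of_int N"
    have e: "ang \<theta> (N,0,0) = t" "ang \<theta> (N,2,-2) = t - 2 * y" "ang \<theta> (N,-2,2) = t + 2 * y"
      by (simp_all add: ang_def y_def t_def shear_def)
    have c: "cis (- (t - 2 * y)) = cis (- t) * cis (2 * y)" "cis (- (t + 2 * y)) = cis (- t) * cis (- (2 * y))"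
      by (simp_all add: cis_mult)
    have "(cis (2 * y) + cis (- (2 * y))) / 2 = complex_of_real (cos (2 * y))"
      by (simp add: complex_eq_iff)
    also have "cos (2 * y) = 1 - 2 * (sin y)\<^sup>2" by (rule cos_double_sin)
    finally have "(cis (2 * y) + cis (- (2 * y))) / 2 = 1 - complex_of_real (2 * (sin y)\<^sup>2)" by simp
    moreover have "?f (N,0,0) \<theta> - (?f (N,2,-2) \<theta> + ?f (N,-2,2) \<theta>) / 2
        = phi \<theta> ^ m * (cis (- t) * (1 - (cis (2 * y) + cis (- (2 * y))) / 2))"
      unfolding e c by (simp add: algebra_simps add_divide_distrib)
    ultimately have "?f (N,0,0) \<theta> - (?f (N,2,-2) \<theta> + ?f (N,-2,2) \<theta>) / 2
        = phi \<theta> ^ m * (cis (- t) * (1 - (1 - complex_of_real (2 * (sin y)\<^sup>2))))"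
      by (simp only:)
    also have "1 - (1 - complex_of_real (2 * (sin y)\<^sup>2)) = complex_of_real (2 * (sin y)\<^sup>2)"
      by (rule diff_diff_eq2[THEN trans]) simp
    finally show "?f (N,0,0) \<theta> - (?f (N,2,-2) \<theta> + ?f (N,-2,2) \<theta>) / 2
        = phi \<theta> ^ m * (cis (- (fst \<theta> * real_of_int N)) * complex_of_real (2 * (sin (ang \<theta> (shear 1)))\<^sup>2))"
      unfolding y_def t_def .
  qed
  finally show ?thesis unfolding curvc_def by (metis Re_complex_of_real)
qed

text \<open>The extra factor subtracts the mean time of a step. After that all three coordinates are
  centred and the linear term of the expansion vanishes.\<close>

lemma norm_drifted_phi_le:
  obtains D where "0 \<le> D" "\<And>\<theta>. norm (phi \<theta> * cis (- (fst \<theta> * drift)) - 1) \<le> D * (mag \<theta>)\<^sup>2"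
proof
  let ?D = "measure_pmf.expectation p (\<lambda>s. (nrm s + drift)\<^sup>2)"
  show "0 \<le> ?D" by (rule integral_nonneg_AE) simp
  fix \<theta>
  define Y where "Y s = ang \<theta> s - fst \<theta> * drift" for s
  have iY: "integrable (measure_pmf p) Y" unfolding Y_def[abs_def] using integrable_ang[of \<theta>] by simp
  have EY: "measure_pmf.expectation p Y = 0"
  proof -
    have i: "integrable (measure_pmf p) (\<lambda>s. real_of_int (fst s))" "integrable (measure_pmf p) (\<lambda>s. real_of_int (fst (snd s)))"
      "integrable (measure_pmf p) (\<lambda>s. real_of_int (snd (snd s)))"
      by (rule integrable_le_nrm[where C=1 and B=0]; use abs_coord_le_nrm in simp)+
    then have "measure_pmf.expectation p (ang \<theta>) = fst \<theta> * drift"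
      unfolding ang_def[abs_def] by (simp add: expectation_coords drift_def)
    then show ?thesis unfolding Y_def[abs_def] using integrable_ang[of \<theta>] by simp
  qed
  have iY': "integrable (measure_pmf p) (\<lambda>s. \<i> * complex_of_real (Y s))" using iY by simp
  have iD: "integrable (measure_pmf p) (\<lambda>s. (nrm s + drift)\<^sup>2)"
    using integrable_nrm integrable_nrm_sq by (simp add: power2_sum)
  have EiY: "measure_pmf.expectation p (\<lambda>s. \<i> * complex_of_real (Y s)) = 0"
    by (simp only: integral_mult_right_zero integral_complex_of_real EY) simp
  have "phi \<theta> * cis (- (fst \<theta> * drift)) - 1 = measure_pmf.expectation p (\<lambda>s. cis (ang \<theta> s) * cis (- (fst \<theta> * drift))) - 1"
    unfolding phi_def by simp
  also have "\<dots> = measure_pmf.expectation p (\<lambda>s. cis (Y s)) - 1 - measure_pmf.expectation p (\<lambda>s. \<i> * complex_of_real (Y s))"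
    unfolding EiY by (simp add: cis_mult Y_def[abs_def])
  also have "\<dots> = measure_pmf.expectation p (\<lambda>s. cis (Y s) - 1 - \<i> * complex_of_real (Y s))"
    using iY' by simp
  also have "norm \<dots> \<le> measure_pmf.expectation p (\<lambda>s. norm (cis (Y s) - 1 - \<i> * complex_of_real (Y s)))"
    by (rule integral_norm_bound)
  also have "\<dots> \<le> measure_pmf.expectation p (\<lambda>s. (nrm s + drift)\<^sup>2 * (mag \<theta>)\<^sup>2)"
  proof (rule integral_mono')
    show "integrable (measure_pmf p) (\<lambda>s. (nrm s + drift)\<^sup>2 * (mag \<theta>)\<^sup>2)" using iD by simp
    fix s
    have d0: "0 \<le> drift" using one_le_drift by simp
    have "\<bar>fst \<theta>\<bar> * drift \<le> mag \<theta> * drift"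
      using d0 by (intro mult_right_mono) (simp_all add: mag_def)
    then have "\<bar>Y s\<bar> \<le> mag \<theta> * (nrm s + drift)"
      unfolding Y_def using abs_ang_le[of \<theta> s] d0 abs_triangle_ineq4[of "ang \<theta> s" "fst \<theta> * drift"]
      by (simp add: abs_mult distrib_left)
    then have "\<bar>Y s\<bar>\<^sup>2 \<le> (mag \<theta> * (nrm s + drift))\<^sup>2" by (rule power_mono) simp
    moreover have "norm (cis (Y s) - 1 - \<i> * complex_of_real (Y s)) \<le> (Y s)\<^sup>2 / 2"
      by (rule norm_cis_minus_linear_le)
    moreover have "(mag \<theta> * (nrm s + drift))\<^sup>2 = (nrm s + drift)\<^sup>2 * (mag \<theta>)\<^sup>2" by (simp add: power_mult_distrib)
    moreover have "0 \<le> (Y s)\<^sup>2" by simp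
    ultimately show "norm (cis (Y s) - 1 - \<i> * complex_of_real (Y s)) \<le> (nrm s + drift)\<^sup>2 * (mag \<theta>)\<^sup>2"
      unfolding power2_abs by linarith
  qed simp
  also have "\<dots> = ?D * (mag \<theta>)\<^sup>2" by simp
  finally show "norm (phi \<theta> * cis (- (fst \<theta> * drift)) - 1) \<le> ?D * (mag \<theta>)\<^sup>2" .
qed

text \<open>The squared sine is worth two factors \<open>mag\<close>, a shift of time a third.
  Trading \<open>j\<close> steps for \<open>j * drift\<close> units of time is worth two further
  factors, by \<open>norm_drifted_phi_le\<close>. Hence the powers 5, 6 and 7.\<close>

lemma curvc_bounds:
  obtains C where "0 \<le> C"
    "\<And>m t. 1 \<le> m \<Longrightarrow> \<bar>curvc m t\<bar> \<le> C / sqrt (real m) ^ 5"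
    "\<And>m t u. 1 \<le> m \<Longrightarrow> \<bar>curvc m t - curvc m u\<bar> \<le> C / sqrt (real m) ^ 6 * \<bar>t - u\<bar>"
    "\<And>m j t. 1 \<le> m \<Longrightarrow> \<bar>curvc m t - curvc (m + j) (t + real j * drift)\<bar> \<le> C * real j / sqrt (real m) ^ 7"
proof -
  obtain C2 where "osc_bound 2 C2" using osc_bound_ex by blast
  note C2 = osc_boundD[OF this]
  obtain C3 where "osc_bound 3 C3" using osc_bound_ex by blast
  note C3 = osc_boundD[OF this]
  obtain C4 where "osc_bound 4 C4" using osc_bound_ex by blast
  note C4 = osc_boundD[OF this]
  obtain D where D: "0 \<le> D" "\<And>\<theta>. norm (phi \<theta> * cis (- (fst \<theta> * drift)) - 1) \<le> D * (mag \<theta>)\<^sup>2"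
    by (rule norm_drifted_phi_le, rule that)
  define W where "W \<theta> = complex_of_real (2 * (sin (ang \<theta> (shear 1)))\<^sup>2)" for \<theta>
  have [measurable]: "W \<in> borel_measurable (borel \<Otimes>\<^sub>M (borel \<Otimes>\<^sub>M borel))" unfolding W_def[abs_def] by measurable
  have W: "norm (W \<theta>) \<le> 8 * (mag \<theta>)\<^sup>2" "norm (W \<theta>) \<le> 2" for \<theta>
  proof -
    have "\<bar>sin (ang \<theta> (shear 1))\<bar> \<le> 2 * mag \<theta>"
      by (rule order_trans[OF abs_sin_le_abs abs_ang_shear_le])
    then have "\<bar>sin (ang \<theta> (shear 1))\<bar>\<^sup>2 \<le> (2 * mag \<theta>)\<^sup>2" by (rule power_mono) simp
    then show "norm (W \<theta>) \<le> 8 * (mag \<theta>)\<^sup>2" by (simp add: W_def norm_mult power_mult_distrib norm_power)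
    have "(sin (ang \<theta> (shear 1)))\<^sup>2 \<le> 1" by (simp add: abs_square_le_1)
    then show "norm (W \<theta>) \<le> 2" by (simp add: W_def norm_mult norm_power)
  qed
  have cdef: "curvc m t = Re (\<integral>\<theta>. phi \<theta> ^ m * (cis (- (fst \<theta> * t)) * W \<theta>) \<partial>torus)" for m t
    by (simp add: curvc_def W_def)
  have i: "integrable torus (\<lambda>\<theta>. phi \<theta> ^ m * (cis (- (fst \<theta> * t)) * W \<theta>))" for m t
    by (rule torus_integrable[where B=2]) (measurable, simp add: norm_mult W(2))
  have 1: "\<bar>curvc m t\<bar> \<le> 8 * C2 / sqrt (real m) ^ (3 + 2)" if m: "1 \<le> m" for m t
    unfolding cdef by (rule order_trans[OF abs_Re_le_cmod], rule C2(2)[OF m]) (use W(1) in \<open>simp_all add: norm_mult\<close>)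
  have 2: "\<bar>curvc m t - curvc m u\<bar> \<le> (8 * \<bar>t - u\<bar>) * C3 / sqrt (real m) ^ (3 + 3)" if m: "1 \<le> m" for m t u
  proof -
    have "curvc m t - curvc m u = Re (\<integral>\<theta>. phi \<theta> ^ m * ((cis (- (fst \<theta> * t)) - cis (- (fst \<theta> * u))) * W \<theta>) \<partial>torus)"
      unfolding cdef minus_complex.sel(1)[symmetric]
      by (subst Bochner_Integration.integral_diff[OF i i, symmetric]) (simp add: algebra_simps)
    also have "\<bar>\<dots>\<bar> \<le> norm (\<integral>\<theta>. phi \<theta> ^ m * ((cis (- (fst \<theta> * t)) - cis (- (fst \<theta> * u))) * W \<theta>) \<partial>torus)"
      by (rule abs_Re_le_cmod)
    also have "\<dots> \<le> (8 * \<bar>t - u\<bar>) * C3 / sqrt (real m) ^ (3 + 3)"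
    proof (rule C3(2)[OF m])
      fix \<theta> :: "real \<times> real \<times> real"
      have "cis (- (fst \<theta> * t)) - cis (- (fst \<theta> * u)) = cis (- (fst \<theta> * u)) * (cis (- (fst \<theta> * (t - u))) - 1)"
        by (simp add: cis_mult algebra_simps)
      then have "norm (cis (- (fst \<theta> * t)) - cis (- (fst \<theta> * u))) = norm (cis (- (fst \<theta> * (t - u))) - 1)"
        by (simp add: norm_mult)
      also have "\<dots> \<le> \<bar>- (fst \<theta> * (t - u))\<bar>" by (rule norm_cis_minus_one_le)
      also have "\<dots> \<le> mag \<theta> * \<bar>t - u\<bar>" by (simp add: abs_mult mag_def mult_right_mono)
      finally have "norm ((cis (- (fst \<theta> * t)) - cis (- (fst \<theta> * u))) * W \<theta>) \<le> (mag \<theta> * \<bar>t - u\<bar>) * (8 * (mag \<theta>)\<^sup>2)"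
        unfolding norm_mult by (intro mult_mono W) auto
      then show "norm ((cis (- (fst \<theta> * t)) - cis (- (fst \<theta> * u))) * W \<theta>) \<le> (8 * \<bar>t - u\<bar>) * mag \<theta> ^ 3"
        by (simp add: power3_eq_cube power2_eq_square mult_ac)
    qed simp
    finally show ?thesis .
  qed
  have 3: "\<bar>curvc m t - curvc (m + j) (t + real j * drift)\<bar> \<le> (8 * (real j * D)) * C4 / sqrt (real m) ^ (3 + 4)"
    if m: "1 \<le> m" for m j t
  proof -
    define z where "z \<theta> = phi \<theta> * cis (- (fst \<theta> * drift))" for \<theta>
    have zj: "phi \<theta> ^ (m + j) * (cis (- (fst \<theta> * (t + real j * drift))) * W \<theta>)
        = phi \<theta> ^ m * (cis (- (fst \<theta> * t)) * z \<theta> ^ j * W \<theta>)" for \<theta>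
    proof -
      have "cis (- (fst \<theta> * (t + real j * drift))) = cis (- (fst \<theta> * t)) * cis (- (fst \<theta> * drift)) ^ j"
        unfolding Complex.DeMoivre cis_mult by (rule arg_cong[where f=cis]) (simp add: algebra_simps)
      then show ?thesis by (simp add: z_def power_mult_distrib power_add mult_ac)
    qed
    have "curvc m t - curvc (m + j) (t + real j * drift)
        = Re (\<integral>\<theta>. phi \<theta> ^ m * (cis (- (fst \<theta> * t)) * ((1 - z \<theta> ^ j) * W \<theta>)) \<partial>torus)"
      unfolding cdef minus_complex.sel(1)[symmetric]
      by (subst Bochner_Integration.integral_diff[OF i i, symmetric]) (simp only: zj, simp add: algebra_simps)
    also have "\<bar>\<dots>\<bar> \<le> norm (\<integral>\<theta>. phi \<theta> ^ m * (cis (- (fst \<theta> * t)) * ((1 - z \<theta> ^ j) * W \<theta>)) \<partial>torus)"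
      by (rule abs_Re_le_cmod)
    also have "\<dots> \<le> (8 * (real j * D)) * C4 / sqrt (real m) ^ (3 + 4)"
    proof (rule C4(2)[OF m])
      show "0 \<le> 8 * (real j * D)" using D(1) by simp
      fix \<theta> :: "real \<times> real \<times> real"
      have "norm (z \<theta>) \<le> 1" by (simp add: z_def norm_mult norm_phi_le_1)
      then have "norm (1 - z \<theta> ^ j) \<le> real j * norm (z \<theta> - 1)" by (rule norm_one_minus_power_le)
      also have "\<dots> \<le> real j * (D * (mag \<theta>)\<^sup>2)" unfolding z_def by (intro mult_left_mono D) simp
      finally have "norm (cis (- (fst \<theta> * t)) * ((1 - z \<theta> ^ j) * W \<theta>)) \<le> (real j * (D * (mag \<theta>)\<^sup>2)) * (8 * (mag \<theta>)\<^sup>2)"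
        unfolding norm_mult norm_cis mult_1 by (intro mult_mono W) (use D(1) in auto)
      then show "norm (cis (- (fst \<theta> * t)) * ((1 - z \<theta> ^ j) * W \<theta>)) \<le> 8 * (real j * D) * mag \<theta> ^ 4"
        by (simp add: power4_eq_xxxx power2_eq_square mult_ac)
    qed
    finally show ?thesis .
  qed
  let ?C = "8 * C2 + 8 * C3 + 8 * D * C4"
  have nn: "0 \<le> C2" "0 \<le> C3" "0 \<le> D * C4" using C2(1) C3(1) C4(1) D(1) by auto
  show thesis
  proof (rule that[of ?C])
    show "0 \<le> ?C" using nn by simp
    show "\<bar>curvc m t\<bar> \<le> ?C / sqrt (real m) ^ 5" if "1 \<le> m" for m t
    proof -
      have "8 * C2 / sqrt (real m) ^ 5 \<le> ?C / sqrt (real m) ^ 5" using nn by (intro divide_right_mono) auto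
      with 1[OF that, of t] show ?thesis by simp
    qed
    show "\<bar>curvc m t - curvc m u\<bar> \<le> ?C / sqrt (real m) ^ 6 * \<bar>t - u\<bar>" if "1 \<le> m" for m t u
    proof -
      have "8 * C3 / sqrt (real m) ^ 6 * \<bar>t - u\<bar> \<le> ?C / sqrt (real m) ^ 6 * \<bar>t - u\<bar>"
        using nn by (intro mult_right_mono divide_right_mono) auto
      with 2[OF that, of t u] show ?thesis by (simp add: mult_ac)
    qed
    show "\<bar>curvc m t - curvc (m + j) (t + real j * drift)\<bar> \<le> ?C * real j / sqrt (real m) ^ 7" if "1 \<le> m" for m j t
    proof -
      have "8 * D * C4 * real j / sqrt (real m) ^ 7 \<le> ?C * real j / sqrt (real m) ^ 7"
        using nn by (intro mult_right_mono divide_right_mono) auto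
      with 3[OF that, of t j] show ?thesis by (simp add: mult_ac)
    qed
  qed
qed

text \<open>Summing over time turns point masses into masses of the space marginal; whatever the
  time window misses lies outside the box. The factor 2 is the total absolute weight of the three
  terms of \<open>curv\<close>.\<close>

lemma planar_curv_le:
  assumes F: "\<And>s. s \<in> centred_box m r \<Longrightarrow> a \<le> fst s \<and> fst s < a + int k"
  shows "\<bar>(\<Sum>i<k. curv m (a + int i)) - planar m\<bar> \<le> 2 * measure_pmf.prob (steps p m) (- centred_box m r)"
proof -
  let ?P = "measure_pmf.prob (steps p m)" and ?T = "measure_pmf.prob (steps p m) (- centred_box m r)"
  have one: "\<bar>(\<Sum>i<k. pmf (steps p m) (a + int i, w)) - ?P {s. snd s = w}\<bar> \<le> ?T" for w
  proof -
    let ?A = "(\<lambda>i. (a + int i, w)) ` {..<k}"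
    have "(\<Sum>i<k. pmf (steps p m) (a + int i, w)) = ?P ?A"
      by (subst measure_measure_pmf_finite) (auto simp: sum.reindex inj_on_def)
    moreover have "?P {s. snd s = w} = ?P ?A + ?P ({s. snd s = w} - ?A)"
    proof -
      have "{s. snd s = w} = ?A \<union> ({s. snd s = w} - ?A)" by auto
      then show ?thesis by (metis Diff_disjoint measure_pmf.finite_measure_Union sets_measure_pmf UNIV_I)
    qed
    moreover have "?P ({s. snd s = w} - ?A) \<le> ?T"
    proof (rule measure_pmf.finite_measure_mono)
      show "{s. snd s = w} - ?A \<subseteq> - centred_box m r"
      proof
        fix s assume s: "s \<in> {s. snd s = w} - ?A"
        show "s \<in> - centred_box m r"
        proof
          assume "s \<in> centred_box m r"
          from F[OF this] have "fst s = a + int (nat (fst s - a))" "nat (fst s - a) < k" by auto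
          then have "s \<in> ?A" using s by (intro image_eqI[of _ _ "nat (fst s - a)"]) (auto simp: prod_eq_iff)
          with s show False by simp
        qed
      qed
    qed simp
    moreover have "0 \<le> ?P ({s. snd s = w} - ?A)" by simp
    ultimately show ?thesis by linarith
  qed
  let ?S = "\<lambda>w. \<Sum>i<k. pmf (steps p m) (a + int i, w)"
  have "(\<Sum>i<k. curv m (a + int i)) = ?S (0, 0) - (?S (2, - 2) + ?S (- 2, 2)) / 2"
    unfolding curv_def by (simp add: sum_subtractf sum.distrib sum_divide_distrib[symmetric])
  moreover have "\<bar>(x1 - (x2 + x3) / 2) - (y1 - (y2 + y3) / 2)\<bar> \<le> 2 * t"
    if "\<bar>x1 - y1\<bar> \<le> t" "\<bar>x2 - y2\<bar> \<le> t" "\<bar>x3 - y3\<bar> \<le> t" for x1 x2 x3 y1 y2 y3 t :: real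
    using that unfolding add_divide_distrib by linarith
  ultimately show ?thesis unfolding planar_def using one by simp
qed

text \<open>For \<open>n\<close> near \<open>n0\<close>, \<open>curv n N\<close> is close to the
  curvature at \<open>n0\<close> steps and time \<open>N + (n0 - n) * drift\<close>. The sum over
  \<open>n\<close> is thus a Riemann sum with mesh \<open>drift\<close> of an integral over time,
  while \<open>planar n0\<close> is nearly the Riemann sum with mesh 1 of the same integral; this is
  where the division by \<open>drift\<close> comes from.\<close>

lemma curv_window:
  obtains C where "0 \<le> C"
    "\<And>N n0 J. 1 \<le> J \<Longrightarrow> J < n0 \<Longrightarrow> real n0 * drift \<le> real N \<Longrightarrow> real N < (real n0 + 1) * drift \<Longrightarrow>
      \<bar>(\<Sum>n=n0-J..n0+J. curv n (int N)) - planar n0 / drift\<bar>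
      \<le> C * ((2 * real J + 1) * real J / sqrt (real (n0 - J)) ^ 7 + (2 * real J + 1) / sqrt (real n0) ^ 6
          + 1 / sqrt (real n0) ^ 5)
        + 2 * measure_pmf.prob (steps p n0) (- centred_box n0 (real J - 1))"
proof -
  obtain C where C: "0 \<le> C"
    "\<And>m t. 1 \<le> m \<Longrightarrow> \<bar>curvc m t\<bar> \<le> C / sqrt (real m) ^ 5"
    "\<And>m t u. 1 \<le> m \<Longrightarrow> \<bar>curvc m t - curvc m u\<bar> \<le> C / sqrt (real m) ^ 6 * \<bar>t - u\<bar>"
    "\<And>m j t. 1 \<le> m \<Longrightarrow> \<bar>curvc m t - curvc (m + j) (t + real j * drift)\<bar> \<le> C * real j / sqrt (real m) ^ 7"
    by (rule curvc_bounds, rule that)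
  note \<mu> = one_le_drift
  have main: "\<bar>(\<Sum>n=n0-J..n0+J. curv n (int N)) - planar n0 / drift\<bar>
      \<le> (2 * real J + 1) * (C * real J / sqrt (real (n0 - J)) ^ 7)
        + ((2 * real J + 1) * (drift\<^sup>2 + drift + 2) * (C / sqrt (real n0) ^ 6) + 3 * (C / sqrt (real n0) ^ 5))
        + 2 * measure_pmf.prob (steps p n0) (- centred_box n0 (real J - 1))"
    if J: "1 \<le> J" "J < n0" and N: "real n0 * drift \<le> real N" "real N < (real n0 + 1) * drift" for N n0 J
  proof -
    define g where "g = curvc n0"
    \<comment> \<open>\<open>A\<close> is the shifted time for the largest number of steps
      \<open>n0 + J\<close>, and the \<open>K\<close> sample points with spacing
      \<open>drift\<close> fill the interval from \<open>A\<close> to \<open>E\<close>. The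
      \<open>k\<close> integer cells starting at \<open>a\<close> cover it; rounding leaves at most
      1 unit on the left and 2 on the right, whence the term \<open>3 * B\<close>.\<close>
    define A where "A = real N - real J * drift"
    define K where "K = 2 * J + 1"
    define E where "E = A + real K * drift"
    define L where "L = C / sqrt (real n0) ^ 6"
    define B where "B = C / sqrt (real n0) ^ 5"
    define a where "a = \<lfloor>A\<rfloor>"
    define k where "k = nat \<lceil>real K * drift\<rceil> + 1"
    let ?T = "measure_pmf.prob (steps p n0) (- centred_box n0 (real J - 1))"
    let ?G = "\<Sum>i<K. g (A + real i * drift)"
    have n0: "1 \<le> n0" using J by simp
    have L0: "0 \<le> L" "0 \<le> B" using C(1) by (auto simp: L_def B_def)
    have gL: "\<bar>g x - g y\<bar> \<le> L * \<bar>x - y\<bar>" for x y unfolding g_def L_def by (rule C(3)[OF n0])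
    have gB: "\<bar>g x\<bar> \<le> B" for x unfolding g_def B_def by (rule C(2)[OF n0])
    have cont: "continuous_on S g" for S
    proof (rule continuous_on_subset[OF lipschitz_on_continuous_on])
      show "L-lipschitz_on UNIV g" using gL L0 by (intro lipschitz_onI) (auto simp: dist_real_def)
    qed simp
    have S: "\<bar>(\<Sum>n=n0-J..n0+J. curv n (int N)) - ?G\<bar> \<le> (2 * real J + 1) * (C * real J / sqrt (real (n0 - J)) ^ 7)"
    proof -
      have "(\<Sum>n=n0-J..n0+J. curv n (int N)) = (\<Sum>i<K. curv (n0 + J - i) (int N))"
        by (rule sum.reindex_bij_witness[of _ "\<lambda>i. n0 + J - i" "\<lambda>n. n0 + J - n"]) (use J in \<open>auto simp: K_def\<close>)
      then have "\<bar>(\<Sum>n=n0-J..n0+J. curv n (int N)) - ?G\<bar> = \<bar>\<Sum>i<K. curv (n0 + J - i) (int N) - g (A + real i * drift)\<bar>"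
        by (simp add: sum_subtractf)
      also have "\<dots> \<le> (\<Sum>i<K. \<bar>curv (n0 + J - i) (int N) - g (A + real i * drift)\<bar>)" by (rule sum_abs)
      also have "\<dots> \<le> (\<Sum>i<K. C * real J / sqrt (real (n0 - J)) ^ 7)"
      proof (rule sum_mono)
        fix i assume "i \<in> {..<K}"
        then have i: "i < 2 * J + 1" by (simp add: K_def)
        have mono: "C * real j / sqrt (real m) ^ 7 \<le> C * real J / sqrt (real (n0 - J)) ^ 7"
          if "j \<le> J" "n0 - J \<le> m" for j m
          using that J C(1) by (intro frac_le mult_left_mono power_mono) auto
        have cN: "curv n (int N) = curvc n (real N)" for n using curvc_int[of n "int N"] by simp
        show "\<bar>curv (n0 + J - i) (int N) - g (A + real i * drift)\<bar> \<le> C * real J / sqrt (real (n0 - J)) ^ 7"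
        \<comment> \<open>The comparison in \<open>curvc_bounds\<close> only adds steps, so it
          starts from the smaller number of steps: from \<open>n0\<close> in the first case, from
          \<open>n0 - j\<close> in the second.\<close>
        proof (cases "i \<le> J")
          case True
          define j where "j = J - i"
          have j: "n0 + J - i = n0 + j" "A + real i * drift + real j * drift = real N"
            using True by (simp_all add: j_def A_def algebra_simps)
          have "\<bar>curvc n0 (A + real i * drift) - curvc (n0 + j) (A + real i * drift + real j * drift)\<bar> \<le> C * real j / sqrt (real n0) ^ 7"
            by (rule C(4)[OF n0])
          also have "\<dots> \<le> C * real J / sqrt (real (n0 - J)) ^ 7" by (rule mono) (simp_all add: j_def)
          finally show ?thesis unfolding j cN g_def by (simp add: abs_minus_commute)
        next
          case False
          define j where "j = i - J"
          have jJ: "j \<le> J" using i by (simp add: j_def)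
          have j: "n0 + J - i = n0 - j" "real N + real j * drift = A + real i * drift" "n0 - j + j = n0"
            using False J jJ by (simp_all add: j_def A_def algebra_simps of_nat_diff)
          have "\<bar>curvc (n0 - j) (real N) - curvc (n0 - j + j) (real N + real j * drift)\<bar> \<le> C * real j / sqrt (real (n0 - j)) ^ 7"
            by (rule C(4)) (use J jJ in simp)
          also have "\<dots> \<le> C * real J / sqrt (real (n0 - J)) ^ 7" by (rule mono) (use jJ in auto)
          finally show ?thesis unfolding j cN g_def .
        qed
      qed
      also have "\<dots> = (2 * real J + 1) * (C * real J / sqrt (real (n0 - J)) ^ 7)"
        by (simp add: K_def add.commute)
      finally show ?thesis .
    qed
    have R1: "\<bar>integral {A..E} g - drift * ?G\<bar> \<le> real K * drift\<^sup>2 * L"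
      unfolding E_def by (rule riemann_sum_lipschitz[OF gL]) (use \<mu> in simp)
    have R2: "\<bar>integral {real_of_int a..real_of_int a + real k} g - (\<Sum>i<k. g (real_of_int a + real i))\<bar> \<le> real k * L"
      using riemann_sum_lipschitz[OF gL, of 1 "real_of_int a" k] by simp
    have kK: "real K * drift + 1 \<le> real k" "real k \<le> real K * drift + 2"
    proof -
      have "0 \<le> real K * drift" using \<mu> by simp
      then show "real K * drift + 1 \<le> real k" "real k \<le> real K * drift + 2" unfolding k_def by linarith+
    qed
    have aA: "real_of_int a \<le> A" "A \<le> real_of_int a + 1" unfolding a_def by linarith+
    have AE: "A \<le> E" "E \<le> real_of_int a + real k" "real_of_int a + real k \<le> E + 2"
    proof -
      have "0 \<le> real K * drift" using \<mu> by simp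
      then show "A \<le> E" "E \<le> real_of_int a + real k" "real_of_int a + real k \<le> E + 2"
        using kK aA unfolding E_def by linarith+
    qed
    have int: "integral {real_of_int a..A} g + integral {A..E} g + integral {E..real_of_int a + real k} g
        = integral {real_of_int a..real_of_int a + real k} g"
    proof -
      have "integral {A..E} g + integral {E..real_of_int a + real k} g = integral {A..real_of_int a + real k} g"
        by (rule Henstock_Kurzweil_Integration.integral_combine) (use AE in \<open>auto intro: integrable_continuous_real cont\<close>)
      moreover have "integral {real_of_int a..A} g + integral {A..real_of_int a + real k} g = integral {real_of_int a..real_of_int a + real k} g"
        by (rule Henstock_Kurzweil_Integration.integral_combine) (use aA AE in \<open>auto intro: integrable_continuous_real cont\<close>)
      ultimately show ?thesis by simp
    qed
    have small: "\<bar>integral {x..y} g\<bar> \<le> B * (y - x)" if "x \<le> y" for x y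
      using integral_bound[OF that cont, of B] gB by simp
    have "\<bar>integral {real_of_int a..A} g\<bar> \<le> B * 1" "\<bar>integral {E..real_of_int a + real k} g\<bar> \<le> B * 2"
      using order_trans[OF small[OF aA(1)] mult_left_mono[OF _ L0(2)], of 1]
        order_trans[OF small[OF AE(2)] mult_left_mono[OF _ L0(2)], of 2] aA AE by simp_all
    with int have I: "\<bar>integral {A..E} g - integral {real_of_int a..real_of_int a + real k} g\<bar> \<le> 3 * B" by linarith
    have P: "\<bar>(\<Sum>i<k. g (real_of_int a + real i)) - planar n0\<bar> \<le> 2 * ?T"
    proof -
      have "g (real_of_int a + real i) = curv n0 (a + int i)" for i
        unfolding g_def using curvc_int[of n0 "a + int i"] by simp
      moreover have "\<bar>(\<Sum>i<k. curv n0 (a + int i)) - planar n0\<bar> \<le> 2 * ?T"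
      proof (rule planar_curv_le)
        fix s assume "s \<in> centred_box n0 (real J - 1)"
        then have s: "\<bar>real_of_int (fst s) - real n0 * drift\<bar> < real J - 1" by (simp add: centred_box_def)
        \<comment> \<open>\<open>N\<close> may exceed \<open>n0 * drift\<close> by almost one
          \<open>drift\<close>, so the box radius \<open>J - 1\<close> rather than \<open>J\<close>
          guarantees that the box lies in the time window.\<close>
        have Jm: "real J - 1 \<le> (real J - 1) * drift"
          using J \<mu> mult_left_mono[of 1 drift "real J - 1"] by simp
        have "A < real_of_int (fst s)"
          using s N Jm unfolding A_def distrib_right left_diff_distrib by linarith
        moreover have "real_of_int (fst s) < real_of_int a + real k"
        proof -
          have "E = real N + (real J - 1) * drift + 2 * drift" by (simp add: E_def A_def K_def algebra_simps)
          then have "real_of_int (fst s) < E" using s N Jm \<mu> by linarith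
          then show ?thesis using AE by linarith
        qed
        ultimately show "a \<le> fst s \<and> fst s < a + int k" using aA by linarith
      qed
      ultimately show ?thesis by simp
    qed
    have "\<bar>drift * ?G - planar n0\<bar> \<le> real K * drift\<^sup>2 * L + real k * L + 3 * B + 2 * ?T"
      using R1 R2 I P by linarith
    also have "real K * drift\<^sup>2 * L + real k * L \<le> real K * (drift\<^sup>2 + drift + 2) * L"
    proof -
      have "real k \<le> real K * (drift + 2)" using kK(2) by (simp add: K_def algebra_simps)
      then have "real k * L \<le> real K * (drift + 2) * L" using L0 by (intro mult_right_mono) auto
      then show ?thesis by (simp add: algebra_simps)
    qed
    finally have 1: "\<bar>drift * ?G - planar n0\<bar> \<le> real K * (drift\<^sup>2 + drift + 2) * L + 3 * B + 2 * ?T" by simp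
    have "?G - planar n0 / drift = (drift * ?G - planar n0) / drift" using \<mu> by (simp add: field_simps)
    then have "\<bar>?G - planar n0 / drift\<bar> = \<bar>drift * ?G - planar n0\<bar> / drift" using \<mu> by simp
    also have "\<dots> \<le> \<bar>drift * ?G - planar n0\<bar>"
      using \<mu> mult_left_mono[of 1 drift "\<bar>drift * ?G - planar n0\<bar>"] by (simp add: divide_le_eq)
    finally have "\<bar>?G - planar n0 / drift\<bar> \<le> real K * (drift\<^sup>2 + drift + 2) * L + 3 * B + 2 * ?T" using 1 by linarith
    moreover have KJ: "real K = 2 * real J + 1" by (simp add: K_def)
    ultimately have "\<bar>?G - planar n0 / drift\<bar> \<le> (2 * real J + 1) * (drift\<^sup>2 + drift + 2) * L + 3 * B + 2 * ?T"
      by (simp only: KJ)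
    then show ?thesis using S unfolding L_def[symmetric] B_def[symmetric] by linarith
  qed
  let ?D = "C * (drift\<^sup>2 + drift + 5)"
  show thesis
  proof (rule that[of ?D])
    have d: "0 \<le> drift\<^sup>2 + drift" using \<mu> by simp
    show "0 \<le> ?D" using C(1) d by simp
    fix N n0 J :: nat
    assume *: "1 \<le> J" "J < n0" "real n0 * drift \<le> real N" "real N < (real n0 + 1) * drift"
    let ?x = "(2 * real J + 1) * real J / sqrt (real (n0 - J)) ^ 7" and ?y = "(2 * real J + 1) / sqrt (real n0) ^ 6"
      and ?z = "1 / sqrt (real n0) ^ 5"
    have nn: "0 \<le> ?x" "0 \<le> ?y" "0 \<le> ?z" by simp_all
    have "C * ?x + C * (drift\<^sup>2 + drift + 2) * ?y + C * 3 * ?z \<le> ?D * ?x + ?D * ?y + ?D * ?z"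
      using C(1) d nn by (intro add_mono mult_right_mono) (auto simp: mult_le_cancel_left1 mult_left_mono)
    moreover have "(2 * real J + 1) * (C * real J / sqrt (real (n0 - J)) ^ 7)
        + ((2 * real J + 1) * (drift\<^sup>2 + drift + 2) * (C / sqrt (real n0) ^ 6) + 3 * (C / sqrt (real n0) ^ 5))
        = C * ?x + C * (drift\<^sup>2 + drift + 2) * ?y + C * 3 * ?z" by (simp add: mult_ac)
    ultimately show "\<bar>(\<Sum>n=n0-J..n0+J. curv n (int N)) - planar n0 / drift\<bar>
      \<le> ?D * (?x + ?y + ?z) + 2 * measure_pmf.prob (steps p n0) (- centred_box n0 (real J - 1))"
      using main[OF *] unfolding distrib_left[of ?D] by linarith
  qed
qed

end

section \<open>The window of step numbers that can reach time \<open>N\<close>\<close>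

lemma div_sqrt_scale_le:
  assumes "0 < N" "0 < s" "real N \<le> s\<^sup>2 * real m" "0 \<le> C"
  shows "C / sqrt (real m) ^ k \<le> s ^ k * C / sqrt (real N) ^ k"
proof -
  have m: "0 < real m"
  proof (rule ccontr)
    assume "\<not> 0 < real m"
    then show False using assms by simp
  qed
  have "sqrt (real N) \<le> sqrt (s\<^sup>2 * real m)" using assms by simp
  then have "sqrt (real N) \<le> s * sqrt (real m)" using assms by (simp add: real_sqrt_mult)
  then have "sqrt (real N) ^ k \<le> (s * sqrt (real m)) ^ k" by (rule power_mono) simp
  then have "C * sqrt (real N) ^ k \<le> C * (s ^ k * sqrt (real m) ^ k)"
    using assms(4) by (intro mult_left_mono) (simp_all add: power_mult_distrib)
  then show ?thesis using assms m by (simp add: field_simps)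
qed

text \<open>Larger than \<open>sqrt N\<close> by \<open>(ln N)^2\<close>, so that a tail exponential
  in \<open>spread N / sqrt N\<close> decays faster than every power of \<open>N\<close>.\<close>

definition spread :: "nat \<Rightarrow> real" where "spread N = sqrt (real N) * (ln (real N))\<^sup>2"

definition half_width :: "nat \<Rightarrow> nat" where "half_width N = nat \<lceil>spread N\<rceil>"

lemma spread_nonneg: "0 \<le> spread N"
  by (simp add: spread_def)

lemma half_width_bounds: "spread N \<le> real (half_width N)" "real (half_width N) \<le> spread N + 1"
  unfolding half_width_def using spread_nonneg[of N] by linarith+

context cone_walk
begin

definition centre :: "nat \<Rightarrow> nat" where "centre N = nat \<lfloor>real N / drift\<rfloor>"

lemma centre_bounds: "real (centre N) * drift \<le> real N" "real N < (real (centre N) + 1) * drift"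
proof -
  have d: "0 < drift" using one_le_drift by simp
  have "0 \<le> real N / drift" using d by simp
  then have "real (centre N) \<le> real N / drift" "real N / drift < real (centre N) + 1"
    unfolding centre_def by linarith+
  then show "real (centre N) * drift \<le> real N" "real N < (real (centre N) + 1) * drift"
    using d by (simp_all add: field_simps)
qed

text \<open>The last inequality is the important one: even the smallest number of steps in the
  window is comparable to \<open>N\<close>, so powers of \<open>n\<close> may be replaced by powers
  of \<open>N\<close>.\<close>

lemma eventually_window:
  "\<forall>\<^sub>F N in sequentially. 1 \<le> half_width N \<and> half_width N < centre N \<and> centre N \<le> N \<and> half_width N \<le> N
    \<and> real N \<le> 4 * drift * real (centre N - half_width N)"
proof -
  note \<mu> = one_le_drift
  have "(\<lambda>N. (spread N + 2) / real N) \<longlonglongrightarrow> 0" unfolding spread_def by real_asymp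
  then have "\<forall>\<^sub>F N in sequentially. (spread N + 2) / real N < 3 / (4 * drift)"
    by (rule order_tendstoD) (use \<mu> in simp)
  moreover have "\<forall>\<^sub>F N in sequentially. 1 \<le> spread N" unfolding spread_def by real_asymp
  ultimately show ?thesis
    using eventually_gt_at_top[of 0]
  proof eventually_elim
    case (elim N)
    let ?h = "half_width N" and ?c = "centre N"
    have N: "0 < real N" using elim by simp
    have sp: "spread N + 2 < 3 / (4 * drift) * real N" using elim(1) N by (simp add: divide_less_eq)
    have "3 / (4 * drift) * real N = 3 / 4 * (real N / drift)" by simp
    with sp have sp: "spread N + 2 < 3 / 4 * (real N / drift)" by simp
    have cN: "real N / drift < real ?c + 1" using centre_bounds(2)[of N] \<mu> by (simp add: divide_less_eq)
    have Nd: "real N / drift \<le> real N" using \<mu> N by (simp add: divide_le_eq mult_le_cancel_left1)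
    have 1: "1 \<le> ?h" using elim(2) half_width_bounds(1)[of N] by linarith
    have diff: "1 / 4 * (real N / drift) < real ?c - real ?h" using sp cN half_width_bounds(2)[of N] by linarith
    moreover have "0 \<le> real N / drift" using \<mu> by simp
    ultimately have hc: "?h < ?c" by linarith
    have "1 / 4 * (real N / drift) \<le> real (?c - ?h)" using diff hc by (simp add: of_nat_diff)
    then have 4: "real N \<le> 4 * drift * real (?c - ?h)" using \<mu> by (simp add: field_simps)
    have "real ?c * 1 \<le> real ?c * drift" using \<mu> by (intro mult_left_mono) auto
    then have cN': "?c \<le> N" using centre_bounds(1)[of N] by linarith
    show ?case using 1 hc cN' 4 by simp
  qed
qed

lemma centre_ratio: "(\<lambda>N. real (centre N) / real N) \<longlonglongrightarrow> 1 / drift"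
proof -
  note \<mu> = one_le_drift
  have "(\<lambda>N. real (centre N) / real N - 1 / drift) \<longlonglongrightarrow> 0"
  proof (rule Lim_null_comparison)
    show "\<forall>\<^sub>F N in sequentially. norm (real (centre N) / real N - 1 / drift) \<le> 1 / real N"
      using eventually_gt_at_top[of 0]
    proof eventually_elim
      case (elim N)
      have "real (centre N) \<le> real N / drift" "real N / drift < real (centre N) + 1"
        using centre_bounds[of N] \<mu> by (simp_all add: field_simps)
      then have "\<bar>real (centre N) - real N / drift\<bar> \<le> 1" by linarith
      then have "\<bar>real (centre N) - real N / drift\<bar> / real N \<le> 1 / real N" by (rule divide_right_mono) simp
      moreover have "real (centre N) / real N - 1 / drift = (real (centre N) - real N / drift) / real N"
        using elim by (simp add: diff_divide_distrib)
      ultimately show ?case by simp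
    qed
    show "(\<lambda>N. 1 / real N) \<longlonglongrightarrow> 0" by real_asymp
  qed
  then show ?thesis by (simp add: LIM_zero_iff)
qed

definition curv_sum :: "nat \<Rightarrow> real" where
  "curv_sum N = (\<Sum>n=centre N - half_width N..centre N + half_width N. curv n (int N))"

text \<open>\<open>N\<close> is asymptotically \<open>drift\<close> times \<open>centre N\<close>,
  so \<open>planar (centre N) / drift\<close> is of order \<open>N^-2\<close> with constant
  \<open>\<beta> * drift\<close>.\<close>

lemma curv_sum_limit:
  obtains c where "0 < c" "(\<lambda>N. (real N)\<^sup>2 * curv_sum N) \<longlonglongrightarrow> c"
proof -
  obtain D where D: "0 \<le> D"
    "\<And>N n0 J. 1 \<le> J \<Longrightarrow> J < n0 \<Longrightarrow> real n0 * drift \<le> real N \<Longrightarrow> real N < (real n0 + 1) * drift \<Longrightarrow>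
      \<bar>(\<Sum>n=n0-J..n0+J. curv n (int N)) - planar n0 / drift\<bar>
      \<le> D * ((2 * real J + 1) * real J / sqrt (real (n0 - J)) ^ 7 + (2 * real J + 1) / sqrt (real n0) ^ 6
          + 1 / sqrt (real n0) ^ 5)
        + 2 * measure_pmf.prob (steps p n0) (- centred_box n0 (real J - 1))"
    by (rule curv_window, rule that)
  obtain cb Cb where Cb: "0 < cb" "0 \<le> Cb"
    "\<And>n R. 1 \<le> n \<Longrightarrow> 0 \<le> R \<Longrightarrow>
      measure_pmf.prob (steps p n) (- centred_box n R) \<le> Cb * exp (- cb * (R / sqrt (real n)))"
    by (rule box_deviation, rule that)
  obtain \<beta> where \<beta>: "0 < \<beta>" "(\<lambda>m. (real m)\<^sup>2 * planar m) \<longlonglongrightarrow> \<beta>"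
    by (rule planar_limit, rule that)
  note \<mu> = one_le_drift
  \<comment> \<open>The square of \<open>s\<close> is \<open>4 * drift\<close>, the ratio in
    \<open>eventually_window\<close>.\<close>
  define s where "s = 2 * sqrt drift"
  have s: "0 < s" "s\<^sup>2 = 4 * drift" using \<mu> by (simp_all add: s_def power_mult_distrib)
  define f1 where "f1 N = (real N)\<^sup>2 * ((2 * (sqrt (real N) * (ln (real N))\<^sup>2 + 1) + 1) * (sqrt (real N) * (ln (real N))\<^sup>2 + 1) / sqrt (real N) ^ 7)" for N
  define f2 where "f2 N = (real N)\<^sup>2 * ((2 * (sqrt (real N) * (ln (real N))\<^sup>2 + 1) + 1) / sqrt (real N) ^ 6)" for N
  define f3 where "f3 N = (real N)\<^sup>2 * (1 / sqrt (real N) ^ 5)" for N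
  define f4 where "f4 N = (real N)\<^sup>2 * exp (- cb * ((sqrt (real N) * (ln (real N))\<^sup>2 - 1) / sqrt (real N)))" for N
  have f: "f1 \<longlonglongrightarrow> 0" "f2 \<longlonglongrightarrow> 0" "f3 \<longlonglongrightarrow> 0"
    unfolding f1_def f2_def f3_def by real_asymp+
  have f4: "f4 \<longlonglongrightarrow> 0" unfolding f4_def using Cb(1) by real_asymp
  define e where "e N = D * s ^ 7 * f1 N + D * s ^ 6 * f2 N + D * s ^ 5 * f3 N + 2 * Cb * f4 N" for N
  have "e \<longlonglongrightarrow> D * s ^ 7 * 0 + D * s ^ 6 * 0 + D * s ^ 5 * 0 + 2 * Cb * 0"
    unfolding e_def by (intro tendsto_add tendsto_mult tendsto_const f f4)
  then have e: "e \<longlonglongrightarrow> 0" by simp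
  have "\<forall>\<^sub>F N in sequentially. norm ((real N)\<^sup>2 * curv_sum N - (real N)\<^sup>2 * (planar (centre N) / drift)) \<le> e N"
    using eventually_window eventually_gt_at_top[of 0]
  proof eventually_elim
    case (elim N)
    define n0 where "n0 = centre N"
    define J where "J = half_width N"
    define H where "H = spread N"
    have w: "1 \<le> J" "J < n0" "n0 \<le> N" "J \<le> N" "real N \<le> 4 * drift * real (n0 - J)" and N: "0 < N"
      using elim by (auto simp: n0_def J_def)
    have J: "H \<le> real J" "real J \<le> H + 1" "0 \<le> H"
      unfolding H_def J_def by (rule half_width_bounds spread_nonneg)+
    have sc: "real N \<le> s\<^sup>2 * real (n0 - J)" unfolding s(2) by (rule w(5))
    have sc': "real N \<le> s\<^sup>2 * real n0"
      by (rule order_trans[OF sc], rule mult_left_mono) (simp, rule zero_le_power2)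
    have t1: "(2 * real J + 1) * real J / sqrt (real (n0 - J)) ^ 7 \<le> s ^ 7 * ((2 * (H + 1) + 1) * (H + 1) / sqrt (real N) ^ 7)"
    proof -
      have "(2 * real J + 1) * real J / sqrt (real (n0 - J)) ^ 7 \<le> s ^ 7 * ((2 * real J + 1) * real J) / sqrt (real N) ^ 7"
        by (rule div_sqrt_scale_le[OF N s(1) sc]) simp
      also have "\<dots> \<le> s ^ 7 * ((2 * (H + 1) + 1) * (H + 1)) / sqrt (real N) ^ 7"
        using J s by (intro divide_right_mono mult_left_mono mult_mono) auto
      finally show ?thesis by simp
    qed
    have t2: "(2 * real J + 1) / sqrt (real n0) ^ 6 \<le> s ^ 6 * ((2 * (H + 1) + 1) / sqrt (real N) ^ 6)"
    proof -
      have "(2 * real J + 1) / sqrt (real n0) ^ 6 \<le> s ^ 6 * (2 * real J + 1) / sqrt (real N) ^ 6"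
        by (rule div_sqrt_scale_le[OF N s(1) sc']) simp
      also have "\<dots> \<le> s ^ 6 * (2 * (H + 1) + 1) / sqrt (real N) ^ 6"
        using J s by (intro divide_right_mono mult_left_mono) auto
      finally show ?thesis by simp
    qed
    have t3: "1 / sqrt (real n0) ^ 5 \<le> s ^ 5 * (1 / sqrt (real N) ^ 5)"
      using div_sqrt_scale_le[OF N s(1) sc', of 1 5] by simp
    have t4: "measure_pmf.prob (steps p n0) (- centred_box n0 (real J - 1)) \<le> Cb * exp (- cb * ((H - 1) / sqrt (real N)))"
    proof -
      have "measure_pmf.prob (steps p n0) (- centred_box n0 (real J - 1)) \<le> Cb * exp (- cb * ((real J - 1) / sqrt (real n0)))"
        using w by (intro Cb) auto
      also have "\<dots> \<le> Cb * exp (- cb * ((H - 1) / sqrt (real N)))"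
      proof -
        have "(H - 1) / sqrt (real N) \<le> (real J - 1) / sqrt (real N)" using J by (intro divide_right_mono) auto
        also have "\<dots> \<le> (real J - 1) / sqrt (real n0)" using w N by (intro divide_left_mono) auto
        finally have "cb * ((H - 1) / sqrt (real N)) \<le> cb * ((real J - 1) / sqrt (real n0))"
          using Cb(1) by (intro mult_left_mono) auto
        then show ?thesis using Cb(2) by (intro mult_left_mono) auto
      qed
      finally show ?thesis .
    qed
    have "\<bar>curv_sum N - planar n0 / drift\<bar> \<le> D * (s ^ 7 * ((2 * (H + 1) + 1) * (H + 1) / sqrt (real N) ^ 7)
        + s ^ 6 * ((2 * (H + 1) + 1) / sqrt (real N) ^ 6) + s ^ 5 * (1 / sqrt (real N) ^ 5))
        + 2 * (Cb * exp (- cb * ((H - 1) / sqrt (real N))))"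
      unfolding curv_sum_def n0_def[symmetric] J_def[symmetric]
      by (rule order_trans[OF D(2)[OF w(1,2)]], unfold n0_def, rule centre_bounds, rule centre_bounds, unfold n0_def[symmetric])
        (intro add_mono mult_left_mono t1 t2 t3 t4 D(1), simp)
    then have "(real N)\<^sup>2 * \<bar>curv_sum N - planar n0 / drift\<bar> \<le> (real N)\<^sup>2 * (D * (s ^ 7 * ((2 * (H + 1) + 1) * (H + 1) / sqrt (real N) ^ 7)
        + s ^ 6 * ((2 * (H + 1) + 1) / sqrt (real N) ^ 6) + s ^ 5 * (1 / sqrt (real N) ^ 5))
        + 2 * (Cb * exp (- cb * ((H - 1) / sqrt (real N)))))"
      by (rule mult_left_mono) simp
    also have "\<dots> = e N"
    proof -
      have "x * (D * (y7 * z1 + y6 * z2 + y5 * z3) + 2 * (Cb * z4))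
          = D * y7 * (x * z1) + D * y6 * (x * z2) + D * y5 * (x * z3) + 2 * Cb * (x * z4)"
        for x y7 y6 y5 z1 z2 z3 z4 :: real by (simp add: algebra_simps)
      then show ?thesis unfolding e_def f1_def f2_def f3_def f4_def H_def spread_def by (simp only:)
    qed
    finally show ?case
      unfolding n0_def right_diff_distrib[symmetric] real_norm_def abs_mult by simp
  qed
  from Lim_null_comparison[OF this e]
  have 1: "(\<lambda>N. (real N)\<^sup>2 * curv_sum N - (real N)\<^sup>2 * (planar (centre N) / drift)) \<longlonglongrightarrow> 0" .
  have cinf: "filterlim centre sequentially sequentially"
  proof (rule filterlim_at_top_mono)
    show "filterlim (\<lambda>N. nat \<lfloor>real N / drift\<rfloor>) sequentially sequentially"
    proof -
      have "filterlim (\<lambda>N. 1 / drift * real N) at_top sequentially"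
        by (rule filterlim_tendsto_pos_mult_at_top[OF tendsto_const _ filterlim_real_sequentially]) (use \<mu> in simp)
      then have "filterlim (\<lambda>N. real N / drift) at_top sequentially" by simp
      then show ?thesis
        by (intro filterlim_compose[OF filterlim_nat_sequentially] filterlim_compose[OF filterlim_floor_sequentially])
    qed
  qed (simp add: centre_def)
  have "(\<lambda>N. ((real (centre N))\<^sup>2 * planar (centre N)) / (real (centre N) / real N)\<^sup>2 / drift) \<longlonglongrightarrow> \<beta> / (1 / drift)\<^sup>2 / drift"
    by (intro tendsto_divide tendsto_power centre_ratio tendsto_const filterlim_compose[OF \<beta>(2) cinf]) (use \<mu> in auto)
  moreover have "\<forall>\<^sub>F N in sequentially. ((real (centre N))\<^sup>2 * planar (centre N)) / (real (centre N) / real N)\<^sup>2 / drift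
      = (real N)\<^sup>2 * (planar (centre N) / drift)"
    using eventually_window by eventually_elim (auto simp: power_divide field_simps)
  ultimately have 2: "(\<lambda>N. (real N)\<^sup>2 * (planar (centre N) / drift)) \<longlonglongrightarrow> \<beta> / (1 / drift)\<^sup>2 / drift"
    by (rule Lim_transform_eventually)
  have "0 < \<beta> / (1 / drift)\<^sup>2 / drift" using \<beta>(1) \<mu> by simp
  moreover have "(\<lambda>N. (real N)\<^sup>2 * curv_sum N) \<longlonglongrightarrow> \<beta> / (1 / drift)\<^sup>2 / drift"
    using tendsto_add[OF 1 2] by simp
  ultimately show thesis using that by blast
qed

section \<open>Arrival at time \<open>N\<close>, compared with the sum of curvatures\<close>

lemma steps_time: "s \<in> set_pmf (steps p n) \<Longrightarrow> int n \<le> fst s"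
proof (induction n arbitrary: s)
  case (Suc n)
  then obtain x y where x: "x \<in> set_pmf p" and y: "y \<in> set_pmf (steps p n)" and s: "s = x + y"
    by auto
  have "1 \<le> fst x" "int n \<le> fst y" using time_pos[OF x] Suc.IH[OF y] by auto
  then show ?case by (simp add: s)
qed simp

lemma kill_le_pmf: "kill p n (indicator {w}) z \<le> pmf (steps p n) (w - z)"
  using kill_le_free[of "indicator {w}" 1 p n z] by (simp add: free_indicator_single indicator_def)

text \<open>For \<open>z2 = (0, u, y)\<close> the target is \<open>(N, u, y)\<close>; giving it in
  reversed form makes the two ends symmetric. The sum stops at \<open>N\<close> since every step
  takes at least one unit of time.\<close>

definition arrival :: "point \<Rightarrow> point \<Rightarrow> nat \<Rightarrow> real" where
  "arrival z z2 N = (\<Sum>n\<le>N. kill p n (indicator {time_flip (int N) z2}) z)"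

text \<open>The parameters of the one-sided estimate are taken as powers of \<open>N\<close>:
  \<open>\<kappa> = N\<^sup>1\<^sup>/\<^sup>8\<close> steps near the start, \<open>m0 = N\<^sup>1\<^sup>3\<^sup>/\<^sup>1\<^sup>6\<close> steps near the end, and a strip of width
  \<open>a = N\<^sup>7\<^sup>/\<^sup>1\<^sup>6\<close> along the diagonal, so that \<open>a\<close> is much larger than \<open>sqrt m0\<close>.\<close>

lemma arrival_error:
  fixes K :: real
  assumes K: "0 < K"
  obtains e where "e \<longlonglongrightarrow> 0"
    "\<forall>\<^sub>F N in sequentially. \<forall>z z2. gap z > 0 \<longrightarrow> gap z2 > 0 \<longrightarrow> fst z = 0 \<longrightarrow> fst z2 = 0
      \<longrightarrow> nrm z \<le> K * ln (real N) \<longrightarrow> nrm z2 \<le> K * ln (real N)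
      \<longrightarrow> (real N)\<^sup>2 * \<bar>arrival z z2 N - ren z * ren z2 * (curv_sum N / 4)\<bar> \<le> e N"
proof -
  obtain Co c1 where Co: "0 \<le> Co" "0 < c1" and one_sided:
    "\<And>n \<kappa> m0 a z w. 2 \<le> n \<Longrightarrow> 1 \<le> \<kappa> \<Longrightarrow> 2 * \<kappa> \<le> n \<Longrightarrow> 1 \<le> m0 \<Longrightarrow> 2 * m0 \<le> n
      \<Longrightarrow> gap z > 0 \<Longrightarrow> 0 < a \<Longrightarrow> a \<le> real_of_int (gap w)
      \<Longrightarrow> \<bar>kill p n (indicator {w}) z - ren z * dker n w\<bar>
        \<le> Co * (real_of_int (gap z) * (nrm z + 1) / sqrt (real n) ^ 5
          + real \<kappa> * (nrm z + real \<kappa>) / sqrt (real n) ^ 5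
          + real_of_int (gap z) / (sqrt (real \<kappa>) * sqrt (real n) ^ 4)
          + real_of_int (gap z) / (sqrt (real n) * sqrt (real m0) ^ 4)
          + real n * exp (- c1 * (a / sqrt (real m0))))"
    by (rule one_sided, rule that)
  obtain Ck where Ck: "0 \<le> Ck" "\<And>n z w. 1 \<le> n \<Longrightarrow> gap z > 0 \<Longrightarrow>
      kill p n (indicator {w}) z \<le> Ck * real_of_int (gap z) / sqrt (real n) ^ 4"
    by (rule kill_point_le, rule that)
  obtain Cd where Cd: "0 \<le> Cd" "\<And>n w. 1 \<le> n \<Longrightarrow> \<bar>dker n w\<bar> \<le> Cd / sqrt (real n) ^ 4"
    by (rule dker_le, rule that)
  obtain Q where Q: "0 \<le> Q" "\<And>z. gap z > 0 \<Longrightarrow> real_of_int (gap z) \<le> ren z"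
    "\<And>z. gap z > 0 \<Longrightarrow> ren z \<le> Q * real_of_int (gap z)"
    "\<And>z m l. gap z > 0 \<Longrightarrow> (\<Sum>k=m..<m+l. kill p k over z) \<le> Q * kill p m (\<lambda>_. 1) z"
    "\<And>z m. gap z > 0 \<Longrightarrow>
      \<bar>ren z - real_of_int (gap z) - (\<Sum>k<m. kill p k over z)\<bar> \<le> Q * kill p m (\<lambda>_. 1) z"
    by (rule ren_bounds, rule that)
  obtain cb Cb where Cb: "0 < cb" "0 \<le> Cb"
    "\<And>n R. 1 \<le> n \<Longrightarrow> 0 \<le> R \<Longrightarrow>
      measure_pmf.prob (steps p n) (- centred_box n R) \<le> Cb * exp (- cb * (R / sqrt (real n)))"
    by (rule box_deviation, rule that)
  note \<mu> = one_le_drift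
  \<comment> \<open>Now the square is \<open>16 * drift\<close>: the cut leaves each half at least a
    quarter of \<open>n\<close>, on top of the ratio \<open>4 * drift\<close> in
    \<open>eventually_window\<close>.\<close>
  define s where "s = 4 * sqrt drift"
  have s: "0 < s" "s\<^sup>2 = 16 * drift" using \<mu> by (simp_all add: s_def power_mult_distrib)
  \<comment> \<open>The added 1, here and in \<open>Co'\<close>, makes the constants strictly
    positive, so that their signs are known in the limits below.\<close>
  define CM where "CM = (Ck + Q * Cd) * s ^ 4 + 1"
  define Co' where "Co' = Co + 1"
  have CM: "0 < CM" using Ck(1) Q(1) Cd(1) s by (simp add: CM_def add_nonneg_pos)
  have Co': "0 < Co'" "Co \<le> Co'" using Co(1) by (auto simp: Co'_def)
  \<comment> \<open>The tail is taken at radius \<open>R N / 2\<close> after at most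
    \<open>2 * N\<close> steps, which costs 2 and \<open>sqrt 2\<close>.\<close>
  define c3 where "c3 = cb / (2 * sqrt 2)"
  have c3: "0 < c3" using Cb(1) by (simp add: c3_def)

  define lg where "lg N = K * ln (real N)" for N
  define R where "R N = spread N" for N
  define a where "a N = real N powr (7/16)" for N
  define M where "M N = CM * lg N / sqrt (real N) ^ 4" for N
  define e1 where "e1 N = s ^ 5 * (lg N * (lg N + 1)) / sqrt (real N) ^ 5
      + s ^ 5 * ((real N powr (1/8) + 1) * (lg N + (real N powr (1/8) + 1))) / sqrt (real N) ^ 5
      + s ^ 4 * (lg N / sqrt (real N powr (1/8))) / sqrt (real N) ^ 4
      + s ^ 1 * (lg N / sqrt (real N powr (13/16)) ^ 4) / sqrt (real N) ^ 1" for N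
  define e2 where "e2 N = 2 * real N * exp (- c1 * (a N / sqrt (real N powr (13/16) + 1)))" for N
  define \<epsilon> where "\<epsilon> N = Co' * (e1 N + e2 N)" for N
  define T where "T N = Cb * exp (- c3 * (ln (real N))\<^sup>2)" for N
  define U where "U N = (1 + Q\<^sup>2 * K\<^sup>2) * (1 + (ln (real N))\<^sup>2)" for N
  define W where "W N = 2 * (spread N + 1) + 1" for N
  \<comment> \<open>Two terms for the algebraic and the exponentially small part of the one-sided
    error, then the strip, the exits from the box, and the numbers of steps outside the window.
    \<open>W\<close> bounds the length of the window.\<close>
  define e where "e N = (real N)\<^sup>2 * (W N * ((2 * R N + 1) ^ 3 * (2 * M N * (Co' * e1 N))))
      + (real N)\<^sup>2 * (W N * ((2 * R N + 1) ^ 3 * (2 * M N * (Co' * e2 N))))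
      + (real N)\<^sup>2 * (W N * ((2 * R N + 1)\<^sup>2 * (a N + 1) * (2 * (M N)\<^sup>2)))
      + ((1 + Q\<^sup>2 * K\<^sup>2) * Cb) * ((real N)\<^sup>2 * (W N * ((1 + (ln (real N))\<^sup>2) * exp (- c3 * (ln (real N))\<^sup>2))))
      + Cb * ((real N)\<^sup>2 * ((real N + 1) * exp (- cb * (ln (real N))\<^sup>2)))" for N
  \<comment> \<open>Up to logarithms this is \<open>N^2\<close> times \<open>e1\<close>. Its slowest
    term is the one with \<open>\<kappa>\<close>, of order \<open>N^(-2 - 1/16)\<close>, so
    \<open>N^(-1/16)\<close> is left over.\<close>
  have l1: "(\<lambda>N. (real N)\<^sup>2 * (W N * ((2 * R N + 1) ^ 3 * (2 * M N * (Co' * e1 N))))) \<longlonglongrightarrow> 0"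
    unfolding W_def R_def M_def e1_def lg_def spread_def using K CM Co'(1) s(1) by real_asymp
  \<comment> \<open>The ratio of \<open>a\<close> to \<open>sqrt m0\<close> is of order
    \<open>N^(7/16 - 13/32) = N^(1/32)\<close>, so the exponential beats every power of
    \<open>N\<close>.\<close>
  have l2: "(\<lambda>N. (real N)\<^sup>2 * (W N * ((2 * R N + 1) ^ 3 * (2 * M N * (Co' * e2 N))))) \<longlonglongrightarrow> 0"
    unfolding W_def R_def M_def e2_def a_def lg_def spread_def using K CM Co'(1) Co(2) by real_asymp
  \<comment> \<open>Power count for the strip: \<open>2 + 1/2 + 1 + 7/16 - 4 = -1/16\<close>. This
    is why \<open>a\<close> must stay below \<open>sqrt N\<close> by a power.\<close>
  have l3: "(\<lambda>N. (real N)\<^sup>2 * (W N * ((2 * R N + 1)\<^sup>2 * (a N + 1) * (2 * (M N)\<^sup>2)))) \<longlonglongrightarrow> 0"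
    unfolding W_def R_def M_def a_def lg_def spread_def using K CM by real_asymp
  have l4: "(\<lambda>N. (real N)\<^sup>2 * (W N * ((1 + (ln (real N))\<^sup>2) * exp (- c3 * (ln (real N))\<^sup>2)))) \<longlonglongrightarrow> 0"
    unfolding W_def spread_def using c3 by real_asymp
  have l5: "(\<lambda>N. (real N)\<^sup>2 * ((real N + 1) * exp (- cb * (ln (real N))\<^sup>2))) \<longlonglongrightarrow> 0"
    using Cb(1) by real_asymp
  have "e \<longlonglongrightarrow> 0 + 0 + 0 + (1 + Q\<^sup>2 * K\<^sup>2) * Cb * 0 + Cb * 0"
    unfolding e_def by (intro tendsto_add tendsto_mult[OF tendsto_const] l1 l2 l3 l4 l5)
  then have lim: "e \<longlonglongrightarrow> 0" by simp

  have ev1: "\<forall>\<^sub>F N in sequentially. 2 \<le> R N" unfolding R_def spread_def by real_asymp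
  have ev2: "\<forall>\<^sub>F N in sequentially. lg N \<le> R N / 2"
    unfolding R_def lg_def spread_def using K by real_asymp
  have ev3: "\<forall>\<^sub>F N in sequentially. 2 * (real N powr (1/8) + 1) / real N < 1 / (16 * drift)"
  proof (rule order_tendstoD)
    show "(\<lambda>N. 2 * (real N powr (1/8) + 1) / real N) \<longlonglongrightarrow> 0" by real_asymp
  qed (use \<mu> in simp)
  have ev4: "\<forall>\<^sub>F N in sequentially. 2 * (real N powr (13/16) + 1) / real N < 1 / (16 * drift)"
  proof (rule order_tendstoD)
    show "(\<lambda>N. 2 * (real N powr (13/16) + 1) / real N) \<longlonglongrightarrow> 0" by real_asymp
  qed (use \<mu> in simp)
  have ev5: "\<forall>\<^sub>F N in sequentially. 16 * drift \<le> real N"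
    using filterlim_real_sequentially unfolding filterlim_at_top by blast

  have bound: "\<forall>\<^sub>F N in sequentially. \<forall>z z2. gap z > 0 \<longrightarrow> gap z2 > 0 \<longrightarrow> fst z = 0 \<longrightarrow> fst z2 = 0
      \<longrightarrow> nrm z \<le> K * ln (real N) \<longrightarrow> nrm z2 \<le> K * ln (real N)
      \<longrightarrow> (real N)\<^sup>2 * \<bar>arrival z z2 N - ren z * ren z2 * (curv_sum N / 4)\<bar> \<le> e N"
    using eventually_window ev1 ev2 ev3 ev4 ev5
  proof eventually_elim
    case (elim N)
    have N16: "16 \<le> real N" using elim(6) \<mu> by linarith
    have N: "0 < N" "0 < real N" using N16 by auto
    have L0: "0 \<le> ln (real N)" using N16 by simp
    define h where "h = half_width N"
    define n0 where "n0 = centre N"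
    have w: "1 \<le> h" "h < n0" "n0 \<le> N" "h \<le> N" "real N \<le> 4 * drift * real (n0 - h)"
      using elim(1) by (auto simp: h_def n0_def)
    have R: "2 \<le> R N" "lg N \<le> R N / 2" using elim by auto
    have lg0: "0 \<le> lg N" using K L0 by (simp add: lg_def)
    have a0: "0 < a N" using N by (simp add: a_def)
    have M0: "0 \<le> M N" using CM lg0 by (simp add: M_def)
    define \<kappa> where "\<kappa> = nat \<lceil>real N powr (1/8)\<rceil>"
    define m0 where "m0 = nat \<lceil>real N powr (13/16)\<rceil>"
    have pw: "1 \<le> real N powr (1/8)" "1 \<le> real N powr (13/16)" using N16 by (simp_all add: ge_one_powr_ge_zero)
    have \<kappa>: "real N powr (1/8) \<le> real \<kappa>" "real \<kappa> \<le> real N powr (1/8) + 1" "1 \<le> \<kappa>"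
      using pw(1) unfolding \<kappa>_def by linarith+
    have m0: "real N powr (13/16) \<le> real m0" "real m0 \<le> real N powr (13/16) + 1" "1 \<le> m0"
      using pw(2) unfolding m0_def by linarith+
    have big: "2 * real \<kappa> \<le> real N / (16 * drift)" "2 * real m0 \<le> real N / (16 * drift)"
    proof -
      have "2 * (real N powr (1/8) + 1) < 1 / (16 * drift) * real N" using elim(4) N by (simp only: divide_less_eq if_True)
      then show "2 * real \<kappa> \<le> real N / (16 * drift)" using \<kappa>(2) by simp
      have "2 * (real N powr (13/16) + 1) < 1 / (16 * drift) * real N" using elim(5) N by (simp only: divide_less_eq if_True)
      then show "2 * real m0 \<le> real N / (16 * drift)" using m0(2) by simp
    qed

    have osb: "\<bar>kill p m (indicator {u}) z - ren z * dker m u\<bar> \<le> \<epsilon> N"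
      if m: "2 \<le> m" "real N \<le> s\<^sup>2 * real m" "real m \<le> 2 * real N"
        and z: "gap z > 0" "nrm z \<le> lg N" and u: "a N \<le> real_of_int (gap u)" for m z u
    proof -
      let ?g = "real_of_int (gap z)"
      have g: "0 \<le> ?g" "?g \<le> lg N" using z abs_gap_le_nrm[of z] by linarith+
      have Nm: "real N / (16 * drift) \<le> real m" using m(2) \<mu> by (simp add: s(2) field_simps)
      have \<kappa>m: "2 * \<kappa> \<le> m" "2 * m0 \<le> m" using big Nm by linarith+
      have mp: "0 < sqrt (real m)" using m by simp
      have "\<bar>kill p m (indicator {u}) z - ren z * dker m u\<bar>
        \<le> Co * (?g * (nrm z + 1) / sqrt (real m) ^ 5
          + real \<kappa> * (nrm z + real \<kappa>) / sqrt (real m) ^ 5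
          + ?g / (sqrt (real \<kappa>) * sqrt (real m) ^ 4)
          + ?g / (sqrt (real m) * sqrt (real m0) ^ 4)
          + real m * exp (- c1 * (a N / sqrt (real m0))))"
        by (rule one_sided[OF m(1) \<kappa>(3) \<kappa>m(1) m0(3) \<kappa>m(2) z(1) a0 u])
      also have "\<dots> \<le> Co * (e1 N + e2 N)"
        unfolding e1_def e2_def
      proof (rule mult_left_mono[OF _ Co(1)])
        have "?g * (nrm z + 1) / sqrt (real m) ^ 5 \<le> lg N * (lg N + 1) / sqrt (real m) ^ 5"
          using g z by (intro divide_right_mono mult_mono) auto
        also have "\<dots> \<le> s ^ 5 * (lg N * (lg N + 1)) / sqrt (real N) ^ 5"
          by (rule div_sqrt_scale_le[OF N(1) s(1) m(2)]) (use lg0 in simp)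
        finally have 1: "?g * (nrm z + 1) / sqrt (real m) ^ 5 \<le> s ^ 5 * (lg N * (lg N + 1)) / sqrt (real N) ^ 5" .
        let ?k = "real N powr (1/8) + 1"
        have "real \<kappa> * (nrm z + real \<kappa>) / sqrt (real m) ^ 5 \<le> ?k * (lg N + ?k) / sqrt (real m) ^ 5"
          using \<kappa> z lg0 by (intro divide_right_mono mult_mono add_mono) auto
        also have "\<dots> \<le> s ^ 5 * (?k * (lg N + ?k)) / sqrt (real N) ^ 5"
          by (rule div_sqrt_scale_le[OF N(1) s(1) m(2)]) (use lg0 in simp)
        finally have 2: "real \<kappa> * (nrm z + real \<kappa>) / sqrt (real m) ^ 5 \<le> s ^ 5 * (?k * (lg N + ?k)) / sqrt (real N) ^ 5" .
        have "?g / (sqrt (real \<kappa>) * sqrt (real m) ^ 4) = (?g / sqrt (real \<kappa>)) / sqrt (real m) ^ 4" by simp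
        also have "\<dots> \<le> (lg N / sqrt (real N powr (1/8))) / sqrt (real m) ^ 4"
          using \<kappa> g lg0 pw N by (intro divide_right_mono frac_le) auto
        also have "\<dots> \<le> s ^ 4 * (lg N / sqrt (real N powr (1/8))) / sqrt (real N) ^ 4"
          by (rule div_sqrt_scale_le[OF N(1) s(1) m(2)]) (use lg0 in simp)
        finally have 3: "?g / (sqrt (real \<kappa>) * sqrt (real m) ^ 4) \<le> s ^ 4 * (lg N / sqrt (real N powr (1/8))) / sqrt (real N) ^ 4" .
        have "?g / (sqrt (real m) * sqrt (real m0) ^ 4) = (?g / sqrt (real m0) ^ 4) / sqrt (real m) ^ 1" by simp
        also have "\<dots> \<le> (lg N / sqrt (real N powr (13/16)) ^ 4) / sqrt (real m) ^ 1"
          using m0 g lg0 pw N by (intro divide_right_mono frac_le power_mono) auto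
        also have "\<dots> \<le> s ^ 1 * (lg N / sqrt (real N powr (13/16)) ^ 4) / sqrt (real N) ^ 1"
          by (rule div_sqrt_scale_le[OF N(1) s(1) m(2)]) (use lg0 in simp)
        finally have 4: "?g / (sqrt (real m) * sqrt (real m0) ^ 4) \<le> s ^ 1 * (lg N / sqrt (real N powr (13/16)) ^ 4) / sqrt (real N) ^ 1" .
        have "a N / sqrt (real N powr (13/16) + 1) \<le> a N / sqrt (real m0)"
          using a0 m0 by (intro divide_left_mono) auto
        then have "c1 * (a N / sqrt (real N powr (13/16) + 1)) \<le> c1 * (a N / sqrt (real m0))"
          by (rule mult_left_mono) (use Co(2) in simp)
        then have "exp (- c1 * (a N / sqrt (real m0))) \<le> exp (- c1 * (a N / sqrt (real N powr (13/16) + 1)))"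
          by (simp only: exp_le_cancel_iff mult_minus_left neg_le_iff_le)
        then have 5: "real m * exp (- c1 * (a N / sqrt (real m0))) \<le> 2 * real N * exp (- c1 * (a N / sqrt (real N powr (13/16) + 1)))"
          using m(3) by (intro mult_mono) auto
        show "?g * (nrm z + 1) / sqrt (real m) ^ 5
          + real \<kappa> * (nrm z + real \<kappa>) / sqrt (real m) ^ 5
          + ?g / (sqrt (real \<kappa>) * sqrt (real m) ^ 4)
          + ?g / (sqrt (real m) * sqrt (real m0) ^ 4)
          + real m * exp (- c1 * (a N / sqrt (real m0)))
          \<le> s ^ 5 * (lg N * (lg N + 1)) / sqrt (real N) ^ 5
      + s ^ 5 * (?k * (lg N + ?k)) / sqrt (real N) ^ 5
      + s ^ 4 * (lg N / sqrt (real N powr (1/8))) / sqrt (real N) ^ 4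
      + s ^ 1 * (lg N / sqrt (real N powr (13/16)) ^ 4) / sqrt (real N) ^ 1
      + 2 * real N * exp (- c1 * (a N / sqrt (real N powr (13/16) + 1)))"
          by (intro add_mono 1 2 3 4 5)
      qed
      also have "\<dots> \<le> \<epsilon> N"
        unfolding \<epsilon>_def using Co'(2) lg0 s(1) N by (intro mult_right_mono) (auto simp: e1_def e2_def)
      finally show ?thesis .
    qed

    have Mb: "kill p m (indicator {u}) z \<le> M N" "\<bar>ren z * dker m u\<bar> \<le> M N"
      if m: "1 \<le> m" "real N \<le> s\<^sup>2 * real m" and z: "gap z > 0" "nrm z \<le> lg N" for m z u
    proof -
      let ?g = "real_of_int (gap z)"
      have g: "0 \<le> ?g" "?g \<le> lg N" using z abs_gap_le_nrm[of z] by linarith+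
      have sc: "C * lg N / sqrt (real m) ^ 4 \<le> s ^ 4 * (C * lg N) / sqrt (real N) ^ 4" if "0 \<le> C" for C
        by (rule div_sqrt_scale_le[OF N(1) s(1) m(2)]) (use lg0 that in simp)
      have le: "s ^ 4 * (C * lg N) / sqrt (real N) ^ 4 \<le> M N" if "0 \<le> C" "C \<le> Ck + Q * Cd" for C
      proof -
        have "C * s ^ 4 \<le> (Ck + Q * Cd) * s ^ 4" using that s by (intro mult_right_mono) auto
        then have "C * s ^ 4 * lg N \<le> CM * lg N" using lg0 by (intro mult_right_mono) (auto simp: CM_def)
        then have "C * s ^ 4 * lg N / sqrt (real N) ^ 4 \<le> M N" unfolding M_def by (rule divide_right_mono) simp
        then show ?thesis by (simp add: mult_ac)
      qed
      have "kill p m (indicator {u}) z \<le> Ck * ?g / sqrt (real m) ^ 4" by (rule Ck(2)[OF m(1) z(1)])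
      also have "\<dots> \<le> Ck * lg N / sqrt (real m) ^ 4" using g Ck(1) by (intro divide_right_mono mult_left_mono) auto
      also have "\<dots> \<le> M N" using Ck(1) Q(1) Cd(1) by (intro order_trans[OF sc le]) auto
      finally show "kill p m (indicator {u}) z \<le> M N" .
      have r: "0 \<le> ren z" "ren z \<le> Q * lg N"
        using Q(2)[OF z(1)] g(1) order_trans[OF Q(3)[OF z(1)] mult_left_mono[OF g(2) Q(1)]] by auto
      have "\<bar>ren z * dker m u\<bar> = ren z * \<bar>dker m u\<bar>" using r by (simp add: abs_mult)
      also have "\<dots> \<le> (Q * lg N) * (Cd / sqrt (real m) ^ 4)"
        using r Cd(2)[OF m(1)] Q(1) lg0 by (intro mult_mono) auto
      also have "\<dots> = (Q * Cd) * lg N / sqrt (real m) ^ 4" by simp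
      also have "\<dots> \<le> M N" using Ck(1) Q(1) Cd(1) by (intro order_trans[OF sc le]) auto
      finally show "\<bar>ren z * dker m u\<bar> \<le> M N" .
    qed

    show ?case
    proof (intro allI impI)
      fix z z2 :: point
      assume z: "gap z > 0" and z2: "gap z2 > 0" and z0: "fst z = 0" and z20: "fst z2 = 0"
        and nz: "nrm z \<le> K * ln (real N)" and nz2: "nrm z2 \<le> K * ln (real N)"
      let ?w = "time_flip (int N) z2"
      let ?W = "{n0 - h..n0 + h}"
      let ?V = "ren z * ren z2"
      define f where "f n = kill p n (indicator {?w}) z" for n
      have f0: "0 \<le> f n" for n unfolding f_def by (rule kill_nonneg) (use z in auto)
      have nl: "nrm z \<le> lg N" "nrm z2 \<le> lg N" using nz nz2 by (simp_all add: lg_def)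
      have V: "\<bar>?V\<bar> \<le> Q\<^sup>2 * K\<^sup>2 * (ln (real N))\<^sup>2"
      proof -
        have r: "0 \<le> ren y" "ren y \<le> Q * lg N" if "gap y > 0" "nrm y \<le> lg N" for y
        proof -
          have g: "real_of_int (gap y) \<le> lg N" using that abs_gap_le_nrm[of y] by linarith
          show "ren y \<le> Q * lg N" by (rule order_trans[OF Q(3)[OF that(1)] mult_left_mono[OF g Q(1)]])
          have "0 < real_of_int (gap y)" using that by simp
          then show "0 \<le> ren y" using Q(2)[OF that(1)] by linarith
        qed
        have "\<bar>?V\<bar> = ren z * ren z2" using r[OF z nl(1)] r[OF z2 nl(2)] by simp
        also have "\<dots> \<le> (Q * lg N) * (Q * lg N)"
          using r[OF z nl(1)] r[OF z2 nl(2)] Q(1) lg0 by (intro mult_mono) auto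
        also have "\<dots> = Q\<^sup>2 * K\<^sup>2 * (ln (real N))\<^sup>2" by (simp add: lg_def power2_eq_square)
        finally show ?thesis .
      qed
      have inner: "\<bar>f n - ?V * (curv n (int N) / 4)\<bar>
          \<le> (2 * R N + 1) ^ 3 * (2 * M N * \<epsilon> N) + (2 * R N + 1)\<^sup>2 * (a N + 1) * (2 * (M N)\<^sup>2) + U N * T N"
        if n: "n \<in> ?W" for n
      proof -
        define m1 where "m1 = n div 2"
        define m2 where "m2 = n - n div 2"
        have nn: "n = m1 + m2" by (simp add: m1_def m2_def)
        have nge: "real (n0 - h) \<le> real n" using n by simp
        have "real N \<le> 4 * drift * real n"
          by (rule order_trans[OF w(5)]) (use nge \<mu> in \<open>intro mult_left_mono, auto\<close>)
        then have n4: "4 * (4 * drift) \<le> 4 * drift * real n" using elim(6) by linarith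
        have "4 \<le> real n" using n4 \<mu> by (simp add: mult.commute)
        then have n4': "4 \<le> n" by simp
        have nle: "n \<le> 2 * N" using n w by simp
        have m: "2 \<le> m1" "2 \<le> m2" "real n \<le> 4 * real m1" "real n \<le> 4 * real m2" "m1 \<le> n" "m2 \<le> n"
          using n4' unfolding m1_def m2_def by linarith+
        have sc: "real N \<le> s\<^sup>2 * real m" if "real n \<le> 4 * real m" for m
        proof -
          have "4 * drift * real n \<le> 4 * drift * (4 * real m)" using that \<mu> by (intro mult_left_mono) auto
          with \<open>real N \<le> 4 * drift * real n\<close> have "real N \<le> 4 * drift * (4 * real m)" by (rule order_trans)
          also have "\<dots> = s\<^sup>2 * real m" by (simp add: s(2))
          finally show ?thesis .
        qed
        have "\<bar>kill p n (indicator {?w}) z - ?V * (curv n (int N) / 4)\<bar>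
            \<le> (2 * R N + 1) ^ 3 * (2 * M N * \<epsilon> N) + (2 * R N + 1)\<^sup>2 * (a N + 1) * (2 * (M N)\<^sup>2)
            + (1 + \<bar>?V\<bar>) * measure_pmf.prob (steps p m1) (- centred_box m1 (R N / 2))"
        proof (rule two_sided[OF nn z z2 z20 R(1)])
          show "nrm z \<le> R N / 2" using nl(1) R(2) by linarith
          show "0 \<le> a N" using a0 by simp
        qed (use m nle nl in \<open>auto intro!: Mb osb sc z z2\<close>)
        also have "(1 + \<bar>?V\<bar>) * measure_pmf.prob (steps p m1) (- centred_box m1 (R N / 2)) \<le> U N * T N"
        proof (rule mult_mono)
          have "\<bar>?V\<bar> \<le> Q\<^sup>2 * K\<^sup>2 * (ln (real N))\<^sup>2" by (rule V)
          moreover have "0 \<le> Q\<^sup>2 * K\<^sup>2" "0 \<le> (ln (real N))\<^sup>2" by simp_all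
          ultimately show "1 + \<bar>?V\<bar> \<le> U N" unfolding U_def distrib_left distrib_right by linarith
          have "measure_pmf.prob (steps p m1) (- centred_box m1 (R N / 2)) \<le> Cb * exp (- cb * (R N / 2 / sqrt (real m1)))"
            using m R by (intro Cb) auto
          also have "\<dots> \<le> T N"
          proof -
            have "c3 * (ln (real N))\<^sup>2 = cb * (R N / 2 / sqrt (2 * real N))"
              using N by (simp add: c3_def R_def spread_def real_sqrt_mult)
            also have "\<dots> \<le> cb * (R N / 2 / sqrt (real m1))"
              using Cb(1) R m nle N by (intro mult_left_mono divide_left_mono) auto
            finally show ?thesis unfolding T_def using Cb(2) by (intro mult_left_mono) auto
          qed
          finally show "measure_pmf.prob (steps p m1) (- centred_box m1 (R N / 2)) \<le> T N" .
          show "0 \<le> U N" by (simp add: U_def)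
        qed simp
        finally show ?thesis unfolding f_def by simp
      qed
      \<comment> \<open>Outside the window, arriving at time exactly \<open>N\<close> is a deviation
        of at least \<open>spread N\<close> from the mean time \<open>n * drift\<close>.\<close>
      have outer: "f n \<le> Cb * exp (- cb * (ln (real N))\<^sup>2)" if n: "n \<le> N" "n \<notin> ?W" for n
      proof (cases "n = 0")
        case True
        have "z \<noteq> ?w"
        proof
          assume "z = ?w"
          then have "fst z = int N" using z20 by (simp add: time_flip_def)
          with z0 N show False by simp
        qed
        then show ?thesis using True Cb(2) by (simp add: f_def)
      next
        case False
        have "f n \<le> pmf (steps p n) (?w - z)" unfolding f_def by (rule kill_le_pmf)
        also have "\<dots> = measure_pmf.prob (steps p n) {?w - z}" by (simp add: measure_pmf_single)
        also have "\<dots> \<le> measure_pmf.prob (steps p n) (- centred_box n (spread N))"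
        proof (rule measure_pmf.finite_measure_mono)
          have "fst (?w - z) = int N" using z0 z20 by (simp add: time_flip_def)
          moreover have "spread N \<le> \<bar>real N - real n * drift\<bar>"
          proof -
            have hs: "spread N \<le> real h" unfolding h_def by (rule half_width_bounds)
            have hd: "real h * 1 \<le> real h * drift" using \<mu> by (intro mult_left_mono) auto
            have c: "real n0 * drift \<le> real N" "real N < (real n0 + 1) * drift"
              unfolding n0_def by (rule centre_bounds)+
            consider "n + h + 1 \<le> n0" | "n0 + h + 1 \<le> n" using n w by (auto simp: not_le)
            then show ?thesis
            proof cases
              case 1
              then have "(real n + real h + 1) * drift \<le> real n0 * drift" using \<mu> by (intro mult_right_mono) auto
              then show ?thesis using hs hd c \<mu> unfolding distrib_right by linarith
            next
              case 2
              then have "(real n0 + real h + 1) * drift \<le> real n * drift" using \<mu> by (intro mult_right_mono) auto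
              then show ?thesis using hs hd c \<mu> unfolding distrib_right by linarith
            qed
          qed
          ultimately show "{?w - z} \<subseteq> - centred_box n (spread N)" by (simp add: centred_box_def)
        qed simp
        also have "\<dots> \<le> Cb * exp (- cb * (spread N / sqrt (real n)))"
          using False spread_nonneg by (intro Cb) auto
        also have "\<dots> \<le> Cb * exp (- cb * (ln (real N))\<^sup>2)"
        proof -
          have "(ln (real N))\<^sup>2 = spread N / sqrt (real N)" using N by (simp add: spread_def)
          also have "\<dots> \<le> spread N / sqrt (real n)"
            using False n N spread_nonneg[of N] by (intro divide_left_mono) auto
          finally have "cb * (ln (real N))\<^sup>2 \<le> cb * (spread N / sqrt (real n))"
            by (rule mult_left_mono) (use Cb(1) in simp)
          then have "exp (- cb * (spread N / sqrt (real n))) \<le> exp (- cb * (ln (real N))\<^sup>2)"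
            unfolding mult_minus_left exp_le_cancel_iff neg_le_iff_le .
          then show ?thesis by (rule mult_left_mono) (use Cb(2) in simp)
        qed
        finally show ?thesis .
      qed
      \<comment> \<open>Lets the whole window be added to the sum, even if part of it lies beyond
        \<open>N\<close>.\<close>
      have big: "f n = 0" if "N < n" for n
      proof -
        have "fst (?w - z) = int N" using z0 z20 by (simp add: time_flip_def)
        then have "?w - z \<notin> set_pmf (steps p n)" using steps_time[of "?w - z" n] that by auto
        then have "pmf (steps p n) (?w - z) = 0" by (simp add: pmf_eq_0_set_pmf)
        then show ?thesis using kill_le_pmf[of n ?w z] f0[of n] by (simp add: f_def)
      qed
      have "arrival z z2 N = (\<Sum>n\<in>{..N} \<union> ?W. f n)"
        unfolding arrival_def f_def[symmetric] by (rule sum.mono_neutral_left) (auto intro: big)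
      also have "{..N} \<union> ?W = ?W \<union> ({..N} - ?W)" by auto
      also have "(\<Sum>n\<in>?W \<union> ({..N} - ?W). f n) = (\<Sum>n\<in>?W. f n) + (\<Sum>n\<in>{..N} - ?W. f n)"
        by (rule sum.union_disjoint) auto
      finally have split: "arrival z z2 N = (\<Sum>n\<in>?W. f n) + (\<Sum>n\<in>{..N} - ?W. f n)" .
      let ?B = "(2 * R N + 1) ^ 3 * (2 * M N * \<epsilon> N) + (2 * R N + 1)\<^sup>2 * (a N + 1) * (2 * (M N)\<^sup>2) + U N * T N"
      have B0: "0 \<le> ?B" by (rule order_trans[OF abs_ge_zero inner[of n0]]) simp
      have in_sum: "\<bar>(\<Sum>n\<in>?W. f n) - ?V * (curv_sum N / 4)\<bar> \<le> W N * ?B"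
      proof -
        have "?V * (curv_sum N / 4) = (\<Sum>n\<in>?W. ?V * (curv n (int N) / 4))"
          unfolding curv_sum_def n0_def h_def by (simp add: sum_distrib_left sum_divide_distrib)
        then have "\<bar>(\<Sum>n\<in>?W. f n) - ?V * (curv_sum N / 4)\<bar> = \<bar>\<Sum>n\<in>?W. f n - ?V * (curv n (int N) / 4)\<bar>"
          by (simp add: sum_subtractf)
        also have "\<dots> \<le> (\<Sum>n\<in>?W. \<bar>f n - ?V * (curv n (int N) / 4)\<bar>)" by (rule sum_abs)
        also have "\<dots> \<le> real (card ?W) * ?B" by (rule sum_bounded_above) (rule inner)
        also have "\<dots> \<le> W N * ?B"
        proof (rule mult_right_mono[OF _ B0])
          have "real (card ?W) = 2 * real h + 1" using w by simp
          then show "real (card ?W) \<le> W N" using half_width_bounds(2)[of N] by (simp add: W_def h_def)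
        qed
        finally show ?thesis .
      qed
      have out_sum: "\<bar>\<Sum>n\<in>{..N} - ?W. f n\<bar> \<le> (real N + 1) * (Cb * exp (- cb * (ln (real N))\<^sup>2))"
      proof -
        have "\<bar>\<Sum>n\<in>{..N} - ?W. f n\<bar> = (\<Sum>n\<in>{..N} - ?W. f n)" using f0 by (simp add: sum_nonneg)
        also have "\<dots> \<le> real (card ({..N} - ?W)) * (Cb * exp (- cb * (ln (real N))\<^sup>2))"
          by (rule sum_bounded_above) (rule outer, auto)
        also have "\<dots> \<le> (real N + 1) * (Cb * exp (- cb * (ln (real N))\<^sup>2))"
        proof (rule mult_right_mono)
          have "card ({..N} - ?W) \<le> card {..N}" by (rule card_mono) auto
          then show "real (card ({..N} - ?W)) \<le> real N + 1" by simp
        qed (use Cb(2) in simp)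
        finally show ?thesis .
      qed
      have "\<bar>arrival z z2 N - ?V * (curv_sum N / 4)\<bar>
          \<le> W N * ?B + (real N + 1) * (Cb * exp (- cb * (ln (real N))\<^sup>2))"
        unfolding split using in_sum out_sum by linarith
      then have "(real N)\<^sup>2 * \<bar>arrival z z2 N - ?V * (curv_sum N / 4)\<bar>
          \<le> (real N)\<^sup>2 * (W N * ?B + (real N + 1) * (Cb * exp (- cb * (ln (real N))\<^sup>2)))"
        by (rule mult_left_mono) simp
      also have "\<dots> = e N"
        unfolding e_def \<epsilon>_def U_def T_def by (simp add: algebra_simps)
      finally show "(real N)\<^sup>2 * \<bar>arrival z z2 N - ?V * (curv_sum N / 4)\<bar> \<le> e N" .
    qed
  qed
  from lim bound show thesis by (rule that)
qed

theorem arrival_asymptotics: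
  obtains c where "0 < c"
    "\<And>K \<epsilon>. 0 < K \<Longrightarrow> 0 < \<epsilon> \<Longrightarrow> \<forall>\<^sub>F N in sequentially. \<forall>z z2. gap z > 0 \<longrightarrow> gap z2 > 0 \<longrightarrow> fst z = 0 \<longrightarrow> fst z2 = 0
      \<longrightarrow> nrm z \<le> K * ln (real N) \<longrightarrow> nrm z2 \<le> K * ln (real N)
      \<longrightarrow> \<bar>(real N)\<^sup>2 * arrival z z2 N / (ren z * ren z2) - c\<bar> < \<epsilon>"
proof -
  obtain Q where Q: "0 \<le> Q" "\<And>z. gap z > 0 \<Longrightarrow> real_of_int (gap z) \<le> ren z"
    "\<And>z. gap z > 0 \<Longrightarrow> ren z \<le> Q * real_of_int (gap z)"
    "\<And>z m l. gap z > 0 \<Longrightarrow> (\<Sum>k=m..<m+l. kill p k over z) \<le> Q * kill p m (\<lambda>_. 1) z"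
    "\<And>z m. gap z > 0 \<Longrightarrow>
      \<bar>ren z - real_of_int (gap z) - (\<Sum>k<m. kill p k over z)\<bar> \<le> Q * kill p m (\<lambda>_. 1) z"
    by (rule ren_bounds, rule that)
  obtain c where c: "0 < c" "(\<lambda>N. (real N)\<^sup>2 * curv_sum N) \<longlonglongrightarrow> c"
    by (rule curv_sum_limit, rule that)
  have main: "\<forall>\<^sub>F N in sequentially. \<forall>z z2. gap z > 0 \<longrightarrow> gap z2 > 0 \<longrightarrow> fst z = 0 \<longrightarrow> fst z2 = 0
      \<longrightarrow> nrm z \<le> K * ln (real N) \<longrightarrow> nrm z2 \<le> K * ln (real N)
      \<longrightarrow> \<bar>(real N)\<^sup>2 * arrival z z2 N / (ren z * ren z2) - c / 4\<bar> < \<epsilon>"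
    if K: "0 < K" and \<epsilon>: "0 < \<epsilon>" for K \<epsilon>
  proof -
    obtain e where e: "e \<longlonglongrightarrow> 0" and ev:
      "\<forall>\<^sub>F N in sequentially. \<forall>z z2. gap z > 0 \<longrightarrow> gap z2 > 0 \<longrightarrow> fst z = 0 \<longrightarrow> fst z2 = 0
      \<longrightarrow> nrm z \<le> K * ln (real N) \<longrightarrow> nrm z2 \<le> K * ln (real N)
      \<longrightarrow> (real N)\<^sup>2 * \<bar>arrival z z2 N - ren z * ren z2 * (curv_sum N / 4)\<bar> \<le> e N"
      by (rule arrival_error[OF K], rule that)
    have e1: "\<forall>\<^sub>F N in sequentially. e N < \<epsilon> / 2"
      by (rule order_tendstoD(2)[OF e]) (use \<epsilon> in simp)
    have e2: "\<forall>\<^sub>F N in sequentially. dist ((real N)\<^sup>2 * curv_sum N) c < \<epsilon>"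
      by (rule tendstoD[OF c(2) \<epsilon>])
    show ?thesis
      using ev e1 e2
    proof eventually_elim
      case (elim N)
      show ?case
      proof (intro allI impI)
        fix z z2 :: point
        assume z: "gap z > 0" "gap z2 > 0" "fst z = 0" "fst z2 = 0" "nrm z \<le> K * ln (real N)" "nrm z2 \<le> K * ln (real N)"
        define V where "V = ren z * ren z2"
        \<comment> \<open>Since \<open>ren\<close> is at least the gap, hence at least 1, the
          additive error remains small after division by both values, uniformly in the end
          points.\<close>
        have r: "1 \<le> ren z" "1 \<le> ren z2"
          using Q(2)[OF z(1)] Q(2)[OF z(2)] one_le_gap_real[OF z(1)] one_le_gap_real[OF z(2)] by linarith+
        then have V: "1 \<le> V" using mult_mono[of 1 "ren z" 1 "ren z2"] by (simp add: V_def)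
        have b: "(real N)\<^sup>2 * \<bar>arrival z z2 N - V * (curv_sum N / 4)\<bar> \<le> e N"
          using elim(1) z unfolding V_def by blast
        have "(real N)\<^sup>2 * arrival z z2 N / V - (real N)\<^sup>2 * curv_sum N / 4
            = (real N)\<^sup>2 * (arrival z z2 N - V * (curv_sum N / 4)) / V"
          using V by (simp add: field_simps)
        then have "\<bar>(real N)\<^sup>2 * arrival z z2 N / V - (real N)\<^sup>2 * curv_sum N / 4\<bar>
            = (real N)\<^sup>2 * \<bar>arrival z z2 N - V * (curv_sum N / 4)\<bar> / V"
          using V by (simp add: abs_mult)
        also have "\<dots> \<le> (real N)\<^sup>2 * \<bar>arrival z z2 N - V * (curv_sum N / 4)\<bar> / 1"
          using V by (intro divide_left_mono) auto
        also have "\<dots> < \<epsilon> / 2" using b elim(2) by simp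
        finally have 1: "\<bar>(real N)\<^sup>2 * arrival z z2 N / V - (real N)\<^sup>2 * curv_sum N / 4\<bar> < \<epsilon> / 2" .
        have "\<bar>(real N)\<^sup>2 * curv_sum N - c\<bar> < \<epsilon>" using elim(3) by (simp add: dist_real_def)
        then have "\<bar>(real N)\<^sup>2 * curv_sum N / 4 - c / 4\<bar> < \<epsilon> / 4" by linarith
        with 1 \<epsilon> show "\<bar>(real N)\<^sup>2 * arrival z z2 N / (ren z * ren z2) - c / 4\<bar> < \<epsilon>"
          unfolding V_def by linarith
      qed
    qed
  qed
  show thesis by (rule that[of "c / 4"]) (use c(1) main in auto)
qed

end

subsection \<open>From the random steps to the killed walk\<close>

text \<open>Natural numbers have no true subtraction; with integer time the lattice is a group,
  which shifts, reflection and reversal need.\<close>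

definition int_time :: "triple \<Rightarrow> point" where
  "int_time s = (int (fst s), snd s)"

lemma inj_int_time: "inj int_time"
  by (rule injI) (simp add: int_time_def prod_eq_iff)

lemma int_time_add: "int_time (x + y) = int_time x + int_time y"
  by (simp add: int_time_def prod_eq_iff)

lemma gap_int_time: "gap (int_time s) > 0 \<longleftrightarrow> V_of s < X_of s"
  by (simp add: gap_def int_time_def V_of_def X_of_def)

text \<open>The position together with a record of whether the order has held so far. The pair obeys
  the one-step recursion \<open>extend_path\<close>, so its law can be built up by adding one
  independent step at a time.\<close>

definition ordered_path :: "(nat \<Rightarrow> 'a \<Rightarrow> triple) \<Rightarrow> int \<Rightarrow> int \<Rightarrow> nat \<Rightarrow> 'a \<Rightarrow> triple \<times> bool" where
  "ordered_path \<sigma> v x n \<omega> = (walk \<sigma> v x n \<omega>, \<forall>k\<in>{1..n}. V_of (walk \<sigma> v x k \<omega>) < X_of (walk \<sigma> v x k \<omega>))"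

definition extend_path :: "(triple \<times> bool) \<times> triple \<Rightarrow> triple \<times> bool" where
  "extend_path y = (let w = fst (fst y) + snd y in (w, snd (fst y) \<and> V_of w < X_of w))"

lemma walk_Suc: "walk \<sigma> v x (Suc n) \<omega> = walk \<sigma> v x n \<omega> + \<sigma> (Suc n) \<omega>"
  by (simp add: walk_def add.assoc)

lemma ordered_path_Suc: "ordered_path \<sigma> v x (Suc n) \<omega> = extend_path (ordered_path \<sigma> v x n \<omega>, \<sigma> (Suc n) \<omega>)"
  unfolding ordered_path_def extend_path_def Let_def
  by (auto simp: walk_Suc[symmetric] atLeastAtMostSuc_conv)

text \<open>Exhibits the path as a function of the steps 1 to \<open>n\<close> only, which is what
  makes it independent of step \<open>Suc n\<close>.\<close>

lemma ordered_path_restrict: "ordered_path \<sigma> v x n \<omega> = ordered_path (\<lambda>k y. y k) v x n (restrict (\<lambda>k. \<sigma> k \<omega>) {1..n})"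
proof -
  have "walk \<sigma> v x m \<omega> = walk (\<lambda>k y. y k) v x m (restrict (\<lambda>k. \<sigma> k \<omega>) {1..n})" if "m \<le> n" for m
    unfolding walk_def using that by (auto intro!: sum.cong)
  then show ?thesis unfolding ordered_path_def by simp
qed

lemma (in prob_space) distr_pmf:
  fixes X :: "'a \<Rightarrow> 'b :: countable"
  assumes X: "X \<in> measurable M (count_space UNIV)"
  obtains q where "measure_pmf q = distr M (count_space UNIV) X"
proof -
  let ?D = "distr M (count_space UNIV) X"
  interpret D: prob_space ?D by (rule prob_space_distr[OF X])
  have "AE x in ?D. measure ?D {x} \<noteq> 0"
    by (subst D.AE_support_countable) (auto intro: exI[of _ UNIV])
  then have "measure_pmf (Abs_pmf ?D) = ?D"
    by (intro Abs_pmf_inverse) (simp add: D.prob_space_axioms)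
  then show thesis by (rule that)
qed

lemma (in prob_space) pmf_distr:
  assumes "X \<in> measurable M (count_space UNIV)" "measure_pmf q = distr M (count_space UNIV) X"
  shows "pmf q a = prob {\<omega> \<in> space M. X \<omega> = a}"
  unfolding pmf.rep_eq assms(2) using assms(1)
  by (subst measure_distr) (auto intro!: arg_cong[where f=prob])

locale walk_law = prob_space M for M :: "'a measure" +
  fixes \<sigma> :: "nat \<Rightarrow> 'a \<Rightarrow> triple" and q :: "triple pmf"
  assumes iid: "iid_steps M \<sigma>"
    and law: "measure_pmf q = distr M (count_space UNIV) (\<sigma> 1)"
begin

lemma measurable_step: "1 \<le> k \<Longrightarrow> \<sigma> k \<in> measurable M (count_space UNIV)"
  using iid unfolding iid_steps_def indep_vars_def by auto

text \<open>The second component \<open>True\<close> is a dummy: \<open>indep_var\<close> needs variables of the same type.\<close>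

lemma indep_path_step:
  "indep_var (count_space UNIV) (ordered_path \<sigma> v x n) (count_space UNIV) (\<lambda>\<omega>. (\<sigma> (Suc n) \<omega>, True))"
proof -
  let ?C = "count_space (UNIV :: triple set)"
  have PiM: "PiM A (\<lambda>_. ?C) = count_space (PiE A (\<lambda>_. UNIV))" if "finite A" for A :: "nat set"
    using count_space_PiM_finite[OF that, of "\<lambda>_. UNIV :: triple set"] by simp
  have ind: "indep_vars (\<lambda>_. ?C) \<sigma> {1..}" using iid by (simp add: iid_steps_def)
  have "indep_var (count_space UNIV) (ordered_path (\<lambda>k y. y k) v x n \<circ> (\<lambda>\<omega>. restrict (\<lambda>k. \<sigma> k \<omega>) {1..n}))
      (count_space UNIV) ((\<lambda>y. (y (Suc n), True)) \<circ> (\<lambda>\<omega>. restrict (\<lambda>k. \<sigma> k \<omega>) {Suc n}))"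
    by (rule indep_var_compose[OF indep_var_restrict[OF ind]]) (auto simp: PiM)
  moreover have "ordered_path (\<lambda>k y. y k) v x n \<circ> (\<lambda>\<omega>. restrict (\<lambda>k. \<sigma> k \<omega>) {1..n}) = ordered_path \<sigma> v x n"
    unfolding o_def ordered_path_restrict[of \<sigma>, symmetric] ..
  moreover have "(\<lambda>y. (y (Suc n), True)) \<circ> (\<lambda>\<omega>. restrict (\<lambda>k. \<sigma> k \<omega>) {Suc n}) = (\<lambda>\<omega>. (\<sigma> (Suc n) \<omega>, True))"
    by (simp add: fun_eq_iff)
  ultimately show ?thesis by simp
qed

lemma measurable_path: "ordered_path \<sigma> v x n \<in> measurable M (count_space UNIV)"
  using indep_path_step[of v x n] by (rule indep_var_rv1)

lemma pmf_step: "1 \<le> k \<Longrightarrow> pmf q a = prob {\<omega> \<in> space M. \<sigma> k \<omega> = a}"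
proof (rule pmf_distr[OF measurable_step])
  assume "1 \<le> k"
  then have "distr M (count_space UNIV) (\<sigma> k) = distr M (count_space UNIV) (\<sigma> 1)"
    using iid unfolding iid_steps_def by blast
  then show "measure_pmf q = distr M (count_space UNIV) (\<sigma> k)" by (simp only: law)
qed

lemma ordered_path_law_Suc:
  assumes r: "measure_pmf r = distr M (count_space UNIV) (ordered_path \<sigma> v x n)"
    and r': "measure_pmf r' = distr M (count_space UNIV) (ordered_path \<sigma> v x (Suc n))"
  shows "r' = map_pmf extend_path (pair_pmf r q)"
proof -
  let ?X = "\<lambda>\<omega>. (ordered_path \<sigma> v x n \<omega>, \<sigma> (Suc n) \<omega>)"
  have mX: "?X \<in> measurable M (count_space UNIV)"
    using measurable_Pair[OF measurable_path[of v x n] measurable_step[of "Suc n"]]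
    by (simp add: pair_measure_countable)
  obtain j where j: "measure_pmf j = distr M (count_space UNIV) ?X"
    by (rule distr_pmf[OF mX])
  have "j = pair_pmf r q"
  proof (rule pmf_eqI)
    fix y :: "(triple \<times> bool) \<times> triple"
    obtain a b where y: "y = (a, b)" by (cases y)
    let ?Y = "\<lambda>\<omega>. (\<sigma> (Suc n) \<omega>, True)"
    have "pmf j y = prob ((\<lambda>\<omega>. (ordered_path \<sigma> v x n \<omega>, ?Y \<omega>)) -` ({a} \<times> {(b, True)}) \<inter> space M)"
      unfolding pmf_distr[OF mX j] y by (rule arg_cong[where f=prob]) auto
    also have "\<dots> = prob (ordered_path \<sigma> v x n -` {a} \<inter> space M) * prob (?Y -` {(b, True)} \<inter> space M)"
      by (rule indep_varD[OF indep_path_step]) auto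
    also have "ordered_path \<sigma> v x n -` {a} \<inter> space M = {\<omega> \<in> space M. ordered_path \<sigma> v x n \<omega> = a}" by auto
    also have "?Y -` {(b, True)} \<inter> space M = {\<omega> \<in> space M. \<sigma> (Suc n) \<omega> = b}" by auto
    also have "prob {\<omega> \<in> space M. ordered_path \<sigma> v x n \<omega> = a} * prob {\<omega> \<in> space M. \<sigma> (Suc n) \<omega> = b} = pmf r a * pmf q b"
      using pmf_distr[OF measurable_path r] pmf_step[of "Suc n"] by simp
    also have "\<dots> = pmf (pair_pmf r q) y" by (simp add: y pmf_pair)
    finally show "pmf j y = pmf (pair_pmf r q) y" .
  qed
  moreover have "measure_pmf (map_pmf extend_path j) = measure_pmf r'"
    unfolding map_pmf_rep_eq j r' using mX
    by (subst distr_distr) (auto simp: o_def ordered_path_Suc[symmetric])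
  ultimately show ?thesis by (simp add: measure_pmf_inject)
qed

text \<open>The law of the path grows by a step at its end, while \<open>kill\<close> recurses at
  the start. The induction therefore varies \<open>f\<close>: the last step is absorbed as one
  killed step applied to \<open>f\<close>, and \<open>kill_add_time\<close> puts it back.\<close>

lemma expectation_path:
  assumes r: "measure_pmf r = distr M (count_space UNIV) (ordered_path \<sigma> v x n)"
    and f: "\<And>y. \<bar>f y\<bar> \<le> B"
  shows "measure_pmf.expectation r (\<lambda>y. if snd y then f (int_time (fst y)) else 0)
    = kill (map_pmf int_time q) n f (0, v, x)"
  using r f
proof (induction n arbitrary: r f B)
  case 0
  have "r = return_pmf ((0, v, x), True)"
  proof (rule pmf_eqI)
    fix a
    show "pmf r a = pmf (return_pmf ((0, v, x), True)) a"
      unfolding pmf_distr[OF measurable_path 0(1)]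
      by (auto simp: ordered_path_def walk_def prob_space indicator_def)
  qed
  then show ?case by (simp add: int_time_def)
next
  case (Suc n)
  let ?p = "map_pmf int_time q" and ?g = "\<lambda>y. kill (map_pmf int_time q) 1 f y"
  obtain r0 where r0: "measure_pmf r0 = distr M (count_space UNIV) (ordered_path \<sigma> v x n)"
    by (rule distr_pmf[OF measurable_path])
  have B0: "0 \<le> B" using Suc.prems(2)[of 0] by linarith
  have r: "r = map_pmf extend_path (pair_pmf r0 q)" by (rule ordered_path_law_Suc[OF r0 Suc.prems(1)])
  let ?h = "\<lambda>y. if snd y then f (int_time (fst y)) else 0"
  have g: "\<bar>?g y\<bar> \<le> B" for y
    unfolding One_nat_def kill.simps using Suc.prems(2) B0
    by (intro expectation_abs_le) (simp del: split_paired_All)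
  have inner: "measure_pmf.expectation q (\<lambda>s. ?h (extend_path (y, s))) = (if snd y then ?g (int_time (fst y)) else 0)" for y
    by (simp add: extend_path_def Let_def gap_int_time[symmetric] int_time_add cong: if_cong)
  have "measure_pmf.expectation r ?h = measure_pmf.expectation (pair_pmf r0 q) (\<lambda>y. ?h (extend_path y))"
    unfolding r by simp
  also have "\<dots> = measure_pmf.expectation r0 (\<lambda>y. measure_pmf.expectation q (\<lambda>s. ?h (extend_path (y, s))))"
    unfolding pair_pmf_def
    by (subst expectation_bind_pmf[where B=B],
        use Suc.prems(2) B0 in simp)
      (subst expectation_bind_pmf[where B=B], use Suc.prems(2) B0 in simp_all)
  also have "\<dots> = kill ?p n ?g (0, v, x)"
    unfolding inner by (rule Suc.IH[OF r0 g])
  also have "\<dots> = kill ?p (Suc n) f (0, v, x)"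
    unfolding kill_add_time[symmetric] by (simp only: add_Suc_right add_0_right One_nat_def)
  finally show ?case .
qed

lemma prob_ordered:
  "prob ({\<omega> \<in> space M. walk \<sigma> v x n \<omega> = w} \<inter> ordered_event M \<sigma> v x n)
    = kill (map_pmf int_time q) n (indicator {int_time w}) (0, v, x)"
proof -
  obtain r where r: "measure_pmf r = distr M (count_space UNIV) (ordered_path \<sigma> v x n)"
    by (rule distr_pmf[OF measurable_path])
  have "{\<omega> \<in> space M. walk \<sigma> v x n \<omega> = w} \<inter> ordered_event M \<sigma> v x n
      = {\<omega> \<in> space M. ordered_path \<sigma> v x n \<omega> = (w, True)}"
    by (auto simp: ordered_event_def ordered_path_def)
  then have "prob ({\<omega> \<in> space M. walk \<sigma> v x n \<omega> = w} \<inter> ordered_event M \<sigma> v x n) = pmf r (w, True)"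
    using pmf_distr[OF measurable_path r] by simp
  also have "\<dots> = measure_pmf.expectation r (indicat_real {(w, True)})"
    by (simp add: measure_pmf_single)
  also have "indicat_real {(w, True)} = (\<lambda>y. if snd y then indicator {int_time w} (int_time (fst y)) else 0)"
    using inj_int_time by (auto simp: fun_eq_iff indicator_def inj_eq)
  also have "measure_pmf.expectation r \<dots> = kill (map_pmf int_time q) n (indicator {int_time w}) (0, v, x)"
    by (rule expectation_path[OF r, where B=1]) (simp add: indicator_def)
  finally show ?thesis .
qed

lemma ordered_event_measurable:
  "{\<omega> \<in> space M. walk \<sigma> v x n \<omega> = w} \<inter> ordered_event M \<sigma> v x n \<in> sets M"
proof -
  have "{\<omega> \<in> space M. walk \<sigma> v x n \<omega> = w} \<inter> ordered_event M \<sigma> v x n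
      = ordered_path \<sigma> v x n -` {(w, True)} \<inter> space M"
    by (auto simp: ordered_event_def ordered_path_def)
  then show ?thesis using measurable_sets[OF measurable_path[of v x n], of "{(w, True)}"] by simp
qed

lemma walk_time:
  assumes "\<omega> \<in> space M"
  shows "n + fst (walk \<sigma> v x m \<omega>) \<le> fst (walk \<sigma> v x (m + n) \<omega>)"
proof (induction n)
  case (Suc n)
  have "1 \<le> fst (\<sigma> (Suc (m + n)) \<omega>)"
    using iid assms unfolding iid_steps_def time_of_def by simp
  then show ?case using Suc by (simp add: walk_Suc)
qed simp

text \<open>Time increases strictly along the walk, so a space-time point is visited for at most one
  \<open>n\<close>, and for \<open>n \<le> N\<close>: the union is finite and disjoint.\<close>

lemma ordered_hitting_prob_eq:
  "ordered_hitting_prob M \<sigma> v x (N, u, y)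
    = (\<Sum>n\<le>N. kill (map_pmf int_time q) n (indicator {(int N, u, y)}) (0, v, x))"
proof -
  let ?E = "\<lambda>n. {\<omega> \<in> space M. walk \<sigma> v x n \<omega> = (N, u, y)} \<inter> ordered_event M \<sigma> v x n"
  have "?E n = {}" if "N < n" for n
  proof -
    have "walk \<sigma> v x n \<omega> \<noteq> (N, u, y)" if "\<omega> \<in> space M" for \<omega>
      using walk_time[OF that, of n v x 0] \<open>N < n\<close> by auto
    then show ?thesis by auto
  qed
  then have "(\<Union>n. ?E n) = (\<Union>n\<in>{..N}. ?E n)" by (fastforce simp: not_le[symmetric])
  moreover have "disjoint_family_on ?E {..N}"
  proof -
    have ne: "walk \<sigma> v x m \<omega> \<noteq> walk \<sigma> v x n \<omega>" if "\<omega> \<in> space M" "m < n" for m n \<omega>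
      using walk_time[OF that(1), of "n - m" v x m] that(2) by auto
    show ?thesis
      unfolding disjoint_family_on_def
    proof (intro ballI impI)
      fix m n :: nat assume "m \<noteq> n"
      then consider "m < n" | "n < m" by linarith
      then show "?E m \<inter> ?E n = {}" by cases (use ne in fastforce)+
    qed
  qed
  ultimately have "ordered_hitting_prob M \<sigma> v x (N, u, y) = (\<Sum>n\<le>N. prob (?E n))"
    unfolding ordered_hitting_prob_def
    by (simp only:) (rule finite_measure_finite_Union, use ordered_event_measurable in auto)
  then show ?thesis by (simp add: prob_ordered int_time_def)
qed

lemma integrable_time:
  assumes "exponential_time_tail M (\<sigma> 1)"
  obtains \<delta> where "0 < \<delta>" "integrable (measure_pmf q) (\<lambda>s. exp (\<delta> * real (fst s)))"
proof -
  obtain \<beta> C :: real where \<beta>: "\<beta> > 0"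
    and C: "\<And>t. prob {\<omega> \<in> space M. time_of (\<sigma> 1 \<omega>) > t} \<le> C * exp (- \<beta> * real t)"
    using assms unfolding exponential_time_tail_def by auto
  let ?r = "map_pmf fst q"
  have m1: "\<sigma> 1 \<in> measurable M (count_space UNIV)" by (rule measurable_step) simp
  have m: "{\<omega> \<in> space M. P (\<sigma> 1 \<omega>)} \<in> sets M" for P
    using measurable_sets[OF m1, of "Collect P"] by (simp add: vimage_def Int_def conj_commute)
  have pr: "pmf ?r (Suc t) \<le> C * exp (- \<beta> * real t)" for t
  proof -
    have "pmf ?r (Suc t) = measure (measure_pmf q) (fst -` {Suc t})" by (simp add: pmf_map)
    also have "\<dots> = prob {\<omega> \<in> space M. fst (\<sigma> 1 \<omega>) = Suc t}"
      unfolding law using m1 by (subst measure_distr) (auto intro!: arg_cong[where f=prob])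
    also have "\<dots> \<le> prob {\<omega> \<in> space M. time_of (\<sigma> 1 \<omega>) > t}"
      by (rule finite_measure_mono) (use m in \<open>auto simp: time_of_def\<close>)
    also have "\<dots> \<le> C * exp (- \<beta> * real t)" by (rule C)
    finally show ?thesis .
  qed
  \<comment> \<open>Half of the tail rate becomes the exponent of the moment; the other half makes
    the series geometric. The index is \<open>Suc t\<close> because the tail bound concerns times
    greater than \<open>t\<close>.\<close>
  have "summable (\<lambda>t. pmf ?r (Suc t) * exp (\<beta> / 2 * real (Suc t)))"
  proof (rule summable_comparison_test')
    show "summable (\<lambda>t. C * exp (\<beta> / 2) * exp (- \<beta> / 2) ^ t)"
      using \<beta> by (intro summable_mult summable_geometric) simp
    show "norm (pmf ?r (Suc t) * exp (\<beta> / 2 * real (Suc t))) \<le> C * exp (\<beta> / 2) * exp (- \<beta> / 2) ^ t" if "0 \<le> t" for t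
    proof -
      have "norm (pmf ?r (Suc t) * exp (\<beta> / 2 * real (Suc t))) = pmf ?r (Suc t) * exp (\<beta> / 2 * real (Suc t))"
        by simp
      also have "\<dots> \<le> C * exp (- \<beta> * real t) * exp (\<beta> / 2 * real (Suc t))"
        by (rule mult_right_mono[OF pr]) simp
      also have "\<dots> = C * exp (- \<beta> * real t + \<beta> / 2 * real (Suc t))"
        by (simp only: exp_add mult.assoc)
      also have "- \<beta> * real t + \<beta> / 2 * real (Suc t) = \<beta> / 2 + real t * (- \<beta> / 2)"
        by (simp add: field_simps)
      also have "C * exp (\<beta> / 2 + real t * (- \<beta> / 2)) = C * exp (\<beta> / 2) * exp (- \<beta> / 2) ^ t"
        by (simp only: exp_add exp_of_nat_mult mult.assoc)
      finally show ?thesis .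
    qed
  qed
  then have "summable (\<lambda>t. pmf ?r t * exp (\<beta> / 2 * real t))"
    by (rule summable_Suc_iff[THEN iffD1])
  then have "integrable (measure_pmf ?r) (\<lambda>t. exp (\<beta> / 2 * real t))"
    by (simp add: measure_pmf_eq_density integrable_density integrable_count_space_nat_iff)
  then have "integrable (measure_pmf q) (\<lambda>s. exp (\<beta> / 2 * real (fst s)))"
    by simp
  with \<beta> show thesis by (intro that[of "\<beta> / 2"]) auto
qed

lemma symmetric_pmf:
  assumes "full_cone_range M (\<sigma> 1)" "conditionally_symmetric M (\<sigma> 1)"
  shows "pmf q (t, v, x) = pmf q (t, x, v)" "pmf q (t, v, x) = pmf q (t, - v, - x)"
proof -
  have eq: "pmf q (t, v, x) = pmf q (t, x, v) \<and> pmf q (t, v, x) = pmf q (t, \<bar>v\<bar>, \<bar>x\<bar>)" for v x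
  proof (cases "t = 0")
    \<comment> \<open>Conditional symmetry speaks of times from 1 on; at time 0 both sides vanish
      because no step takes zero time.\<close>
    case True
    have "pmf q (0, a) = 0" for a
    proof -
      have "{\<omega> \<in> space M. \<sigma> 1 \<omega> = (0, a)} = {}"
        using iid unfolding iid_steps_def time_of_def by fastforce
      then show ?thesis by (simp only: pmf_step[OF order_refl] measure_empty)
    qed
    then show ?thesis using True by simp
  next
    case False
    let ?c = "\<lambda>a b. \<P>(\<omega> in M. V_of (\<sigma> 1 \<omega>) = a \<and> X_of (\<sigma> 1 \<omega>) = b \<bar> time_of (\<sigma> 1 \<omega>) = t)"
    let ?D = "prob {\<omega> \<in> space M. time_of (\<sigma> 1 \<omega>) = t}"
    have m1: "\<sigma> 1 \<in> measurable M (count_space UNIV)" by (rule measurable_step) simp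
    have m: "{\<omega> \<in> space M. time_of (\<sigma> 1 \<omega>) = t} \<in> sets M"
      using measurable_sets[OF m1, of "{s. time_of s = t}"] by (simp add: vimage_def Int_def conj_commute)
    obtain \<alpha> :: real where \<alpha>: "\<alpha> > 0" "{s. \<P>(\<omega> in M. \<sigma> 1 \<omega> = s) > 0} =
       {(t, v, x). t \<ge> 1 \<and> \<bar>real_of_int v\<bar> < \<alpha> * real t \<and> \<bar>real_of_int x\<bar> < \<alpha> * real t}"
      using assms(1) unfolding full_cone_range_def by auto
    \<comment> \<open>The range condition shows that the conditioning event has positive
      probability, so the conditional probabilities are true quotients and not the default
      0.\<close>
    have "(t, 0, 0) \<in> {s. \<P>(\<omega> in M. \<sigma> 1 \<omega> = s) > 0}" unfolding \<alpha>(2) using False \<alpha>(1) by simp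
    then have "0 < prob {\<omega> \<in> space M. \<sigma> 1 \<omega> = (t, 0, 0)}" by simp
    also have "\<dots> \<le> ?D" by (rule finite_measure_mono[OF _ m]) (auto simp: time_of_def)
    finally have D: "0 < ?D" .
    have c: "pmf q (t, a, b) = ?c a b * ?D" for a b
    proof -
      have "{\<omega> \<in> space M. (V_of (\<sigma> 1 \<omega>) = a \<and> X_of (\<sigma> 1 \<omega>) = b) \<and> time_of (\<sigma> 1 \<omega>) = t}
          = {\<omega> \<in> space M. \<sigma> 1 \<omega> = (t, a, b)}"
        by (auto simp: V_of_def X_of_def time_of_def prod_eq_iff)
      then show ?thesis using D pmf_step[of 1 "(t, a, b)"] by (simp add: cond_prob_def)
    qed
    have "1 \<le> t" using False by simp
    note sy = assms(2)[unfolded conditionally_symmetric_def, rule_format, OF this, of v x]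
    have "pmf q (t, v, x) = pmf q (t, x, v)" unfolding c sy[THEN conjunct2] ..
    moreover have "pmf q (t, v, x) = pmf q (t, \<bar>v\<bar>, \<bar>x\<bar>)" unfolding c sy[THEN conjunct1] ..
    ultimately show ?thesis ..
  qed
  from eq[of v x] eq[of "- v" "- x"]
  show "pmf q (t, v, x) = pmf q (t, x, v)" "pmf q (t, v, x) = pmf q (t, - v, - x)" by simp_all
qed

lemma cone_walk_int_time:
  assumes range: "full_cone_range M (\<sigma> 1)" and tail: "exponential_time_tail M (\<sigma> 1)"
    and sym: "conditionally_symmetric M (\<sigma> 1)"
  shows "cone_walk (map_pmf int_time q)"
proof
  obtain \<alpha> :: real where \<alpha>: "\<alpha> > 0" and ran: "{s. \<P>(\<omega> in M. \<sigma> 1 \<omega> = s) > 0} =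
      {(t, v, x). t \<ge> 1 \<and> \<bar>real_of_int v\<bar> < \<alpha> * real t \<and> \<bar>real_of_int x\<bar> < \<alpha> * real t}"
    using range unfolding full_cone_range_def by auto
  have pos: "0 < pmf q s \<longleftrightarrow> 1 \<le> fst s \<and> \<bar>real_of_int (fst (snd s))\<bar> < \<alpha> * real (fst s)
      \<and> \<bar>real_of_int (snd (snd s))\<bar> < \<alpha> * real (fst s)" for s
  proof -
    have "0 < pmf q s \<longleftrightarrow> s \<in> {s. \<P>(\<omega> in M. \<sigma> 1 \<omega> = s) > 0}" using pmf_step[of 1 s] by simp
    then show ?thesis unfolding ran by (cases s) auto
  qed
  have supp: "1 \<le> fst s \<and> \<bar>real_of_int (fst (snd s))\<bar> < \<alpha> * real (fst s)
      \<and> \<bar>real_of_int (snd (snd s))\<bar> < \<alpha> * real (fst s)" if "s \<in> set_pmf q" for s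
    unfolding pos[symmetric] using that by (rule pmf_positive)
  have swap: "map_pmf (\<lambda>s. (fst s, snd (snd s), fst (snd s))) q = q"
  proof (rule pmf_eqI)
    fix s :: triple
    have "pmf (map_pmf (\<lambda>s. (fst s, snd (snd s), fst (snd s))) q) ((\<lambda>s. (fst s, snd (snd s), fst (snd s))) (fst s, snd (snd s), fst (snd s)))
        = pmf q (fst s, snd (snd s), fst (snd s))"
      by (rule pmf_map_inj') (auto intro!: injI simp: prod_eq_iff)
    then show "pmf (map_pmf (\<lambda>s. (fst s, snd (snd s), fst (snd s))) q) s = pmf q s"
      using symmetric_pmf(1)[OF range sym, of "fst s" "fst (snd s)" "snd (snd s)"] by simp
  qed
  have neg: "map_pmf (\<lambda>s. (fst s, - fst (snd s), - snd (snd s))) q = q"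
  proof (rule pmf_eqI)
    fix s :: triple
    have "pmf (map_pmf (\<lambda>s. (fst s, - fst (snd s), - snd (snd s))) q) ((\<lambda>s. (fst s, - fst (snd s), - snd (snd s))) (fst s, - fst (snd s), - snd (snd s)))
        = pmf q (fst s, - fst (snd s), - snd (snd s))"
      by (rule pmf_map_inj') (auto intro!: injI simp: prod_eq_iff)
    then show "pmf (map_pmf (\<lambda>s. (fst s, - fst (snd s), - snd (snd s))) q) s = pmf q s"
      using symmetric_pmf(2)[OF range sym, of "fst s" "fst (snd s)" "snd (snd s)"] by simp
  qed
  have "map_pmf mirror (map_pmf int_time q) = map_pmf int_time (map_pmf (\<lambda>s. (fst s, snd (snd s), fst (snd s))) q)"
    by (simp add: pmf.map_comp o_def mirror_def int_time_def)
  then show "map_pmf mirror (map_pmf int_time q) = map_pmf int_time q" unfolding swap .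
  have "map_pmf (\<lambda>z. (fst z, - fst (snd z), - snd (snd z))) (map_pmf int_time q)
      = map_pmf int_time (map_pmf (\<lambda>s. (fst s, - fst (snd s), - snd (snd s))) q)"
    by (simp add: pmf.map_comp o_def int_time_def)
  then show "map_pmf (\<lambda>z. (fst z, - fst (snd z), - snd (snd z))) (map_pmf int_time q) = map_pmf int_time q"
    unfolding neg .
  show "1 \<le> fst s" if "s \<in> set_pmf (map_pmf int_time q)" for s
    using that supp by (auto simp: int_time_def)
  \<comment> \<open>Large enough that \<open>\<alpha> * t\<close> exceeds 1, so that the cone at
    height \<open>t\<close> contains the neighbours of the origin.\<close>
  obtain t :: nat where t: "1 / \<alpha> < real t" using reals_Archimedean2 by blast
  then have "1 < \<alpha> * real t" using \<alpha> by (simp add: field_simps)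
  moreover have "0 < real t" using t \<alpha> by (meson divide_pos_pos less_trans zero_less_one)
  ultimately have at: "0 < pmf q (t, 0, 0)" "0 < pmf q (t + 1, 0, 0)" "0 < pmf q (t, 1, 0)" "0 < pmf q (t, 0, 1)"
    using \<alpha> unfolding pos by auto
  have pe: "pmf (map_pmf int_time q) (int k, a) = pmf q (k, a)" for k a
    using pmf_map_inj'[OF inj_int_time, of q "(k, a)"] by (simp add: int_time_def)
  show "\<exists>t. 0 < pmf (map_pmf int_time q) (t, 0, 0) \<and> 0 < pmf (map_pmf int_time q) (t + 1, 0, 0)
      \<and> 0 < pmf (map_pmf int_time q) (t, 1, 0) \<and> 0 < pmf (map_pmf int_time q) (t, 0, 1)"
    using at pe[of "t + 1"] by (intro exI[of _ "int t"]) (simp add: pe add.commute)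
  obtain \<delta> where \<delta>: "0 < \<delta>" "integrable (measure_pmf q) (\<lambda>s. exp (\<delta> * real (fst s)))"
    by (rule integrable_time[OF tail])
  \<comment> \<open>On the cone the norm is at most \<open>1 + 2 * \<alpha>\<close> times the
    duration, so a moment of the duration bounds one of the norm.\<close>
  let ?g = "\<delta> / (1 + 2 * \<alpha>)"
  have "integrable (measure_pmf q) (\<lambda>s. exp (?g * nrm (int_time s)))"
  proof (rule Bochner_Integration.integrable_bound[OF \<delta>(2)])
    show "AE s in measure_pmf q. norm (exp (?g * nrm (int_time s))) \<le> norm (exp (\<delta> * real (fst s)))"
    proof (rule AE_pmfI)
      fix s assume "s \<in> set_pmf q"
      then have "nrm (int_time s) \<le> (1 + 2 * \<alpha>) * real (fst s)"
        using supp[of s] by (simp add: nrm_def int_time_def distrib_right)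
      then have "?g * nrm (int_time s) \<le> ?g * ((1 + 2 * \<alpha>) * real (fst s))"
        using \<delta>(1) \<alpha> by (intro mult_left_mono) auto
      also have "\<dots> = \<delta> * real (fst s)" using \<alpha> by (simp add: field_simps)
      finally show "norm (exp (?g * nrm (int_time s))) \<le> norm (exp (\<delta> * real (fst s)))" by simp
    qed
  qed simp
  then show "\<exists>\<gamma>>0. integrable (measure_pmf (map_pmf int_time q)) (\<lambda>s. exp (\<gamma> * nrm s))"
    using \<delta>(1) \<alpha> by (intro exI[of _ ?g]) simp
qed

end

theorem theorem2:
  fixes M :: "'a measure" and \<sigma> :: "nat \<Rightarrow> 'a \<Rightarrow> nat \<times> int \<times> int"
  assumes "prob_space M"
    and "iid_steps M \<sigma>"
    and "full_cone_range M (\<sigma> 1)"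
    and "exponential_time_tail M (\<sigma> 1)"
    and "conditionally_symmetric M (\<sigma> 1)"
  shows "\<exists>(U :: nat \<Rightarrow> real) (c :: real).
    (\<forall>z\<ge>1. U z > 0) \<and>
    bdd_above ((\<lambda>z. U z / real z) ` {1..}) \<and>
    c > 0 \<and>
    (\<forall>K>0. \<forall>\<epsilon>>0. \<forall>\<^sub>F N in sequentially.
      \<forall>v x u y :: int. v < x \<longrightarrow> u < y \<longrightarrow>
        (\<forall>z\<in>{v, x, u, y}. \<bar>real_of_int z\<bar> \<le> K * ln (real N)) \<longrightarrow>
        \<bar>(real N)\<^sup>2 * ordered_hitting_prob M \<sigma> v x (N, u, y)
           / (U (nat (x - v)) * U (nat (y - u))) - c\<bar> < \<epsilon>)"
proof -
  interpret prob_space M by fact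
  have "\<sigma> 1 \<in> measurable M (count_space UNIV)"
    using assms(2) unfolding iid_steps_def indep_vars_def by auto
  then obtain q where q: "measure_pmf q = distr M (count_space UNIV) (\<sigma> 1)" by (rule distr_pmf)
  interpret W: walk_law M \<sigma> q by standard (fact assms(2) q)+
  interpret cone_walk "map_pmf int_time q" by (rule W.cone_walk_int_time) fact+
  obtain Q where Q: "\<And>z. gap z > 0 \<Longrightarrow> real_of_int (gap z) \<le> ren z"
      "\<And>z. gap z > 0 \<Longrightarrow> ren z \<le> Q * real_of_int (gap z)"
    by (rule ren_bounds, rule that)
  obtain c where c: "0 < c"
    "\<And>K \<epsilon>. 0 < K \<Longrightarrow> 0 < \<epsilon> \<Longrightarrow> \<forall>\<^sub>F N in sequentially. \<forall>z z2. gap z > 0 \<longrightarrow> gap z2 > 0 \<longrightarrow> fst z = 0 \<longrightarrow> fst z2 = 0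
      \<longrightarrow> nrm z \<le> K * ln (real N) \<longrightarrow> nrm z2 \<le> K * ln (real N)
      \<longrightarrow> \<bar>(real N)\<^sup>2 * arrival z z2 N / (ren z * ren z2) - c\<bar> < \<epsilon>"
    by (rule arrival_asymptotics, rule that)
  \<comment> \<open>Any point with gap \<open>z\<close> would do, by
    \<open>ren_gap_only\<close>.\<close>
  define U where "U z = ren (0, 0, int z)" for z
  have Ub: "real z \<le> U z" "U z \<le> Q * real z" if "1 \<le> z" for z
    using Q[of "(0, 0, int z)"] that by (simp_all add: U_def gap_def)
  have bdd: "bdd_above ((\<lambda>z. U z / real z) ` {1..})"
  proof (rule bdd_aboveI2)
    show "U z / real z \<le> Q" if "z \<in> {1..}" for z
      using Ub(2)[of z] that by (simp add: field_simps)
  qed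
  have "\<forall>\<^sub>F N in sequentially. \<forall>v x u y :: int. v < x \<longrightarrow> u < y \<longrightarrow>
        (\<forall>z\<in>{v, x, u, y}. \<bar>real_of_int z\<bar> \<le> K * ln (real N)) \<longrightarrow>
        \<bar>(real N)\<^sup>2 * ordered_hitting_prob M \<sigma> v x (N, u, y)
           / (U (nat (x - v)) * U (nat (y - u))) - c\<bar> < \<epsilon>" if "0 < K" "0 < \<epsilon>" for K \<epsilon>
    \<comment> \<open>Doubled because \<open>nrm\<close> adds the absolute values of both space
      coordinates.\<close>
    using c(2)[of "2 * K" \<epsilon>]
  proof (rule eventually_mono)
    show "0 < 2 * K" "0 < \<epsilon>" using that by simp_all
    fix N
    assume *: "\<forall>z z2. gap z > 0 \<longrightarrow> gap z2 > 0 \<longrightarrow> fst z = 0 \<longrightarrow> fst z2 = 0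
      \<longrightarrow> nrm z \<le> 2 * K * ln (real N) \<longrightarrow> nrm z2 \<le> 2 * K * ln (real N)
      \<longrightarrow> \<bar>(real N)\<^sup>2 * arrival z z2 N / (ren z * ren z2) - c\<bar> < \<epsilon>"
    show "\<forall>v x u y :: int. v < x \<longrightarrow> u < y \<longrightarrow>
        (\<forall>z\<in>{v, x, u, y}. \<bar>real_of_int z\<bar> \<le> K * ln (real N)) \<longrightarrow>
        \<bar>(real N)\<^sup>2 * ordered_hitting_prob M \<sigma> v x (N, u, y)
           / (U (nat (x - v)) * U (nat (y - u))) - c\<bar> < \<epsilon>"
    proof (intro allI impI)
      fix v x u y :: int
      assume o: "v < x" "u < y" and b: "\<forall>z\<in>{v, x, u, y}. \<bar>real_of_int z\<bar> \<le> K * ln (real N)"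
      have "ordered_hitting_prob M \<sigma> v x (N, u, y) = arrival (0, v, x) (0, u, y) N"
        by (simp add: W.ordered_hitting_prob_eq arrival_def time_flip_def)
      moreover have "U (nat (x - v)) = ren (0, v, x)" "U (nat (y - u)) = ren (0, u, y)"
        unfolding U_def using o by (auto intro!: ren_gap_only simp: gap_def)
      moreover have "nrm (0, v, x) \<le> 2 * K * ln (real N)" "nrm (0, u, y) \<le> 2 * K * ln (real N)"
        using b by (auto simp: nrm_def)
      ultimately show "\<bar>(real N)\<^sup>2 * ordered_hitting_prob M \<sigma> v x (N, u, y)
           / (U (nat (x - v)) * U (nat (y - u))) - c\<bar> < \<epsilon>"
        using *[rule_format, of "(0, v, x)" "(0, u, y)"] o by (simp add: gap_def)
    qed
  qed
  moreover have "\<forall>z\<ge>1. 0 < U z" using Ub(1) by (metis le_less_trans less_le_trans less_one not_le of_nat_0_less_iff)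
  ultimately show ?thesis using bdd c(1) by blast
qed

end
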